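(* Let $\Sigma$ be a compact, connected, orientable surface of genus $g$ with $r\ge 0$ boundary components, where $3g+r>3$, let $p\in\Sigma$, and let $S$ be a simple generating set for $\pi_1(\Sigma,p)$. Then for every curve $\gamma$ on $\Sigma$ and every integer $k\ge 1$, $\ell_S(\gamma^k)=k\cdot\ell_S(\gamma)$, where $\gamma^k$ denotes the $k$-th power of $\gamma$.
   Context: Elements of $\pi_1(\Sigma,p)$ are identified with homotopy classes (relative to $p$) of loops based at $p$. A simple generating set is a generating set $S$ of $\pi_1(\Sigma,p)$ consisting of (classes of) simple loops based at $p$ that are pairwise non-homotopic and pairwise disjoint except at $p$. The word length $|w|_S$ is the minimum of $|\alpha_1|+\cdots+|\alpha_l|$ over all expressions $w=g_{n_1}^{\alpha_1}\cdots g_{n_l}^{\alpha_l}$ in $\pi_1(\Sigma,p)$ with $g_{n_i}\in S$, $\alpha_i\in\mathbb{Z}$. A curve is a properly immersed closed curve, not freely homotopic to a point or a boundary component. A free homotopy class $[\gamma]$ of a closed curve is identified with a conjugacy class, also denoted $[\gamma]$, in $\pi_1(\Sigma,p)$, and $\ell_S(\gamma)=\min\{|\delta|_S:\delta\in[\gamma]\}$. If $\gamma$ corresponds to the conjugacy class of $\delta$, then $\gamma^k$ corresponds to the conjugacy class of $\delta^k$. *)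

theory Defs
  imports "HOL-Analysis.Analysis" "HOL-Homology.Homology"
begin

section \<open>Compact surfaces\<close>

text \<open>A surface is a set \<open>M\<close> in a topological space, with the subspace topology.\<close>

definition surface_with_boundary :: "'a::topological_space set \<Rightarrow> bool" where
  "surface_with_boundary M \<longleftrightarrow>
     Hausdorff_space (top_of_set M) \<and> second_countable (top_of_set M) \<and>
     (\<forall>x\<in>M. \<exists>U V. openin (top_of_set M) U \<and> x \<in> U \<and>
        openin (top_of_set {z::complex. Im z \<ge> 0}) V \<and> U homeomorphic V)"

definition surface_interior :: "'a::topological_space set \<Rightarrow> 'a set" where
  "surface_interior M =
     {x\<in>M. \<exists>U (V::complex set). openin (top_of_set M) U \<and> x \<in> U \<and> open V \<and> U homeomorphic V}"

definition surface_boundary :: "'a::topological_space set \<Rightarrow> 'a set" where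
  "surface_boundary M = M - surface_interior M"

text \<open>Orientability by local homology, for a surface \<open>N\<close> without boundary: a choice of generators
  \<open>\<mu> x\<close> of the groups \<open>H\<^sub>2(N, N - {x})\<close> that is locally induced by one class of \<open>H\<^sub>2(N, N - B)\<close>.
  A surface with boundary is orientable if its interior is.\<close>

definition local_orientation :: "'a::topological_space set \<Rightarrow> ('a \<Rightarrow> 'a chain set) \<Rightarrow> bool" where
  "local_orientation N \<mu> \<longleftrightarrow>
     (\<forall>x\<in>N. \<mu> x \<in> carrier (relative_homology_group 2 (top_of_set N) (N - {x})) \<and>
        generate (relative_homology_group 2 (top_of_set N) (N - {x})) {\<mu> x}
          = carrier (relative_homology_group 2 (top_of_set N) (N - {x}))) \<and>
     (\<forall>x\<in>N. \<exists>B c. openin (top_of_set N) B \<and> x \<in> B \<and>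
        c \<in> carrier (relative_homology_group 2 (top_of_set N) (N - B)) \<and>
        (\<forall>y\<in>B. hom_induced 2 (top_of_set N) (N - B) (top_of_set N) (N - {y}) id c = \<mu> y))"

definition orientable_surface :: "'a::topological_space set \<Rightarrow> bool" where
  "orientable_surface M \<longleftrightarrow> (\<exists>\<mu>. local_orientation (surface_interior M) \<mu>)"

text \<open>The genus is the largest number of disjoint simple closed curves in the interior whose
  union does not separate the surface.\<close>

definition simple_closed_curve :: "'a::topological_space set \<Rightarrow> bool" where
  "simple_closed_curve C \<longleftrightarrow>
     (\<exists>c. simple_path c \<and> pathfinish c = pathstart c \<and> path_image c = C)"

definition nonseparating_system :: "'a::topological_space set \<Rightarrow> 'a set set \<Rightarrow> bool" where
  "nonseparating_system M \<C> \<longleftrightarrow>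
     finite \<C> \<and> (\<forall>C\<in>\<C>. simple_closed_curve C \<and> C \<subseteq> surface_interior M) \<and>
     pairwise disjnt \<C> \<and> connected (M - \<Union>\<C>)"

definition has_genus :: "'a::topological_space set \<Rightarrow> nat \<Rightarrow> bool" where
  "has_genus M g \<longleftrightarrow>
     (\<exists>\<C>. nonseparating_system M \<C> \<and> card \<C> = g) \<and>
     (\<forall>\<C>. nonseparating_system M \<C> \<longrightarrow> card \<C> \<le> g)"

definition has_boundary_components :: "'a::topological_space set \<Rightarrow> nat \<Rightarrow> bool" where
  "has_boundary_components M r \<longleftrightarrow>
     finite (components (surface_boundary M)) \<and> card (components (surface_boundary M)) = r"


section \<open>The fundamental group\<close>

definition loop_at :: "'a::topological_space set \<Rightarrow> 'a \<Rightarrow> (real \<Rightarrow> 'a) \<Rightarrow> bool" where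
  "loop_at M p a \<longleftrightarrow> path a \<and> path_image a \<subseteq> M \<and> pathstart a = p \<and> pathfinish a = p"

definition loop_class :: "'a::topological_space set \<Rightarrow> (real \<Rightarrow> 'a) \<Rightarrow> (real \<Rightarrow> 'a) set" where
  "loop_class M a = {b. homotopic_paths M a b}"

definition fundamental_group :: "'a::topological_space set \<Rightarrow> 'a \<Rightarrow> (real \<Rightarrow> 'a) set monoid" where
  "fundamental_group M p =
     \<lparr>carrier = {loop_class M a | a. loop_at M p a},
      monoid.mult = (\<lambda>A B. {c. \<exists>a\<in>A. \<exists>b\<in>B. homotopic_paths M (a +++ b) c}),
      one = loop_class M (\<lambda>t. p)\<rparr>"

definition simple_generating_set :: "'a::topological_space set \<Rightarrow> 'a \<Rightarrow> (real \<Rightarrow> 'a) set set \<Rightarrow> bool" where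
  "simple_generating_set M p S \<longleftrightarrow>
     (\<exists>L. S = loop_class M ` L \<and>
        (\<forall>a\<in>L. loop_at M p a \<and> simple_path a) \<and>
        pairwise (\<lambda>a b. \<not> homotopic_paths M a b \<and> path_image a \<inter> path_image b = {p}) L) \<and>
     generate (fundamental_group M p) S = carrier (fundamental_group M p)"

text \<open>An expression \<open>g\<^sub>1\<^bsup>\<alpha>\<^sub>1\<^esup> \<dots> g\<^sub>l\<^bsup>\<alpha>\<^sub>l\<^esup>\<close> is the list of the pairs \<open>(g\<^sub>i, \<alpha>\<^sub>i)\<close>.\<close>

definition word_value :: "('b, 'c) monoid_scheme \<Rightarrow> ('b \<times> int) list \<Rightarrow> 'b" where
  "word_value G u = foldr (\<lambda>(x, \<alpha>) y. (x [^]\<^bsub>G\<^esub> \<alpha>) \<otimes>\<^bsub>G\<^esub> y) u \<one>\<^bsub>G\<^esub>"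

definition word_length :: "('b, 'c) monoid_scheme \<Rightarrow> 'b set \<Rightarrow> 'b \<Rightarrow> nat" where
  "word_length G S w =
     (LEAST n. \<exists>u. fst ` set u \<subseteq> S \<and> word_value G u = w \<and> n = (\<Sum>(x, \<alpha>)\<leftarrow>u. nat \<bar>\<alpha>\<bar>))"


section \<open>Curves\<close>

text \<open>A closed curve is a loop on \<open>[0, 1]\<close>; its periodic extension is \<open>\<lambda>t. \<gamma> (frac t)\<close>.
  It is immersed in the topological sense if the extension is locally injective, and properly
  immersed if, moreover, it avoids the boundary, the preimage of \<open>\<partial>M\<close> having to be \<open>\<partial>S\<^sup>1 = \<emptyset>\<close>.\<close>

definition immersed_closed_curve :: "'a::topological_space set \<Rightarrow> (real \<Rightarrow> 'a) \<Rightarrow> bool" where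
  "immersed_closed_curve M \<gamma> \<longleftrightarrow>
     path \<gamma> \<and> pathfinish \<gamma> = pathstart \<gamma> \<and> path_image \<gamma> \<subseteq> surface_interior M \<and>
     (\<forall>t. \<exists>e>0. inj_on (\<lambda>s. \<gamma> (frac s)) {t - e<..<t + e})"

text \<open>Since \<open>b\<close> ranges over all simple parametrizations, both orientations of a boundary
  component are excluded.\<close>

definition curve_on :: "'a::topological_space set \<Rightarrow> (real \<Rightarrow> 'a) \<Rightarrow> bool" where
  "curve_on M \<gamma> \<longleftrightarrow>
     immersed_closed_curve M \<gamma> \<and>
     \<not> (\<exists>x\<in>M. homotopic_loops M \<gamma> (\<lambda>t. x)) \<and>
     \<not> (\<exists>b. simple_path b \<and> pathfinish b = pathstart b \<and>
          path_image b \<in> components (surface_boundary M) \<and> homotopic_loops M \<gamma> b)"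

definition curve_power :: "(real \<Rightarrow> 'a) \<Rightarrow> nat \<Rightarrow> real \<Rightarrow> 'a" where
  "curve_power \<gamma> k = (\<lambda>t. \<gamma> (frac (real k * t)))"

definition free_class :: "'a::topological_space set \<Rightarrow> 'a \<Rightarrow> (real \<Rightarrow> 'a) \<Rightarrow> (real \<Rightarrow> 'a) set set" where
  "free_class M p \<gamma> = {loop_class M \<delta> | \<delta>. loop_at M p \<delta> \<and> homotopic_loops M \<gamma> \<delta>}"

definition curve_length :: "'a::topological_space set \<Rightarrow> 'a \<Rightarrow> (real \<Rightarrow> 'a) set set \<Rightarrow> (real \<Rightarrow> 'a) \<Rightarrow> nat" where
  "curve_length M p S \<gamma> =
     (LEAST n. \<exists>x\<in>free_class M p \<gamma>. n = word_length (fundamental_group M p) S x)"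


section \<open>Free homotopy classes are conjugacy classes, and powers correspond to powers\<close>

lemma loop_at_join: "loop_at M p a \<Longrightarrow> loop_at M p b \<Longrightarrow> loop_at M p (a +++ b)"
  unfolding loop_at_def by (simp add: subset_path_image_join)

lemma loop_at_const: "p \<in> M \<Longrightarrow> loop_at M p (\<lambda>t. p)"
  unfolding loop_at_def by (auto simp: path_def path_image_def pathstart_def pathfinish_def)

lemma loop_at_reversepath: "loop_at M p a \<Longrightarrow> loop_at M p (reversepath a)"
  unfolding loop_at_def by auto

lemma loop_class_eq_iff:
  assumes "loop_at M p a"
  shows "loop_class M a = loop_class M b \<longleftrightarrow> homotopic_paths M a b"
proof
  assume eq: "loop_class M a = loop_class M b"
  have "homotopic_paths M a a" using assms by (simp add: loop_at_def)
  then have "a \<in> loop_class M b" using eq by (auto simp: loop_class_def)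
  then show "homotopic_paths M a b" by (auto simp: loop_class_def homotopic_paths_sym)
next
  assume "homotopic_paths M a b"
  then show "loop_class M a = loop_class M b"
    unfolding loop_class_def by (blast intro: homotopic_paths_sym homotopic_paths_trans)
qed

lemma carrier_fundamental_group:
  "x \<in> carrier (fundamental_group M p) \<longleftrightarrow> (\<exists>a. loop_at M p a \<and> x = loop_class M a)"
  unfolding fundamental_group_def by auto

lemma one_fundamental_group: "\<one>\<^bsub>fundamental_group M p\<^esub> = loop_class M (\<lambda>t. p)"
  unfolding fundamental_group_def by simp

lemma mult_fundamental_group:
  assumes "loop_at M p a" "loop_at M p b"
  shows "loop_class M a \<otimes>\<^bsub>fundamental_group M p\<^esub> loop_class M b = loop_class M (a +++ b)"
proof -
  have "homotopic_paths M (a +++ b) (a' +++ b')"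
    if "homotopic_paths M a a'" "homotopic_paths M b b'" for a' b'
    using that assms by (intro homotopic_paths_join) (auto simp: loop_at_def)
  moreover have "homotopic_paths M a a" "homotopic_paths M b b"
    using assms by (auto simp: loop_at_def)
  ultimately show ?thesis
    unfolding fundamental_group_def loop_class_def
    by (auto intro: homotopic_paths_trans simp del: homotopic_paths_refl)
qed

lemma homotopic_paths_linear_image:
  fixes \<phi> \<psi> :: "real \<Rightarrow> 'b::real_normed_vector" and h :: "'b \<Rightarrow> 'a::topological_space"
  assumes "continuous_on C h" "h ` C \<subseteq> M" "convex C"
    and "path \<phi>" "path \<psi>" "path_image \<phi> \<subseteq> C" "path_image \<psi> \<subseteq> C"
    and "pathstart \<phi> = pathstart \<psi>" "pathfinish \<phi> = pathfinish \<psi>"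
  shows "homotopic_paths M (h \<circ> \<phi>) (h \<circ> \<psi>)"
proof (rule homotopic_paths_continuous_image[of C])
  show "homotopic_paths C \<phi> \<psi>"
  proof (rule homotopic_paths_linear)
    fix t :: real assume "t \<in> {0..1}"
    then have "\<phi> t \<in> C" "\<psi> t \<in> C" using assms by (auto simp: path_image_def)
    then show "closed_segment (\<phi> t) (\<psi> t) \<subseteq> C" using assms(3) by (simp add: closed_segment_subset)
  qed (use assms in auto)
qed (use assms in auto)

lemma group_fundamental_group:
  assumes "p \<in> M"
  shows "group (fundamental_group M p)"
proof (rule groupI)
  let ?G = "fundamental_group M p"
  fix x y z assume "x \<in> carrier ?G" "y \<in> carrier ?G" "z \<in> carrier ?G"
  then obtain a b c where abc: "loop_at M p a" "loop_at M p b" "loop_at M p c"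
    and [simp]: "x = loop_class M a" "y = loop_class M b" "z = loop_class M c"
    unfolding carrier_fundamental_group by blast
  have "homotopic_paths M ((a +++ b) +++ c) (a +++ (b +++ c))"
    using abc by (intro homotopic_paths_sym[OF homotopic_paths_assoc]) (auto simp: loop_at_def)
  then show "x \<otimes>\<^bsub>?G\<^esub> y \<otimes>\<^bsub>?G\<^esub> z = x \<otimes>\<^bsub>?G\<^esub> (y \<otimes>\<^bsub>?G\<^esub> z)"
    using abc by (simp add: mult_fundamental_group loop_at_join loop_class_eq_iff[where p = p])
next
  let ?G = "fundamental_group M p"
  fix x y assume "x \<in> carrier ?G" "y \<in> carrier ?G"
  then obtain a b where "loop_at M p a" "loop_at M p b" "x = loop_class M a" "y = loop_class M b"
    unfolding carrier_fundamental_group by blast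
  then show "x \<otimes>\<^bsub>?G\<^esub> y \<in> carrier ?G"
    by (auto simp: mult_fundamental_group carrier_fundamental_group intro: loop_at_join)
next
  let ?G = "fundamental_group M p"
  show "\<one>\<^bsub>?G\<^esub> \<in> carrier ?G"
    using loop_at_const[OF assms] by (auto simp: one_fundamental_group carrier_fundamental_group)
  fix x assume "x \<in> carrier ?G"
  then obtain a where a: "loop_at M p a" and [simp]: "x = loop_class M a"
    unfolding carrier_fundamental_group by blast
  have ca: "continuous_on {0..1} a" "a ` {0..1} \<subseteq> M"
    using a by (auto simp: loop_at_def path_def path_image_def)
  have a01: "a 0 = p" "a 1 = p" using a by (auto simp: loop_at_def pathstart_def pathfinish_def)
  have "homotopic_paths M (a \<circ> (linepath 0 0 +++ linepath 0 1)) (a \<circ> linepath 0 1)"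
    by (rule homotopic_paths_linear_image[OF ca])
      (auto simp: path_image_join closed_segment_eq_real_ivl intro!: path_join_imp)
  moreover have "a \<circ> (linepath 0 0 +++ linepath 0 1) = (\<lambda>t. p) +++ a" "a \<circ> linepath 0 1 = a"
    by (auto simp: fun_eq_iff joinpaths_def linepath_def a01)
  ultimately have "homotopic_paths M ((\<lambda>t. p) +++ a) a" by simp
  then show "\<one>\<^bsub>?G\<^esub> \<otimes>\<^bsub>?G\<^esub> x = x"
    using a loop_at_const[OF assms]
    by (simp add: one_fundamental_group mult_fundamental_group loop_class_eq_iff[where p = p] loop_at_join)
  have "homotopic_paths M (a \<circ> (linepath 1 0 +++ linepath 0 1)) (a \<circ> linepath 1 1)"
    by (rule homotopic_paths_linear_image[OF ca])
      (auto simp: path_image_join closed_segment_eq_real_ivl intro!: path_join_imp)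
  moreover have "a \<circ> (linepath 1 0 +++ linepath 0 1) = reversepath a +++ a" "a \<circ> linepath 1 1 = (\<lambda>t. p)"
    by (auto simp: fun_eq_iff joinpaths_def linepath_def reversepath_def a01)
  ultimately have "homotopic_paths M (reversepath a +++ a) (\<lambda>t. p)" by simp
  then have "loop_class M (reversepath a) \<otimes>\<^bsub>?G\<^esub> x = \<one>\<^bsub>?G\<^esub>"
    using a loop_at_reversepath[OF a]
    by (simp add: one_fundamental_group mult_fundamental_group loop_class_eq_iff[where p = p] loop_at_join)
  then show "\<exists>y\<in>carrier ?G. y \<otimes>\<^bsub>?G\<^esub> x = \<one>\<^bsub>?G\<^esub>"
    using loop_at_reversepath[OF a] carrier_fundamental_group by blast
qed

lemma inv_fundamental_group:
  assumes "loop_at M p a"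
  shows "inv\<^bsub>fundamental_group M p\<^esub> (loop_class M a) = loop_class M (reversepath a)"
proof -
  have ca: "continuous_on {0..1} a" "a ` {0..1} \<subseteq> M"
    using assms by (auto simp: loop_at_def path_def path_image_def)
  have a01: "a 0 = p" "a 1 = p" using assms by (auto simp: loop_at_def pathstart_def pathfinish_def)
  have pM: "p \<in> M" using ca(2) a01 by force
  interpret group "fundamental_group M p" by (rule group_fundamental_group[OF pM])
  have "homotopic_paths M (a \<circ> (linepath 1 0 +++ linepath 0 1)) (a \<circ> linepath 1 1)"
    by (rule homotopic_paths_linear_image[OF ca])
      (auto simp: path_image_join closed_segment_eq_real_ivl intro!: path_join_imp)
  moreover have "a \<circ> (linepath 1 0 +++ linepath 0 1) = reversepath a +++ a" "a \<circ> linepath 1 1 = (\<lambda>t. p)"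
    by (auto simp: fun_eq_iff joinpaths_def linepath_def reversepath_def a01)
  ultimately have "homotopic_paths M (reversepath a +++ a) (\<lambda>t. p)" by simp
  then show ?thesis
    using assms loop_at_reversepath[OF assms]
    by (intro inv_equality)
      (simp add: one_fundamental_group mult_fundamental_group loop_class_eq_iff[where p = p]
        loop_at_join, (use carrier_fundamental_group in blast)+)
qed

lemma continuous_on_frac_snd:
  fixes h :: "real \<times> real \<Rightarrow> 'a::topological_space"
  assumes "continuous_on ({0..1} \<times> {0..1}) h" and "\<And>s. s \<in> {0..1} \<Longrightarrow> h (s, 0) = h (s, 1)"
  shows "continuous_on ({0..1} \<times> {0..real k}) (\<lambda>z. h (fst z, frac (snd z)))"
proof (induction k)
  case 0
  have "continuous_on ({0..1} \<times> {0}) (\<lambda>z. h (fst z, 0))"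
    by (rule continuous_on_compose2[OF assms(1)]) (auto intro!: continuous_intros)
  then show ?case by (subst continuous_on_cong[OF refl, where g = "\<lambda>z. h (fst z, 0)"]) auto
next
  case (Suc k)
  have "continuous_on ({0..1} \<times> {real k..real k + 1}) (\<lambda>z. h (fst z, snd z - real k))"
    by (rule continuous_on_compose2[OF assms(1)]) (auto intro!: continuous_intros)
  moreover have "h (s, frac t) = h (s, t - real k)"
    if "s \<in> {0..1}" "t \<in> {real k..real k + 1}" for s t
  proof (cases "t = real k + 1")
    case True
    then have "frac t = 0" using frac_of_int[of "int k + 1"] by simp
    moreover have "t - real k = 1" using True by simp
    ultimately show ?thesis using assms(2)[OF that(1)] by metis
  next
    case False
    then have "frac t = t - real k" using that(2) by (auto simp: frac_unique_iff)
    then show ?thesis by simp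
  qed
  ultimately have "continuous_on ({0..1} \<times> {real k..real k + 1}) (\<lambda>z. h (fst z, frac (snd z)))"
    by (subst continuous_on_cong[OF refl, where g = "\<lambda>z. h (fst z, snd z - real k)"]) auto
  then have "continuous_on ({0..1} \<times> {0..real k} \<union> {0..1} \<times> {real k..real k + 1})
      (\<lambda>z. h (fst z, frac (snd z)))"
    by (intro continuous_on_closed_Un Suc closed_Times) auto
  moreover have "{0..1::real} \<times> {0..real k} \<union> {0..1} \<times> {real k..real k + 1} = {0..1} \<times> {0..real (Suc k)}"
    by auto
  ultimately show ?case by simp
qed

lemma homotopic_loops_square:
  assumes "homotopic_loops M \<gamma> \<delta>"
  obtains h where "continuous_on ({0..1} \<times> {0..1}) h" "h ` ({0..1::real} \<times> {0..1::real}) \<subseteq> M"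
    "\<forall>x\<in>{0..1}. h (0, x) = \<gamma> x" "\<forall>x\<in>{0..1}. h (1, x) = \<delta> x"
    "\<forall>t\<in>{0..1}. h (t, 0) = h (t, 1)"
proof -
  obtain h where h: "continuous_on ({0..1} \<times> {0..1}) h" "h \<in> {0..1} \<times> {0..1} \<rightarrow> M"
    "\<forall>x\<in>{0..1}. h (0, x) = \<gamma> x" "\<forall>x\<in>{0..1}. h (1, x) = \<delta> x"
    "\<forall>t\<in>{0..1::real}. pathfinish (h \<circ> Pair t) = pathstart (h \<circ> Pair t)"
    using assms unfolding homotopic_loops by blast
  have "\<forall>t\<in>{0..1}. h (t, 0) = h (t, 1)" using h(5) by (simp add: pathfinish_def pathstart_def)
  with h show thesis by (intro that[of h]) (auto simp: image_subset_iff_funcset)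
qed

lemma homotopic_loops_curve_power:
  assumes "homotopic_loops M \<gamma> \<delta>"
  shows "homotopic_loops M (curve_power \<gamma> k) (curve_power \<delta> k)"
proof -
  obtain h where h: "continuous_on ({0..1} \<times> {0..1}) h" "h ` ({0..1::real} \<times> {0..1::real}) \<subseteq> M"
    "\<forall>x\<in>{0..1}. h (0, x) = \<gamma> x" "\<forall>x\<in>{0..1}. h (1, x) = \<delta> x"
    "\<forall>t\<in>{0..1}. h (t, 0) = h (t, 1)"
    using homotopic_loops_square[OF assms] .
  have fr: "frac x \<in> {0..1}" for x :: real using frac_lt_1[of x] by simp
  let ?f = "\<lambda>z::real \<times> real. (fst z, real k * snd z)"
  have per: "h (s, 0) = h (s, 1)" if "s \<in> {0..1}" for s
    using h(5) that by blast
  have "continuous_on ({0..1} \<times> {0..1}) ?f"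
    by (intro continuous_intros)
  moreover have "?f ` ({0..1} \<times> {0..1}) \<subseteq> {0..1} \<times> {0..real k}"
    by (auto intro!: mult_left_le)
  ultimately have "continuous_on ({0..1} \<times> {0..1}) (\<lambda>z. h (fst (?f z), frac (snd (?f z))))"
    using continuous_on_compose2[OF continuous_on_frac_snd[OF h(1) per]] by blast
  then have "continuous_on ({0..1} \<times> {0..1}) (\<lambda>z. h (fst z, frac (real k * snd z)))"
    by simp
  moreover have "h (s, frac x) \<in> M" if "s \<in> {0..1}" for s x
    using h(2) fr[of x] that by blast
  moreover have "h (0, frac x) = \<gamma> (frac x)" "h (1, frac x) = \<delta> (frac x)" for x
    using h(3,4) fr[of x] by blast+
  moreover have fk: "frac (real k) = 0"
    by simp
  ultimately show ?thesis
    unfolding homotopic_loops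
    by (intro exI[of _ "\<lambda>z. h (fst z, frac (real k * snd z))"])
      (simp add: curve_power_def pathfinish_def pathstart_def Pi_iff fk del: frac_eq_0_iff)
qed

lemma loop_class_curve_power:
  assumes "loop_at M p \<delta>"
  shows "loop_at M p (curve_power \<delta> k)"
    and "loop_class M (curve_power \<delta> k) = loop_class M \<delta> [^]\<^bsub>fundamental_group M p\<^esub> k"
proof -
  have d01: "\<delta> 0 = p" "\<delta> 1 = p" using assms by (auto simp: loop_at_def pathstart_def pathfinish_def)
  have "homotopic_loops M \<delta> \<delta>" using assms by (simp add: loop_at_def homotopic_loops_refl)
  then have "homotopic_loops M (curve_power \<delta> k) (curve_power \<delta> k)" for k
    by (rule homotopic_loops_curve_power)
  then have L: "loop_at M p (curve_power \<delta> k)" for k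
    unfolding homotopic_loops_refl loop_at_def
    by (auto simp: curve_power_def pathstart_def pathfinish_def d01)
  show "loop_at M p (curve_power \<delta> k)" by (rule L)
  show "loop_class M (curve_power \<delta> k) = loop_class M \<delta> [^]\<^bsub>fundamental_group M p\<^esub> k"
  proof (induction k)
    case 0
    show ?case by (simp add: one_fundamental_group curve_power_def d01)
  next
    case (Suc k)
    define f where "f = (\<lambda>t::real. (real k * min (2 * t) 1 + max (2 * t - 1) 0) / (real k + 1))"
    have "homotopic_paths M (curve_power \<delta> (Suc k)) (curve_power \<delta> k +++ \<delta>)"
    proof (rule homotopic_paths_reparametrize[where f = f])
      show "continuous_on {0..1} f"
        unfolding f_def by (intro continuous_intros) auto
      show "f \<in> {0..1} \<rightarrow> {0..1}"
      proof
        fix t :: real assume t: "t \<in> {0..1}"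
        then have "0 \<le> real k * min (2 * t) 1" "real k * min (2 * t) 1 \<le> real k"
          by (auto intro: mult_left_le)
        moreover have "0 \<le> max (2 * t - 1) 0" "max (2 * t - 1) 0 \<le> 1" using t by auto
        ultimately show "f t \<in> {0..1}" unfolding f_def by (simp add: divide_simps)
      qed
      show "f 0 = 0" "f 1 = 1" by (auto simp: f_def)
      fix t :: real assume t: "t \<in> {0..1}"
      have fr: "\<delta> (frac x) = \<delta> x" if "x \<in> {0..1}" for x
        using that d01 by (cases "x = 1") auto
      show "(curve_power \<delta> k +++ \<delta>) t = curve_power \<delta> (Suc k) (f t)"
      proof (cases "t \<le> 1/2")
        case True
        then have "real (Suc k) * f t = real k * (2 * t)" by (simp add: f_def add.commute)
        then show ?thesis using True by (simp add: joinpaths_def curve_power_def)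
      next
        case False
        then have "real (Suc k) * f t = real k + (2 * t - 1)" by (simp add: f_def add.commute)
        then have "frac (real (Suc k) * f t) = frac (2 * t - 1)"
          by (metis frac_add_of_int_left of_int_of_nat_eq)
        then show ?thesis using False t fr[of "2 * t - 1"] by (simp add: joinpaths_def curve_power_def)
      qed
    qed (use L in \<open>auto simp: loop_at_def\<close>)
    then have "loop_class M (curve_power \<delta> (Suc k)) = loop_class M (curve_power \<delta> k +++ \<delta>)"
      using loop_class_eq_iff[OF L] by blast
    then show ?case using mult_fundamental_group[OF L assms, of k] Suc by (metis nat_pow_Suc)
  qed
qed

lemma homotopic_loops_swap:
  assumes "loop_at M p a" "loop_at M p b"
  shows "homotopic_loops M (a +++ b) (b +++ a)"
proof -
  let ?c = "a +++ b"
  have c: "loop_at M p ?c" by (rule loop_at_join[OF assms])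
  have ab: "a 0 = p" "a 1 = p" "b 0 = p" "b 1 = p"
    using assms by (auto simp: loop_at_def pathstart_def pathfinish_def)
  have fr: "frac x \<in> {0..1}" for x :: real using frac_lt_1[of x] by simp
  have "continuous_on ({0..1} \<times> {0..1}) (\<lambda>z::real\<times>real. ?c (snd z))"
    by (rule continuous_on_compose2[of "{0..1}" ?c])
      (use c in \<open>auto simp: loop_at_def path_def intro!: continuous_intros\<close>)
  from continuous_on_frac_snd[OF this, of 2]
  have cont: "continuous_on ({0..1::real} \<times> {0..2}) (\<lambda>z. ?c (frac (snd z)))"
    using ab by (auto simp: joinpaths_def)
  have "continuous_on ({0..1} \<times> {0..1}) (\<lambda>z::real\<times>real. ?c (frac (snd (fst z, snd z + fst z / 2))))"
    by (rule continuous_on_compose2[OF cont, where f = "\<lambda>z. (fst z, snd z + fst z / 2)"])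
      (auto intro!: continuous_intros)
  moreover have "?c (frac x) \<in> M" for x
    using c fr[of x] by (auto simp: loop_at_def path_image_def image_subset_iff)
  moreover have "?c (frac x) = ?c x" if "x \<in> {0..1}" for x
    using that ab by (cases "x = 1") (auto simp: joinpaths_def)
  moreover have "?c (frac (x + 1/2)) = (b +++ a) x" if "x \<in> {0..1}" for x
  proof -
    consider "x < 1/2" | "x = 1/2" | "x > 1/2" by linarith
    then show ?thesis
    proof cases
      case 1
      then have "frac (x + 1/2) = x + 1/2" using that by (auto simp: frac_eq)
      then show ?thesis using 1 that ab by (cases "x = 0") (auto simp: joinpaths_def field_simps)
    next
      case 2
      then have "x + 1/2 = 1" by simp
      then have "?c (frac (x + 1/2)) = p" using ab by (simp only:) (simp add: joinpaths_def)
      moreover have "(b +++ a) x = p" unfolding \<open>x = 1/2\<close> using ab by (simp add: joinpaths_def)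
      ultimately show ?thesis by simp
    next
      case 3
      have "frac (x + 1/2) = x - 1/2" using 3 that by (auto simp: frac_unique_iff)
      then have "?c (frac (x + 1/2)) = ?c (x - 1/2)" by (simp only:)
      also have "\<dots> = (b +++ a) x" using 3 that by (simp add: joinpaths_def right_diff_distrib)
      finally show ?thesis .
    qed
  qed
  moreover have "frac (1 + x) = frac x" for x :: real by (metis add.commute frac_1_eq)
  ultimately show ?thesis
    unfolding homotopic_loops
    by (intro exI[of _ "\<lambda>z. ?c (frac (snd z + fst z / 2))"])
      (auto simp: pathfinish_def pathstart_def)
qed

lemma homotopic_loops_imp_conjugate:
  assumes "homotopic_loops M \<gamma> \<delta>" "loop_at M p \<gamma>" "loop_at M p \<delta>"
  obtains c where "loop_at M p c" "homotopic_paths M \<delta> (reversepath c +++ (\<gamma> +++ c))"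
proof -
  obtain h where h: "continuous_on ({0..1} \<times> {0..1}) h" "h ` ({0..1::real} \<times> {0..1::real}) \<subseteq> M"
    "\<forall>x\<in>{0..1}. h (0, x) = \<gamma> x" "\<forall>x\<in>{0..1}. h (1, x) = \<delta> x"
    "\<forall>t\<in>{0..1}. h (t, 0) = h (t, 1)"
    using homotopic_loops_square[OF assms(1)] .
  define c where "c = h \<circ> linepath (0, 0) (1, 0)"
  have e: "\<gamma> 0 = p" "\<gamma> 1 = p" "\<delta> 0 = p" "\<delta> 1 = p"
    using assms by (auto simp: loop_at_def pathstart_def pathfinish_def)
  have sq: "convex ({0..1::real} \<times> {0..1::real})" by (intro convex_Times) auto
  have seg: "path_image (linepath x y) \<subseteq> {0..1} \<times> {0..1}"
    if "x \<in> {0..1} \<times> {0..1}" "y \<in> {0..1} \<times> {0..1}" for x y :: "real \<times> real"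
    using that sq by (simp add: closed_segment_subset)
  have c: "loop_at M p c"
  proof -
    have sub: "path_image (linepath (0, 0) (1, 0)) \<subseteq> {0..1::real} \<times> {0..1::real}"
      by (rule seg) auto
    have "path c"
      unfolding c_def by (intro path_continuous_image continuous_on_subset[OF h(1) sub] path_linepath)
    moreover have "path_image c \<subseteq> M"
      unfolding c_def path_image_compose using h(2) image_mono[OF sub, of h] by (rule order_trans[rotated])
    moreover have "h (0, 0) = p" using h(3) e(1) by simp
    moreover have "h (1, 0) = p" using h(4) e(3) by simp
    ultimately show ?thesis
      by (simp add: loop_at_def c_def pathstart_compose pathfinish_compose)
  qed
  have "homotopic_paths M (h \<circ> linepath (1, 0) (1, 1))
     (h \<circ> (linepath (1, 0) (0, 0) +++ (linepath (0, 0) (0, 1) +++ linepath (0, 1) (1, 1))))"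
    by (rule homotopic_paths_linear_image[OF h(1,2) sq])
      (simp_all add: seg subset_path_image_join del: path_image_linepath)
  also have "h \<circ> (linepath (1, 0) (0, 0) +++ (linepath (0, 0) (0, 1) +++ linepath (0, 1) (1, 1)))
     = (h \<circ> linepath (1, 0) (0, 0)) +++ ((h \<circ> linepath (0, 0) (0, 1)) +++ (h \<circ> linepath (0, 1) (1, 1)))"
    by (simp add: path_compose_join)
  finally have H: "homotopic_paths M (h \<circ> linepath (1, 0) (1, 1))
     ((h \<circ> linepath (1, 0) (0, 0)) +++ ((h \<circ> linepath (0, 0) (0, 1)) +++ (h \<circ> linepath (0, 1) (1, 1))))" .
  have eq: "h (linepath (1, 0) (1, 1) t) = \<delta> t" "h (linepath (1, 0) (0, 0) t) = reversepath c t"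
    "h (linepath (0, 0) (0, 1) t) = \<gamma> t" "h (linepath (0, 1) (1, 1) t) = c t"
    if "t \<in> {0..1}" for t
  proof -
    show "h (linepath (1, 0) (1, 1) t) = \<delta> t" using h(4) that by (simp add: linepath_def)
    show "h (linepath (1, 0) (0, 0) t) = reversepath c t" by (simp add: linepath_def reversepath_def c_def)
    show "h (linepath (0, 0) (0, 1) t) = \<gamma> t" using h(3) that by (simp add: linepath_def)
    have "h (t, 0) = h (t, 1)" using h(5) that by blast
    then show "h (linepath (0, 1) (1, 1) t) = c t" by (simp add: linepath_def c_def)
  qed
  have "homotopic_paths M \<delta> (h \<circ> linepath (1, 0) (1, 1))"
    by (rule homotopic_paths_eq) (use assms(3) in \<open>simp_all add: loop_at_def eq(1)\<close>)
  also note H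
  also have "homotopic_paths M
     ((h \<circ> linepath (1, 0) (0, 0)) +++ ((h \<circ> linepath (0, 0) (0, 1)) +++ (h \<circ> linepath (0, 1) (1, 1))))
     (reversepath c +++ (\<gamma> +++ c))"
    using loop_at_join[OF loop_at_reversepath[OF c] loop_at_join[OF assms(2) c]]
    by (intro homotopic_paths_sym[OF homotopic_paths_eq])
      (simp_all add: joinpaths_def eq loop_at_def)
  finally show thesis using that c by blast
qed

lemma free_class_loop_at:
  assumes "loop_at M p \<delta>"
  shows "free_class M p \<delta> =
    {inv\<^bsub>fundamental_group M p\<^esub> x \<otimes>\<^bsub>fundamental_group M p\<^esub> (loop_class M \<delta> \<otimes>\<^bsub>fundamental_group M p\<^esub> x)
      | x. x \<in> carrier (fundamental_group M p)}" (is "_ = ?R")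
proof -
  have pM: "p \<in> M" using assms by (auto simp: loop_at_def path_image_def pathstart_def)
  interpret group "fundamental_group M p" by (rule group_fundamental_group[OF pM])
  have conj: "inv\<^bsub>fundamental_group M p\<^esub> (loop_class M c) \<otimes>\<^bsub>fundamental_group M p\<^esub>
      (loop_class M \<delta> \<otimes>\<^bsub>fundamental_group M p\<^esub> loop_class M c) =
      loop_class M (reversepath c +++ (\<delta> +++ c))" if "loop_at M p c" for c
    using that assms
    by (simp add: inv_fundamental_group mult_fundamental_group loop_at_join loop_at_reversepath)
  show ?thesis
  proof (intro equalityI subsetI)
    fix x assume "x \<in> free_class M p \<delta>"
    then obtain e where e: "x = loop_class M e" "loop_at M p e" "homotopic_loops M \<delta> e"
      unfolding free_class_def by blast
    then obtain c where "loop_at M p c" "homotopic_paths M e (reversepath c +++ (\<delta> +++ c))"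
      using homotopic_loops_imp_conjugate assms by metis
    then show "x \<in> ?R"
      using e conj loop_class_eq_iff[OF e(2)] carrier_fundamental_group by (smt (verit) mem_Collect_eq)
  next
    fix x assume "x \<in> ?R"
    then obtain c where c: "loop_at M p c" "x = loop_class M (reversepath c +++ (\<delta> +++ c))"
      using conj carrier_fundamental_group by (smt (verit) mem_Collect_eq)
    let ?e = "(\<delta> +++ c) +++ reversepath c"
    have L: "loop_at M p ?e" "loop_at M p (reversepath c +++ (\<delta> +++ c))"
      using c assms by (auto intro!: loop_at_join loop_at_reversepath)
    have "loop_class M ?e = loop_class M \<delta>"
      using c assms carrier_fundamental_group[of _ M p]
      by (simp flip: mult_fundamental_group[where p = p] inv_fundamental_group[where p = p]
          add: loop_at_join loop_at_reversepath)
        (metis inv_solve_right m_closed)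
    then have "homotopic_paths M \<delta> ?e" using loop_class_eq_iff[OF assms] by blast
    then have "homotopic_loops M \<delta> ?e"
      using L assms by (intro homotopic_paths_imp_homotopic_loops) (auto simp: loop_at_def)
    moreover have "homotopic_loops M ?e (reversepath c +++ (\<delta> +++ c))"
      using c assms by (intro homotopic_loops_swap[where p = p] loop_at_join loop_at_reversepath)
    ultimately show "x \<in> free_class M p \<delta>"
      using c L unfolding free_class_def by (blast intro: homotopic_loops_trans)
  qed
qed

lemma free_class_homotopic_loops:
  "homotopic_loops M \<gamma> \<delta> \<Longrightarrow> free_class M p \<gamma> = free_class M p \<delta>"
  unfolding free_class_def by (blast intro: homotopic_loops_sym homotopic_loops_trans)

end

theory Submission
 imports Defs "HOL-Complex_Analysis.Complex_Analysis"
begin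

text \<open>The vertices of the coset graph of a cyclic subgroup \<open>\<langle>x\<rangle>\<close> are the points over \<open>p\<close> of an
 annular covering of the surface, and a word \<open>w = x\<^sup>j\<close> is a closed edge path in it. Cut into
 edge paths without repeated vertices, it is made up of loops that lift to simple closed curves. By
 the key fact below each of them is trivial or conjugate to \<open>x\<close> or its inverse, so
 \<open>w\<close> has at least \<open>\<bar>j\<bar>\<close> times as many letters as a shortest conjugate of \<open>x\<close>.

 Key fact: a simple closed curve \<open>C\<close> in the covering represents \<open>1\<close> or \<open>x\<close> or its inverse, and in the last two
 cases \<open>x\<close> has infinite order. A unimodular function \<open>\<Theta>\<close> with two charges, of index \<open>1\<close> and
 \<open>-1\<close>, on the two local sides of \<open>C\<close> has winding number \<open>1\<close> along \<open>C\<close>.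
 If the charges can be moved off the compact image of a homotopy from \<open>C\<close> to the \<open>m\<close>-th power of another
 loop, then \<open>m\<close> divides \<open>1\<close>. Otherwise one side of \<open>C\<close> is relatively compact. A flat line
 bundle with holonomy in the \<open>n\<close>-th roots of unity, nontrivial along \<open>C\<close>, has a section over this side with
 finitely many zeros, and the total index of its \<open>n\<close>-th power contradicts that of a power of \<open>\<Theta>\<close>.
 The indices add up because the surface is oriented.\<close>

section \<open>Winding numbers of nonvanishing functions\<close>

text \<open>Shortest words for a power show no visible periodicity, so words are not rewritten; the
  exponent of a closed word is accounted for by its simple pieces. That the generators are simple
  and meet only at \<open>p\<close> is used to see that a piece without repeated vertices lifts to
  an embedded circle. The covering is not identified with an annulus, so no Jordan curve theorem is
  at hand there. A dipole next to the curve serves as a cohomology class dual to it, and the two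
  ways of disposing of its charges replace a separation argument. The modulus \<open>n\<close> must
  not divide the exponent \<open>j\<close> while admitting a character of the powers of
  \<open>x\<close>: it is \<open>ord x\<close> for finite order and \<open>\<bar>j\<bar> + 1\<close>
  otherwise, so that torsion is treated by the same argument. Charts range over the whole plane,
  whereas \<open>p\<close> and the generators may touch the boundary; the boundary is therefore not
  deleted but given an open collar, which retracts back without changing homotopy classes.
  Orientability is a statement on local homology and has to be turned into winding numbers of
  transition maps; this is the purpose of the singular chains.\<close>

abbreviation seg :: "('a::real_normed_vector \<Rightarrow> 'b) \<Rightarrow> 'a \<Rightarrow> 'a \<Rightarrow> real \<Rightarrow> 'b" where
 "seg k u v \<equiv> k \<circ> linepath u v"

abbreviation wind :: "(real \<Rightarrow> complex) \<Rightarrow> complex" where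
 "wind p \<equiv> winding_number p 0"

lemma path_log:
 assumes "path p" "0 \<notin> path_image p"
 obtains q where "path q" "pathfinish q - pathstart q = 2 * of_real pi * \<i> * wind p"
  "\<And>t. t \<in> {0..1} \<Longrightarrow> p t = exp (q t)"
 using winding_number_as_continuous_log[OF assms] by auto

lemma winding_number_exp_path:
 assumes "path q" "\<And>t. t \<in> {0..1} \<Longrightarrow> p t = exp (q t)"
 shows "wind p = (pathfinish q - pathstart q) / (2 * of_real pi * \<i>)"
proof -
 have "wind p = wind (exp \<circ> q)" by (rule winding_number_cong) (use assms(2) in auto)
 thus ?thesis by (simp add: winding_number_compose_exp[OF assms(1)])
qed

lemma winding_number_mult:
 assumes "path p" "0 \<notin> path_image p" "path q" "0 \<notin> path_image q"
 shows "wind (\<lambda>t. p t * q t) = wind p + wind q"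
proof -
 obtain u where u: "path u" "pathfinish u - pathstart u = 2 * of_real pi * \<i> * wind p"
  "\<And>t. t \<in> {0..1} \<Longrightarrow> p t = exp (u t)" using path_log[OF assms(1,2)] by blast
 obtain v where v: "path v" "pathfinish v - pathstart v = 2 * of_real pi * \<i> * wind q"
  "\<And>t. t \<in> {0..1} \<Longrightarrow> q t = exp (v t)" using path_log[OF assms(3,4)] by blast
 have "path (\<lambda>t. u t + v t)" using u(1) v(1) unfolding path_def by (intro continuous_intros)
 hence "wind (\<lambda>t. p t * q t) = (pathfinish (\<lambda>t. u t + v t) - pathstart (\<lambda>t. u t + v t)) / (2 * of_real pi * \<i>)"
  by (rule winding_number_exp_path) (simp add: u v exp_add)
 also have "\<dots> = ((pathfinish u - pathstart u) + (pathfinish v - pathstart v)) / (2 * of_real pi * \<i>)"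
  by (simp add: pathfinish_def pathstart_def algebra_simps)
 also have "\<dots> = wind p + wind q" unfolding u(2) v(2) by (simp add: field_simps)
 finally show ?thesis .
qed

lemma winding_number_inverse:
 assumes "path p" "0 \<notin> path_image p"
 shows "wind (\<lambda>t. inverse (p t)) = - wind p"
proof -
 obtain u where u: "path u" "pathfinish u - pathstart u = 2 * of_real pi * \<i> * wind p"
  "\<And>t. t \<in> {0..1} \<Longrightarrow> p t = exp (u t)" using path_log[OF assms(1,2)] by blast
 have "path (\<lambda>t. - u t)" using u(1) unfolding path_def by (intro continuous_intros)
 hence "wind (\<lambda>t. inverse (p t)) = (pathfinish (\<lambda>t. - u t) - pathstart (\<lambda>t. - u t)) / (2 * of_real pi * \<i>)"
  by (rule winding_number_exp_path) (simp add: u exp_minus)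
 also have "\<dots> = - (pathfinish u - pathstart u) / (2 * of_real pi * \<i>)"
  by (simp add: pathfinish_def pathstart_def)
 also have "\<dots> = - wind p" unfolding u(2) by (simp add: field_simps)
 finally show ?thesis .
qed

lemma path_nonzero_inverse:
 fixes p q :: "real \<Rightarrow> complex"
 assumes "path p" "0 \<notin> path_image p"
 shows "path (\<lambda>t. inverse (p t))" "0 \<notin> path_image (\<lambda>t. inverse (p t))"
 using assms unfolding path_def path_image_def by (auto intro!: continuous_intros)

lemma winding_number_divide:
 assumes "path p" "0 \<notin> path_image p" "path q" "0 \<notin> path_image q"
 shows "wind (\<lambda>t. p t / q t) = wind p - wind q"
 using winding_number_mult[OF assms(1,2) path_nonzero_inverse[OF assms(3,4)]]
 by (simp add: winding_number_inverse[OF assms(3,4)] flip: divide_inverse)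

lemma path_nonzero_power:
 fixes p q :: "real \<Rightarrow> complex"
 assumes "path p" "0 \<notin> path_image p"
 shows "path (\<lambda>t. p t ^ n)" "0 \<notin> path_image (\<lambda>t. p t ^ n)"
 using assms unfolding path_def path_image_def by (auto intro!: continuous_intros)

lemma winding_number_power:
 assumes "path p" "0 \<notin> path_image p"
 shows "wind (\<lambda>t. p t ^ n) = of_nat n * wind p"
proof (induction n)
 case 0
 thus ?case using winding_number_zero_const[of 1 0] by simp
next
 case (Suc n)
 thus ?case
  using winding_number_mult[OF assms path_nonzero_power[OF assms], of n] by (simp add: algebra_simps)
qed

lemma winding_number_powi:
 assumes "path p" "0 \<notin> path_image p"
 shows "wind (\<lambda>t. p t powi n) = of_int n * wind p"
proof (cases "n \<ge> 0")
 case True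
 thus ?thesis using winding_number_power[OF assms, of "nat n"] by (simp add: power_int_def)
next
 case False
 thus ?thesis using winding_number_power[OF path_nonzero_inverse[OF assms], of "nat (-n)"]
  by (simp add: power_int_def winding_number_inverse[OF assms])
qed

text \<open>Dividing by the modulus subtracts the real part from a logarithm. For a closed path the
  real parts at the two ends agree, so the increment is unchanged.\<close>

lemma winding_number_normalize:
 assumes "path p" "0 \<notin> path_image p" "pathfinish p = pathstart p"
 shows "wind (\<lambda>t. p t / of_real (cmod (p t))) = wind p"
proof -
 obtain u where u: "path u" "pathfinish u - pathstart u = 2 * of_real pi * \<i> * wind p"
  "\<And>t. t \<in> {0..1} \<Longrightarrow> p t = exp (u t)" using path_log[OF assms(1,2)] by blast
 let ?v = "\<lambda>t. u t - of_real (Re (u t))"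
 have "path ?v" using u(1) unfolding path_def by (intro continuous_intros)
 hence "wind (\<lambda>t. p t / of_real (cmod (p t))) = (pathfinish ?v - pathstart ?v) / (2 * of_real pi * \<i>)"
  by (rule winding_number_exp_path) (simp add: u exp_diff flip: exp_of_real)
 moreover have "Re (pathfinish u) = Re (pathstart u)"
 proof -
  have "exp (pathfinish u) = exp (pathstart u)" using assms(3) u(3)[of 0] u(3)[of 1]
   by (simp add: pathfinish_def pathstart_def)
  hence "cmod (exp (pathfinish u)) = cmod (exp (pathstart u))" by simp
  thus ?thesis by simp
 qed
 hence "pathfinish ?v - pathstart ?v = pathfinish u - pathstart u"
  by (simp add: pathfinish_def pathstart_def)
 ultimately show ?thesis unfolding u(2) by simp
qed

text \<open>A continuous logarithm on the whole image has equal values at the two ends of a closed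
  path.\<close>

lemma winding_number_exp_closed:
 assumes "path \<gamma>" "pathfinish \<gamma> = pathstart \<gamma>" "continuous_on (path_image \<gamma>) u"
 shows "wind (\<lambda>t. exp (u (\<gamma> t))) = 0"
proof -
 have "path (u \<circ> \<gamma>)" using assms by (intro path_continuous_image) auto
 hence "wind (\<lambda>t. exp (u (\<gamma> t))) = (pathfinish (u \<circ> \<gamma>) - pathstart (u \<circ> \<gamma>)) / (2 * of_real pi * \<i>)"
  by (rule winding_number_exp_path) auto
 moreover have "pathfinish (u \<circ> \<gamma>) = pathstart (u \<circ> \<gamma>)"
  using assms(2) by (simp only: pathfinish_compose pathstart_compose)
 ultimately show ?thesis by simp
qed

lemma winding_number_homotopic_image:
 assumes "homotopic_loops T p q" "continuous_on T f" "\<forall>w\<in>T. f w \<noteq> 0"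
 shows "wind (f \<circ> p) = wind (f \<circ> q)"
 by (intro winding_number_homotopic_loops homotopic_loops_continuous_image[OF assms(1,2)])
  (use assms(3) in auto)

subsection \<open>Functions on discs with finitely many punctures\<close>

text \<open>At each fixed angle the linear homotopy only interpolates between the radii
  \<open>r\<close> and \<open>s\<close>, so it stays in the closed annulus.\<close>

lemma homotopic_circlepaths:
 assumes "0 < r" "r \<le> s" "\<And>w. r \<le> dist a w \<Longrightarrow> dist a w \<le> s \<Longrightarrow> w \<in> T"
 shows "homotopic_loops T (circlepath a r) (circlepath a s)"
proof (rule homotopic_loops_linear)
 fix t :: real assume "t \<in> {0..1}"
 show "closed_segment (circlepath a r t) (circlepath a s t) \<subseteq> T"
 proof
  fix w assume "w \<in> closed_segment (circlepath a r t) (circlepath a s t)"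
  then obtain u where u: "0 \<le> u" "u \<le> 1" "w = (1 - u) *\<^sub>R circlepath a r t + u *\<^sub>R circlepath a s t"
   by (auto simp: in_segment)
  have "w - a = of_real ((1 - u) * r + u * s) * exp (2 * of_real pi * \<i> * t)"
   unfolding u(3) circlepath by (simp add: scaleR_conv_of_real algebra_simps)
  hence "cmod (w - a) = \<bar>(1 - u) * r + u * s\<bar>" by (simp add: norm_mult del: of_real_add of_real_mult of_real_diff)
  moreover have "(1 - u) * r + u * s = r + u * (s - r)" by (simp add: algebra_simps)
  moreover have "0 \<le> u * (s - r)" "u * (s - r) \<le> s - r" using u assms(2) by (auto intro: mult_left_le_one_le)
  ultimately have "r \<le> dist a w \<and> dist a w \<le> s" using assms(1) by (auto simp: dist_norm norm_minus_commute)
  thus "w \<in> T" using assms(3) by blast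
 qed
qed auto

lemma winding_number_circles_eq:
 assumes "0 < r" "r \<le> s" "continuous_on T f" "\<forall>w\<in>T. f w \<noteq> 0"
  "\<And>w. r \<le> dist a w \<Longrightarrow> dist a w \<le> s \<Longrightarrow> w \<in> T"
 shows "wind (f \<circ> circlepath a r) = wind (f \<circ> circlepath a s)"
 using winding_number_homotopic_image[OF homotopic_circlepaths[OF assms(1,2,5)] assms(3,4)] by blast

text \<open>Asking for the common value on all sufficiently small circles makes the index depend
  only on the germ of \<open>f\<close> at \<open>z\<close>, so that no radius has to be carried
  along. At an isolated puncture \<open>index_at_circle\<close> computes it on one circle.\<close>

definition index_at :: "(complex \<Rightarrow> complex) \<Rightarrow> complex \<Rightarrow> complex" where
 "index_at f z = (THE n. \<exists>\<phi>>0. \<forall>r. 0 < r \<and> r < \<phi> \<longrightarrow> wind (f \<circ> circlepath z r) = n)"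

lemma index_at_eqI:
 assumes "\<phi> > 0" "\<And>r. 0 < r \<Longrightarrow> r < \<phi> \<Longrightarrow> wind (f \<circ> circlepath z r) = n"
 shows "index_at f z = n" unfolding index_at_def
proof (rule the_equality)
 show "\<exists>\<phi>>0. \<forall>r. 0 < r \<and> r < \<phi> \<longrightarrow> wind (f \<circ> circlepath z r) = n" using assms by blast
 fix m assume "\<exists>\<phi>>0. \<forall>r. 0 < r \<and> r < \<phi> \<longrightarrow> wind (f \<circ> circlepath z r) = m"
 then obtain \<delta> where "\<delta> > 0" "\<forall>r. 0 < r \<and> r < \<delta> \<longrightarrow> wind (f \<circ> circlepath z r) = m" by blast
 thus "m = n" using assms(1) assms(2)[of "min \<phi> \<delta> / 2"]
  by (metis field_sum_of_halves less_add_same_cancel1 min.bounded_iff min_def half_gt_zero order_le_less_trans linorder_not_less nless_le)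
qed

lemma index_at_circle:
 assumes "r > 0" "continuous_on (cball z r - {z}) f" "\<forall>w\<in>(cball z r - {z}). f w \<noteq> 0"
 shows "index_at f z = wind (f \<circ> circlepath z r)"
proof (rule index_at_eqI[OF assms(1)])
 fix s assume "0 < s" "s < r"
 thus "wind (f \<circ> circlepath z s) = wind (f \<circ> circlepath z r)"
  by (intro winding_number_circles_eq[OF _ _ assms(2,3)]) (auto simp: dist_commute)
qed

lemma index_at_cong:
 assumes "\<phi> > 0" "\<And>w. w \<in> ball z \<phi> - {z} \<Longrightarrow> f w = g w"
 shows "index_at f z = index_at g z"
proof -
 have *: "wind (f \<circ> circlepath z r) = wind (g \<circ> circlepath z r)" if "0 < r" "r < \<phi>" for r
 proof (rule winding_number_cong)
  fix t :: real assume "0 \<le> t" "t \<le> 1"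
  have "dist z (circlepath z r t) = r" using that(1) by (simp add: circlepath norm_mult dist_norm)
  hence "circlepath z r t \<in> ball z \<phi> - {z}" using that by auto
  from assms(2)[OF this] show "(f \<circ> circlepath z r) t = (g \<circ> circlepath z r) t" by simp
 qed
 have "(\<exists>e>0. \<forall>r. 0 < r \<and> r < e \<longrightarrow> wind (f \<circ> circlepath z r) = n) \<longleftrightarrow>
    (\<exists>e>0. \<forall>r. 0 < r \<and> r < e \<longrightarrow> wind (g \<circ> circlepath z r) = n)" for n
  using assms(1) * by (metis min_less_iff_conj)
 thus ?thesis unfolding index_at_def by simp
qed

lemma circle_loop:
 assumes "r > 0" "continuous_on (sphere z r) f" "\<forall>w\<in>sphere z r. f w \<noteq> 0"
 shows "path (f \<circ> circlepath z r)" "0 \<notin> path_image (f \<circ> circlepath z r)"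
  "pathfinish (f \<circ> circlepath z r) = pathstart (f \<circ> circlepath z r)" using assms
 by (auto simp: path_image_compose path_image_circlepath pathfinish_compose pathstart_compose
   intro!: path_continuous_image)

lemma circle_winding_Ints:
 assumes "r > 0" "continuous_on (sphere z r) f" "\<forall>w\<in>sphere z r. f w \<noteq> 0"
 shows "wind (f \<circ> circlepath z r) \<in> \<int>"
 using circle_loop[OF assms] by (intro integer_winding_number)

lemma winding_number_disc_0:
 assumes "r > 0" "continuous_on (cball z r) f" "\<forall>w\<in>cball z r. f w \<noteq> 0"
 shows "wind (f \<circ> circlepath z r) = 0"
proof -
 have "homotopic_loops (cball z r) (circlepath z r) (\<lambda>t. z)" by (rule homotopic_loops_linear)
   (use assms(1) in \<open>auto simp: path_def pathfinish_def pathstart_def circlepath closed_segment_subset norm_mult dist_norm intro!: continuous_intros\<close>)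
 from winding_number_homotopic_image[OF this assms(2,3)] 
 have "wind (f \<circ> circlepath z r) = wind (\<lambda>t. f z)" by (simp add: o_def)
 moreover have "f z \<noteq> 0" using assms by force
 ultimately show ?thesis by (simp add: winding_number_zero_const)
qed

text \<open>Winding number \<open>0\<close> means that the boundary values are null-homotopic in the
  punctured plane, and a null-homotopic map on a circle extends over the disc. The rest is the
  change between loops, maps on the unit circle and maps on \<open>sphere a r\<close>.\<close>

lemma disc_extension_winding_0:
 fixes f :: "complex \<Rightarrow> complex"
 assumes "r > 0" "continuous_on (sphere a r) f" "\<forall>w\<in>sphere a r. f w \<noteq> 0"
  "wind (f \<circ> circlepath a r) = 0"
 obtains g where "continuous_on (cball a r) g" "\<forall>w\<in>cball a r. g w \<noteq> 0"
  "\<And>w. w \<in> sphere a r \<Longrightarrow> g w = f w"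
proof -
 let ?h = "\<lambda>w. a + of_real r * w"
 have "homotopic_loops (-{0}) (f \<circ> circlepath a r) (\<lambda>t. b)" if "b = 0 \<Longrightarrow> False" and "homotopic_loops (-{0}) (f \<circ> circlepath a r) (\<lambda>t. b)" for b
  using that by simp
 obtain b where b: "homotopic_loops (-{0}) (f \<circ> circlepath a r) (\<lambda>t. b)"
  using winding_number_homotopic_loops_null_eq[OF circle_loop(1,2)[OF assms(1-3)]] assms(4) by blast
 from homotopic_loops_imp_homotopic_circlemaps[OF b]
 have H: "homotopic_with_canon (\<lambda>h. True) (sphere 0 1) (-{0})
  ((f \<circ> circlepath a r) \<circ> (\<lambda>z. Arg2pi z / (2 * pi))) (\<lambda>t. b)" by (simp add: o_def)
 have eq: "circlepath a r (Arg2pi z / (2 * pi)) = ?h z" if "z \<in> sphere 0 1" for z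
  using that Arg2pi_eq[of z] by (simp add: circlepath)
 have "homotopic_with_canon (\<lambda>h. True) (sphere 0 1) (-{0}) (f \<circ> ?h) (\<lambda>t. b)"
  by (rule homotopic_with_eq[OF H]) (auto simp: eq)
 then obtain g where g: "continuous_on (cball 0 1) g" "g ` cball 0 1 \<subseteq> -{0}"
  "\<And>w. w \<in> sphere 0 1 \<Longrightarrow> g w = (f \<circ> ?h) w"
  using nullhomotopic_from_sphere_extension[of 0 1 "-{0}" "f \<circ> ?h"] by blast
 let ?k = "\<lambda>w. (w - a) / of_real r"
 have k: "?k w \<in> cball 0 1" if "w \<in> cball a r" for w
  using that assms(1) by (simp add: dist_norm norm_divide norm_minus_commute)
 show thesis
 proof (rule that[of "g \<circ> ?k"])
  show "continuous_on (cball a r) (g \<circ> ?k)" unfolding o_def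
   by (rule continuous_on_compose2[OF g(1), of _ ?k])
    (use k assms(1) in \<open>auto intro!: continuous_intros simp del: mem_cball\<close>)
  show "\<forall>w\<in>cball a r. (g \<circ> ?k) w \<noteq> 0" using g(2) k by fastforce
  fix w assume "w \<in> sphere a r"
  hence "?k w \<in> sphere 0 1" using assms(1) by (simp add: dist_norm norm_divide norm_minus_commute)
  from g(3)[OF this] show "(g \<circ> ?k) w = f w" using assms(1) by simp
 qed
qed

lemma index_at_mult:
 assumes "r > 0" "continuous_on (cball z r - {z}) f" "\<forall>w\<in>(cball z r - {z}). f w \<noteq> 0"
  "continuous_on (cball z r - {z}) g" "\<forall>w\<in>(cball z r - {z}). g w \<noteq> 0"
 shows "index_at (\<lambda>w. f w * g w) z = index_at f z + index_at g z"
proof -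
 have sub: "sphere z r \<subseteq> cball z r - {z}" using assms(1) by auto
 note cl = circle_loop[OF assms(1) continuous_on_subset[OF _ sub]]
 have "index_at (\<lambda>w. f w * g w) z = wind ((\<lambda>w. f w * g w) \<circ> circlepath z r)"
  by (rule index_at_circle[OF assms(1)]) (use assms in \<open>auto intro!: continuous_intros\<close>)
 also have "\<dots> = wind (\<lambda>t. (f \<circ> circlepath z r) t * (g \<circ> circlepath z r) t)"
  by (simp add: o_def)
 also have "\<dots> = wind (f \<circ> circlepath z r) + wind (g \<circ> circlepath z r)"
  by (intro winding_number_mult cl) (use assms sub in auto)
 finally show ?thesis by (simp add: index_at_circle[OF assms(1)] assms)
qed

lemma index_at_0:
 assumes "r > 0" "continuous_on (cball z r) f" "\<forall>w\<in>cball z r. f w \<noteq> 0"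
 shows "index_at f z = 0" by (subst index_at_circle[OF assms(1)])
  (use assms winding_number_disc_0 in \<open>auto intro: continuous_on_subset\<close>)

lemma index_at_power:
 assumes "r > 0" "continuous_on (cball z r - {z}) f" "\<forall>w\<in>(cball z r - {z}). f w \<noteq> 0"
 shows "index_at (\<lambda>w. f w ^ n) z = of_nat n * index_at f z"
proof (induction n)
 case 0
 show ?case using index_at_0[OF assms(1), of z "\<lambda>w. 1"] by simp
next
 case (Suc n)
 have "index_at (\<lambda>w. f w * f w ^ n) z = index_at f z + index_at (\<lambda>w. f w ^ n) z"
  by (rule index_at_mult[OF assms]) (use assms in \<open>auto intro!: continuous_intros\<close>)
 thus ?case using Suc by (simp add: algebra_simps)
qed

lemma index_at_inverse:
 assumes "r > 0" "continuous_on (cball z r - {z}) f" "\<forall>w\<in>(cball z r - {z}). f w \<noteq> 0"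
 shows "index_at (\<lambda>w. inverse (f w)) z = - index_at f z"
proof -
 have "index_at (\<lambda>w. f w * inverse (f w)) z = index_at f z + index_at (\<lambda>w. inverse (f w)) z"
  by (rule index_at_mult[OF assms]) (use assms in \<open>auto intro!: continuous_intros\<close>)
 moreover have "index_at (\<lambda>w. f w * inverse (f w)) z = index_at (\<lambda>w. 1) z"
  by (rule index_at_cong[OF assms(1)]) (use assms(3) in auto)
 moreover have "index_at (\<lambda>w. 1) z = 0"
  using index_at_0[OF assms(1), of z "\<lambda>w. 1"] by simp
 ultimately show ?thesis by (simp add: eq_neg_iff_add_eq_0 add.commute)
qed

lemma index_at_Ints:
 assumes "r > 0" "continuous_on (cball z r - {z}) f" "\<forall>w\<in>(cball z r - {z}). f w \<noteq> 0"
 shows "index_at f z \<in> \<int>"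
proof -
 have sub: "sphere z r \<subseteq> cball z r - {z}" using assms(1) by auto
 show ?thesis unfolding index_at_circle[OF assms]
  by (rule circle_winding_Ints[OF assms(1)]) (use assms sub in \<open>auto intro: continuous_on_subset\<close>)
qed

lemma finite_isolated_radius:
 assumes "finite Q" "(q::complex) \<in> ball a R"
 obtains d where "d > 0" "cball q d \<subseteq> ball a R" "cball q d \<inter> (Q - {q}) = {}"
proof -
 have "open (ball a R - (Q - {q}))" using assms(1) by (intro open_Diff finite_imp_closed) auto
 then obtain d where "d > 0" "cball q d \<subseteq> ball a R - (Q - {q})"
  using open_contains_cball assms(2) by (metis Diff_iff insertCI)
 thus thesis using that[of d] by blast
qed

text \<open>Dividing by a power of \<open>w - q\<close> makes the index at \<open>q\<close> vanish, and then the puncture can be filled.\<close>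

theorem disc_argument_principle:
 assumes "R > 0" "finite Q" "Q \<subseteq> ball a R"
  "continuous_on (cball a R - Q) f" "\<forall>w\<in>(cball a R - Q). f w \<noteq> 0"
 shows "wind (f \<circ> circlepath a R) = (\<Sum>q\<in>Q. index_at f q)" using assms(2-)
proof (induction Q arbitrary: f rule: finite_induct)
 case empty
 thus ?case using winding_number_disc_0[OF assms(1), of a f] by (simp del: o_apply)
next
 case (insert q Q)
 have q: "q \<in> ball a R" using insert.prems by auto
 obtain d where d: "d > 0" "cball q d \<subseteq> ball a R" "cball q d \<inter> (Q - {q}) = {}"
  using finite_isolated_radius[OF insert.hyps(1) q] .
 have dQ: "cball q d \<inter> Q = {}" using d(3) insert.hyps(2) by blast
 have sub: "cball q d - {q} \<subseteq> cball a R - insert q Q" using d dQ by auto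
 have c1: "continuous_on (cball q d - {q}) f" "\<forall>w\<in>(cball q d - {q}). f w \<noteq> 0"
  using insert.prems(2,3) sub by (auto intro: continuous_on_subset)
 obtain n where n: "index_at f q = of_int n" using index_at_Ints[OF d(1) c1] Ints_cases by blast
 let ?p = "\<lambda>w. (w - q) powi (- n)"
 define g where "g = (\<lambda>w. f w * ?p w)"
 have pc: "continuous_on (- {q}) ?p" "\<forall>w\<in>(- {q}). ?p w \<noteq> 0"
  by (auto intro!: continuous_intros)
 have lin: "path ((\<lambda>w. w - q) \<circ> circlepath b s)" "0 \<notin> path_image ((\<lambda>w. w - q) \<circ> circlepath b s)"
  "wind ((\<lambda>w. w - q) \<circ> circlepath b s) = 1" if "q \<in> ball b s" for b s
 proof -
  have "s > 0" using that by (metis ball_empty empty_iff linorder_not_less)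
  thus "path ((\<lambda>w. w - q) \<circ> circlepath b s)" "0 \<notin> path_image ((\<lambda>w. w - q) \<circ> circlepath b s)"
   using that by (auto simp: path_image_compose path_image_circlepath intro!: path_continuous_image continuous_intros)
  have "winding_number (circlepath b s) q = wind ((\<lambda>w. w - q) \<circ> circlepath b s)"
   by (subst winding_number_offset) (simp add: o_def)
  thus "wind ((\<lambda>w. w - q) \<circ> circlepath b s) = 1"
   using winding_number_circlepath[of q b s] that by (simp add: dist_norm norm_minus_commute)
 qed
 have gc: "continuous_on (cball a R - insert q Q) g" "\<forall>w\<in>(cball a R - insert q Q). g w \<noteq> 0"
  unfolding g_def using insert.prems pc by (auto intro!: continuous_intros continuous_on_subset[OF pc(1)])
 have wg: "wind (g \<circ> circlepath b s) = wind (f \<circ> circlepath b s) - of_int n"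
  if "q \<in> ball b s" "sphere b s \<subseteq> cball a R - insert q Q" for b s
 proof -
  have "s > 0" using that by (metis ball_empty empty_iff linorder_not_less)
  have "\<forall>w\<in>sphere b s. f w \<noteq> 0" using insert.prems(3) that(2) by blast
  note fl = circle_loop[OF \<open>s > 0\<close> continuous_on_subset[OF insert.prems(2) that(2)] this]
  have pl: "path (\<lambda>t. ((\<lambda>w. w - q) \<circ> circlepath b s) t powi (- n))" "0 \<notin> path_image (\<lambda>t. ((\<lambda>w. w - q) \<circ> circlepath b s) t powi (- n))"
   using lin(1,2)[OF that(1)] unfolding path_def path_image_def by (auto intro!: continuous_intros)
  have "wind (g \<circ> circlepath b s) = winding_number (\<lambda>t. (f \<circ> circlepath b s) t * (((\<lambda>w. w - q) \<circ> circlepath b s) t powi (- n))) 0"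
   by (simp add: g_def o_def)
  also have "\<dots> = wind (f \<circ> circlepath b s) + wind (\<lambda>t. ((\<lambda>w. w - q) \<circ> circlepath b s) t powi (- n))"
   by (rule winding_number_mult[OF fl(1,2) pl])
  also have "wind (\<lambda>t. ((\<lambda>w. w - q) \<circ> circlepath b s) t powi (- n)) = - of_int n"
   using winding_number_powi[OF lin(1,2)[OF that(1)], of "-n"] lin(3)[OF that(1)] by simp
  finally show ?thesis by (simp add: o_def)
 qed
 have sd: "sphere q d \<subseteq> cball a R - insert q Q" using sub d(1) by auto
 have "wind (g \<circ> circlepath q d) = 0"
  using wg[of q d] sd d(1) n index_at_circle[OF d(1) c1] by simp
 then obtain h where h: "continuous_on (cball q d) h" "\<forall>w\<in>cball q d. h w \<noteq> 0"
  "\<And>w. w \<in> sphere q d \<Longrightarrow> h w = g w"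
  using disc_extension_winding_0[OF d(1) continuous_on_subset[OF gc(1) sd]] gc(2) sd by blast
 define k where "k = (\<lambda>w. if w \<in> cball q d then h w else g w)"
 have cov: "cball a R - Q = cball q d \<union> (cball a R - Q - ball q d)" using d dQ by auto
 have "continuous_on (cball q d \<union> (cball a R - Q - ball q d)) k" unfolding k_def
 proof (rule continuous_on_cases_local)
  show "closedin (top_of_set (cball q d \<union> (cball a R - Q - ball q d))) (cball q d)"
   by (intro closed_subset) auto
  show "closedin (top_of_set (cball q d \<union> (cball a R - Q - ball q d))) (cball a R - Q - ball q d)"
   unfolding cov[symmetric] closedin_closed by (intro exI[of _ "- ball q d"]) auto
  show "continuous_on (cball a R - Q - ball q d) g"
   by (rule continuous_on_subset[OF gc(1)]) (use d(1) in auto)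
  fix x assume "x \<in> cball q d \<and> x \<notin> cball q d \<or> x \<in> cball a R - Q - ball q d \<and> x \<in> cball q d"
  thus "h x = g x" using h(3) by auto
 qed (rule h(1))
 hence kc: "continuous_on (cball a R - Q) k" using cov by simp
 have k0: "\<forall>w\<in>(cball a R - Q). k w \<noteq> 0"
 proof
  fix w assume w: "w \<in> cball a R - Q"
  show "k w \<noteq> 0"
  proof (cases "w \<in> cball q d")
   case False
   hence "w \<in> cball a R - insert q Q" using w d(1) by auto
   thus ?thesis using gc(2) False by (simp add: k_def)
  qed (use h(2) in \<open>simp add: k_def\<close>)
 qed
 have "wind (k \<circ> circlepath a R) = (\<Sum>x\<in>Q. index_at k x)"
  using insert.prems(1) by (intro insert.IH kc k0) auto
 moreover have "wind (k \<circ> circlepath a R) = wind (g \<circ> circlepath a R)"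
 proof (rule winding_number_cong)
  fix t :: real assume "0 \<le> t" "t \<le> 1"
  have "circlepath a R t \<in> sphere a R" using assms(1) by (simp add: circlepath dist_norm norm_mult)
  hence "circlepath a R t \<notin> cball q d" using d(2) by auto
  thus "(k \<circ> circlepath a R) t = (g \<circ> circlepath a R) t" by (simp add: k_def)
 qed
 moreover have "wind (g \<circ> circlepath a R) = wind (f \<circ> circlepath a R) - of_int n"
  using insert.prems(1) sphere_cball[of a R] by (intro wg[OF q]) fastforce
 \<comment> \<open>The induction hypothesis is about \<open>k\<close>, so its indices at the
   remaining punctures must be traced back to \<open>f\<close>: near them \<open>k\<close> is
   \<open>g\<close>, and the factor \<open>?p\<close> is regular there.\<close>
 moreover have "index_at k x = index_at f x" if x: "x \<in> Q" for x
 proof -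
  obtain e where e: "e > 0" "cball x e \<subseteq> ball a R" "cball x e \<inter> (insert q Q - {x}) = {}"
   using finite_isolated_radius[of "insert q Q" x a R] insert.hyps insert.prems x by (metis finite_insert insertCI subsetD)
  have "open (- cball q d)" "x \<in> - cball q d" using dQ x by auto
  then obtain e' where e': "e' > 0" "ball x e' \<subseteq> - cball q d" using open_contains_ball by blast
  have xq: "x \<noteq> q" using x insert.hyps by blast
  have se: "cball x e - {x} \<subseteq> cball a R - insert q Q" using e(2,3) ball_subset_cball[of a R] by blast
  have pe: "cball x e \<subseteq> - {q}" using e(3) xq by blast
  have "index_at k x = index_at g x"
   by (rule index_at_cong[OF e'(1)]) (use e' in \<open>auto simp: k_def\<close>)
  also have "\<dots> = index_at f x + index_at ?p x" unfolding g_def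
  proof (rule index_at_mult[OF e(1)])
   show "continuous_on (cball x e - {x}) f" "\<forall>w\<in>cball x e - {x}. f w \<noteq> 0"
    using continuous_on_subset[OF insert.prems(2) se] insert.prems(3) se by blast+
   show "continuous_on (cball x e - {x}) ?p" "\<forall>w\<in>cball x e - {x}. ?p w \<noteq> 0"
    using continuous_on_subset[OF pc(1), of "cball x e - {x}"] pc(2) pe by blast+
  qed
  also have "index_at ?p x = 0"
   using index_at_0[OF e(1) continuous_on_subset[OF pc(1) pe]] pc(2) pe by blast
  finally show ?thesis by simp
 qed
 ultimately show ?case using insert.hyps n by (simp add: o_def)
qed

text \<open>In the punctured plane the path is homotopic to the circle, but the homotopy may leave
  the disc where \<open>f\<close> is known. Precomposing \<open>f\<close> with the radial retraction
  \<open>\<rho>\<close> onto the punctured disc removes the problem. General paths are needed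
  because transition maps do not preserve circles.\<close>

lemma index_at_loop:
 assumes "r > 0" "continuous_on (cball z r - {z}) f" "\<forall>w\<in>cball z r - {z}. f w \<noteq> 0"
  "path \<gamma>" "pathfinish \<gamma> = pathstart \<gamma>" "path_image \<gamma> \<subseteq> cball z r - {z}" "winding_number \<gamma> z = 1"
 shows "wind (f \<circ> \<gamma>) = index_at f z"
proof -
 define \<rho> where "\<rho> = (\<lambda>w. z + of_real (min 1 (r / cmod (w - z))) * (w - z))"
 have hl: "homotopic_loops (-{z}) \<gamma> (circlepath z r)"
  using winding_number_circlepath_centre[OF assms(1), of z] assms(1,4-)
  by (subst winding_number_homotopic_loops_eq[symmetric]) auto
 have r1: "\<rho> w \<in> cball z r - {z}" if "w \<noteq> z" for w
 proof -
  have "min 1 (r / cmod (w - z)) > 0" using that assms(1) by simp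
  hence "cmod (\<rho> w - z) = min 1 (r / cmod (w - z)) * cmod (w - z)" by (simp add: \<rho>_def norm_mult)
  also have "\<dots> = min (cmod (w - z)) r" using that by (simp add: min_mult_distrib_right)
  finally have "cmod (\<rho> w - z) = min (cmod (w - z)) r" .
  thus ?thesis using that assms(1) by (auto simp: dist_norm norm_minus_commute min_def split: if_splits)
 qed
 have r2: "\<rho> w = w" if "w \<in> cball z r - {z}" for w
 proof -
  have "min 1 (r / cmod (w - z)) = 1" using that assms(1)
   by (auto simp: dist_norm norm_minus_commute min_def field_simps)
  thus ?thesis by (simp add: \<rho>_def)
 qed
 have rc: "continuous_on (-{z}) \<rho>" unfolding \<rho>_def by (intro continuous_intros) auto
 have fc: "continuous_on (-{z}) (\<lambda>w. f (\<rho> w))"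
  by (rule continuous_on_compose2[OF assms(2) rc]) (use r1 in blast)
 have "\<forall>w\<in>-{z}. f (\<rho> w) \<noteq> 0" using r1 assms(3) by blast
 from winding_number_homotopic_image[OF hl fc this] have "wind ((\<lambda>w. f (\<rho> w)) \<circ> \<gamma>) = wind ((\<lambda>w. f (\<rho> w)) \<circ> circlepath z r)"
  .
 moreover have "wind ((\<lambda>w. f (\<rho> w)) \<circ> \<gamma>) = wind (f \<circ> \<gamma>)"
 proof (rule winding_number_cong)
  fix t :: real assume "0 \<le> t" "t \<le> 1"
  hence "\<gamma> t \<in> path_image \<gamma>" by (simp add: path_image_def)
  hence "\<gamma> t \<in> cball z r - {z}" using assms(6) by blast
  thus "((\<lambda>w. f (\<rho> w)) \<circ> \<gamma>) t = (f \<circ> \<gamma>) t" using r2 by simp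
 qed
 moreover have "wind ((\<lambda>w. f (\<rho> w)) \<circ> circlepath z r) = wind (f \<circ> circlepath z r)"
 proof (rule winding_number_cong)
  fix t :: real assume "0 \<le> t" "t \<le> 1"
  have "dist z (circlepath z r t) = r" using assms(1) by (simp add: circlepath norm_mult dist_norm)
  hence "circlepath z r t \<in> cball z r - {z}" using assms(1) by auto
  thus "((\<lambda>w. f (\<rho> w)) \<circ> circlepath z r) t = (f \<circ> circlepath z r) t" using r2 by simp
 qed
 ultimately show ?thesis using index_at_circle[OF assms(1-3)] by simp
qed

text \<open>A circle-valued function on a compact plane set extends away from finitely many points,
  and these can be pushed to any set \<open>L\<close> meeting the bounded complementary components.
  \<open>L = UNIV\<close> gives uncontrolled punctures; a single point collects all of them.\<close>

lemma unimodular_extension: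
 fixes f :: "complex \<Rightarrow> complex"
 assumes "compact S" "continuous_on S f" "\<forall>w\<in>S. cmod (f w) = 1"
  and "\<And>C. C \<in> components (- S) \<Longrightarrow> bounded C \<Longrightarrow> C \<inter> L \<noteq> {}"
 obtains K g where "finite K" "K \<subseteq> L" "K \<inter> S = {}" "continuous_on (- K) g"
  "\<forall>w\<in>- K. cmod (g w) = 1" "\<And>w. w \<in> S \<Longrightarrow> g w = f w"
proof -
 obtain K g where "finite K" "K \<subseteq> L" "disjnt K S" "continuous_on (UNIV - K) g"
  "g \<in> (UNIV - K) \<rightarrow> sphere 0 1" "\<And>w. w \<in> S \<Longrightarrow> g w = f w"
  by (rule extend_map_affine_to_sphere_cofinite[of S UNIV 1 f 0 L])
   (use assms in \<open>auto simp: Compl_eq_Diff_UNIV\<close>)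
 thus thesis by (intro that[of K g]) (auto simp: Compl_eq_Diff_UNIV disjnt_def Pi_iff)
qed

text \<open>The open disc is the only bounded component of the complement of the circle, so one
  puncture, at any chosen point \<open>c\<close> of the disc, is enough.\<close>

lemma unimodular_cone:
 fixes f :: "complex \<Rightarrow> complex"
 assumes "continuous_on (sphere a R) f" "\<forall>w\<in>sphere a R. cmod (f w) = 1" "c \<in> ball a R"
 obtains g where "continuous_on (- {c}) g" "\<forall>w\<in>- {c}. cmod (g w) = 1"
  "\<And>w. w \<in> sphere a R \<Longrightarrow> g w = f w"
proof -
 have "C \<inter> {c} \<noteq> {}" if C: "C \<in> components (- sphere a R)" "bounded C" for C
 proof -
  have un: "- sphere a R = ball a R \<union> - cball a R" by auto
  have conn: "connected (- cball a R)" by (rule connected_complement_bounded_convex) auto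
  have inf: "\<not> bounded (- cball a R)"
   using bounded_Un[of "cball a R" "- cball a R"] by (auto simp: Un_commute)
  obtain x where x: "x \<in> C" using C(1) in_components_nonempty by blast
  hence "x \<in> ball a R \<or> x \<in> - cball a R" using C(1) in_components_subset un by blast
  thus ?thesis
  proof
   assume "x \<in> ball a R"
   hence "ball a R \<subseteq> C" using components_maximal[OF C(1), of "ball a R"] x un by blast
   thus ?thesis using assms(3) by auto
  next
   assume "x \<in> - cball a R"
   hence "- cball a R \<subseteq> C" using components_maximal[OF C(1) conn] x un by blast
   thus ?thesis using inf C(2) bounded_subset by blast
  qed
 qed
 then obtain K g where K: "K \<subseteq> {c}" "continuous_on (- K) g" "\<forall>w\<in>- K. cmod (g w) = 1"
  "\<And>w. w \<in> sphere a R \<Longrightarrow> g w = f w"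
  using unimodular_extension[OF _ assms(1,2), of "{c}"] by (metis compact_sphere)
 show thesis by (rule that[of g]) (use K continuous_on_subset[OF K(2)] in auto)
qed

text \<open>A dipole is \<open>(w - y) / (w - y')\<close> near the two charges and \<open>1\<close> far away; the logarithm of
 the quotient is defined far away because the quotient is close to \<open>1\<close> there.\<close>

lemma dipole:
 assumes "R > 0" "y \<in> ball a (R/8)" "y' \<in> ball a (R/8)" "y \<noteq> y'"
 obtains \<theta> where "continuous_on (- {y, y'}) \<theta>" "\<forall>w\<in>- {y, y'}. cmod (\<theta> w) = 1"
  "\<And>w. w \<notin> ball a R \<Longrightarrow> \<theta> w = 1"
  "\<And>\<gamma>. path \<gamma> \<Longrightarrow> pathfinish \<gamma> = pathstart \<gamma> \<Longrightarrow> path_image \<gamma> \<subseteq> - {y, y'} \<Longrightarrow>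
   wind (\<theta> \<circ> \<gamma>) = winding_number \<gamma> y - winding_number \<gamma> y'"
proof -
 define q where "q = (\<lambda>w. (w - y) / (w - y'))"
 \<comment> \<open>\<open>lam\<close> is \<open>1\<close> up to radius \<open>R/2\<close> and
   \<open>0\<close> from radius \<open>R\<close> on, so that \<open>\<theta>0\<close> is the power
   of \<open>q\<close> with exponent \<open>lam\<close>: it is \<open>q\<close> near the charges and
   \<open>1\<close> outside the ball.\<close>
 define lam where "lam = (\<lambda>w. min 1 (max 0 (2 - 2 * cmod (w - a) / R)))"
 define u where "u = (\<lambda>w. (of_real (lam w) - 1) * Ln (q w))"
 define \<theta>0 where "\<theta>0 = (\<lambda>w. q w * exp (u w))"
 define \<theta> where "\<theta> = (\<lambda>w. \<theta>0 w / of_real (cmod (\<theta>0 w)))"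
 \<comment> \<open>With both charges within \<open>R/8\<close> of the centre, a point at distance at
   least \<open>R/2\<close> has distance more than \<open>3R/8\<close> from \<open>y'\<close>, while
   the charges are less than \<open>R/4\<close> apart. Hence \<open>q w\<close> is at distance less
   than \<open>1\<close> from \<open>1\<close>, and the principal logarithm is continuous
   there.\<close>
 have far: "Re (q w) > 0" if "w \<notin> ball a (R/2)" for w
 proof -
  have "cmod (w - a) \<ge> R/2" using that by (simp add: dist_norm norm_minus_commute)
  moreover have y: "cmod (y - a) < R/8" "cmod (y' - a) < R/8" using assms by (auto simp: dist_norm norm_minus_commute)
  moreover have "cmod (w - y') \<ge> cmod (w - a) - cmod (y' - a)"
   using norm_triangle_ineq2[of "w - a" "y' - a"] by simp
  moreover have "cmod (y' - y) \<le> cmod (y' - a) + cmod (y - a)"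
   using norm_triangle_ineq4[of "y' - a" "y - a"] by simp
  ultimately have *: "cmod (w - y') > 0" "cmod (y' - y) < cmod (w - y')" using assms(1) by linarith+
  have "q w - 1 = (y' - y) / (w - y')" using *(1) by (simp add: q_def field_simps)
  hence "cmod (q w - 1) < 1" using * by (simp add: norm_divide)
  hence "\<bar>Re (q w - 1)\<bar> < 1" using abs_Re_le_cmod[of "q w - 1"] by linarith
  thus ?thesis by simp
 qed
 have qc: "continuous_on (- {y, y'}) q" unfolding q_def by (intro continuous_intros) auto
 have q0: "q w \<noteq> 0" if "w \<in> - {y, y'}" for w using that by (simp add: q_def)
 have lamc: "continuous_on A lam" for A unfolding lam_def by (intro continuous_intros) (use assms(1) in auto)
 have inball: "dist a y < R/2" "dist a y' < R/2" using assms(1-3) by auto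
 have un: "- {y, y'} = (cball a (R/2) - {y, y'}) \<union> (- ball a (R/2))"
  using inball by (auto simp: not_less)
 have sb: "- ball a (R/2) \<subseteq> - {y, y'}" using inball by (auto simp: not_less)
 have uc: "continuous_on (- {y, y'}) u" unfolding un
 proof (rule continuous_on_Un_local)
  show "closedin (top_of_set (cball a (R/2) - {y, y'} \<union> - ball a (R/2))) (cball a (R/2) - {y, y'})"
   unfolding un[symmetric] closedin_closed by (intro exI[of _ "cball a (R/2)"]) auto
  show "closedin (top_of_set (cball a (R/2) - {y, y'} \<union> - ball a (R/2))) (- ball a (R/2))"
   unfolding un[symmetric] closedin_closed by (intro exI[of _ "- ball a (R/2)"]) (use assms in auto)
  have "u w = 0" if "w \<in> cball a (R/2)" for w
  proof -
   have "lam w = 1" using that assms(1) by (simp add: lam_def dist_norm norm_minus_commute min_def max_def field_simps)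
   thus ?thesis by (simp add: u_def)
  qed
  thus "continuous_on (cball a (R/2) - {y, y'}) u"
   by (subst continuous_on_cong[OF refl, where g = "\<lambda>w. 0"]) auto
  have "q w \<notin> \<real>\<^sub>\<le>\<^sub>0" if "w \<in> - ball a (R/2)" for w
   using far[of w] that by (auto simp: complex_nonpos_Reals_iff)
  thus "continuous_on (- ball a (R/2)) u" unfolding u_def
   by (intro continuous_on_mult continuous_on_diff continuous_on_of_real lamc continuous_on_Ln'
     continuous_on_subset[OF qc] continuous_on_const) (use sb in auto)
 qed
 have t0: "\<theta>0 w \<noteq> 0" if "w \<in> - {y, y'}" for w using q0[OF that] by (simp add: \<theta>0_def)
 have t0c: "continuous_on (- {y, y'}) \<theta>0" unfolding \<theta>0_def by (intro continuous_intros qc uc)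
 show thesis
 proof (rule that[of \<theta>])
  show "continuous_on (- {y, y'}) \<theta>"
   unfolding \<theta>_def using t0 by (intro continuous_intros t0c) auto
  show "\<forall>w\<in>- {y, y'}. cmod (\<theta> w) = 1" using t0 by (auto simp: \<theta>_def norm_divide)
  fix w assume w: "w \<notin> ball a R"
  hence "cmod (w - a) \<ge> R" by (simp add: dist_norm norm_minus_commute)
  hence "lam w = 0" using assms(1) by (simp add: lam_def field_simps)
  moreover have "w \<notin> ball a (R/2)" using w assms(1) by auto
  hence "q w \<noteq> 0" using far by fastforce
  ultimately have "\<theta>0 w = 1" by (simp add: \<theta>0_def u_def exp_minus)
  thus "\<theta> w = 1" by (simp add: \<theta>_def)
 next
  fix \<gamma> assume \<gamma>: "path \<gamma>" "pathfinish \<gamma> = pathstart \<gamma>" "path_image \<gamma> \<subseteq> - {y, y'}"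
  let ?a = "\<lambda>t. \<gamma> t - y" and ?b = "\<lambda>t. \<gamma> t - y'" and ?e = "\<lambda>t. exp (u (\<gamma> t))"
  have g: "\<gamma> t \<noteq> y" "\<gamma> t \<noteq> y'" if "t \<in> {0..1}" for t
  proof -
   have "\<gamma> t \<in> - {y, y'}" using \<gamma>(3) that unfolding path_image_def by blast
   thus "\<gamma> t \<noteq> y" "\<gamma> t \<noteq> y'" by auto
  qed
  have gc: "continuous_on {0..1} \<gamma>" using \<gamma>(1) by (simp add: path_def)
  have ab: "path ?a" "path ?b" "path (\<lambda>t. ?a t / ?b t)"
   unfolding path_def using g by (auto intro!: continuous_intros gc)
  have ab0: "0 \<notin> path_image ?a" "0 \<notin> path_image ?b" "0 \<notin> path_image (\<lambda>t. ?a t / ?b t)"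
   using g unfolding path_image_def image_iff by simp_all
  have "path (u \<circ> \<gamma>)" using \<gamma>(1) by (rule path_continuous_image) (rule continuous_on_subset[OF uc \<gamma>(3)])
  hence e: "path ?e" unfolding path_def o_def by (rule continuous_on_exp)
  have e0: "0 \<notin> path_image ?e" unfolding path_image_def image_iff by simp
  have p: "path (\<theta>0 \<circ> \<gamma>)"
   using \<gamma>(1) by (rule path_continuous_image) (rule continuous_on_subset[OF t0c \<gamma>(3)])
  have p0: "0 \<notin> path_image (\<theta>0 \<circ> \<gamma>)"
   using t0 \<gamma>(3) by (force simp: path_image_compose)
  have p1: "pathfinish (\<theta>0 \<circ> \<gamma>) = pathstart (\<theta>0 \<circ> \<gamma>)"
   using \<gamma>(2) by (simp only: pathfinish_compose pathstart_compose)
  have "wind (\<theta> \<circ> \<gamma>) = wind (\<theta>0 \<circ> \<gamma>)"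
   using winding_number_normalize[OF p p0 p1] by (simp add: \<theta>_def o_def)
  also have "\<theta>0 \<circ> \<gamma> = (\<lambda>t. (?a t / ?b t) * ?e t)" by (simp add: \<theta>0_def q_def o_def)
  also have "wind \<dots> = wind (\<lambda>t. ?a t / ?b t) + wind ?e"
   by (rule winding_number_mult[OF ab(3) ab0(3) e e0])
  also have "wind ?e = 0"
   by (rule winding_number_exp_closed[OF \<gamma>(1,2) continuous_on_subset[OF uc \<gamma>(3)]])
  also have "wind (\<lambda>t. ?a t / ?b t) = wind ?a - wind ?b"
   by (rule winding_number_divide[OF ab(1) ab0(1) ab(2) ab0(2)])
  finally show "wind (\<theta> \<circ> \<gamma>) = winding_number \<gamma> y - winding_number \<gamma> y'"
   by (simp add: o_def flip: winding_number_offset)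
 qed
qed

lemma dipole_index:
 assumes "y \<noteq> y'" and "continuous_on (- {y, y'}) \<theta>" and nz: "\<forall>w\<in>- {y, y'}. cmod (\<theta> w) = 1"
  and wn: "\<And>\<gamma>. path \<gamma> \<Longrightarrow> pathfinish \<gamma> = pathstart \<gamma> \<Longrightarrow> path_image \<gamma> \<subseteq> - {y, y'} \<Longrightarrow>
   wind (\<theta> \<circ> \<gamma>) = winding_number \<gamma> y - winding_number \<gamma> y'"
 shows "index_at \<theta> y = 1" "index_at \<theta> y' = - 1"
proof -
 define r where "r = dist y y' / 2"
 have r: "r > 0" using assms(1) by (simp add: r_def)
 have n: "y' \<notin> cball y r" "y \<notin> cball y' r" using r by (auto simp: r_def dist_commute)
 have sub: "cball y r - {y} \<subseteq> - {y, y'}" "cball y' r - {y'} \<subseteq> - {y, y'}" using n by auto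
 have n0: "\<forall>w\<in>- {y, y'}. \<theta> w \<noteq> 0" using nz by force
 have "index_at \<theta> y = wind (\<theta> \<circ> circlepath y r)"
  using sub n0 by (intro index_at_circle[OF r continuous_on_subset[OF assms(2)]]) auto
 also have "\<dots> = winding_number (circlepath y r) y - winding_number (circlepath y r) y'"
  using r n by (intro wn) (auto simp: path_image_circlepath)
 also have "winding_number (circlepath y r) y' = 0"
  by (rule winding_number_zero_outside[of _ "cball y r"]) (use r n in \<open>auto simp: path_image_circlepath\<close>)
 finally show "index_at \<theta> y = 1" using winding_number_circlepath_centre[OF r] by simp
 have "index_at \<theta> y' = wind (\<theta> \<circ> circlepath y' r)"
  using sub n0 by (intro index_at_circle[OF r continuous_on_subset[OF assms(2)]]) auto
 also have "\<dots> = winding_number (circlepath y' r) y - winding_number (circlepath y' r) y'"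
  using r n by (intro wn) (auto simp: path_image_circlepath)
 also have "winding_number (circlepath y' r) y = 0"
  by (rule winding_number_zero_outside[of _ "cball y' r"]) (use r n in \<open>auto simp: path_image_circlepath\<close>)
 finally show "index_at \<theta> y' = - 1" using winding_number_circlepath_centre[OF r] by simp
qed

section \<open>Oriented surfaces\<close>

abbreviation coord :: "(complex \<Rightarrow> 'x) \<Rightarrow> 'x \<Rightarrow> complex" where
 "coord \<equiv> inv_into UNIV"

text \<open>Charts are parametrized by the whole plane. They are compatible if the transition maps have
 local degree \<open>1\<close>, measured by the winding number of the image of a small circle.\<close>

locale oriented_surface =
 fixes X :: "'x topology" and E :: "(complex \<Rightarrow> 'x) set"
 assumes hausdorff: "Hausdorff_space X"
  and chart_inj: "e \<in> E \<Longrightarrow> inj e"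
  and openin_iff: "openin X U \<longleftrightarrow> U \<subseteq> (\<Union>e\<in>E. range e) \<and> (\<forall>e\<in>E. open (e -` U))"
  and chart_open: "e \<in> E \<Longrightarrow> e' \<in> E \<Longrightarrow> open W \<Longrightarrow> open (e' -` (e ` W))"
  and oriented: "e \<in> E \<Longrightarrow> e' \<in> E \<Longrightarrow> e z = e' z' \<Longrightarrow>
   \<exists>r>0. e ` cball z r \<subseteq> range e' \<and> winding_number (coord e' \<circ> e \<circ> circlepath z r) z' = 1"
begin

lemma topspace_eq: "topspace X = (\<Union>e\<in>E. range e)"
proof
 show "topspace X \<subseteq> (\<Union>e\<in>E. range e)" using openin_iff[of "topspace X"] by simp
 have "e -` (\<Union>e\<in>E. range e) = UNIV" if "e \<in> E" for e using that by auto
 hence "openin X (\<Union>e\<in>E. range e)" using openin_iff[of "\<Union>e\<in>E. range e"] by auto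
 thus "(\<Union>e\<in>E. range e) \<subseteq> topspace X" by (rule openin_subset)
qed

lemma chart_in_topspace: "e \<in> E \<Longrightarrow> e z \<in> topspace X" unfolding topspace_eq by auto

lemma coord_chart [simp]: "e \<in> E \<Longrightarrow> coord e (e z) = z" using chart_inj by simp

lemma openin_chart_image: "e \<in> E \<Longrightarrow> open W \<Longrightarrow> openin X (e ` W)"
 unfolding openin_iff using chart_open by auto

lemma open_chart_vimage: "e \<in> E \<Longrightarrow> openin X U \<Longrightarrow> open (e -` U)"
 using openin_iff by blast

lemma continuous_map_chart: "e \<in> E \<Longrightarrow> continuous_map euclidean X e"
 unfolding continuous_map_def using chart_in_topspace open_chart_vimage by (auto simp: vimage_def)

lemma compactin_chart_image: "e \<in> E \<Longrightarrow> compact K \<Longrightarrow> compactin X (e ` K)"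
 using image_compactin[OF _ continuous_map_chart] by (simp add: compactin_euclidean_iff)

lemma closedin_chart_image: "e \<in> E \<Longrightarrow> compact K \<Longrightarrow> closedin X (e ` K)"
 using compactin_chart_image compactin_imp_closedin hausdorff by blast

lemma closed_chart_vimage:
 assumes "e \<in> E" "closedin X U"
 shows "closed (e -` U)"
proof -
 have "e -` U = - (e -` (topspace X - U))" using chart_in_topspace[OF assms(1)] by auto
 moreover have "open (e -` (topspace X - U))"
  using open_chart_vimage[OF assms(1), of "topspace X - U"] assms(2) by (simp add: closedin_def)
 ultimately show ?thesis unfolding closed_def by simp
qed

lemma in_range_chart: "x \<in> topspace X \<Longrightarrow> \<exists>e\<in>E. \<exists>z. x = e z"
 unfolding topspace_eq by auto

lemma transition_continuous:
 assumes "e \<in> E" "e' \<in> E"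
 shows "continuous_on (e -` range e') (coord e' \<circ> e)"
proof -
 have o: "open (e -` range e')" using chart_open[OF assms(2,1) open_UNIV] .
 show ?thesis unfolding continuous_on_open_vimage[OF o]
 proof (intro allI impI)
  fix B :: "complex set" assume "open B"
  moreover have "(coord e' \<circ> e) -` B \<inter> e -` range e' = e -` (e' ` B)"
   using chart_inj[OF assms(2)] by (auto simp: inj_def image_iff)
  ultimately show "open ((coord e' \<circ> e) -` B \<inter> e -` range e')"
   using chart_open[OF assms(2,1)] by simp
 qed
qed

text \<open>Continuity on arbitrary subsets is needed, since functions are glued along closed
  pieces; testing it in charts leaves only plane topology.\<close>

definition chart_continuous :: "'x set \<Rightarrow> ('x \<Rightarrow> complex) \<Rightarrow> bool" where
 "chart_continuous Y g \<longleftrightarrow> (\<forall>e\<in>E. continuous_on (e -` Y) (g \<circ> e))"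

lemma chart_continuousD: "chart_continuous Y g \<Longrightarrow> e \<in> E \<Longrightarrow> A \<subseteq> e -` Y \<Longrightarrow> continuous_on A (g \<circ> e)"
 unfolding chart_continuous_def by (blast intro: continuous_on_subset)

lemma chart_continuous_subset: "chart_continuous Y g \<Longrightarrow> Z \<subseteq> Y \<Longrightarrow> chart_continuous Z g"
 unfolding chart_continuous_def by (blast intro: continuous_on_subset)

lemma chart_continuous_cong:
 assumes "chart_continuous Y g" "\<And>x. x \<in> Y \<Longrightarrow> f x = g x"
 shows "chart_continuous Y f" unfolding chart_continuous_def
proof
 fix e assume "e \<in> E"
 hence "continuous_on (e -` Y) (g \<circ> e)" using assms(1) by (auto simp: chart_continuous_def)
 thus "continuous_on (e -` Y) (f \<circ> e)" by (rule continuous_on_eq) (use assms(2) in auto)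
qed

lemma chart_continuous_const [simp]: "chart_continuous Y (\<lambda>x. c)"
 by (simp add: chart_continuous_def o_def)

lemma chart_continuous_mult:
 "chart_continuous Y f \<Longrightarrow> chart_continuous Y g \<Longrightarrow> chart_continuous Y (\<lambda>x. f x * g x)"
 unfolding chart_continuous_def o_def by (auto intro!: continuous_on_mult)

lemma chart_continuous_power:
 "chart_continuous Y f \<Longrightarrow> chart_continuous Y (\<lambda>x. f x ^ n)"
 unfolding chart_continuous_def o_def by (auto intro!: continuous_on_power)

lemma chart_continuous_inverse:
 "chart_continuous Y f \<Longrightarrow> \<forall>x\<in>Y. f x \<noteq> 0 \<Longrightarrow> chart_continuous Y (\<lambda>x. inverse (f x))"
 unfolding chart_continuous_def o_def by (auto intro!: continuous_on_inverse)

lemma chart_continuous_glue: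
 assumes "chart_continuous (Y \<inter> A) g" "chart_continuous (Y \<inter> B) g" "closedin X A" "closedin X B"
  "Y \<subseteq> A \<union> B"
 shows "chart_continuous Y g" unfolding chart_continuous_def
proof
 fix e assume e: "e \<in> E"
 have un: "e -` Y = e -` (Y \<inter> A) \<union> e -` (Y \<inter> B)" using assms(5) by auto
 show "continuous_on (e -` Y) (g \<circ> e)" unfolding un
 proof (rule continuous_on_Un_local)
  show "closedin (top_of_set (e -` (Y \<inter> A) \<union> e -` (Y \<inter> B))) (e -` (Y \<inter> A))"
   unfolding un[symmetric] closedin_closed using closed_chart_vimage[OF e assms(3)]
   by (intro exI[of _ "e -` A"]) auto
  show "closedin (top_of_set (e -` (Y \<inter> A) \<union> e -` (Y \<inter> B))) (e -` (Y \<inter> B))"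
   unfolding un[symmetric] closedin_closed using closed_chart_vimage[OF e assms(4)]
   by (intro exI[of _ "e -` B"]) auto
 qed (use assms(1,2) e in \<open>auto simp: chart_continuous_def\<close>)
qed

lemma chart_continuous_from_chart:
 assumes "e \<in> E" "continuous_on W h" "Y \<subseteq> e ` W"
 shows "chart_continuous Y (\<lambda>x. h (coord e x))" unfolding chart_continuous_def
proof
 fix e' assume e': "e' \<in> E"
 have "continuous_on (e' -` Y) (\<lambda>w. h ((coord e \<circ> e') w))"
 proof (rule continuous_on_compose2[OF assms(2)])
  show "continuous_on (e' -` Y) (coord e \<circ> e')"
   by (rule continuous_on_subset[OF transition_continuous[OF e' assms(1)]]) (use assms(3) in auto)
  show "(coord e \<circ> e') ` e' -` Y \<subseteq> W"
  proof
   fix w assume "w \<in> (coord e \<circ> e') ` e' -` Y"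
   then obtain v where v: "w = coord e (e' v)" "e' v \<in> Y" by auto
   then obtain u where "u \<in> W" "e' v = e u" using assms(3) by auto
   thus "w \<in> W" using v assms(1) by simp
  qed
 qed
 thus "continuous_on (e' -` Y) ((\<lambda>x. h (coord e x)) \<circ> e')" by (simp add: o_def)
qed

lemma chart_continuous_imp_continuous_map:
 assumes "chart_continuous Y g" "Y \<subseteq> topspace X"
 shows "continuous_map (subtopology X Y) euclidean g" unfolding continuous_map
proof (intro conjI allI impI)
 fix U :: "complex set" assume U: "openin euclidean U"
 show "openin (subtopology X Y) {x \<in> topspace (subtopology X Y). g x \<in> U}"
  unfolding openin_subopen[of _ "{x \<in> topspace (subtopology X Y). g x \<in> U}"]
 proof
  fix x assume "x \<in> {x \<in> topspace (subtopology X Y). g x \<in> U}"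
  hence x: "x \<in> Y" "g x \<in> U" by auto
  then obtain e z where e: "e \<in> E" "x = e z" using in_range_chart assms(2) by blast
  have "continuous_on (e -` Y) (g \<circ> e)" using assms(1) e by (auto simp: chart_continuous_def)
  then obtain W where W: "open W" "W \<inter> e -` Y = (g \<circ> e) -` U \<inter> e -` Y"
   using U unfolding continuous_on_open_invariant by (metis open_openin)
  have "openin (subtopology X Y) (e ` W \<inter> Y)"
   using openin_chart_image[OF e(1) W(1)] by (rule openin_subtopology_Int)
  moreover have "x \<in> e ` W \<inter> Y" using x e W(2) by auto
  moreover have "e ` W \<inter> Y \<subseteq> {x \<in> topspace (subtopology X Y). g x \<in> U}"
   using W(2) assms(2) by auto
  ultimately show "\<exists>T. openin (subtopology X Y) T \<and> x \<in> T \<and> T \<subseteq> {x \<in> topspace (subtopology X Y). g x \<in> U}"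
   by blast
 qed
qed auto

lemma chart_continuous_path:
 assumes "chart_continuous Y g" "continuous_map (top_of_set {0..1}) X \<gamma>" "\<gamma> ` {0..1} \<subseteq> Y" "Y \<subseteq> topspace X"
 shows "path (g \<circ> \<gamma>)"
proof -
 have "continuous_map (top_of_set {0..1}) (subtopology X Y) \<gamma>"
  using assms by (auto simp: continuous_map_in_subtopology)
 from continuous_map_compose[OF this chart_continuous_imp_continuous_map[OF assms(1,4)]]
 show ?thesis by (simp add: path_def)
qed

subsection \<open>The index at a puncture\<close>

definition isolated_puncture :: "('x \<Rightarrow> complex) \<Rightarrow> 'x \<Rightarrow> bool" where
 "isolated_puncture g q \<longleftrightarrow> (\<exists>N. openin X N \<and> q \<in> N \<and> chart_continuous (N - {q}) g \<and> (\<forall>x\<in>N - {q}. g x \<noteq> 0))"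

text \<open>By \<open>index_chart_independent\<close> the choice does not matter at an isolated
  puncture. Choosing the value, rather than a chart, reduces \<open>index_cong\<close> to an
  equality of predicates.\<close>

definition index :: "('x \<Rightarrow> complex) \<Rightarrow> 'x \<Rightarrow> complex" where
 "index g q = (SOME n. \<exists>e\<in>E. \<exists>z. e z = q \<and> n = index_at (g \<circ> e) z)"

lemma chart_punctured_disc:
 assumes "e \<in> E" "openin X N" "e z \<in> N" "chart_continuous (N - {e z}) g" "\<forall>x\<in>N - {e z}. g x \<noteq> 0"
 obtains r where "r > 0" "e ` cball z r \<subseteq> N"
  "\<forall>s\<le>r. continuous_on (cball z s - {z}) (g \<circ> e) \<and> (\<forall>w\<in>cball z s - {z}. (g \<circ> e) w \<noteq> 0)"
proof -
 have "open (e -` N)" "z \<in> e -` N" using open_chart_vimage assms by auto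
 then obtain r where r: "r > 0" "cball z r \<subseteq> e -` N" using open_contains_cball by blast
 have ne: "e w \<noteq> e z" if "w \<noteq> z" for w using chart_inj[OF assms(1)] that by (auto simp: inj_def)
 show thesis
 proof (rule that[OF r(1)])
  show "e ` cball z r \<subseteq> N" using r by auto
  show "\<forall>s\<le>r. continuous_on (cball z s - {z}) (g \<circ> e) \<and> (\<forall>w\<in>cball z s - {z}. (g \<circ> e) w \<noteq> 0)"
  proof (intro allI impI conjI)
   fix s assume "s \<le> r"
   hence *: "cball z s - {z} \<subseteq> e -` (N - {e z})" using r(2) subset_cball[of s r z] ne by auto
   show "continuous_on (cball z s - {z}) (g \<circ> e)" by (rule chart_continuousD[OF assms(4,1) *])
   show "\<forall>w\<in>cball z s - {z}. (g \<circ> e) w \<noteq> 0" using * assms(5) by auto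
  qed
 qed
qed

text \<open>Here the orientation enters: the transition map \<open>T\<close> takes a small circle
  around \<open>z\<close> to a closed path winding once around \<open>z'\<close>, and
  \<open>index_at_loop\<close> evaluates \<open>g \<circ> e'\<close> along that path.\<close>

lemma index_chart_independent:
 assumes "isolated_puncture g q" "e \<in> E" "e z = q" "e' \<in> E" "e' z' = q"
 shows "index_at (g \<circ> e) z = index_at (g \<circ> e') z'"
proof -
 obtain N where N: "openin X N" "q \<in> N" "chart_continuous (N - {q}) g" "\<forall>x\<in>N - {q}. g x \<noteq> 0"
  using assms(1) unfolding isolated_puncture_def by blast
 obtain r' where r': "r' > 0" "e' ` cball z' r' \<subseteq> N" "continuous_on (cball z' r' - {z'}) (g \<circ> e')"
  "\<forall>w\<in>cball z' r' - {z'}. (g \<circ> e') w \<noteq> 0"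
  using chart_punctured_disc[OF assms(4) N(1), of z' g] N assms(5) by (metis order_refl)
 obtain r1 where r1: "r1 > 0" "e ` cball z r1 \<subseteq> range e'" "winding_number (coord e' \<circ> e \<circ> circlepath z r1) z' = 1"
  using oriented[OF assms(2,4)] assms(3,5) by metis
 define T where "T = coord e' \<circ> e"
 have Tc: "continuous_on (cball z r1) T"
  unfolding T_def by (rule continuous_on_subset[OF transition_continuous[OF assms(2,4)]]) (use r1 in auto)
 have eT: "e' (T w) = e w" if "w \<in> cball z r1" for w
  using r1(2) that unfolding T_def by (auto simp: f_inv_into_f image_subset_iff)
 have "e z = e' z'" using assms(3,5) by simp
 hence Tz: "T z = z'" using assms(4) by (simp add: T_def)
 have Tne: "T w \<noteq> z'" if "w \<in> cball z r1" "w \<noteq> z" for w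
  using eT[OF that(1)] assms that chart_inj[OF assms(2)] by (metis injD)
 have "openin X (e' ` ball z' r')" by (rule openin_chart_image[OF assms(4)]) auto
 moreover have "q \<in> e' ` ball z' r'" using assms(5) r'(1) by force
 ultimately have O: "openin X (e' ` ball z' r' \<inter> N)" "e z \<in> e' ` ball z' r' \<inter> N"
  using N assms(3) by auto
 have c: "chart_continuous (e' ` ball z' r' \<inter> N - {e z}) g" "\<forall>x\<in>e' ` ball z' r' \<inter> N - {e z}. g x \<noteq> 0"
  using N(3,4) assms(3) by (auto intro: chart_continuous_subset)
 obtain r2 where r2: "r2 > 0" "e ` cball z r2 \<subseteq> e' ` ball z' r' \<inter> N"
  "\<forall>s\<le>r2. continuous_on (cball z s - {z}) (g \<circ> e) \<and> (\<forall>w\<in>cball z s - {z}. (g \<circ> e) w \<noteq> 0)"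
  using chart_punctured_disc[OF assms(2) O c] .
 define r where "r = min r1 r2"
 have r: "r > 0" "r \<le> r1" "r \<le> r2" using r1(1) r2(1) by (auto simp: r_def)
 define \<gamma> where "\<gamma> = T \<circ> circlepath z r"
 have sp: "sphere z r \<subseteq> cball z r1" "sphere z r \<subseteq> cball z r2" using r by auto
 have \<gamma>: "path \<gamma>" "pathfinish \<gamma> = pathstart \<gamma>" unfolding \<gamma>_def using r sp
  by (auto simp: pathfinish_compose pathstart_compose path_image_circlepath
    intro!: path_continuous_image continuous_on_subset[OF Tc])
 have "path_image \<gamma> \<subseteq> cball z' r' - {z'}"
 proof
  fix x assume "x \<in> path_image \<gamma>"
  then obtain w where w: "x = T w" "w \<in> sphere z r"
   using r by (auto simp: \<gamma>_def path_image_compose path_image_circlepath)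
  have w1: "w \<in> cball z r1" "w \<in> cball z r2" "w \<noteq> z" using w(2) sp r(1) by auto
  have "e w \<in> e' ` ball z' r'" using r2(2) w1(2) by blast
  then obtain v where "v \<in> ball z' r'" "e w = e' v" by blast
  moreover have "e' x = e w" using eT w(1) w1(1) by simp
  ultimately have "x \<in> ball z' r'" using chart_inj[OF assms(4)] by (metis injD)
  moreover have "x \<noteq> z'" using Tne w1 w(1) by simp
  ultimately show "x \<in> cball z' r' - {z'}" by auto
 qed
 \<comment> \<open>The degree is known on the circle of radius \<open>r1\<close> only; it persists
   on the smaller circle because \<open>T\<close> takes the value \<open>z'\<close> only at
   \<open>z\<close>.\<close>
 moreover have "winding_number \<gamma> z' = 1"
 proof -
  have "wind ((\<lambda>w. T w - z') \<circ> circlepath z r) = wind ((\<lambda>w. T w - z') \<circ> circlepath z r1)"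
  proof (rule winding_number_circles_eq[where T = "cball z r1 - {z}"])
   show "continuous_on (cball z r1 - {z}) (\<lambda>w. T w - z')"
    by (intro continuous_intros continuous_on_subset[OF Tc]) auto
  qed (use r Tne in auto)
  thus ?thesis
   unfolding \<gamma>_def using r1(3) winding_number_offset[of "T \<circ> circlepath z r" z'] winding_number_offset[of "T \<circ> circlepath z r1" z']
   by (simp add: o_def T_def)
 qed
 ultimately have "wind ((g \<circ> e') \<circ> \<gamma>) = index_at (g \<circ> e') z'"
  by (intro index_at_loop[OF r'(1,3,4) \<gamma>])
 moreover have "wind ((g \<circ> e') \<circ> \<gamma>) = wind ((g \<circ> e) \<circ> circlepath z r)"
 proof (rule winding_number_cong)
  fix t :: real assume "0 \<le> t" "t \<le> 1"
  have "circlepath z r t \<in> cball z r1" using r by (simp add: circlepath norm_mult dist_norm)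
  from eT[OF this] show "((g \<circ> e') \<circ> \<gamma>) t = ((g \<circ> e) \<circ> circlepath z r) t" by (simp add: \<gamma>_def)
 qed
 moreover have "wind ((g \<circ> e) \<circ> circlepath z r) = index_at (g \<circ> e) z"
  using index_at_circle[OF r(1), of z "g \<circ> e"] r2(3) r(3) by auto
 ultimately show ?thesis by simp
qed

lemma index_chart:
 assumes "isolated_puncture g (e z)" "e \<in> E"
 shows "index g (e z) = index_at (g \<circ> e) z"
proof -
 have "\<exists>n. \<exists>e'\<in>E. \<exists>z'. e' z' = e z \<and> n = index_at (g \<circ> e') z'" using assms(2) by blast
 from someI_ex[OF this] obtain e' z' where "e' \<in> E" "e' z' = e z" "index g (e z) = index_at (g \<circ> e') z'"
  unfolding index_def by blast
 thus ?thesis using index_chart_independent[OF assms(1,2) refl] by simp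
qed

end

context oriented_surface
begin

lemma index_cong:
 assumes "openin X N" "q \<in> N" "\<And>x. x \<in> N \<Longrightarrow> x \<noteq> q \<Longrightarrow> f x = g x"
 shows "index f q = index g q"
proof -
 have *: "index_at (f \<circ> e) z = index_at (g \<circ> e) z" if "e \<in> E" "e z = q" for e z
 proof -
  have "open (e -` N)" "z \<in> e -` N" using open_chart_vimage that assms by auto
  then obtain r where r: "r > 0" "ball z r \<subseteq> e -` N" using open_contains_ball by blast
  show ?thesis
  proof (rule index_at_cong[OF r(1)])
   fix w assume "w \<in> ball z r - {z}"
   moreover from this have "e w \<noteq> q" using chart_inj[OF that(1)] that(2) by (auto simp: inj_def)
   ultimately show "(f \<circ> e) w = (g \<circ> e) w" using r(2) assms(3)[of "e w"] by auto
  qed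
 qed
 have "(\<lambda>n. \<exists>e\<in>E. \<exists>z. e z = q \<and> n = index_at (f \<circ> e) z) = (\<lambda>n. \<exists>e\<in>E. \<exists>z. e z = q \<and> n = index_at (g \<circ> e) z)"
  by (intro ext bex_cong refl ex_cong1 conj_cong) (simp add: *)
 thus ?thesis unfolding index_def by simp
qed

text \<open>Values on the unit circle rather than merely nonzero ones, because the extension results
  are for maps into a sphere. \<open>Q\<close> may contain points where \<open>g\<close> is regular;
  they contribute index \<open>0\<close>.\<close>

definition punctured :: "'x set \<Rightarrow> ('x \<Rightarrow> complex) \<Rightarrow> bool" where
 "punctured Q g \<longleftrightarrow> finite Q \<and> chart_continuous (topspace X - Q) g \<and> (\<forall>x\<in>topspace X - Q. cmod (g x) = 1)"

lemma closedin_finite: "finite Q \<Longrightarrow> Q \<subseteq> topspace X \<Longrightarrow> closedin X Q"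
 using hausdorff Hausdorff_imp_t1_space t1_space_closedin_finite by blast

lemma openin_diff_finite: "finite Q \<Longrightarrow> openin X (topspace X - Q)"
 using closedin_finite[of "Q \<inter> topspace X"] by (metis Diff_Int2 Diff_Int_distrib2 Int_lower2 Int_absorb closedin_def finite_Int)

lemma punctured_isolated:
 assumes "punctured Q g" "q \<in> topspace X"
 shows "isolated_puncture g q" unfolding isolated_puncture_def
proof (intro exI[of _ "topspace X - (Q - {q})"] conjI)
 show "openin X (topspace X - (Q - {q}))" using assms by (intro openin_diff_finite) (auto simp: punctured_def)
 have *: "topspace X - (Q - {q}) - {q} \<subseteq> topspace X - Q" by auto
 show "chart_continuous (topspace X - (Q - {q}) - {q}) g"
  using assms(1) chart_continuous_subset[OF _ *] by (auto simp: punctured_def)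
 show "\<forall>x\<in>topspace X - (Q - {q}) - {q}. g x \<noteq> 0" using assms(1) * by (force simp: punctured_def)
qed (use assms in auto)

lemma index_regular:
 assumes "openin X N" "q \<in> N" "chart_continuous N g" "\<forall>x\<in>N. g x \<noteq> 0"
 shows "index g q = 0"
proof -
 have "isolated_puncture g q"
  unfolding isolated_puncture_def using assms chart_continuous_subset[OF assms(3)] by blast
 moreover obtain e z where e: "e \<in> E" "q = e z" using in_range_chart assms(1,2) openin_subset by blast
 ultimately have "index g q = index_at (g \<circ> e) z" using index_chart by simp
 also have "\<dots> = 0"
 proof -
  have "open (e -` N)" "z \<in> e -` N" using open_chart_vimage e assms by auto
  then obtain r where r: "r > 0" "cball z r \<subseteq> e -` N" using open_contains_cball by blast
  show ?thesis
   by (rule index_at_0[OF r(1) chart_continuousD[OF assms(3) e(1) r(2)]]) (use r(2) assms(4) in auto)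
 qed
 finally show ?thesis .
qed

lemma punctured_index_0:
 assumes "punctured Q g" "q \<in> topspace X - Q"
 shows "index g q = 0" by (rule index_regular[of "topspace X - Q"])
  (use assms openin_diff_finite in \<open>auto simp: punctured_def, force\<close>)

subsection \<open>Changing a punctured function inside a chart disc\<close>

lemma generic_radius:
 fixes Q :: "complex set"
 assumes "finite Q" "a < b"
 obtains R where "a < R" "R < b" "sphere z R \<inter> Q = {}"
proof -
 have "finite (dist z ` Q)" using assms(1) by simp
 moreover have "infinite {a<..<b}" using assms(2) by (simp add: infinite_Ioo)
 ultimately have "\<not> {a<..<b} \<subseteq> dist z ` Q" using finite_subset by blast
 then obtain R where "R \<in> {a<..<b}" "R \<notin> dist z ` Q" by blast
 moreover from this have "sphere z R \<inter> Q = {}" unfolding sphere_def by blast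
 ultimately show thesis using that[of R] by simp
qed

definition surgery :: "(complex \<Rightarrow> 'x) \<Rightarrow> complex \<Rightarrow> real \<Rightarrow> (complex \<Rightarrow> complex) \<Rightarrow> ('x \<Rightarrow> complex) \<Rightarrow> 'x \<Rightarrow> complex" where
 "surgery e z R h g x = (if x \<in> e ` cball z R then h (coord e x) else g x)"

lemma surgery_inside: "e \<in> E \<Longrightarrow> w \<in> cball z R \<Longrightarrow> surgery e z R h g (e w) = h w"
 by (simp add: surgery_def)

lemma surgery_outside:
 assumes "e \<in> E" "\<And>w. w \<in> sphere z R \<Longrightarrow> h w = g (e w)" "x \<notin> e ` ball z R"
 shows "surgery e z R h g x = g x"
proof (cases "x \<in> e ` cball z R")
 case True
 then obtain w where w: "w \<in> cball z R" "x = e w" by blast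
 hence "w \<in> sphere z R" using assms(3) by force
 thus ?thesis using assms w by (simp add: surgery_inside)
qed (simp add: surgery_def)

text \<open>Old and new punctures in the disc have the same total index, namely the winding number
  along the bounding circle, where \<open>g\<close> and the inserted function \<open>h\<close>
  agree; outside the disc nothing changes.\<close>

lemma surgery_sum:
 assumes g: "punctured Q g" "Q \<subseteq> topspace X" and e: "e \<in> E" and R: "R > 0" "e ` sphere z R \<inter> Q = {}"
  and h: "finite K" "K \<subseteq> ball z R" "continuous_on (cball z R - K) h" "\<forall>w\<in>cball z R - K. cmod (h w) = 1"
   "\<And>w. w \<in> sphere z R \<Longrightarrow> h w = g (e w)"
 shows "punctured ((Q - e ` cball z R) \<union> e ` K) (surgery e z R h g)"
  and "(\<Sum>q\<in>(Q - e ` cball z R) \<union> e ` K. index (surgery e z R h g) q) = (\<Sum>q\<in>Q. index g q)"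
proof -
 let ?g = "surgery e z R h g" and ?Q = "(Q - e ` cball z R) \<union> e ` K"
 have fQ: "finite Q" using g by (simp add: punctured_def)
 have inj: "inj e" using chart_inj e .
 have cl1: "closedin X (e ` cball z R)" by (rule closedin_chart_image[OF e]) auto
 have op: "openin X (e ` ball z R)" by (rule openin_chart_image[OF e]) auto
 have cl2: "closedin X (topspace X - e ` ball z R)" using op by auto
 show P: "punctured ?Q ?g" unfolding punctured_def
 proof (intro conjI)
  show "finite ?Q" using fQ h(1) by simp
  show "chart_continuous (topspace X - ?Q) ?g"
  proof (rule chart_continuous_glue[OF _ _ cl1 cl2])
   have "chart_continuous ((topspace X - ?Q) \<inter> e ` cball z R) (\<lambda>x. h (coord e x))"
    by (rule chart_continuous_from_chart[OF e h(3)]) auto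
   thus "chart_continuous ((topspace X - ?Q) \<inter> e ` cball z R) ?g"
    by (rule chart_continuous_cong) (simp add: surgery_def)
   have "chart_continuous ((topspace X - ?Q) \<inter> (topspace X - e ` ball z R)) g"
   proof (rule chart_continuous_subset)
    show "chart_continuous (topspace X - Q) g" using g by (simp add: punctured_def)
    have "e ` cball z R \<inter> Q \<subseteq> e ` ball z R" using R(2) by force
    thus "(topspace X - ?Q) \<inter> (topspace X - e ` ball z R) \<subseteq> topspace X - Q" by blast
   qed
   thus "chart_continuous ((topspace X - ?Q) \<inter> (topspace X - e ` ball z R)) ?g"
    by (rule chart_continuous_cong) (rule surgery_outside[OF e], use h(5) in auto)
   have "e ` ball z R \<subseteq> e ` cball z R" by (intro image_mono ball_subset_cball)
   thus "topspace X - ?Q \<subseteq> e ` cball z R \<union> (topspace X - e ` ball z R)" by blast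
  qed
  show "\<forall>x\<in>topspace X - ?Q. cmod (?g x) = 1"
  proof
   fix x assume x: "x \<in> topspace X - ?Q"
   show "cmod (?g x) = 1"
   proof (cases "x \<in> e ` cball z R")
    case True
    then obtain w where "w \<in> cball z R" "x = e w" by blast
    thus ?thesis using h(4) x by (auto simp: surgery_inside e)
   next
    case False
    thus ?thesis using x g by (auto simp: surgery_def punctured_def)
   qed
  qed
 qed
 define Q0 where "Q0 = e -` Q \<inter> ball z R"
 have fQ0: "finite Q0" unfolding Q0_def using finite_vimageI[OF fQ inj] by auto
 have Q0': "Q0 = e -` Q \<inter> cball z R"
 proof (intro equalityI subsetI)
  fix w assume w: "w \<in> e -` Q \<inter> cball z R"
  hence "w \<notin> sphere z R" using R(2) by blast
  thus "w \<in> Q0" using w by (auto simp: Q0_def)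
 qed (auto simp: Q0_def)
 have Q0: "e ` Q0 = Q \<inter> e ` cball z R" using R(2) unfolding Q0_def by force
 have sum_in: "(\<Sum>q\<in>e ` P. index f q) = wind (f \<circ> e \<circ> circlepath z R)"
  if "punctured P' f" "P = e -` P' \<inter> cball z R" "P \<subseteq> ball z R" "finite P" for P P' f
 proof -
  have "wind ((f \<circ> e) \<circ> circlepath z R) = (\<Sum>q\<in>P. index_at (f \<circ> e) q)"
  proof (rule disc_argument_principle[OF R(1) that(4,3)])
   have *: "cball z R - P \<subseteq> e -` (topspace X - P')" using that(2) chart_in_topspace[OF e] by auto
   show "continuous_on (cball z R - P) (f \<circ> e)"
    by (rule chart_continuousD[OF _ e *]) (use that(1) in \<open>simp add: punctured_def\<close>)
   show "\<forall>w\<in>cball z R - P. (f \<circ> e) w \<noteq> 0" using * that(1) by (force simp: punctured_def)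
  qed
  also have "\<dots> = (\<Sum>q\<in>P. index f (e q))"
   using punctured_isolated[OF that(1)] chart_in_topspace[OF e] index_chart[OF _ e] by simp
  also have "\<dots> = (\<Sum>q\<in>e ` P. index f q)"
   by (subst sum.reindex) (use inj in \<open>auto intro: inj_on_subset\<close>)
  finally show ?thesis by simp
 qed
 have "(\<Sum>q\<in>Q. index g q) = (\<Sum>q\<in>Q - e ` cball z R. index g q) + (\<Sum>q\<in>e ` Q0. index g q)"
  unfolding Q0 using fQ by (metis sum.Int_Diff add.commute)
 also have "(\<Sum>q\<in>e ` Q0. index g q) = wind (g \<circ> e \<circ> circlepath z R)"
  by (rule sum_in[OF g(1)]) (use fQ0 Q0' in \<open>auto simp: Q0_def\<close>)
 also have "\<dots> = wind (?g \<circ> e \<circ> circlepath z R)"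
 proof (rule winding_number_cong)
  fix t :: real assume "0 \<le> t" "t \<le> 1"
  have "circlepath z R t \<in> sphere z R" using R by (simp add: circlepath norm_mult dist_norm)
  thus "(g \<circ> e \<circ> circlepath z R) t = (?g \<circ> e \<circ> circlepath z R) t"
   using h(5) e by (simp add: surgery_inside)
 qed
 also have "\<dots> = (\<Sum>q\<in>e ` K. index ?g q)"
  by (rule sum_in[OF P, symmetric]) (use h(1,2) inj in \<open>auto simp: inj_def\<close>)
 also have "(\<Sum>q\<in>Q - e ` cball z R. index g q) = (\<Sum>q\<in>Q - e ` cball z R. index ?g q)"
 proof (rule sum.cong[OF refl])
  fix q assume "q \<in> Q - e ` cball z R"
  thus "index g q = index ?g q"
   using cl1 g(2) by (intro index_cong[of "topspace X - e ` cball z R"]) (auto simp: surgery_def)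
 qed
 also have "(\<Sum>q\<in>Q - e ` cball z R. index ?g q) + (\<Sum>q\<in>e ` K. index ?g q) = (\<Sum>q\<in>?Q. index ?g q)"
 proof (rule sum.union_disjoint[symmetric])
  show "(Q - e ` cball z R) \<inter> e ` K = {}" using h(2) ball_subset_cball by blast
 qed (use fQ h(1) in auto)
 finally show "(\<Sum>q\<in>?Q. index ?g q) = (\<Sum>q\<in>Q. index g q)" by simp
qed

end

section \<open>Total index of a compactly supported function\<close>

context oriented_surface
begin

text \<open>Induction on the number of discs supporting \<open>g\<close>. In one disc
  \<open>g\<close> is replaced by a function that is \<open>1\<close> wherever the other discs do
  not reach; surgery keeps the total index, and the new function is supported by the remaining
  discs.\<close>

lemma monopole_cover:
 assumes "finite F" "F \<subseteq> E \<times> UNIV" "punctured Q g" "Q \<subseteq> topspace X"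
  "\<forall>x\<in>topspace X - (\<Union>(e, z)\<in>F. e ` ball z 1) - Q. g x = 1"
 shows "(\<Sum>q\<in>Q. index g q) = 0" using assms
proof (induction F arbitrary: Q g rule: finite_induct)
 case empty
 have "index g q = 0" if q: "q \<in> Q" for q
 proof -
  have fQ: "finite (Q - {q})" using empty.prems(2) by (simp add: punctured_def)
  have "index g q = index (\<lambda>x. 1) q"
   using q empty.prems openin_diff_finite[OF fQ] by (intro index_cong[of "topspace X - (Q - {q})"]) auto
  also have "\<dots> = 0" by (rule index_regular[of "topspace X"]) (use q empty.prems in auto)
  finally show ?thesis .
 qed
 thus ?case by simp
next
 case (insert ez F)
 obtain e z where ez: "ez = (e, z)" by (cases ez)
 have e: "e \<in> E" using insert.prems(1) ez by auto
 have inj: "inj e" using chart_inj e .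
 define U where "U = (\<Union>(e, z)\<in>F. e ` ball z 1)"
 have FE: "F \<subseteq> E \<times> UNIV" using insert.prems(1) by auto
 have oU: "openin X U" unfolding U_def
 proof (rule openin_Union, clarify)
  fix e z assume "(e, z) \<in> F"
  hence "e \<in> E" using FE by auto
  thus "openin X (e ` ball z 1)" by (rule openin_chart_image) auto
 qed
 have g1: "g x = 1" if "x \<in> topspace X" "x \<notin> U" "x \<notin> e ` ball z 1" "x \<notin> Q" for x
  using insert.prems(4) that ez by (auto simp: U_def)
 have "finite (e -` Q)" using insert.prems(2) finite_vimageI[OF _ inj] by (auto simp: punctured_def)
 \<comment> \<open>Beyond radius \<open>1\<close> this disc no longer supports \<open>g\<close>, so
   on the circle of radius \<open>R\<close> the function is already \<open>1\<close> off the other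
   discs; a generic \<open>R\<close> also avoids the punctures.\<close>
 then obtain R where R: "1 < R" "R < 2" "sphere z R \<inter> e -` Q = {}" using generic_radius[of "e -` Q" 1 2] by auto
 \<comment> \<open>Data for the replacement: the old values on the bounding circle, and
   \<open>1\<close> on the part of the disc outside \<open>U\<close>. The two prescriptions agree
   where they overlap by the choice of \<open>R\<close>.\<close>
 define S where "S = sphere z R \<union> (cball z R - e -` U)"
 define f where "f = (\<lambda>w. if w \<in> e -` U then g (e w) else 1)"
 have cS: "compact S"
  unfolding S_def using open_chart_vimage[OF e oU] by (intro compact_Un compact_diff) auto
 have fsphere: "f w = g (e w)" if "w \<in> sphere z R" for w
 proof -
  have "w \<notin> ball z 1" using that R by auto
  hence "e w \<notin> e ` ball z 1" using inj_image_mem_iff[OF inj] by blast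
  moreover have "e w \<notin> Q" using that R(3) by auto
  ultimately show ?thesis using g1[of "e w"] chart_in_topspace[OF e] by (auto simp: f_def)
 qed
 have sph: "sphere z R \<subseteq> e -` (topspace X - Q)" using R(3) chart_in_topspace[OF e] by auto
 have cg: "chart_continuous (topspace X - Q) g" "\<forall>x\<in>topspace X - Q. cmod (g x) = 1"
  using insert.prems(2) by (auto simp: punctured_def)
 have "continuous_on (sphere z R) f"
  by (rule continuous_on_eq[OF chart_continuousD[OF cg(1) e sph]]) (simp add: fsphere)
 moreover have "continuous_on (cball z R - e -` U) f"
  by (rule continuous_on_eq[of _ "\<lambda>w. 1"]) (auto simp: f_def)
 ultimately have fc: "continuous_on S f"
  unfolding S_def using open_chart_vimage[OF e oU] by (intro continuous_on_closed_Un) auto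
 have f1: "\<forall>w\<in>S. cmod (f w) = 1"
 proof
  fix w assume w: "w \<in> S"
  show "cmod (f w) = 1"
  proof (cases "w \<in> sphere z R")
   case True
   thus ?thesis using fsphere cg(2) sph by auto
  next
   case False
   thus ?thesis using w by (auto simp: S_def f_def)
  qed
 qed
 obtain K h where h: "finite K" "K \<inter> S = {}" "continuous_on (- K) h" "\<forall>w\<in>- K. cmod (h w) = 1"
  "\<And>w. w \<in> S \<Longrightarrow> h w = f w"
  using unimodular_extension[OF cS fc f1, of UNIV] in_components_nonempty by (metis Int_UNIV_right)
 define K0 where "K0 = K \<inter> cball z R"
 define g' where "g' = surgery e z R h g"
 define Q' where "Q' = (Q - e ` cball z R) \<union> e ` K0"
 have K0: "finite K0" "K0 \<subseteq> ball z R"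
 proof -
  show "finite K0" using h(1) by (simp add: K0_def)
  have "K0 \<inter> sphere z R = {}" using h(2) by (auto simp: K0_def S_def)
  thus "K0 \<subseteq> ball z R" by (force simp: K0_def)
 qed
 have R0: "R > 0" and sQ: "e ` sphere z R \<inter> Q = {}" using R by auto
 have hs: "\<And>w. w \<in> sphere z R \<Longrightarrow> h w = g (e w)" using h(5) fsphere by (simp add: S_def)
 have hc: "continuous_on (cball z R - K0) h" "\<forall>w\<in>cball z R - K0. cmod (h w) = 1"
  using h(3,4) by (auto simp: K0_def intro: continuous_on_subset)
 note SS = surgery_sum[OF insert.prems(2,3) e R0 sQ K0 hc hs, folded g'_def Q'_def]
 have "(\<Sum>q\<in>Q'. index g' q) = 0"
 proof (rule insert.IH[OF FE SS(1)])
  show "Q' \<subseteq> topspace X" using insert.prems(3) chart_in_topspace[OF e] by (auto simp: Q'_def)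
  show "\<forall>x\<in>topspace X - (\<Union>(e, z)\<in>F. e ` ball z 1) - Q'. g' x = 1"
  proof
   fix x assume x: "x \<in> topspace X - (\<Union>(e, z)\<in>F. e ` ball z 1) - Q'"
   hence x: "x \<in> topspace X" "x \<notin> U" "x \<notin> Q'" by (auto simp: U_def)
   show "g' x = 1"
   proof (cases "x \<in> e ` cball z R")
    case True
    then obtain w where w: "w \<in> cball z R" "x = e w" by blast
    hence "w \<in> S" "f w = 1" using x by (auto simp: S_def f_def)
    thus ?thesis using h(5) w by (simp add: g'_def surgery_inside[OF e w(1)])
   next
    case False
    moreover from this have "x \<notin> e ` ball z 1" using R by fastforce
    ultimately show ?thesis using x g1 by (auto simp: g'_def surgery_def Q'_def)
   qed
  qed
 qed
 thus ?case using SS(2) by simp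
qed

lemma compactin_chart_cover:
 assumes "compactin X K"
 obtains F where "finite F" "F \<subseteq> E \<times> UNIV" "K \<subseteq> (\<Union>(e, z)\<in>F. e ` ball z 1)"
proof -
 let ?\<U> = "(\<lambda>(e, z). e ` ball z 1) ` (E \<times> UNIV)"
 have "\<forall>U\<in>?\<U>. openin X U" using openin_chart_image by auto
 moreover have "K \<subseteq> \<Union>?\<U>"
 proof
  fix x assume "x \<in> K"
  then obtain e z where "e \<in> E" "x = e z" using in_range_chart assms compactin_subset_topspace by blast
  thus "x \<in> \<Union>?\<U>" by (intro UnionI[of "e ` ball z 1"]) auto
 qed
 ultimately obtain \<F> where "finite \<F>" "\<F> \<subseteq> ?\<U>" "K \<subseteq> \<Union>\<F>"
  using assms unfolding compactin_def by meson
 moreover from this obtain F where "F \<subseteq> E \<times> UNIV" "finite F" "\<F> = (\<lambda>(e, z). e ` ball z 1) ` F"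
  using finite_subset_image by metis
 ultimately show thesis using that[of F] by blast
qed

text \<open>The compact support is covered by finitely many chart discs, so
  \<open>monopole_cover\<close> applies. This takes the place of the theorem on the sum of
  residues.\<close>

theorem monopole:
 assumes "punctured Q g" "Q \<subseteq> topspace X" "compactin X K" "\<forall>x\<in>topspace X - K - Q. g x = 1"
 shows "(\<Sum>q\<in>Q. index g q) = 0"
proof -
 obtain F where F: "finite F" "F \<subseteq> E \<times> UNIV" "K \<subseteq> (\<Union>(e, z)\<in>F. e ` ball z 1)"
  using compactin_chart_cover[OF assms(3)] .
 show ?thesis by (rule monopole_cover[OF F(1,2) assms(1,2)]) (use F(3) assms(4) in blast)
qed

subsection \<open>Moving and cancelling punctures\<close>

text \<open>Coning off the values on the bounding circle concentrates the whole charge of the disc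
  at \<open>c\<close>.\<close>

lemma merge_punctures:
 assumes g: "punctured Q g" "Q \<subseteq> topspace X" and e: "e \<in> E" and R: "R > 0" "e ` sphere z R \<inter> Q = {}"
  and c: "c \<in> ball z R"
 obtains g' where "punctured ((Q - e ` cball z R) \<union> {e c}) g'"
  "(\<Sum>q\<in>(Q - e ` cball z R) \<union> {e c}. index g' q) = (\<Sum>q\<in>Q. index g q)"
  "\<And>x. x \<notin> e ` ball z R \<Longrightarrow> g' x = g x"
proof -
 have sph: "sphere z R \<subseteq> e -` (topspace X - Q)" using R(2) chart_in_topspace[OF e] by auto
 have "continuous_on (sphere z R) (g \<circ> e)"
  by (rule chart_continuousD[OF _ e sph]) (use g in \<open>simp add: punctured_def\<close>)
 moreover have "\<forall>w\<in>sphere z R. cmod ((g \<circ> e) w) = 1" using sph g by (auto simp: punctured_def)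
 ultimately obtain h where h: "continuous_on (- {c}) h" "\<forall>w\<in>- {c}. cmod (h w) = 1"
  "\<And>w. w \<in> sphere z R \<Longrightarrow> h w = (g \<circ> e) w" using unimodular_cone[OF _ _ c] by blast
 have hc: "continuous_on (cball z R - {c}) h" "\<forall>w\<in>cball z R - {c}. cmod (h w) = 1"
  using h(2) by (auto intro: continuous_on_subset[OF h(1)])
 have hs: "\<And>w. w \<in> sphere z R \<Longrightarrow> h w = g (e w)" using h(3) by simp
 have c': "{c} \<subseteq> ball z R" using c by simp
 note SS = surgery_sum[OF g e R _ c' hc hs, simplified]
 show thesis by (rule that[of "surgery e z R h g"]) (use SS surgery_outside[of e z R h g] e hs in auto)
qed

text \<open>The points to which the charge at \<open>q\<close> can be brought form an open and
  closed subset of the connected set \<open>N\<close>, because inside one chart disc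
  \<open>merge_punctures\<close> takes it from any point to any other. Only an inclusion is claimed
  for \<open>Q'\<close>, since the charge may absorb another puncture on its way.\<close>

lemma move_puncture:
 assumes g: "punctured Q g" "Q \<subseteq> topspace X" and N: "openin X N" "connectedin X N" "q \<in> N" "a \<in> N"
 obtains Q' g' where "punctured Q' g'" "Q' \<subseteq> (Q - {q}) \<union> {a}" "Q' \<subseteq> topspace X"
  "(\<Sum>q\<in>Q'. index g' q) = (\<Sum>q\<in>Q. index g q)"
  "\<And>x. x \<notin> N \<Longrightarrow> g' x = g x"
proof -
 define P where "P = (\<lambda>a. \<exists>Q' g'. punctured Q' g' \<and> Q' \<subseteq> (Q - {q}) \<union> {a} \<and> Q' \<subseteq> topspace X \<and>
  (\<Sum>q\<in>Q'. index g' q) = (\<Sum>q\<in>Q. index g q) \<and> (\<forall>x. x \<notin> N \<longrightarrow> g' x = g x))"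
 have loc: "\<exists>W. openin X W \<and> a \<in> W \<and> W \<subseteq> N \<and> (\<forall>b\<in>W. \<forall>c\<in>W. P b \<longrightarrow> P c)" if a: "a \<in> N" for a
 proof -
  obtain e w where e: "e \<in> E" "a = e w" using in_range_chart a N(1) openin_subset by blast
  have inj: "inj e" using chart_inj e(1) .
  have fin: "finite (e -` Q)" using g(1) finite_vimageI[OF _ inj] by (auto simp: punctured_def)
  have "open (e -` N - (e -` Q - {w}))"
   using fin open_chart_vimage[OF e(1) N(1)] by (intro open_Diff finite_imp_closed) auto
  moreover have "w \<in> e -` N - (e -` Q - {w})" using a e by auto
  \<comment> \<open>The disc contains no puncture of \<open>Q\<close> except possibly its centre, so
    a merge inside it involves at most that one and the moving charge.\<close>
  ultimately obtain r where r: "r > 0" "cball w r \<subseteq> e -` N - (e -` Q - {w})"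
   using open_contains_cball by blast
  show ?thesis
  proof (intro exI[of _ "e ` ball w r"] conjI ballI impI)
   show "openin X (e ` ball w r)" by (rule openin_chart_image[OF e(1)]) auto
   show "a \<in> e ` ball w r" using r e by auto
   show WN: "e ` ball w r \<subseteq> N" using r(2) ball_subset_cball[of w r] by blast
   fix b c assume bc: "b \<in> e ` ball w r" "c \<in> e ` ball w r" and "P b"
   then obtain Q' g' where Q': "punctured Q' g'" "Q' \<subseteq> (Q - {q}) \<union> {b}" "Q' \<subseteq> topspace X"
    "(\<Sum>q\<in>Q'. index g' q) = (\<Sum>q\<in>Q. index g q)" "\<forall>x. x \<notin> N \<longrightarrow> g' x = g x" unfolding P_def by blast
   obtain c0 b0 where c0: "c = e c0" "c0 \<in> ball w r" "b = e b0" "b0 \<in> ball w r" using bc by blast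
   have "e v \<notin> Q'" if "v \<in> sphere w r" for v
   proof -
    have "v \<in> cball w r" "v \<noteq> w" "v \<noteq> b0" using that r(1) c0(4) by auto
    hence "e v \<notin> Q" "e v \<noteq> b" using r(2) inj c0(3) by (auto simp: inj_def)
    thus ?thesis using Q'(2) by blast
   qed
   hence dis: "e ` sphere w r \<inter> Q' = {}" by blast
   obtain g'' where g'': "punctured ((Q' - e ` cball w r) \<union> {e c0}) g''"
    "(\<Sum>q\<in>(Q' - e ` cball w r) \<union> {e c0}. index g'' q) = (\<Sum>q\<in>Q'. index g' q)"
    "\<And>x. x \<notin> e ` ball w r \<Longrightarrow> g'' x = g' x"
    using merge_punctures[OF Q'(1,3) e(1) r(1) dis c0(2)] by blast
   have "b \<in> e ` cball w r" using c0 by auto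
   hence "(Q' - e ` cball w r) \<union> {e c0} \<subseteq> (Q - {q}) \<union> {c}" using Q'(2) c0 by auto
   moreover have "(Q' - e ` cball w r) \<union> {e c0} \<subseteq> topspace X" using Q'(3) chart_in_topspace[OF e(1)] by auto
   moreover have "\<forall>x. x \<notin> N \<longrightarrow> g'' x = g x" using g''(3) Q'(5) WN by (metis subsetD)
   ultimately show "P c" unfolding P_def using g''(1,2) Q'(4)
    by (intro exI[of _ "(Q' - e ` cball w r) \<union> {e c0}"] exI[of _ g'']) simp
  qed
 qed
 have "P q" 
 proof -
  have "Q \<subseteq> (Q - {q}) \<union> {q}" by blast
  thus ?thesis unfolding P_def using g by metis
 qed
 have op: "openin X {x \<in> N. R x}" if R: "R = P \<or> R = (\<lambda>x. \<not> P x)" for R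
 proof -
  have "\<exists>T. openin X T \<and> x \<in> T \<and> T \<subseteq> {x \<in> N. R x}" if x: "x \<in> N" "R x" for x
  proof -
   obtain W where W: "openin X W" "x \<in> W" "W \<subseteq> N" "\<forall>b\<in>W. \<forall>c\<in>W. P b \<longrightarrow> P c"
    using loc[OF x(1)] by (elim exE conjE)
   have "W \<subseteq> {x \<in> N. R x}"
   proof
    fix v assume "v \<in> W"
    hence "P v = P x" using W(2,4) by metis
    thus "v \<in> {x \<in> N. R x}" using R x(2) W(3) \<open>v \<in> W\<close> by auto
   qed
   with W show ?thesis by (intro exI[of _ W] conjI)
  qed
  thus ?thesis by (subst openin_subopen) simp
 qed
 have op: "openin X {x\<in>N. P x}" "openin X {x\<in>N. \<not> P x}" by (rule op, simp)+
 have "{x\<in>N. \<not> P x} = {}"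
 proof (rule ccontr)
  assume "{x\<in>N. \<not> P x} \<noteq> {}"
  moreover have "{x\<in>N. P x} \<noteq> {}" using \<open>P q\<close> N(3) by blast
  ultimately have "\<exists>E1 E2. openin X E1 \<and> openin X E2 \<and> N \<subseteq> E1 \<union> E2 \<and> E1 \<inter> E2 \<inter> N = {} \<and> E1 \<inter> N \<noteq> {} \<and> E2 \<inter> N \<noteq> {}"
   by (intro exI[of _ "{x\<in>N. P x}"] exI[of _ "{x\<in>N. \<not> P x}"] conjI op) blast+
  thus False using N(2) unfolding connectedin by (elim conjE notE)
 qed
 hence "P a" using N(4) by blast
 then obtain Q' g' where "punctured Q' g'" "Q' \<subseteq> (Q - {q}) \<union> {a}" "Q' \<subseteq> topspace X"
  "(\<Sum>q\<in>Q'. index g' q) = (\<Sum>q\<in>Q. index g q)" "\<forall>x. x \<notin> N \<longrightarrow> g' x = g x"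
  unfolding P_def by (elim exE conjE)
 thus thesis by (intro that[of Q' g']) simp_all
qed

text \<open>Index \<open>0\<close> is winding number \<open>0\<close> along a small circle around
  \<open>a\<close>, so the boundary values extend over the disc without zeros; dividing by the
  modulus makes the extension unimodular again.\<close>

lemma fill_puncture:
 assumes g: "punctured Q g" "Q \<subseteq> {a}" and a: "openin X N" "a \<in> N" "index g a = 0"
 obtains g' where "punctured {} g'" "\<And>x. x \<notin> N \<Longrightarrow> g' x = g x"
proof -
 have aX: "a \<in> topspace X" using a openin_subset by blast
 hence QX: "Q \<subseteq> topspace X" using g by auto
 obtain e w where e: "e \<in> E" "a = e w" using in_range_chart aX by blast
 have inj: "inj e" using chart_inj e(1) .
 have cg: "chart_continuous (topspace X - Q) g" "\<forall>x\<in>topspace X - Q. cmod (g x) = 1"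
  using g by (auto simp: punctured_def)
 have "open (e -` N)" "w \<in> e -` N" using open_chart_vimage e a by auto
 then obtain r where r: "r > 0" "cball w r \<subseteq> e -` N" using open_contains_cball by blast
 have sub: "cball w r - {w} \<subseteq> e -` (topspace X - Q)"
  using e g(2) inj chart_in_topspace[OF e(1)] by (auto simp: inj_def)
 have c1: "continuous_on (cball w r - {w}) (g \<circ> e)" by (rule chart_continuousD[OF cg(1) e(1) sub])
 have c2: "\<forall>v\<in>cball w r - {w}. (g \<circ> e) v \<noteq> 0" using sub cg(2) by force
 have sph: "sphere w r \<subseteq> cball w r - {w}" using r(1) by auto
 have "isolated_puncture g (e w)" using punctured_isolated g(1) aX e(2) by blast
 hence "index_at (g \<circ> e) w = 0" using index_chart[OF _ e(1)] a(3) e(2) by metis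
 hence "wind ((g \<circ> e) \<circ> circlepath w r) = 0"
  using index_at_circle[OF r(1) c1 c2] by (simp add: o_def)
 then obtain h0 where h0: "continuous_on (cball w r) h0" "\<forall>v\<in>cball w r. h0 v \<noteq> 0"
  "\<And>v. v \<in> sphere w r \<Longrightarrow> h0 v = (g \<circ> e) v"
  using disc_extension_winding_0[OF r(1) continuous_on_subset[OF c1 sph]] c2 sph by blast
 define h where "h = (\<lambda>v. h0 v / of_real (cmod (h0 v)))"
 have hc: "continuous_on (cball w r - {}) h" "\<forall>v\<in>cball w r - {}. cmod (h v) = 1"
  unfolding h_def using h0(1,2) by (auto intro!: continuous_intros simp: norm_divide)
 have dis: "e ` sphere w r \<inter> Q = {}" using sph sub by blast
 have hs: "\<And>v. v \<in> sphere w r \<Longrightarrow> h v = g (e v)"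
 proof -
  fix v assume v: "v \<in> sphere w r"
  hence "cmod (g (e v)) = 1" using cg(2) sub sph by blast
  thus "h v = g (e v)" using h0(3)[OF v] by (simp add: h_def)
 qed
 have "a \<in> e ` cball w r" using e r(1) by auto
 hence Q0: "Q - e ` cball w r \<union> e ` {} = {}" using g(2) by auto
 note SS = surgery_sum(1)[OF g(1) QX e(1) r(1) dis finite.emptyI empty_subsetI hc hs, unfolded Q0]
 show thesis
 proof (rule that[OF SS])
  fix x assume "x \<notin> N"
  hence "x \<notin> e ` ball w r" using r(2) ball_subset_cball[of w r] by blast
  thus "surgery e w r h g x = g x" using surgery_outside[of e w r h g] e(1) hs by blast
 qed
qed

end

subsection \<open>Sections of flat line bundles\<close>

context oriented_surface
begin

text \<open>A flat bundle with holonomy in the \<open>n\<close>-th roots of unity is given by its trivializations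
 \<open>\<rho> e\<close> over the charts, relative to an arbitrary set-theoretic trivialization. A function \<open>s\<close>
 represents a continuous section if every \<open>s \<cdot> \<rho> e\<close> is continuous.\<close>

definition local_system :: "nat \<Rightarrow> ((complex \<Rightarrow> 'x) \<Rightarrow> 'x \<Rightarrow> complex) \<Rightarrow> bool" where
 "local_system n \<rho> \<longleftrightarrow> n > 0 \<and> (\<forall>e\<in>E. \<forall>x\<in>range e. \<rho> e x ^ n = 1) \<and>
  (\<forall>e\<in>E. \<forall>e'\<in>E. \<forall>x\<in>range e \<inter> range e'. \<exists>W. openin X W \<and> x \<in> W \<and>
    (\<forall>y\<in>W \<inter> range e \<inter> range e'. \<rho> e y / \<rho> e' y = \<rho> e x / \<rho> e' x))"

definition flat_section :: "((complex \<Rightarrow> 'x) \<Rightarrow> 'x \<Rightarrow> complex) \<Rightarrow> 'x set \<Rightarrow> ('x \<Rightarrow> complex) \<Rightarrow> bool" where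
 "flat_section \<rho> Y s \<longleftrightarrow> (\<forall>e\<in>E. continuous_on (e -` Y) (\<lambda>w. s (e w) * \<rho> e (e w)))"

lemma local_system_norm:
 assumes "local_system n \<rho>" "e \<in> E" "x \<in> range e"
 shows "cmod (\<rho> e x) = 1" "\<rho> e x ^ n = 1"
proof -
 have *: "\<rho> e x ^ n = 1" and n: "n > 0" using assms unfolding local_system_def by auto
 have "cmod (\<rho> e x) ^ n = cmod (\<rho> e x ^ n)" by (rule norm_power[symmetric])
 also have "\<dots> = 1 ^ n" unfolding * by simp
 finally have "cmod (\<rho> e x) ^ n = 1 ^ n" .
 thus "cmod (\<rho> e x) = 1" by (rule power_eq_imp_eq_base) (use n in auto)
 show "\<rho> e x ^ n = 1" by (rule *)
qed

lemma flat_section_subset: "flat_section \<rho> Y s \<Longrightarrow> Z \<subseteq> Y \<Longrightarrow> flat_section \<rho> Z s"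
 unfolding flat_section_def by (blast intro: continuous_on_subset)

lemma flat_section_cong:
 assumes "flat_section \<rho> Y s" "\<And>x. x \<in> Y \<Longrightarrow> t x = s x"
 shows "flat_section \<rho> Y t" unfolding flat_section_def
proof
 fix e assume "e \<in> E"
 hence "continuous_on (e -` Y) (\<lambda>w. s (e w) * \<rho> e (e w))" using assms(1) by (auto simp: flat_section_def)
 thus "continuous_on (e -` Y) (\<lambda>w. t (e w) * \<rho> e (e w))"
  by (rule continuous_on_eq) (use assms(2) in auto)
qed

lemma flat_section_glue:
 assumes "flat_section \<rho> (Y \<inter> A) g" "flat_section \<rho> (Y \<inter> B) g" "closedin X A" "closedin X B"
  "Y \<subseteq> A \<union> B"
 shows "flat_section \<rho> Y g" unfolding flat_section_def
proof
 fix e assume e: "e \<in> E"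
 have un: "e -` Y = e -` (Y \<inter> A) \<union> e -` (Y \<inter> B)" using assms(5) by auto
 show "continuous_on (e -` Y) (\<lambda>w. g (e w) * \<rho> e (e w))" unfolding un
 proof (rule continuous_on_Un_local)
  show "closedin (top_of_set (e -` (Y \<inter> A) \<union> e -` (Y \<inter> B))) (e -` (Y \<inter> A))"
   unfolding un[symmetric] closedin_closed using closed_chart_vimage[OF e assms(3)]
   by (intro exI[of _ "e -` A"]) auto
  show "closedin (top_of_set (e -` (Y \<inter> A) \<union> e -` (Y \<inter> B))) (e -` (Y \<inter> B))"
   unfolding un[symmetric] closedin_closed using closed_chart_vimage[OF e assms(4)]
   by (intro exI[of _ "e -` B"]) auto
 qed (use assms(1,2) e in \<open>auto simp: flat_section_def\<close>)
qed

text \<open>In another chart \<open>e'\<close> the section is multiplied by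
  \<open>\<rho> e' / \<rho> e\<close>, which is locally constant by the definition of a local system
  and therefore continuous.\<close>

lemma flat_section_from_chart:
 assumes \<rho>: "local_system n \<rho>" and e: "e \<in> E" and h: "continuous_on W h" "Y \<subseteq> e ` W"
 shows "flat_section \<rho> Y (\<lambda>x. h (coord e x) / \<rho> e x)" unfolding flat_section_def
proof
 fix e' assume e': "e' \<in> E"
 have "chart_continuous Y (\<lambda>x. h (coord e x))" by (rule chart_continuous_from_chart[OF e h])
 hence c: "continuous_on (e' -` Y) (\<lambda>w. h (coord e (e' w)))" using e' by (simp add: chart_continuous_def o_def)
 have o: "open (e' -` range e)" using chart_open[OF e e' open_UNIV] .
 have "continuous_on (e' -` range e) (\<lambda>w. \<rho> e' (e' w) / \<rho> e (e' w))"
  unfolding continuous_on_eq_continuous_at[OF o]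
 proof
  fix w assume w: "w \<in> e' -` range e"
  hence x: "e' w \<in> range e' \<inter> range e" by auto
  then obtain N where N: "openin X N" "e' w \<in> N"
   "\<forall>y\<in>N \<inter> range e' \<inter> range e. \<rho> e' y / \<rho> e y = \<rho> e' (e' w) / \<rho> e (e' w)"
   using \<rho> e e' unfolding local_system_def by metis
  have op: "open (e' -` N \<inter> e' -` range e)" using open_chart_vimage[OF e' N(1)] o by auto
  have "continuous_on (e' -` N \<inter> e' -` range e) (\<lambda>v. \<rho> e' (e' v) / \<rho> e (e' v))"
   by (rule continuous_on_eq[of _ "\<lambda>v. \<rho> e' (e' w) / \<rho> e (e' w)"]) (use N(3) in auto)
  thus "isCont (\<lambda>v. \<rho> e' (e' v) / \<rho> e (e' v)) w"
   using op w N(2) by (simp add: continuous_on_eq_continuous_at)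
 qed
 hence c2: "continuous_on (e' -` Y) (\<lambda>w. \<rho> e' (e' w) / \<rho> e (e' w))"
  by (rule continuous_on_subset) (use h(2) in auto)
 show "continuous_on (e' -` Y) (\<lambda>w. h (coord e (e' w)) / \<rho> e (e' w) * \<rho> e' (e' w))"
  using continuous_on_mult[OF c c2] by simp
qed

text \<open>One closed disc is added at a time. In the trivialization over its chart a unimodular
  section is a circle-valued function, so \<open>unimodular_extension\<close> supplies the values
  there at the price of finitely many new singular points.\<close>

lemma flat_section_extension:
 assumes \<rho>: "local_system n \<rho>" and C: "closedin X C" "flat_section \<rho> C s0" "\<forall>x\<in>C. cmod (s0 x) = 1"
  and F: "finite F" "F \<subseteq> E \<times> UNIV"
 shows "\<exists>Q s. finite Q \<and> Q \<subseteq> topspace X \<and> Q \<inter> C = {} \<and>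
  flat_section \<rho> (C \<union> (\<Union>(e, z)\<in>F. e ` cball z 1) - Q) s \<and>
  (\<forall>x\<in>C \<union> (\<Union>(e, z)\<in>F. e ` cball z 1) - Q. cmod (s x) = 1) \<and> (\<forall>x\<in>C. s x = s0 x)"
 using F
proof (induction F rule: finite_induct)
 case empty
 show ?case by (intro exI[of _ "{}"] exI[of _ s0]) (use C in auto)
next
 case (insert ez F)
 obtain e z where ez: "ez = (e, z)" by (cases ez)
 have e: "e \<in> E" using insert.prems(1) ez by auto
 have inj: "inj e" using chart_inj e .
 have FE: "F \<subseteq> E \<times> UNIV" using insert.prems(1) by auto
 define Y where "Y = C \<union> (\<Union>(e, z)\<in>F. e ` cball z 1)"
 obtain Q s where Q: "finite Q" "Q \<subseteq> topspace X" "Q \<inter> C = {}"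
  and s: "flat_section \<rho> (Y - Q) s" "\<forall>x\<in>Y - Q. cmod (s x) = 1" "\<forall>x\<in>C. s x = s0 x"
  using insert.IH[OF FE] unfolding Y_def by blast
 have clY: "closedin X Y" unfolding Y_def
 proof (intro closedin_Un C closedin_Union)
  show "finite ((\<lambda>(e, z). e ` cball z 1) ` F)" using insert.hyps by simp
  fix T assume "T \<in> (\<lambda>(e, z). e ` cball z 1) ` F"
  then obtain e z where "(e, z) \<in> F" "T = e ` cball z 1" by auto
  thus "closedin X T" using FE closedin_chart_image[of e "cball z 1"] by auto
 qed
 have fQ: "finite (e -` Q)" using Q(1) finite_vimageI[OF _ inj] by auto
 then obtain R where R: "1 < R" "R < 2" "sphere z R \<inter> e -` Q = {}" using generic_radius[of "e -` Q" 1 2] by auto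
 define Q0 where "Q0 = e -` Q \<inter> cball z R"
 have opO: "open (ball z R - e -` C)" using closed_chart_vimage[OF e C(1)] by auto
 have "Q0 \<subseteq> ball z R - e -` C"
 proof
  fix w assume w: "w \<in> Q0"
  hence "w \<notin> sphere z R" using R(3) by (auto simp: Q0_def)
  thus "w \<in> ball z R - e -` C" using w Q(3) by (auto simp: Q0_def)
 qed
 \<comment> \<open>\<open>B\<close> surrounds the old singular points of the disc, away from
   \<open>C\<close> and the bounding circle. The old values are given up inside \<open>B\<close>, so
   that the data to be extended are continuous on the compact set \<open>S\<close>.\<close>
 then obtain B where B: "open B" "Q0 \<subseteq> B" "B \<subseteq> ball z R - e -` C" using opO by blast
 define S where "S = cball z R \<inter> e -` Y - B"
 have cS: "compact S" unfolding S_def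
  using closed_chart_vimage[OF e clY] B(1) by (intro compact_diff compact_Int_closed) auto
 have SY: "S \<subseteq> e -` (Y - Q)" using B(2) by (auto simp: S_def Q0_def)
 define f where "f = (\<lambda>w. s (e w) * \<rho> e (e w))"
 have fc: "continuous_on S f"
  unfolding f_def using s(1) e continuous_on_subset[OF _ SY] by (auto simp: flat_section_def)
 have f1: "\<forall>w\<in>S. cmod (f w) = 1"
  using s(2) SY local_system_norm(1)[OF \<rho> e] by (auto simp: f_def norm_mult)
 obtain K h where h: "finite K" "K \<inter> S = {}" "continuous_on (- K) h" "\<forall>w\<in>- K. cmod (h w) = 1"
  "\<And>w. w \<in> S \<Longrightarrow> h w = f w"
  using unimodular_extension[OF cS fc f1, of UNIV] in_components_nonempty by (metis Int_UNIV_right)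
 define s' where "s' = (\<lambda>x. if x \<in> e ` cball z R then h (coord e x) / \<rho> e x else s x)"
 define Q' where "Q' = (Q - e ` cball z R) \<union> e ` (K \<inter> cball z R)"
 have s'_in: "s' (e w) = h w / \<rho> e (e w)" if "w \<in> cball z R" for w
  using that e by (simp add: s'_def)
 have s'_S: "s' (e w) = s (e w)" if "w \<in> S" for w
 proof -
  have "\<rho> e (e w) \<noteq> 0" using local_system_norm(1)[OF \<rho> e, of "e w"] by auto
  moreover have "w \<in> cball z R" using that by (simp add: S_def)
  ultimately show ?thesis using s'_in h(5)[OF that] by (simp add: f_def)
 qed
 have s'_out: "s' x = s x" if "x \<in> Y" "x \<notin> e ` ball z R" for x
 proof (cases "x \<in> e ` cball z R")
  case True
  then obtain w where w: "w \<in> cball z R" "x = e w" by blast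
  hence "w \<in> S" using that B(3) by (auto simp: S_def)
  thus ?thesis using s'_S w by simp
 qed (simp add: s'_def)
 have s'_C: "s' x = s x" if "x \<in> C" for x
 proof (cases "x \<in> e ` cball z R")
  case True
  then obtain w where w: "w \<in> cball z R" "x = e w" by blast
  hence "w \<in> S" using that B(3) by (auto simp: S_def Y_def)
  thus ?thesis using s'_S w by simp
 qed (simp add: s'_def)
 let ?Y = "Y \<union> e ` cball z R"
 have cl1: "closedin X (e ` cball z R)" by (rule closedin_chart_image[OF e]) auto
 have cl2: "closedin X (Y - e ` ball z R)"
  using clY openin_chart_image[OF e, of "ball z R"] by (intro closedin_diff) auto
 have ns: "Y \<inter> e ` sphere z R \<inter> Q = {}" using R(3) by auto
 have main: "flat_section \<rho> (?Y - Q') s'"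
 proof (rule flat_section_glue[OF _ _ cl1 cl2])
  have "flat_section \<rho> ((?Y - Q') \<inter> e ` cball z R) (\<lambda>x. h (coord e x) / \<rho> e x)"
   by (rule flat_section_from_chart[OF \<rho> e h(3)]) (auto simp: Q'_def)
  thus "flat_section \<rho> ((?Y - Q') \<inter> e ` cball z R) s'"
   by (rule flat_section_cong) (auto simp: s'_def)
  have "flat_section \<rho> ((?Y - Q') \<inter> (Y - e ` ball z R)) s"
  proof (rule flat_section_subset[OF s(1)])
   have "e ` cball z R \<subseteq> e ` ball z R \<union> e ` sphere z R" by force
   thus "(?Y - Q') \<inter> (Y - e ` ball z R) \<subseteq> Y - Q" using ns by (auto simp: Q'_def)
  qed
  thus "flat_section \<rho> ((?Y - Q') \<inter> (Y - e ` ball z R)) s'"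
   by (rule flat_section_cong) (use s'_out in blast)
  have "e ` ball z R \<subseteq> e ` cball z R" by (intro image_mono ball_subset_cball)
  thus "?Y - Q' \<subseteq> e ` cball z R \<union> (Y - e ` ball z R)" by blast
 qed
 have sub: "C \<union> (\<Union>(e, z)\<in>insert ez F. e ` cball z 1) \<subseteq> ?Y"
 proof -
  have "cball z 1 \<subseteq> cball z R" using R by auto
  thus ?thesis unfolding Y_def ez by auto
 qed
 have n1: "cmod (s' x) = 1" if x: "x \<in> ?Y - Q'" for x
 proof (cases "x \<in> e ` cball z R")
  case True
  then obtain w where w: "w \<in> cball z R" "x = e w" by blast
  hence "w \<notin> K" using x by (auto simp: Q'_def)
  thus ?thesis using s'_in[OF w(1)] w h(4) local_system_norm(1)[OF \<rho> e, of x] by (simp add: norm_divide)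
 next
  case False
  hence "x \<in> Y - Q" using x by (auto simp: Q'_def)
  thus ?thesis using False s(2) by (simp add: s'_def)
 qed
 show ?case
 proof (intro exI[of _ Q'] exI[of _ s'] conjI)
  show "finite Q'" using Q(1) h(1) by (simp add: Q'_def)
  show "Q' \<subseteq> topspace X" using Q(2) chart_in_topspace[OF e] by (auto simp: Q'_def)
  have "e w \<notin> C" if "w \<in> K" "w \<in> cball z R" for w
  proof
   assume "e w \<in> C"
   hence "w \<in> S" using that(2) B(3) by (auto simp: S_def Y_def)
   thus False using h(2) that(1) by blast
  qed
  thus "Q' \<inter> C = {}" using Q(3) by (auto simp: Q'_def)
  show "flat_section \<rho> (C \<union> (\<Union>(e, z)\<in>insert ez F. e ` cball z 1) - Q') s'"
   by (rule flat_section_subset[OF main]) (use sub in blast)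
  show "\<forall>x\<in>C \<union> (\<Union>(e, z)\<in>insert ez F. e ` cball z 1) - Q'. cmod (s' x) = 1"
   using n1 sub by blast
  show "\<forall>x\<in>C. s' x = s0 x" using s'_C s(3) by simp
 qed
qed

text \<open>If one side \<open>N\<close> of \<open>C\<close> is relatively compact, then \<open>s\<^sup>n / \<Theta>\<^sup>m\<close> can be
 extended by \<open>1\<close> beyond \<open>C\<close>, and its total index is \<open>-m\<close> modulo \<open>n\<close>.\<close>

theorem compact_side:
 assumes \<rho>: "local_system n \<rho>" and C: "closedin X C" "flat_section \<rho> C s0" "\<forall>x\<in>C. cmod (s0 x) = 1"
  and N: "openin X N" "N \<inter> C = {}" "compactin X (N \<union> C)"
  and \<Theta>: "punctured {y, y'} \<Theta>" "y \<in> N" "y' \<in> topspace X - (N \<union> C)" "index \<Theta> y \<in> {1, -1}"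
  and eq: "\<forall>x\<in>C. s0 x ^ n = \<Theta> x ^ m"
 shows "n dvd m"
proof -
 obtain F where F: "finite F" "F \<subseteq> E \<times> UNIV" "N \<union> C \<subseteq> (\<Union>(e, z)\<in>F. e ` ball z 1)"
  using compactin_chart_cover[OF N(3)] .
 define D where "D = C \<union> (\<Union>(e, z)\<in>F. e ` cball z 1)"
 obtain Q s where Q: "finite Q" "Q \<subseteq> topspace X" "Q \<inter> C = {}"
  and s: "flat_section \<rho> (D - Q) s" "\<forall>x\<in>D - Q. cmod (s x) = 1" "\<forall>x\<in>C. s x = s0 x"
  using flat_section_extension[OF \<rho> C F(1,2)] unfolding D_def by (elim exE conjE)
 let ?K = "N \<union> C"
 have Ksub: "?K \<subseteq> D"
 proof
  fix x assume "x \<in> N \<union> C"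
  then obtain e z where "(e, z) \<in> F" "x \<in> e ` ball z 1" using F(3) by auto
  moreover from this have "x \<in> e ` cball z 1" using ball_subset_cball[of z 1] by blast
  ultimately show "x \<in> D" unfolding D_def by blast
 qed
 have sK: "flat_section \<rho> (?K - Q) s" by (rule flat_section_subset[OF s(1)]) (use Ksub in blast)
 have sK2: "\<forall>x\<in>?K - Q. cmod (s x) = 1" using s(2) Ksub by blast
 have clK: "closedin X ?K" using compactin_imp_closedin[OF hausdorff N(3)] .
 have KX: "?K \<subseteq> topspace X" using closedin_subset[OF clK] .
 define G where "G = (\<lambda>x. s x ^ n * inverse (\<Theta> x) ^ m)"
 define f where "f = (\<lambda>x. if x \<in> ?K then G x else 1)"
 \<comment> \<open>\<open>y'\<close> lies outside \<open>N \<union> C\<close>, where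
   \<open>f\<close> is \<open>1\<close>; of the two charges only \<open>y\<close> is
   counted.\<close>
 define P where "P = (Q \<inter> N) \<union> {y}"
 have ny: "y \<notin> C" "y' \<notin> ?K" using \<Theta> N by auto
 have cT: "chart_continuous (topspace X - {y, y'}) \<Theta>" "\<forall>x\<in>topspace X - {y, y'}. cmod (\<Theta> x) = 1"
  using \<Theta>(1) by (auto simp: punctured_def)
 have cT0: "\<Theta> x \<noteq> 0" if "x \<in> topspace X - {y, y'}" for x
  using cT(2) that by (metis norm_zero zero_neq_one)
 have cs: "chart_continuous (?K - Q) (\<lambda>x. s x ^ n)" unfolding chart_continuous_def
 proof
  fix e assume e: "e \<in> E"
  have "continuous_on (e -` (?K - Q)) (\<lambda>w. (s (e w) * \<rho> e (e w)) ^ n)"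
   using sK e by (auto simp: flat_section_def intro!: continuous_on_power)
  thus "continuous_on (e -` (?K - Q)) ((\<lambda>x. s x ^ n) \<circ> e)"
   using local_system_norm(2)[OF \<rho> e] by (simp add: power_mult_distrib o_def)
 qed
 have subK: "(topspace X - P) \<inter> ?K \<subseteq> ?K - Q" "(topspace X - P) \<inter> ?K \<subseteq> topspace X - {y, y'}"
  using Q(3) ny by (auto simp: P_def)
 have cG: "chart_continuous ((topspace X - P) \<inter> ?K) G" unfolding G_def
 proof (rule chart_continuous_mult[OF chart_continuous_subset[OF cs subK(1)] chart_continuous_power],
   rule chart_continuous_inverse[OF chart_continuous_subset[OF cT(1) subK(2)]])
  show "\<forall>x\<in>(topspace X - P) \<inter> ?K. \<Theta> x \<noteq> 0" using cT0 subK(2) by blast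
 qed
 have G1: "cmod (G x) = 1" if "x \<in> (topspace X - P) \<inter> ?K" for x
 proof -
  have "x \<in> ?K - Q" "x \<in> topspace X - {y, y'}" using that subK by blast+
  thus ?thesis using sK2 cT(2) by (simp add: G_def norm_mult norm_power norm_inverse)
 qed
 have GC: "G x = 1" if "x \<in> C" for x
 proof -
  have "x \<in> topspace X - {y, y'}" using that ny KX by auto
  hence "\<Theta> x \<noteq> 0" by (rule cT0)
  thus ?thesis using that eq s(3) by (simp add: G_def field_simps)
 qed
 have fP: "punctured P f" unfolding punctured_def
 proof (intro conjI)
  show "finite P" using Q(1) by (simp add: P_def)
  show "chart_continuous (topspace X - P) f"
  proof (rule chart_continuous_glue[OF _ _ clK])
   show "chart_continuous ((topspace X - P) \<inter> ?K) f"
    by (rule chart_continuous_cong[OF cG]) (simp add: f_def)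
   show "chart_continuous ((topspace X - P) \<inter> (topspace X - N)) f"
    by (rule chart_continuous_cong[of _ "\<lambda>x. 1"]) (use GC in \<open>auto simp: f_def\<close>)
   show "closedin X (topspace X - N)" using N(1) by auto
  qed auto
  show "\<forall>x\<in>topspace X - P. cmod (f x) = 1" using G1 by (auto simp: f_def)
 qed
 have PX: "P \<subseteq> N" "P \<subseteq> topspace X" using \<Theta>(2) KX by (auto simp: P_def)
 have total: "(\<Sum>q\<in>P. index f q) = 0" by (rule monopole[OF fP PX(2) N(3)]) (auto simp: f_def)
 \<comment> \<open>In a chart \<open>s ^ n\<close> is the \<open>n\<close>-th power of the honest
   function \<open>u\<close>, because \<open>\<rho> e\<close> takes \<open>n\<close>-th roots of
   unity as values. So its index is a multiple of \<open>n\<close>, and modulo \<open>n\<close> only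
   \<open>\<Theta>\<close> is seen.\<close>
 have loc: "\<exists>k. index f q = of_nat n * of_int k - of_nat m * index \<Theta> q" if q: "q \<in> N" for q
 proof -
  have qX: "q \<in> topspace X" using q KX by auto
  obtain e z where e: "e \<in> E" "q = e z" using in_range_chart[OF qX] by blast
  have "open (e -` (N - (Q \<union> {y} - {q})))"
  proof -
   have "e -` (N - (Q \<union> {y} - {q})) = e -` N - (e -` (Q \<union> {y} - {q}))" by auto
   moreover have "finite (e -` (Q \<union> {y} - {q}))"
    using Q(1) finite_vimageI[OF _ chart_inj[OF e(1)]] by auto
   ultimately show ?thesis using open_chart_vimage[OF e(1) N(1)] by (simp add: open_Diff finite_imp_closed)
  qed
  moreover have "z \<in> e -` (N - (Q \<union> {y} - {q}))" using q e(2) by simp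
  ultimately obtain r where r: "r > 0" "cball z r \<subseteq> e -` (N - (Q \<union> {y} - {q}))"
   unfolding open_contains_cball by blast
  have sub: "cball z r - {z} \<subseteq> e -` (N - Q - {y})"
   using r(2) e(2) chart_inj[OF e(1)] by (auto simp: inj_def)
  define u where "u = (\<lambda>w. s (e w) * \<rho> e (e w))"
  have u: "continuous_on (cball z r - {z}) u" "\<forall>w\<in>cball z r - {z}. u w \<noteq> 0"
  proof -
   have *: "cball z r - {z} \<subseteq> e -` (?K - Q)" using sub by auto
   show "continuous_on (cball z r - {z}) u"
    unfolding u_def using sK e(1) continuous_on_subset[OF _ *] by (auto simp: flat_section_def)
   show "\<forall>w\<in>cball z r - {z}. u w \<noteq> 0"
   proof
    fix w assume "w \<in> cball z r - {z}"
    hence "cmod (s (e w)) = 1" using sK2 * by blast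
    hence "cmod (u w) = 1" using local_system_norm(1)[OF \<rho> e(1), of "e w"] by (simp add: u_def norm_mult)
    thus "u w \<noteq> 0" by auto
   qed
  qed
  have tsub: "cball z r - {z} \<subseteq> e -` (topspace X - {y, y'})" using sub ny KX by auto
  have t: "continuous_on (cball z r - {z}) (\<Theta> \<circ> e)" by (rule chart_continuousD[OF cT(1) e(1) tsub])
  have t0: "\<forall>w\<in>cball z r - {z}. (\<Theta> \<circ> e) w \<noteq> 0" using cT0 tsub by auto
  let ?i = "\<lambda>w. inverse ((\<Theta> \<circ> e) w)"
  have i: "continuous_on (cball z r - {z}) ?i" "\<forall>w\<in>cball z r - {z}. ?i w \<noteq> 0"
   using t t0 by (auto intro!: continuous_on_inverse)
  have "index f q = index_at (f \<circ> e) z"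
   using index_chart[OF _ e(1)] punctured_isolated[OF fP qX] e(2) by simp
  also have "\<dots> = index_at (\<lambda>w. u w ^ n * ?i w ^ m) z"
  proof (rule index_at_cong[OF r(1)])
   fix w assume "w \<in> ball z r - {z}"
   hence "w \<in> cball z r - {z}" by auto
   hence "e w \<in> N" using sub by blast
   thus "(f \<circ> e) w = u w ^ n * ?i w ^ m"
    using local_system_norm(2)[OF \<rho> e(1), of "e w"] by (simp add: f_def G_def u_def power_mult_distrib)
  qed
  also have "\<dots> = index_at (\<lambda>w. u w ^ n) z + index_at (\<lambda>w. ?i w ^ m) z"
   using u i by (intro index_at_mult[OF r(1)]) (auto intro!: continuous_on_power)
  also have "index_at (\<lambda>w. u w ^ n) z = of_nat n * index_at u z"
   by (rule index_at_power[OF r(1) u])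
  also have "index_at (\<lambda>w. ?i w ^ m) z = of_nat m * index_at ?i z"
   by (rule index_at_power[OF r(1) i])
  also have "index_at ?i z = - index_at (\<Theta> \<circ> e) z"
   by (rule index_at_inverse[OF r(1) t t0])
  also have "index_at (\<Theta> \<circ> e) z = index \<Theta> q"
   using index_chart[OF _ e(1)] punctured_isolated[OF \<Theta>(1) qX] e(2) by simp
  finally have "index f q = of_nat n * index_at u z - of_nat m * index \<Theta> q" by simp
  moreover obtain k where "index_at u z = of_int k"
   using index_at_Ints[OF r(1) u] Ints_cases by blast
  ultimately show ?thesis by auto
 qed
 then obtain k where k: "\<And>q. q \<in> N \<Longrightarrow> index f q = of_nat n * of_int (k q) - of_nat m * index \<Theta> q" by metis
 have "(\<Sum>q\<in>P. index f q) = (\<Sum>q\<in>P. of_nat n * of_int (k q) - of_nat m * index \<Theta> q)"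
  using k PX(1) by (intro sum.cong) auto
 also have "\<dots> = of_nat n * of_int (\<Sum>q\<in>P. k q) - of_nat m * (\<Sum>q\<in>P. index \<Theta> q)"
  by (simp add: sum_subtractf sum_distrib_left)
 also have "(\<Sum>q\<in>P. index \<Theta> q) = index \<Theta> y"
 proof -
  have fin: "finite P" "y \<in> P" using fP by (auto simp: punctured_def P_def)
  have "index \<Theta> q = 0" if "q \<in> P - {y}" for q
   by (rule punctured_index_0[OF \<Theta>(1)]) (use that PX ny in auto)
  hence "(\<Sum>q\<in>P - {y}. index \<Theta> q) = 0" by (intro sum.neutral) blast
  thus ?thesis using sum.remove[OF fin, of "index \<Theta>"] by simp
 qed
 finally have "of_nat n * of_int (\<Sum>q\<in>P. k q) = of_nat m * index \<Theta> y" using total by simp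
 moreover obtain i :: int where "index \<Theta> y = of_int i" "i = 1 \<or> i = -1" using \<Theta>(4)
  by (metis insert_iff of_int_1 of_int_minus empty_iff)
 ultimately have "(of_int (int n * (\<Sum>q\<in>P. k q)) :: complex) = of_int (int m * i)" by simp
 hence "int n * (\<Sum>q\<in>P. k q) = int m * i" by (simp only: of_int_eq_iff)
 hence "int n dvd int m * i" by (metis dvd_triv_left)
 thus ?thesis using \<open>i = 1 \<or> i = -1\<close> by auto
qed

end

subsection \<open>Simple closed curves\<close>

text \<open>Its purpose is to cut a path at its last visit to a circle, so that the piece from there
  to \<open>c\<close> meets the circle only at its start.\<close>

lemma last_time_outside:
 fixes \<alpha> :: "real \<Rightarrow> complex"
 assumes "a < c" "continuous_on {a..c} \<alpha>" "dist z (\<alpha> a) \<ge> r" "dist z (\<alpha> c) < r"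
 obtains t where "a \<le> t" "t < c" "dist z (\<alpha> t) = r" "\<And>s. t < s \<Longrightarrow> s \<le> c \<Longrightarrow> dist z (\<alpha> s) < r"
proof -
 let ?d = "\<lambda>t. dist z (\<alpha> t)"
 have dc: "continuous_on {a..c} ?d" using assms(2) by (intro continuous_intros)
 define A where "A = {a..c} \<inter> ?d -` {r..}"
 have "closed A" unfolding A_def by (rule continuous_closed_preimage[OF dc]) auto
 moreover have "bounded A" unfolding A_def by (rule bounded_subset[of "{a..c}"]) auto
 ultimately have "compact A" by (simp add: compact_eq_bounded_closed)
 moreover have "a \<in> A" using assms(1,3) by (simp add: A_def)
 ultimately obtain t where t: "t \<in> A" "\<forall>s\<in>A. s \<le> t" using compact_attains_sup[of A] by blast
 have tc: "t < c" using t(1) assms(4) by (cases "t = c") (auto simp: A_def)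
 have at: "a \<le> t" "?d t \<ge> r" using t(1) by (auto simp: A_def)
 have after: "?d s < r" if "t < s" "s \<le> c" for s
 proof (rule ccontr)
  assume "\<not> ?d s < r"
  hence "s \<in> A" using that at by (auto simp: A_def)
  thus False using t(2) that by force
 qed
 have "\<exists>x\<ge>t. x \<le> c \<and> ?d x = r"
  by (rule IVT2') (use tc at assms(4) in \<open>auto intro: continuous_on_subset[OF dc]\<close>)
 then obtain x where "t \<le> x" "x \<le> c" "?d x = r" by blast
 hence "?d t = r" using after[of x] by (cases "x = t") auto
 thus thesis using that[of t] at tc after by blast
qed

lemma first_time_outside:
 fixes \<alpha> :: "real \<Rightarrow> complex"
 assumes "c < b" "continuous_on {c..b} \<alpha>" "dist z (\<alpha> b) \<ge> r" "dist z (\<alpha> c) < r"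
 obtains t where "c < t" "t \<le> b" "dist z (\<alpha> t) = r" "\<And>s. c \<le> s \<Longrightarrow> s < t \<Longrightarrow> dist z (\<alpha> s) < r"
proof -
 have "continuous_on {-b..-c} (\<alpha> \<circ> uminus)"
  by (rule continuous_on_compose) (use assms in \<open>auto intro: continuous_intros\<close>)
 then obtain t where t: "-b \<le> t" "t < -c" "dist z ((\<alpha> \<circ> uminus) t) = r"
  "\<And>s. t < s \<Longrightarrow> s \<le> -c \<Longrightarrow> dist z ((\<alpha> \<circ> uminus) s) < r"
  using last_time_outside[of "-b" "-c" "\<alpha> \<circ> uminus" r z] assms by auto
 show thesis
 proof (rule that[of "-t"])
  fix s assume "c \<le> s" "s < -t"
  thus "dist z (\<alpha> s) < r" using t(4)[of "-s"] by simp
 qed (use t in auto)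
qed

lemma circular_arc:
 fixes z :: complex
 assumes "r > 0" "dist z p = r" "dist z q = r" "p \<noteq> q"
 obtains \<kappa> where "arc \<kappa>" "pathstart \<kappa> = p" "pathfinish \<kappa> = q" "path_image \<kappa> \<subseteq> sphere z r"
proof -
 have rep: "x = z + of_real r * exp (\<i> * of_real (Arg2pi (x - z)))" if "dist z x = r" for x
  using Arg2pi_eq[of "x - z"] that by (simp add: dist_norm norm_minus_commute)
 let ?s = "Arg2pi (p - z)" and ?t = "Arg2pi (q - z)"
 have "?s \<noteq> ?t" using rep[OF assms(2)] rep[OF assms(3)] assms(4) by metis
 moreover have "\<bar>?s - ?t\<bar> < 2 * pi" using Arg2pi[of "p - z"] Arg2pi[of "q - z"] by linarith
 ultimately have "arc (part_circlepath z r ?s ?t)" using assms(1) by (intro arc_part_circlepath) auto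
 moreover have "path_image (part_circlepath z r ?s ?t) \<subseteq> sphere z r"
  using assms(1) by (auto simp: path_image_def part_circlepath_def dist_norm norm_mult)
 moreover have "pathstart (part_circlepath z r ?s ?t) = p" "pathfinish (part_circlepath z r ?s ?t) = q"
  using rep[OF assms(2)] rep[OF assms(3)] by auto
 ultimately show thesis using that by blast
qed

lemma winding_number_const_on:
 assumes "\<And>t. t \<in> {0..1} \<Longrightarrow> p t = 1"
 shows "wind p = 0"
proof -
 have "wind p = wind (\<lambda>t. 1)" by (rule winding_number_cong) (use assms in auto)
 thus ?thesis by (simp add: winding_number_zero_const)
qed

context oriented_surface
begin

text \<open>\<open>{0<..1}\<close> meets each point of the parameter circle exactly once, so this is
  injectivity of the induced map on the circle.\<close>

definition simple_loop :: "(real \<Rightarrow> 'x) \<Rightarrow> bool" where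
 "simple_loop c \<longleftrightarrow> continuous_map (top_of_set {0..1}) X c \<and> c 0 = c 1 \<and> inj_on c {0<..1}"

lemma closedin_path_piece:
 assumes "continuous_map (top_of_set {0..1}) X c" "compact T" "T \<subseteq> {0..1}"
 shows "closedin X (c ` T)" "compactin X (c ` T)"
proof -
 have "compactin (top_of_set {0..1}) T" using assms(2,3) by (simp add: compactin_subtopology)
 thus "compactin X (c ` T)" using image_compactin assms(1) by blast
 thus "closedin X (c ` T)" by (rule compactin_imp_closedin[OF hausdorff])
qed

text \<open>A short subarc of the curve in a chart disc is closed up along the boundary circle; points on
 the two sides of the resulting Jordan curve close to the middle of the arc carry the dipole.\<close>

theorem jump:
 assumes c: "simple_loop c"
 obtains y y' \<Theta> where "punctured {y, y'} \<Theta>" "y \<noteq> y'" "y \<in> topspace X - c ` {0..1}" "y' \<in> topspace X - c ` {0..1}"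
  "index \<Theta> y = 1" "index \<Theta> y' = -1" "wind (\<Theta> \<circ> c) = 1"
proof -
 have cc: "continuous_map (top_of_set {0..1}) X c" and c01: "c 0 = c 1" and cinj: "inj_on c {0<..1}"
  using c by (auto simp: simple_loop_def)
 have cX: "c t \<in> topspace X" if "t \<in> {0..1}" for t
  using continuous_map_image_subset_topspace[OF cc] that by auto
 have ceq: "s = t" if "s \<in> {0<..<1}" "t \<in> {0..1}" "c s = c t" for s t
 proof (cases "t = 0")
  case True
  hence "c s = c 1" using that c01 by simp
  hence "s = 1" using inj_onD[OF cinj, of s 1] that by auto
  thus ?thesis using that by auto
 qed (use inj_onD[OF cinj, of s t] that in auto)
 \<comment> \<open>The middle parameter \<open>1/2\<close> keeps the local picture away from the
   ends of the parameter interval, which the closed curve identifies.\<close>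
 obtain e z0 where e: "e \<in> E" "c (1/2) = e z0" using in_range_chart[OF cX[of "1/2"]] by auto
 have inj: "inj e" using chart_inj[OF e(1)] .
 have "openin (top_of_set {0..1}) {t \<in> {0..1}. c t \<in> range e}"
  using openin_continuous_map_preimage[OF cc openin_chart_image[OF e(1) open_UNIV]] by simp
 then obtain \<delta>0 where \<delta>0: "\<delta>0 > 0" "\<forall>t\<in>{0..1}. dist t (1/2) < \<delta>0 \<longrightarrow> c t \<in> range e"
 proof -
  have "(1/2::real) \<in> {t \<in> {0..1}. c t \<in> range e}" using e by simp
  with \<open>openin (top_of_set {0..1}) {t \<in> {0..1}. c t \<in> range e}\<close>
  have "\<exists>\<delta>>0. \<forall>t\<in>{0..1}. dist t (1/2) < \<delta> \<longrightarrow> t \<in> {t \<in> {0..1}. c t \<in> range e}"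
   unfolding openin_euclidean_subtopology_iff by blast
  thus ?thesis using that by auto
 qed
 define \<delta> where "\<delta> = min (\<delta>0/2) (1/4)"
 define a b where "a = 1/2 - \<delta>" and "b = 1/2 + \<delta>"
 have ab: "0 < a" "a < 1/2" "1/2 < b" "b < 1" "a < b"
  using \<delta>0(1) by (auto simp: a_def b_def \<delta>_def min_def)
 have cr: "c t \<in> range e" if "t \<in> {a..b}" for t
 proof -
  have "dist t (1/2) \<le> \<delta>" using that by (auto simp: a_def b_def dist_real_def)
  hence "dist t (1/2) < \<delta>0" using \<delta>0(1) by (auto simp: \<delta>_def)
  thus ?thesis using \<delta>0(2) that ab by auto
 qed
 define \<alpha> where "\<alpha> = coord e \<circ> c"
 have e\<alpha>: "e (\<alpha> t) = c t" if "t \<in> {a..b}" for t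
  using cr[OF that] by (simp add: \<alpha>_def f_inv_into_f)
 have \<alpha>inj: "inj_on \<alpha> {a..b}"
 proof
  fix s t assume st: "s \<in> {a..b}" "t \<in> {a..b}" "\<alpha> s = \<alpha> t"
  hence "c s = c t" using e\<alpha> by metis
  thus "s = t" using ceq[of s t] st ab by auto
 qed
 have \<alpha>c: "continuous_on {a..b} \<alpha>"
 proof -
  have "continuous_on {a..b} \<alpha> \<longleftrightarrow> continuous_map (top_of_set {a..b}) euclidean \<alpha>" by simp
  moreover have "continuous_map (subtopology X (range e)) euclidean (coord e)"
   by (rule chart_continuous_imp_continuous_map)
    (use chart_continuous_from_chart[OF e(1) continuous_on_id, of "range e" UNIV] chart_in_topspace[OF e(1)] in auto)
  moreover have "continuous_map (top_of_set {a..b}) X c"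
   by (rule continuous_map_from_subtopology_mono[OF cc]) (use ab in auto)
  hence "continuous_map (top_of_set {a..b}) (subtopology X (range e)) c"
   using cr by (auto simp: continuous_map_in_subtopology)
  ultimately show ?thesis unfolding \<alpha>_def using continuous_map_compose by blast
 qed
 have \<alpha>half: "\<alpha> (1/2) = z0" using e by (simp add: \<alpha>_def)
 have avoid: "\<exists>r>0. cball z0 r \<inter> e -` (c ` T) = {}" if "compact T" "T \<subseteq> {0..1} - {1/2}" for T
 proof -
  have "z0 \<notin> e -` (c ` T)"
  proof
   assume "z0 \<in> e -` (c ` T)"
   then obtain t where "t \<in> T" "c t = c (1/2)" using e by auto
   thus False using ceq[of "1/2" t] that by auto
  qed
  moreover have "closed (e -` (c ` T))"
   using closed_chart_vimage[OF e(1) closedin_path_piece(1)[OF cc that(1)]] that(2) by auto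
  ultimately obtain r where "r > 0" "cball z0 r \<subseteq> - (e -` (c ` T))"
   using open_contains_cball[of "- (e -` (c ` T))"] by (meson ComplI open_Compl)
  thus ?thesis by blast
 qed
 \<comment> \<open>The circle of radius \<open>r1\<close> separates \<open>\<alpha> (1/2)\<close>
   from both \<open>\<alpha> a\<close> and \<open>\<alpha> b\<close>, so the arc through the centre
   reaches it in both directions.\<close>
 obtain r1 where r1: "r1 > 0" "cball z0 r1 \<inter> e -` (c ` {a, b}) = {}"
  using avoid[of "{a, b}"] ab by auto
 have out: "dist z0 (\<alpha> a) \<ge> r1" "dist z0 (\<alpha> b) \<ge> r1"
 proof -
  have "\<alpha> a \<notin> cball z0 r1" "\<alpha> b \<notin> cball z0 r1"
   using r1(2) e\<alpha>[of a] e\<alpha>[of b] ab by auto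
  thus "dist z0 (\<alpha> a) \<ge> r1" "dist z0 (\<alpha> b) \<ge> r1" by auto
 qed
 have h0: "dist z0 (\<alpha> (1/2)) < r1" using \<alpha>half r1 by simp
 obtain t1 where t1: "a \<le> t1" "t1 < 1/2" "dist z0 (\<alpha> t1) = r1" "\<And>s. t1 < s \<Longrightarrow> s \<le> 1/2 \<Longrightarrow> dist z0 (\<alpha> s) < r1"
  using last_time_outside[OF ab(2) continuous_on_subset[OF \<alpha>c] out(1) h0] ab by auto
 obtain t2 where t2: "1/2 < t2" "t2 \<le> b" "dist z0 (\<alpha> t2) = r1" "\<And>s. 1/2 \<le> s \<Longrightarrow> s < t2 \<Longrightarrow> dist z0 (\<alpha> s) < r1"
  using first_time_outside[OF ab(3) continuous_on_subset[OF \<alpha>c] out(2) h0] ab by auto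
 have tsub: "{t1..t2} \<subseteq> {a..b}" and tt: "t1 < t2" "0 < t1" "t2 < 1" using t1 t2 ab by auto
 define \<beta> where "\<beta> = subpath t1 t2 \<alpha>"
 have \<beta>im: "path_image \<beta> = \<alpha> ` {t1..t2}"
  unfolding \<beta>_def using tt by (simp add: path_image_subpath)
 have \<beta>eq: "\<beta> t = \<alpha> (t1 + (t2 - t1) * t)" for t by (simp add: \<beta>_def subpath_def algebra_simps)
 have \<beta>t: "t1 + (t2 - t1) * t \<in> {t1..t2}" if "t \<in> {0..1}" for t
 proof -
  have "0 \<le> (t2 - t1) * t" "(t2 - t1) * t \<le> t2 - t1" using that tt by (auto intro: mult_left_le)
  thus ?thesis by auto
 qed
 have "arc \<beta>" unfolding arc_def
 proof
  have "continuous_on {0..1} (\<lambda>t. \<alpha> (t1 + (t2 - t1) * t))"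
  proof (rule continuous_on_compose2[OF \<alpha>c])
   show "(\<lambda>t. t1 + (t2 - t1) * t) ` {0..1} \<subseteq> {a..b}" using \<beta>t tsub by blast
  qed (intro continuous_intros)
  thus "path \<beta>" unfolding path_def by (simp add: \<beta>eq[abs_def])
  show "inj_on \<beta> {0..1}"
  proof
   fix s t assume st: "s \<in> {0..1}" "t \<in> {0..1}" "\<beta> s = \<beta> t"
   have "t1 + (t2 - t1) * s = t1 + (t2 - t1) * t"
   proof (rule inj_onD[OF \<alpha>inj])
    show "t1 + (t2 - t1) * s \<in> {a..b}" "t1 + (t2 - t1) * t \<in> {a..b}" using \<beta>t[OF st(1)] \<beta>t[OF st(2)] tsub by blast+
   qed (use st(3) \<beta>eq in simp)
   thus "s = t" using tt by simp
  qed
 qed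
 have \<beta>ends: "pathstart \<beta> = \<alpha> t1" "pathfinish \<beta> = \<alpha> t2" by (auto simp: \<beta>_def)
 have "\<alpha> t1 \<noteq> \<alpha> t2" using inj_onD[OF \<alpha>inj, of t1 t2] tt tsub by auto
 then obtain \<kappa> where \<kappa>: "arc \<kappa>" "pathstart \<kappa> = \<alpha> t2" "pathfinish \<kappa> = \<alpha> t1" "path_image \<kappa> \<subseteq> sphere z0 r1"
  using circular_arc[OF r1(1) t2(3) t1(3)] by metis
 define J where "J = \<beta> +++ \<kappa>"
 have "path_image \<beta> \<inter> path_image \<kappa> \<subseteq> {pathstart \<beta>, pathstart \<kappa>}"
 proof
  fix x assume x: "x \<in> path_image \<beta> \<inter> path_image \<kappa>"
  then obtain s where s: "s \<in> {t1..t2}" "x = \<alpha> s" using \<beta>im by auto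
  have "dist z0 x = r1" using x \<kappa>(4) by auto
  hence "\<not> (t1 < s \<and> s \<le> 1/2)" "\<not> (1/2 \<le> s \<and> s < t2)" using t1(4) t2(4) s(2) by force+
  hence "s = t1 \<or> s = t2" using s(1) by auto
  thus "x \<in> {pathstart \<beta>, pathstart \<kappa>}" using s(2) \<beta>ends \<kappa> by auto
 qed
 hence Js: "simple_path J"
  unfolding J_def using \<open>arc \<beta>\<close> \<kappa> \<beta>ends by (intro simple_path_join_loop) auto
 have Jl: "pathfinish J = pathstart J" using \<kappa> \<beta>ends by (simp add: J_def)
 have Jim: "path_image J = path_image \<beta> \<union> path_image \<kappa>"
  unfolding J_def using \<beta>ends \<kappa> by (intro path_image_join) auto
 have z0J: "z0 \<in> path_image J" using Jim \<beta>im \<alpha>half t1 t2 by (auto intro!: image_eqI[of _ _ "1/2"])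
 have "{0..t1} \<union> {t2..1} \<subseteq> {0..1} - {1/2}" using t1(2) t2(1) tt by auto
 moreover have "compact ({0..t1} \<union> {t2..1})" by (intro compact_Un) auto
 \<comment> \<open>The rest of the curve keeps a positive distance from \<open>z0\<close>. Within
   that distance the curve consists of the chosen subarc alone, and the dipole will be supported
   there.\<close>
 ultimately obtain r2' where r2': "r2' > 0" "cball z0 r2' \<inter> e -` (c ` ({0..t1} \<union> {t2..1})) = {}"
  using avoid by blast
 define r2 where "r2 = min r1 r2'"
 have r2: "r2 > 0" "r2 \<le> r1" "cball z0 r2 \<inter> e -` (c ` ({0..t1} \<union> {t2..1})) = {}"
  using r1(1) r2' by (auto simp: r2_def)
 have cout: "c t \<notin> e ` cball z0 r2" if "t \<in> {0..t1} \<union> {t2..1}" for t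
 proof
  assume "c t \<in> e ` cball z0 r2"
  then obtain w where w: "w \<in> cball z0 r2" "e w = c t" by auto
  have "e w \<in> c ` ({0..t1} \<union> {t2..1})" unfolding w(2) using that by (rule imageI)
  hence "w \<in> e -` (c ` ({0..t1} \<union> {t2..1}))" by (rule vimageI2)
  thus False using w(1) r2(3) by (metis IntI empty_iff)
 qed
 note JJ = Jordan_inside_outside[OF Js Jl]
 \<comment> \<open>\<open>z0\<close> lies on the Jordan curve, which is the frontier of both its
   inside and its outside, so both have points arbitrarily close to \<open>z0\<close>. The bound
   \<open>r2/8\<close> is the one required by \<open>dipole\<close>.\<close>
 have near: "\<exists>y\<in>A. y \<in> ball z0 (r2/8)" if "frontier A = path_image J" for A
 proof -
  have "z0 \<in> closure A" using z0J that by (auto simp: frontier_def)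
  then obtain y where "y \<in> A" "dist y z0 < r2/8" using closure_approachable r2(1) by (metis zero_less_divide_iff zero_less_numeral)
  thus ?thesis by (auto simp: dist_commute)
 qed
 obtain u v where uv: "u \<in> inside (path_image J)" "u \<in> ball z0 (r2/8)" "v \<in> outside (path_image J)" "v \<in> ball z0 (r2/8)"
  using near JJ by metis
 have notJ: "u \<notin> path_image J" "v \<notin> path_image J" "u \<noteq> v"
 proof -
  show "u \<notin> path_image J" using uv(1) inside_no_overlap[of "path_image J"] by blast
  show "v \<notin> path_image J" using uv(3) outside_no_overlap[of "path_image J"] by blast
  show "u \<noteq> v" using uv(1,3) inside_Int_outside[of "path_image J"] by blast
 qed
 have wv: "winding_number J v = 0"
  using winding_number_zero_in_outside[of J v] Js Jl uv by (simp add: simple_path_imp_path)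
 have wu: "winding_number J u = 1 \<or> winding_number J u = -1"
  using simple_closed_path_winding_number_inside[OF Js] uv(1) by metis
 \<comment> \<open>\<open>J\<close> may run in either direction; calling the inner point
   \<open>y\<close> or \<open>y'\<close> accordingly makes the difference of winding numbers
   \<open>1\<close>.\<close>
 obtain y y' where yy: "y \<in> ball z0 (r2/8)" "y' \<in> ball z0 (r2/8)" "y \<noteq> y'" "y \<notin> path_image J" "y' \<notin> path_image J"
  "winding_number J y - winding_number J y' = 1"
 proof (cases "winding_number J u = 1")
  case True
  thus ?thesis using that[of u v] uv notJ wv by auto
 next
  case False
  thus ?thesis using that[of v u] uv notJ wv wu by auto
 qed
 obtain \<theta> where \<theta>: "continuous_on (- {y, y'}) \<theta>" "\<forall>w\<in>- {y, y'}. cmod (\<theta> w) = 1"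
  "\<And>w. w \<notin> ball z0 r2 \<Longrightarrow> \<theta> w = 1"
  "\<And>\<gamma>. path \<gamma> \<Longrightarrow> pathfinish \<gamma> = pathstart \<gamma> \<Longrightarrow> path_image \<gamma> \<subseteq> - {y, y'} \<Longrightarrow>
   wind (\<theta> \<circ> \<gamma>) = winding_number \<gamma> y - winding_number \<gamma> y'"
  using dipole[OF r2(1) yy(1-3)] by blast
 note ti = dipole_index[OF yy(3) \<theta>(1,2,4)]
 define \<Theta> where "\<Theta> = surgery e z0 r2 \<theta> (\<lambda>x. 1)"
 have ysub: "{y, y'} \<subseteq> ball z0 r2" using yy(1,2) r2(1) by auto
 have P: "punctured {e y, e y'} \<Theta>"
 proof -
  have "punctured ({} - e ` cball z0 r2 \<union> e ` {y, y'}) (surgery e z0 r2 \<theta> (\<lambda>x. 1))"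
  proof (rule surgery_sum(1)[OF _ _ e(1) r2(1) _ _ ysub])
   show "punctured {} (\<lambda>x. 1)" by (simp add: punctured_def)
   show "continuous_on (cball z0 r2 - {y, y'}) \<theta>" "\<forall>w\<in>cball z0 r2 - {y, y'}. cmod (\<theta> w) = 1"
    using \<theta>(1,2) by (auto intro: continuous_on_subset)
   fix w assume "w \<in> sphere z0 r2"
   thus "\<theta> w = 1" using \<theta>(3)[of w] by auto
  qed auto
  thus ?thesis by (simp add: \<Theta>_def)
 qed
 have \<Theta>e: "\<Theta> (e w) = \<theta> w" for w
 proof (cases "w \<in> cball z0 r2")
  case False
  hence "e w \<notin> e ` cball z0 r2" using inj_image_mem_iff[OF inj] by blast
  thus ?thesis using False \<theta>(3)[of w] by (auto simp: \<Theta>_def surgery_def)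
 qed (simp add: \<Theta>_def surgery_inside[OF e(1)])
 have idx: "index \<Theta> (e w) = index_at \<theta> w" for w
 proof -
  have "index \<Theta> (e w) = index_at (\<Theta> \<circ> e) w"
   by (rule index_chart[OF punctured_isolated[OF P chart_in_topspace[OF e(1)]] e(1)])
  also have "\<Theta> \<circ> e = \<theta>" using \<Theta>e by auto
  finally show ?thesis .
 qed
 have offc: "e w \<notin> c ` {0..1}" if "w \<in> ball z0 r2" "w \<notin> path_image J" for w
 proof
  assume "e w \<in> c ` {0..1}"
  then obtain t where t: "t \<in> {0..1}" "e w = c t" by auto
  have "t \<notin> {0..t1} \<union> {t2..1}"
  proof
   assume "t \<in> {0..t1} \<union> {t2..1}"
   hence "c t \<notin> e ` cball z0 r2" by (rule cout)
   thus False using t(2) that(1) by (metis ball_subset_cball imageI subsetD)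
  qed
  hence "t \<in> {t1..t2}" using t(1) by auto
  moreover from this have "w = \<alpha> t" using e\<alpha>[of t] tsub t(2) inj by (auto simp: inj_def)
  ultimately show False using that(2) Jim \<beta>im by auto
 qed
 define q where "q = \<Theta> \<circ> c"
 have csub: "c ` {0..1} \<subseteq> topspace X - {e y, e y'}"
 proof -
  have "e y \<notin> c ` {0..1}" "e y' \<notin> c ` {0..1}" using offc ysub yy(4,5) by auto
  moreover have "c ` {0..1} \<subseteq> topspace X" using cX by blast
  ultimately show ?thesis by blast
 qed
 have qp: "path q"
  unfolding q_def by (rule chart_continuous_path[OF _ cc csub]) (use P in \<open>auto simp: punctured_def\<close>)
 have q0: "0 \<notin> path_image q"
 proof
  assume "0 \<in> path_image q"
  then obtain t where "t \<in> {0..1}" "q t = 0" by (auto simp: path_image_def)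
  hence "\<Theta> (c t) = 0" by (simp add: q_def)
  moreover have "c t \<in> topspace X - {e y, e y'}" using csub \<open>t \<in> {0..1}\<close> by blast
  hence "cmod (\<Theta> (c t)) = 1" using P unfolding punctured_def by blast
  ultimately show False by simp
 qed
 have q1: "q t = 1" if "t \<in> {0..t1} \<union> {t2..1}" for t
  using cout[OF that] by (simp add: q_def \<Theta>_def surgery_def)
 \<comment> \<open>For parameters outside the open interval from \<open>t1\<close> to
   \<open>t2\<close> the curve avoids the disc carrying the dipole, so \<open>q\<close> is
   constantly \<open>1\<close> there and only the subarc contributes.\<close>
 have "wind q = wind (subpath 0 1 q)" by simp
 also have "\<dots> = wind (subpath 0 t1 q) + wind (subpath t1 1 q)"
  using winding_number_subpath_combine[OF qp q0, of 0 t1 1] tt by simp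
 also have "wind (subpath t1 1 q) = wind (subpath t1 t2 q) + wind (subpath t2 1 q)"
  using winding_number_subpath_combine[OF qp q0, of t1 t2 1] tt by simp
 also have "wind (subpath 0 t1 q) = 0"
 proof (rule winding_number_const_on)
  fix t :: real assume "t \<in> {0..1}"
  hence "t1 * t \<in> {0..t1}" using tt by (auto intro: mult_left_le)
  thus "subpath 0 t1 q t = 1" using q1 by (simp add: subpath_def)
 qed
 also have "wind (subpath t2 1 q) = 0"
 proof (rule winding_number_const_on)
  fix t :: real assume "t \<in> {0..1}"
  hence "0 \<le> (1 - t2) * t" "(1 - t2) * t \<le> 1 - t2" using tt by (auto intro: mult_left_le)
  hence "(1 - t2) * t + t2 \<in> {t2..1}" by auto
  thus "subpath t2 1 q t = 1" using q1 by (simp add: subpath_def)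
 qed
 also have "wind (subpath t1 t2 q) = wind (\<theta> \<circ> \<beta>)"
 proof (rule winding_number_cong)
  fix t :: real assume "0 \<le> t" "t \<le> 1"
  hence "t1 + (t2 - t1) * t \<in> {a..b}" using \<beta>t[of t] tsub by auto
  from e\<alpha>[OF this] show "subpath t1 t2 q t = (\<theta> \<circ> \<beta>) t"
   by (simp add: subpath_def q_def \<beta>eq add.commute flip: \<Theta>e)
 qed
 \<comment> \<open>The closing arc \<open>\<kappa>\<close> lies on the circle of radius
   \<open>r1 \<ge> r2\<close>, where \<open>\<theta>\<close> is \<open>1\<close>, so closing up the
   subarc does not change the winding number.\<close>
 also have "wind (\<theta> \<circ> \<beta>) = wind (\<theta> \<circ> J)"
 proof -
  have sub: "path_image \<beta> \<subseteq> - {y, y'}" "path_image \<kappa> \<subseteq> - {y, y'}" using yy Jim by auto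
  have p: "path (\<theta> \<circ> \<beta>)" "path (\<theta> \<circ> \<kappa>)"
   using \<open>arc \<beta>\<close> \<kappa>(1) sub by (auto intro!: path_continuous_image continuous_on_subset[OF \<theta>(1)] simp: arc_imp_path)
  have n: "0 \<notin> path_image (\<theta> \<circ> \<beta>)" "0 \<notin> path_image (\<theta> \<circ> \<kappa>)"
   using sub \<theta>(2) by (force simp: path_image_compose)+
  have "\<theta> \<circ> J = (\<theta> \<circ> \<beta>) +++ (\<theta> \<circ> \<kappa>)" unfolding J_def by (rule path_compose_join)
  hence "wind (\<theta> \<circ> J) = wind (\<theta> \<circ> \<beta>) + wind (\<theta> \<circ> \<kappa>)"
   using p n \<beta>ends \<kappa> by (simp add: winding_number_join pathfinish_compose pathstart_compose)
  moreover have "wind (\<theta> \<circ> \<kappa>) = 0"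
  proof (rule winding_number_const_on)
   fix t :: real assume "t \<in> {0..1}"
   hence "\<kappa> t \<in> path_image \<kappa>" by (simp add: path_image_def)
   hence "\<kappa> t \<in> sphere z0 r1" using \<kappa>(4) by blast
   hence "\<kappa> t \<notin> ball z0 r2" using r2(2) by auto
   thus "(\<theta> \<circ> \<kappa>) t = 1" using \<theta>(3) by simp
  qed
  ultimately show ?thesis by simp
 qed
 also have "wind (\<theta> \<circ> J) = 1"
 proof -
  have "path_image J \<subseteq> - {y, y'}" using yy(4,5) by blast
  thus ?thesis using \<theta>(4)[OF simple_path_imp_path[OF Js] Jl] yy(6) by simp
 qed
 finally have "wind (\<Theta> \<circ> c) = 1" unfolding q_def by (simp only: add_0_left add_0_right)
 moreover have "e y \<in> topspace X - c ` {0..1}" "e y' \<in> topspace X - c ` {0..1}"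
  using offc ysub yy chart_in_topspace[OF e(1)] by auto
 moreover have "e y \<noteq> e y'" using inj yy(3) by (auto simp: inj_def)
 ultimately show thesis using that[of "e y" "e y'" \<Theta>] P idx ti by simp
qed

end

section \<open>Components of the complement of a simple closed curve\<close>

context oriented_surface
begin

text \<open>Surfaces are locally connected: a chart disc in \<open>U\<close> around a point of a
  component is connected, hence contained in that component.\<close>

lemma component_open:
 assumes "openin X U" "x \<in> U"
 shows "openin X (connected_component_of_set (subtopology X U) x)"
  "connectedin X (connected_component_of_set (subtopology X U) x)"
  "x \<in> connected_component_of_set (subtopology X U) x"
  "connected_component_of_set (subtopology X U) x \<subseteq> U"
proof -
 have UX: "U \<subseteq> topspace X" using assms(1) by (rule openin_subset)
 have top: "topspace (subtopology X U) = U" using UX by auto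
 let ?N = "\<lambda>x. connected_component_of_set (subtopology X U) x"
 have cN: "connectedin (subtopology X U) (?N x)" for x by (rule connectedin_connected_component_of)
 thus "connectedin X (?N x)" by (simp add: connectedin_subtopology)
 show "x \<in> ?N x" using assms(2) top by (simp add: connected_component_of_refl)
 show sub: "?N x \<subseteq> U" using connected_component_of_subset_topspace[of "subtopology X U" x] top by auto
 show "openin X (?N x)"
 proof (subst openin_subopen, intro ballI)
  fix v assume v: "v \<in> ?N x"
  hence vU: "v \<in> U" using sub by blast
  then obtain e w where e: "e \<in> E" "v = e w" using in_range_chart UX by blast
  have "open (e -` U)" "w \<in> e -` U" using open_chart_vimage[OF e(1) assms(1)] vU e by auto
  then obtain r where r: "r > 0" "ball w r \<subseteq> e -` U" using open_contains_ball by blast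
  have "connectedin X (e ` ball w r)"
   by (rule connectedin_continuous_map_image[OF continuous_map_chart[OF e(1)]]) (simp add: convex_connected)
  hence "connectedin (subtopology X U) (e ` ball w r)" using r(2) by (auto simp: connectedin_subtopology)
  hence "e ` ball w r \<subseteq> ?N v" using e(2) r(1) by (intro connected_component_of_maximal) auto
  also have "?N v = ?N x" using v connected_component_of_equiv by (metis mem_Collect_eq)
  finally have "e ` ball w r \<subseteq> ?N x" .
  moreover have "openin X (e ` ball w r)" by (rule openin_chart_image[OF e(1)]) auto
  ultimately show "\<exists>T. openin X T \<and> v \<in> T \<and> T \<subseteq> ?N x"
   using e(2) r(1) by (intro exI[of _ "e ` ball w r"]) auto
 qed
qed

text \<open>The complement is the union of the remaining components, each of which is open; so a
  component can only accumulate at \<open>C\<close>.\<close>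

lemma component_closure:
 assumes "closedin X C" "x \<in> topspace X - C"
 shows "closedin X (connected_component_of_set (subtopology X (topspace X - C)) x \<union> C)"
proof -
 let ?U = "topspace X - C"
 let ?N = "\<lambda>x. connected_component_of_set (subtopology X ?U) x"
 have oU: "openin X ?U" using assms(1) by auto
 have "topspace X - (?N x \<union> C) = (\<Union>v\<in>?U - ?N x. ?N v)"
 proof (intro equalityI subsetI)
  fix v assume "v \<in> topspace X - (?N x \<union> C)"
  hence "v \<in> ?U - ?N x" by blast
  moreover from this have "v \<in> ?N v" using component_open(3)[OF oU, of v] by blast
  ultimately show "v \<in> (\<Union>v\<in>?U - ?N x. ?N v)" by blast
 next
  fix w assume "w \<in> (\<Union>v\<in>?U - ?N x. ?N v)"
  then obtain v where v: "v \<in> ?U" "v \<notin> ?N x" "w \<in> ?N v" by blast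
  hence "w \<in> ?U" using component_open(4)[OF oU v(1)] by blast
  moreover have "w \<notin> ?N x"
   using v(2,3) by (metis connected_component_of_sym connected_component_of_trans mem_Collect_eq)
  ultimately show "w \<in> topspace X - (?N x \<union> C)" by blast
 qed
 moreover have "openin X (\<Union>v\<in>?U - ?N x. ?N v)" using component_open(1)[OF oU] by blast
 moreover have "?N x \<union> C \<subseteq> topspace X" using component_open(4)[OF oU assms(2)] closedin_subset[OF assms(1)] by blast
 ultimately show ?thesis unfolding closedin_def by metis
qed

text \<open>Either the two charges next to the curve can be moved out of the compact set \<open>K\<close>, or one side
 of the curve is contained in \<open>K\<close>.\<close>

theorem simple_loop_obstruction:
 assumes c: "simple_loop c" and K: "compactin X K" "c ` {0..1} \<subseteq> K"
  and hom: "\<And>Q \<Theta>. punctured Q \<Theta> \<Longrightarrow> Q \<inter> K = {} \<Longrightarrow> wind (\<Theta> \<circ> c) \<noteq> 1"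
  and tw: "\<And>\<Theta>. path (\<Theta> \<circ> c) \<Longrightarrow> \<forall>t\<in>{0..1}. cmod (\<Theta> (c t)) = 1 \<Longrightarrow> wind (\<Theta> \<circ> c) = 1 \<Longrightarrow>
   \<exists>n m \<rho> s. local_system n \<rho> \<and> flat_section \<rho> (c ` {0..1}) s \<and> (\<forall>x\<in>c ` {0..1}. cmod (s x) = 1) \<and>
    (\<forall>x\<in>c ` {0..1}. s x ^ n = \<Theta> x ^ m) \<and> \<not> n dvd m"
 shows False
proof -
 define C where "C = c ` {0..1}"
 have cc: "continuous_map (top_of_set {0..1}) X c" using c by (simp add: simple_loop_def)
 have clC: "closedin X C" unfolding C_def by (rule closedin_path_piece(1)[OF cc]) auto
 obtain y y' \<Theta> where \<Theta>: "punctured {y, y'} \<Theta>" "y \<noteq> y'" "y \<in> topspace X - C" "y' \<in> topspace X - C"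
  "index \<Theta> y = 1" "index \<Theta> y' = -1" "wind (\<Theta> \<circ> c) = 1"
  using jump[OF c] unfolding C_def by metis
 have yX: "{y, y'} \<subseteq> topspace X" using \<Theta> by auto
 let ?U = "topspace X - C"
 define comp where "comp x = connected_component_of_set (subtopology X ?U) x" for x
 have oU: "openin X ?U" using clC by auto
 note co = component_open[OF oU, folded comp_def]
 have same: "wind (g \<circ> c) = 1" if "\<And>x. x \<in> C \<Longrightarrow> g x = \<Theta> x" for g
 proof -
  have "wind (g \<circ> c) = wind (\<Theta> \<circ> c)"
   by (rule winding_number_cong) (use that in \<open>auto simp: C_def\<close>)
  thus ?thesis using \<Theta>(7) by simp
 qed
 have csub: "C \<subseteq> topspace X - {y, y'}" using \<Theta>(3,4) closedin_subset[OF clC] by auto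
 have "path (\<Theta> \<circ> c)"
  by (rule chart_continuous_path[OF _ cc csub[unfolded C_def]]) (use \<Theta>(1) in \<open>auto simp: punctured_def\<close>)
 moreover have "\<forall>t\<in>{0..1}. cmod (\<Theta> (c t)) = 1" using \<Theta>(1) csub by (auto simp: punctured_def C_def)
 ultimately obtain n m \<rho> s where tws: "local_system n \<rho>" "flat_section \<rho> C s" "\<forall>x\<in>C. cmod (s x) = 1"
  "\<forall>x\<in>C. s x ^ n = \<Theta> x ^ m" "\<not> n dvd m"
  using tw[OF _ _ \<Theta>(7)] unfolding C_def by blast
 \<comment> \<open>A side contained in \<open>K\<close> would make \<open>comp v \<union> C\<close>
   compact, and \<open>compact_side\<close> then contradicts \<open>\<not> n dvd m\<close>. Either
   charge may be the one on the compact side, hence the two signs of its index.\<close>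
 have side: "\<not> comp v \<subseteq> K" if "{v, v'} = {y, y'}" "v' \<notin> comp v" for v v'
 proof
  assume sub: "comp v \<subseteq> K"
  have v: "v \<in> ?U" "v' \<in> ?U" using that(1) \<Theta>(3,4) by (metis insert_subset empty_subsetI insertCI subsetD)+
  have clo: "closedin X (comp v \<union> C)" using component_closure[OF clC v(1)] by (simp add: comp_def)
  have "comp v \<union> C \<subseteq> K" using sub K(2) by (auto simp: C_def)
  hence "compactin X (comp v \<union> C)" using closed_compactin[OF K(1)] clo by blast
  moreover have "punctured {v, v'} \<Theta>" using \<Theta>(1) that(1) by simp
  moreover have "index \<Theta> v \<in> {1, -1}" using that(1) \<Theta>(5,6) by (metis insertI1 insert_iff singletonD)
  moreover have "comp v \<inter> C = {}" using co(4)[OF v(1)] by blast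
  moreover have "v' \<in> topspace X - (comp v \<union> C)" using v(2) that(2) by blast
  ultimately have "n dvd m"
   by (intro compact_side[OF tws(1) clC tws(2,3) co(1)[OF v(1)] _ _ _ co(3)[OF v(1)] _ _ tws(4)])
  thus False using tws(5) by simp
 qed
 show False
 proof (cases "y' \<in> comp y")
  \<comment> \<open>If the charges lie on the same side, they are brought together; their indices
    cancel and the remaining puncture can be filled, leaving nothing that could meet
    \<open>K\<close>.\<close>
  case True
  obtain Q g where g: "punctured Q g" "Q \<subseteq> ({y, y'} - {y}) \<union> {y'}" "Q \<subseteq> topspace X"
   "(\<Sum>q\<in>Q. index g q) = (\<Sum>q\<in>{y, y'}. index \<Theta> q)" "\<And>x. x \<notin> comp y \<Longrightarrow> g x = \<Theta> x"
   using move_puncture[OF \<Theta>(1) yX co(1-3)[OF \<Theta>(3)] True] by metis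
  have Q: "Q \<subseteq> {y'}" using g(2) by auto
  have "index g y' = 0"
  proof (cases "y' \<in> Q")
   case True
   hence "Q = {y'}" using Q by auto
   thus ?thesis using g(4) \<Theta>(2,5,6) by simp
  qed (use punctured_index_0[OF g(1)] \<Theta>(4) in auto)
  then obtain g' where g': "punctured {} g'" "\<And>x. x \<notin> comp y \<Longrightarrow> g' x = g x"
   using fill_puncture[OF g(1) Q co(1)[OF \<Theta>(3)] True] by metis
  have "wind (g' \<circ> c) = 1"
  proof (rule same)
   fix x assume "x \<in> C"
   hence "x \<notin> comp y" using co(4)[OF \<Theta>(3)] by blast
   thus "g' x = \<Theta> x" using g(5) g'(2) by simp
  qed
  thus False using hom[OF g'(1)] by simp
 next
  case False
  hence F': "y \<notin> comp y'" unfolding comp_def by (simp add: connected_component_of_sym)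
  obtain z where z: "z \<in> comp y" "z \<notin> K" using side[of y y'] False by auto
  obtain z' where z': "z' \<in> comp y'" "z' \<notin> K" using side[of y' y] F' by auto
  obtain Q g where g: "punctured Q g" "Q \<subseteq> ({y, y'} - {y}) \<union> {z}" "Q \<subseteq> topspace X"
   "\<And>x. x \<notin> comp y \<Longrightarrow> g x = \<Theta> x"
   using move_puncture[OF \<Theta>(1) yX co(1-3)[OF \<Theta>(3)] z(1)] by metis
  obtain Q' g' where g': "punctured Q' g'" "Q' \<subseteq> (Q - {y'}) \<union> {z'}"
   "\<And>x. x \<notin> comp y' \<Longrightarrow> g' x = g x"
   using move_puncture[OF g(1,3) co(1-3)[OF \<Theta>(4)] z'(1)] by metis
  have "Q' \<subseteq> {z, z'}" using g(2) g'(2) by auto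
  hence "Q' \<inter> K = {}" using z z' by auto
  moreover have "wind (g' \<circ> c) = 1"
  proof (rule same)
   fix x assume "x \<in> C"
   hence "x \<notin> comp y" "x \<notin> comp y'" using co(4)[OF \<Theta>(3)] co(4)[OF \<Theta>(4)] by blast+
   thus "g' x = \<Theta> x" using g(4) g'(3) by simp
  qed
  ultimately show False using hom[OF g'(1)] by simp
 qed
qed

end

section \<open>Winding numbers of singular chains\<close>

definition chain_sum :: "('b \<Rightarrow> complex) \<Rightarrow> ('b \<Rightarrow>\<^sub>0 int) \<Rightarrow> complex" where
 "chain_sum \<phi> c = (\<Sum>x\<in>Poly_Mapping.keys c. of_int (Poly_Mapping.lookup c x) * \<phi> x)"

lemma chain_sum_add: "chain_sum \<phi> (a + b) = chain_sum \<phi> a + chain_sum \<phi> b"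
proof -
 let ?A = "Poly_Mapping.keys a \<union> Poly_Mapping.keys b"
 have *: "chain_sum \<phi> c = (\<Sum>x\<in>?A. of_int (Poly_Mapping.lookup c x) * \<phi> x)" if "Poly_Mapping.keys c \<subseteq> ?A" for c
  unfolding chain_sum_def by (rule sum.mono_neutral_left) (use that in \<open>auto simp: in_keys_iff\<close>)
 show ?thesis using *[OF keys_add] *[of a] *[of b] by (simp add: lookup_add distrib_right sum.distrib)
qed

lemma chain_sum_of [simp]: "chain_sum \<phi> (frag_of x) = \<phi> x" by (simp add: chain_sum_def)

lemma chain_sum_0 [simp]: "chain_sum \<phi> 0 = 0" by (simp add: chain_sum_def)

lemma chain_sum_diff: "chain_sum \<phi> (a - b) = chain_sum \<phi> a - chain_sum \<phi> b"
 using chain_sum_add[of \<phi> "a - b" b] by simp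

lemma chain_sum_minus: "chain_sum \<phi> (- a) = - chain_sum \<phi> a"
 using chain_sum_diff[of \<phi> 0 a] by simp

lemma chain_sum_cmul: "chain_sum \<phi> (frag_cmul k a) = of_int k * chain_sum \<phi> a"
proof (induction k rule: int_induct[where k = 0])
 case (step1 i)
 thus ?case by (simp add: frag_cmul_distrib chain_sum_add algebra_simps)
next
 case (step2 i)
 have "chain_sum \<phi> (frag_cmul i a) = chain_sum \<phi> (frag_cmul (i - 1) a) + chain_sum \<phi> a"
  using frag_cmul_distrib[of "i - 1" 1 a] by (simp add: chain_sum_add)
 thus ?case using step2 by (simp add: algebra_simps)
qed simp

definition bary1 :: "real \<Rightarrow> nat \<Rightarrow> real" where
 "bary1 t = (\<lambda>i. if i = 0 then 1 - t else if i = 1 then t else 0)"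

definition bary2 :: "real \<times> real \<Rightarrow> nat \<Rightarrow> real" where
 "bary2 w = (\<lambda>i. if i = 0 then 1 - fst w - snd w else if i = 1 then fst w else if i = 2 then snd w else 0)"

definition triangle_domain :: "(real \<times> real) set" where
 "triangle_domain = {w. 0 \<le> fst w \<and> 0 \<le> snd w \<and> fst w + snd w \<le> 1}"

lemma bary1_simplex: "t \<in> {0..1} \<Longrightarrow> bary1 t \<in> standard_simplex 1"
 by (auto simp: bary1_def standard_simplex_def)

lemma bary2_simplex: "w \<in> triangle_domain \<Longrightarrow> bary2 w \<in> standard_simplex 2"
 by (auto simp: bary2_def standard_simplex_def triangle_domain_def numeral_2_eq_2)

lemma continuous_bary:
 "continuous_map (top_of_set {0..1}) (subtopology (powertop_real UNIV) (standard_simplex 1)) bary1"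
 "continuous_map (top_of_set triangle_domain) (subtopology (powertop_real UNIV) (standard_simplex 2)) bary2"
proof -
 have "continuous_on {0..1} (\<lambda>t. bary1 t i)" for i
  by (cases "i = 0"; cases "i = 1") (auto simp: bary1_def intro!: continuous_intros)
 thus "continuous_map (top_of_set {0..1}) (subtopology (powertop_real UNIV) (standard_simplex 1)) bary1"
  using bary1_simplex by (auto simp: continuous_map_in_subtopology continuous_map_componentwise_UNIV)
 have "continuous_on triangle_domain (\<lambda>w. bary2 w i)" for i
  by (cases "i = 0"; cases "i = 1"; cases "i = 2") (auto simp: bary2_def intro!: continuous_intros)
 thus "continuous_map (top_of_set triangle_domain) (subtopology (powertop_real UNIV) (standard_simplex 2)) bary2"
  using bary2_simplex by (auto simp: continuous_map_in_subtopology continuous_map_componentwise_UNIV)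
qed

definition edge_path :: "((nat \<Rightarrow> real) \<Rightarrow> 'a) \<Rightarrow> real \<Rightarrow> 'a" where
 "edge_path f = f \<circ> bary1"

lemma edge_path:
 fixes f :: "(nat \<Rightarrow> real) \<Rightarrow> 'a::topological_space"
 assumes "singular_simplex 1 (top_of_set W) f"
 shows "path (edge_path f)" "path_image (edge_path f) \<subseteq> W"
proof -
 have "continuous_map (top_of_set {0..1}) (top_of_set W) (edge_path f)" unfolding edge_path_def
  by (rule continuous_map_compose[OF continuous_bary(1)]) (use assms in \<open>simp only: singular_simplex_def\<close>)
 thus "path (edge_path f)" "path_image (edge_path f) \<subseteq> W"
  by (auto simp: continuous_map_in_subtopology path_def path_image_def)
qed

text \<open>The winding number about \<open>z\<close>, extended linearly to singular chains. On
  cycles avoiding \<open>z\<close> it is the invariant that identifies the first homology of the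
  punctured plane with the integers: it vanishes on boundaries and is integral.\<close>

definition chain_winding :: "complex \<Rightarrow> complex chain \<Rightarrow> complex" where
 "chain_winding z = chain_sum (\<lambda>f. winding_number (edge_path f) z)"

lemmas chain_winding_linear = chain_sum_add[of "\<lambda>f. winding_number (edge_path f) z" for z, folded chain_winding_def]
 chain_sum_diff[of "\<lambda>f. winding_number (edge_path f) z" for z, folded chain_winding_def]
 chain_sum_cmul[of "\<lambda>f. winding_number (edge_path f) z" for z, folded chain_winding_def]
 chain_sum_minus[of "\<lambda>f. winding_number (edge_path f) z" for z, folded chain_winding_def]

lemma chain_winding_of [simp]: "chain_winding z (frag_of f) = winding_number (edge_path f) z"
 by (simp add: chain_winding_def)

lemma chain_winding_0 [simp]: "chain_winding z 0 = 0" by (simp add: chain_winding_def)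

lemma boundary_of_triangle:
 "chain_boundary 2 (frag_of f) = frag_of (singular_face 2 0 f) - frag_of (singular_face 2 1 f) + frag_of (singular_face 2 2 f)"
 by (simp add: chain_boundary_of numeral_2_eq_2)

lemma edge_path_face:
 assumes "t \<in> {0..1}"
 shows "edge_path (singular_face 2 0 f) t = f (bary2 (linepath (1, 0) (0, 1) t))"
  "edge_path (singular_face 2 1 f) t = f (bary2 (linepath (0, 0) (0, 1) t))"
  "edge_path (singular_face 2 2 f) t = f (bary2 (linepath (0, 0) (1, 0) t))"
proof -
 have b: "bary1 t \<in> standard_simplex 1" using bary1_simplex assms .
 have "simplical_face 0 (bary1 t) = bary2 (linepath (1, 0) (0, 1) t)"
  "simplical_face 1 (bary1 t) = bary2 (linepath (0, 0) (0, 1) t)"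
  "simplical_face 2 (bary1 t) = bary2 (linepath (0, 0) (1, 0) t)"
  by (auto simp: simplical_face_def bary1_def bary2_def linepath_def fun_eq_iff)
 thus "edge_path (singular_face 2 0 f) t = f (bary2 (linepath (1, 0) (0, 1) t))"
  "edge_path (singular_face 2 1 f) t = f (bary2 (linepath (0, 0) (0, 1) t))"
  "edge_path (singular_face 2 2 f) t = f (bary2 (linepath (0, 0) (1, 0) t))"
  using b by (simp_all add: edge_path_def singular_face_def)
qed

text \<open>The path along two edges is homotopic to the third edge within the image of the
  triangle, and this image avoids \<open>z\<close>.\<close>

lemma winding_triangle_boundary:
 assumes "singular_simplex 2 (top_of_set (- {z})) f"
 shows "chain_winding z (chain_boundary 2 (frag_of f)) = 0"
proof -
 define h where "h = f \<circ> bary2"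
 have "continuous_map (top_of_set triangle_domain) (top_of_set (- {z})) h" unfolding h_def
  by (rule continuous_map_compose[OF continuous_bary(2)]) (use assms in \<open>simp only: singular_simplex_def\<close>)
 hence h: "continuous_on triangle_domain h" "h ` triangle_domain \<subseteq> - {z}"
  by (auto simp: continuous_map_in_subtopology)
 have cv: "convex triangle_domain"
 proof -
  have "triangle_domain = {w. inner (-1, 0) w \<le> 0} \<inter> {w. inner (0, -1) w \<le> 0} \<inter> {w. inner (1, 1) w \<le> 1}"
   by (auto simp: triangle_domain_def inner_prod_def)
  thus ?thesis using convex_halfspace_le by (metis convex_Int)
 qed
 have mem: "(0, 0) \<in> triangle_domain" "(1, 0) \<in> triangle_domain" "(0, 1) \<in> triangle_domain"
  by (auto simp: triangle_domain_def)
 have seg: "path_image (linepath a b) \<subseteq> triangle_domain" if "a \<in> triangle_domain" "b \<in> triangle_domain" for a b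
  using that cv by (simp add: closed_segment_subset)
 have p: "path (seg h a b)" "z \<notin> path_image (seg h a b)"
  if "a \<in> triangle_domain" "b \<in> triangle_domain" for a b
 proof -
  show "path (seg h a b)"
   by (rule path_continuous_image[OF path_linepath continuous_on_subset[OF h(1) seg[OF that]]])
  show "z \<notin> path_image (seg h a b)" using h(2) seg[OF that] by (auto simp: path_image_compose)
 qed
 have "homotopic_paths (- {z}) (h \<circ> (linepath (0, 0) (1, 0) +++ linepath (1, 0) (0, 1))) (seg h (0, 0) (0, 1))"
  by (rule homotopic_paths_linear_image[OF h cv])
   (use mem seg in \<open>auto simp: subset_path_image_join simp del: path_image_linepath intro!: path_join_imp\<close>)
 hence "winding_number ((seg h (0, 0) (1, 0)) +++ (seg h (1, 0) (0, 1))) z = winding_number (seg h (0, 0) (0, 1)) z"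
  using winding_number_homotopic_paths by (simp add: path_compose_join)
 hence w1: "winding_number (seg h (0, 0) (1, 0)) z + winding_number (seg h (1, 0) (0, 1)) z = winding_number (seg h (0, 0) (0, 1)) z"
  using p mem by (simp add: winding_number_join pathfinish_compose pathstart_compose)
 have w2: "winding_number (edge_path (singular_face 2 0 f)) z = winding_number (seg h (1, 0) (0, 1)) z"
  "winding_number (edge_path (singular_face 2 1 f)) z = winding_number (seg h (0, 0) (0, 1)) z"
  "winding_number (edge_path (singular_face 2 2 f)) z = winding_number (seg h (0, 0) (1, 0)) z"
  by (rule winding_number_cong, simp add: edge_path_face h_def del: One_nat_def)+
 show ?thesis unfolding boundary_of_triangle chain_winding_linear chain_winding_of w2 w1[symmetric] by simp
qed

lemma chain_winding_boundary:
 assumes "singular_chain 2 (top_of_set (- {z})) c"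
 shows "chain_winding z (chain_boundary 2 c) = 0" using assms unfolding singular_chain_def
proof (induction c rule: frag_induction)
 case (one x)
 thus ?case using winding_triangle_boundary by simp
qed (simp_all add: chain_boundary_diff chain_winding_linear)

text \<open>Modulo integers, the winding number of an edge is a difference of logarithms.\<close>

lemma chain_winding_cycle_Ints:
 assumes "singular_chain 1 (top_of_set (- {z})) c" "chain_boundary 1 c = 0"
 shows "chain_winding z c \<in> \<int>"
proof -
 \<comment> \<open>\<open>v\<close> adds up principal logarithms over the vertices, so the
   correction term is a function of the chain boundary and disappears for a cycle.\<close>
 define v where "v = chain_sum (\<lambda>g::(nat \<Rightarrow> real) \<Rightarrow> complex. Ln (g (\<lambda>j. if j = 0 then 1 else 0) - z))"
 have "chain_winding z c - v (chain_boundary 1 c) / (2 * pi * \<i>) \<in> \<int>"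
  using assms(1) unfolding singular_chain_def
 proof (induction c rule: frag_induction)
  case zero
  thus ?case by (simp add: v_def)
 next
  case (one f)
  hence f: "singular_simplex 1 (top_of_set (- {z})) f" by simp
  let ?p = "edge_path f"
  have p: "path ?p" "z \<notin> path_image ?p" using edge_path[OF f] by auto
  obtain q where q: "path q" "pathfinish q - pathstart q = 2 * of_real pi * \<i> * winding_number ?p z"
   "\<And>t. t \<in> {0..1} \<Longrightarrow> ?p t = z + exp (q t)" using winding_number_as_continuous_log[OF p] by blast
  have pt: "simplical_face 0 (\<lambda>j. if j = 0 then 1 else 0) = bary1 1" "simplical_face 1 (\<lambda>j. if j = 0 then 1 else 0) = bary1 0"
   by (auto simp: simplical_face_def bary1_def fun_eq_iff)
  have b0: "(\<lambda>j. if j = 0 then 1 else 0) \<in> standard_simplex 0" by simp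
  have vb: "v (chain_boundary 1 (frag_of f)) = Ln (?p 1 - z) - Ln (?p 0 - z)"
   using b0 pt by (simp add: chain_boundary_of v_def chain_sum_diff singular_face_def edge_path_def)
  have "\<exists>n. q t = Ln (?p t - z) + of_int (2 * n) * pi * \<i>" if "t \<in> {0..1}" for t
  proof -
   have "exp (q t) = exp (Ln (?p t - z))" using q(3)[OF that] by (simp add: exp_Ln)
   thus ?thesis by (simp add: exp_eq)
  qed
  then obtain n m where "q 1 = Ln (?p 1 - z) + of_int (2 * n) * pi * \<i>" "q 0 = Ln (?p 0 - z) + of_int (2 * m) * pi * \<i>"
   by (metis atLeastAtMost_iff order_refl zero_le_one)
  hence "2 * of_real pi * \<i> * winding_number ?p z = v (chain_boundary 1 (frag_of f)) + of_int (n - m) * (2 * pi * \<i>)"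
  proof -
   have "2 * of_real pi * \<i> * winding_number ?p z = q 1 - q 0"
    using q(2) by (simp add: pathfinish_def pathstart_def)
   also have "\<dots> = (Ln (?p 1 - z) - Ln (?p 0 - z)) + of_int (n - m) * (2 * pi * \<i>)"
    unfolding \<open>q 1 = _\<close> \<open>q 0 = _\<close> by (simp add: algebra_simps)
   finally show ?thesis using vb by simp
  qed
  hence "chain_winding z (frag_of f) - v (chain_boundary 1 (frag_of f)) / (2 * pi * \<i>) = of_int (n - m)"
   by (simp add: field_simps)
  thus ?case by (metis Ints_of_int)
 next
  case (diff a b)
  have "chain_winding z (a - b) - v (chain_boundary 1 (a - b)) / (2 * pi * \<i>) =
   (chain_winding z a - v (chain_boundary 1 a) / (2 * pi * \<i>)) - (chain_winding z b - v (chain_boundary 1 b) / (2 * pi * \<i>))"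
   by (simp add: chain_winding_linear chain_boundary_diff v_def chain_sum_diff diff_divide_distrib)
  thus ?case using diff Ints_diff by metis
 qed
 thus ?thesis using assms(2) by (simp add: v_def)
qed

text \<open>The winding number of each edge is continuous in the point off the edge; this is what
  makes orientation degrees locally constant.\<close>

lemma chain_winding_continuous:
 assumes "singular_chain 1 (top_of_set (- D)) c"
 shows "continuous_on D (\<lambda>z. chain_winding z c)" unfolding chain_winding_def chain_sum_def
proof (intro continuous_intros)
 fix f assume "f \<in> Poly_Mapping.keys c"
 hence "singular_simplex 1 (top_of_set (- D)) f" using assms by (auto simp: singular_chain_def)
 from edge_path[OF this] show "continuous_on D (winding_number (edge_path f))"
  by (intro continuous_on_subset[OF continuous_on_winding_number]) auto
qed

text \<open>The affine triangle with vertices \<open>z + r(-1 - \<i>)\<close>, \<open>z + r(2 - \<i>)\<close>, \<open>z + r(-1 + 2\<i>)\<close>.\<close>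

definition triangle_simplex :: "complex \<Rightarrow> real \<Rightarrow> (nat \<Rightarrow> real) \<Rightarrow> complex" where
 "triangle_simplex z r = restrict (\<lambda>x. z + of_real r * Complex (3 * x 1 - 1) (3 * x 2 - 1)) (standard_simplex 2)"

definition triangle_loop :: "complex \<Rightarrow> real \<Rightarrow> real \<Rightarrow> complex" where
 "triangle_loop z r = linepath (z + of_real r * Complex (-1) (-1)) (z + of_real r * Complex 2 (-1)) +++
  linepath (z + of_real r * Complex 2 (-1)) (z + of_real r * Complex (-1) 2) +++
  linepath (z + of_real r * Complex (-1) 2) (z + of_real r * Complex (-1) (-1))"

lemma simplex2_coords:
 assumes "x \<in> standard_simplex 2"
 shows "0 \<le> x 0" "0 \<le> x 1" "0 \<le> x 2" "x 0 + x 1 + x 2 = 1"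
 using assms by (auto simp: standard_simplex_def numeral_2_eq_2)

lemma triangle_simplex_in:
 assumes "r > 0" "x \<in> standard_simplex 2"
 shows "triangle_simplex z r x \<in> cball z (4 * r)"
proof -
 have "cmod (Complex (3 * x 1 - 1) (3 * x 2 - 1)) \<le> \<bar>3 * x 1 - 1\<bar> + \<bar>3 * x 2 - 1\<bar>"
  using cmod_le[of "Complex (3 * x 1 - 1) (3 * x 2 - 1)"] by simp
 also have "\<dots> \<le> 4" using simplex2_coords[OF assms(2)] by linarith
 finally have "r * cmod (Complex (3 * x 1 - 1) (3 * x 2 - 1)) \<le> r * 4" using assms(1) by (intro mult_left_mono) auto
 thus ?thesis using assms by (simp add: triangle_simplex_def dist_norm norm_mult)
qed

lemma singular_triangle_simplex:
 assumes "r > 0" "cball z (4 * r) \<subseteq> W"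
 shows "singular_simplex 2 (top_of_set W) (triangle_simplex z r)" unfolding singular_simplex_def
proof
 let ?S = "subtopology (powertop_real UNIV) (standard_simplex 2)"
 have proj: "continuous_map ?S euclideanreal (\<lambda>x. x i)" for i
  by (intro continuous_map_from_subtopology continuous_map_product_projection) auto
 have "continuous_map ?S euclidean (\<lambda>x. z + of_real r * Complex (3 * x 1 - 1) (3 * x 2 - 1))"
 proof -
  let ?g = "\<lambda>w::real \<times> real. z + of_real r * Complex (3 * fst w - 1) (3 * snd w - 1)"
  have "continuous_on UNIV ?g" unfolding Complex_eq by (intro continuous_intros)
  hence "continuous_map (prod_topology euclideanreal euclideanreal) euclidean ?g" by simp
  moreover have "continuous_map ?S (prod_topology euclideanreal euclideanreal) (\<lambda>x. (x 1, x 2))"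
   using proj unfolding continuous_map_paired by blast
  ultimately show ?thesis using continuous_map_compose[of ?S _ "\<lambda>x. (x 1, x 2)" euclidean ?g] by (simp add: o_def)
 qed
 hence "continuous_map ?S euclidean (triangle_simplex z r)"
  by (rule continuous_map_eq) (auto simp: triangle_simplex_def)
 moreover have "triangle_simplex z r x \<in> W" if "x \<in> standard_simplex 2" for x
  using triangle_simplex_in[OF assms(1) that] assms(2) by blast
 ultimately show "continuous_map ?S (top_of_set W) (triangle_simplex z r)"
  by (auto simp: continuous_map_in_subtopology)
qed (simp add: triangle_simplex_def)

text \<open>\<open>z\<close> is the barycentre, and the nearest side, on the line
  \<open>x + y = 1\<close> in units of \<open>r\<close>, has distance \<open>r / sqrt 2\<close> from
  it; so the triangle contains \<open>ball z (r/2)\<close>.\<close>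

lemma triangle_loop_winding:
 assumes "r > 0" "w \<in> ball z (r/2)"
 shows "winding_number (triangle_loop z r) w = 1" "w \<notin> path_image (triangle_loop z r)"
  "path (triangle_loop z r)" "pathfinish (triangle_loop z r) = pathstart (triangle_loop z r)"
proof -
 define a b c where "a = z + of_real r * Complex (-1) (-1)" and "b = z + of_real r * Complex 2 (-1)"
  and "c = z + of_real r * Complex (-1) 2"
 have loop: "triangle_loop z r = linepath a b +++ linepath b c +++ linepath c a"
  by (simp add: triangle_loop_def a_def b_def c_def)
 have sub: "ball z (r/2) \<subseteq> convex hull {a, b, c}"
 proof
  fix v assume v: "v \<in> ball z (r/2)"
  define x y where "x = Re (v - z) / r" and "y = Im (v - z) / r"
  have "\<bar>Re (v - z)\<bar> \<le> r/2" "\<bar>Im (v - z)\<bar> \<le> r/2"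
   using v abs_Re_le_cmod[of "v - z"] abs_Im_le_cmod[of "v - z"] by (auto simp: dist_norm norm_minus_commute)
  hence xy: "\<bar>x\<bar> \<le> 1/2" "\<bar>y\<bar> \<le> 1/2" using assms(1) by (auto simp: x_def y_def abs_divide field_simps)
  have "v = ((1 - x - y) / 3) *\<^sub>R a + ((x + 1) / 3) *\<^sub>R b + ((y + 1) / 3) *\<^sub>R c"
   using assms(1) by (simp add: complex_eq_iff a_def b_def c_def x_def y_def field_simps)
  moreover have "0 \<le> (1 - x - y) / 3" "0 \<le> (x + 1) / 3" "0 \<le> (y + 1) / 3"
   "(1 - x - y) / 3 + (x + 1) / 3 + (y + 1) / 3 = 1" using xy by (auto simp: field_simps)
  ultimately show "v \<in> convex hull {a, b, c}" unfolding convex_hull_3 by blast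
 qed
 have int: "w \<in> interior (convex hull {a, b, c})" using interior_maximal[OF sub] assms(2) by auto
 have "\<bar>Im (w - z)\<bar> \<le> cmod (w - z)" by (rule abs_Im_le_cmod)
 hence im: "Im (w - z) > - r" using assms by (auto simp: dist_norm norm_minus_commute)
 have "Im ((b - a) * cnj (b - w)) = 3 * r * (Im (w - z) + r)" by (simp add: a_def b_def algebra_simps)
 moreover have "3 * r * (Im (w - z) + r) > 0" using im assms(1) by (intro mult_pos_pos) auto
 \<comment> \<open>This sign is the test for a counterclockwise triangle and decides between
   \<open>1\<close> and \<open>-1\<close>.\<close>
 ultimately have pos: "0 < Im ((b - a) * cnj (b - w))" by metis
 show "winding_number (triangle_loop z r) w = 1"
  unfolding loop winding_number_triangle[OF int] using pos by auto
 have "path_image (triangle_loop z r) = closed_segment a b \<union> closed_segment b c \<union> closed_segment c a"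
  unfolding loop by (simp add: path_image_join Un_assoc)
 moreover have "frontier (convex hull {a, b, c}) = closed_segment a b \<union> closed_segment b c \<union> closed_segment c a"
  by (rule frontier_of_triangle) simp
 ultimately show "w \<notin> path_image (triangle_loop z r)" using int by (auto simp: frontier_def)
 show "path (triangle_loop z r)" "pathfinish (triangle_loop z r) = pathstart (triangle_loop z r)"
  unfolding loop by auto
qed

lemma triangle_loop_image:
 assumes "r > 0"
 shows "path_image (triangle_loop z r) \<subseteq> cball z (4 * r)"
proof -
 have m: "z + of_real r * Complex x y \<in> cball z (4 * r)" if "\<bar>x\<bar> + \<bar>y\<bar> \<le> 4" for x y
 proof -
  have "cmod (Complex x y) \<le> 4" using cmod_le[of "Complex x y"] that by simp
  hence "r * cmod (Complex x y) \<le> r * 4" using assms by (intro mult_left_mono) auto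
  thus ?thesis using assms by (simp add: dist_norm norm_mult)
 qed
 show ?thesis unfolding triangle_loop_def
  by (intro subset_path_image_join; unfold path_image_linepath; intro closed_segment_subset m convex_cball; simp)
qed

text \<open>The boundary of the simplex consists of the same three edges; the one from
  \<open>a\<close> to \<open>c\<close> enters with a minus sign, which turns it into the edge from
  \<open>c\<close> to \<open>a\<close> of the loop.\<close>

lemma triangle_boundary_winding:
 assumes "r > 0" "continuous_on (cball z (4 * r)) T" "u \<notin> T ` path_image (triangle_loop z r)"
 shows "chain_winding u (chain_boundary 2 (chain_map 2 T (frag_of (triangle_simplex z r)))) = winding_number (T \<circ> triangle_loop z r) u"
proof -
 define a b c where "a = z + of_real r * Complex (-1) (-1)" and "b = z + of_real r * Complex 2 (-1)"
  and "c = z + of_real r * Complex (-1) 2"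
 have loop: "triangle_loop z r = linepath a b +++ linepath b c +++ linepath c a"
  by (simp add: triangle_loop_def a_def b_def c_def)
 have img: "path_image (triangle_loop z r) = closed_segment a b \<union> closed_segment b c \<union> closed_segment c a"
  unfolding loop by (simp add: path_image_join Un_assoc)
 define f where "f = simplex_map 2 T (triangle_simplex z r)"
 have f: "f (bary2 (x, y)) = T (z + of_real r * Complex (3 * x - 1) (3 * y - 1))" if "(x, y) \<in> triangle_domain" for x y
  using bary2_simplex[OF that] unfolding f_def simplex_map_def triangle_simplex_def by (simp add: bary2_def)
 have faces: "edge_path (singular_face 2 0 f) t = (seg T b c) t"
  "edge_path (singular_face 2 1 f) t = (seg T a c) t"
  "edge_path (singular_face 2 2 f) t = (seg T a b) t" if "t \<in> {0..1}" for t
 proof -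
  have "(1 - t, t) \<in> triangle_domain" "(0, t) \<in> triangle_domain" "(t, 0) \<in> triangle_domain"
   using that by (auto simp: triangle_domain_def)
  note ff = f[OF this(1)] f[OF this(2)] f[OF this(3)]
  have l: "linepath (1, 0) (0, 1) t = (1 - t, t)" "linepath (0, 0) (0, 1) t = (0, t)" "linepath (0, 0) (1, 0) t = (t, 0)"
   by (auto simp: linepath_def)
  show "edge_path (singular_face 2 0 f) t = (seg T b c) t"
   unfolding edge_path_face(1)[OF that] l ff o_apply by (rule arg_cong[of _ _ T]) (simp add: linepath_def b_def c_def complex_eq_iff algebra_simps)
  show "edge_path (singular_face 2 1 f) t = (seg T a c) t"
   unfolding edge_path_face(2)[OF that] l ff o_apply by (rule arg_cong[of _ _ T]) (simp add: linepath_def a_def c_def complex_eq_iff algebra_simps)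
  show "edge_path (singular_face 2 2 f) t = (seg T a b) t"
   unfolding edge_path_face(3)[OF that] l ff o_apply by (rule arg_cong[of _ _ T]) (simp add: linepath_def b_def a_def complex_eq_iff algebra_simps)
 qed
 have seg: "closed_segment a b \<subseteq> cball z (4 * r)" "closed_segment b c \<subseteq> cball z (4 * r)" "closed_segment c a \<subseteq> cball z (4 * r)"
  using triangle_loop_image[OF assms(1), of z] img by auto
 have p: "path (seg T a b)" "path (seg T b c)" "path (seg T c a)"
  using seg by (auto intro!: path_continuous_image continuous_on_subset[OF assms(2)])
 have n: "u \<notin> path_image (seg T a b)" "u \<notin> path_image (seg T b c)" "u \<notin> path_image (seg T c a)"
  using assms(3) img by (auto simp: path_image_compose)
 have "reversepath (seg T c a) = seg T a c"
  by (auto simp: fun_eq_iff reversepath_def linepath_def add.commute)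
 hence "winding_number (seg T a c) u = - winding_number (seg T c a) u"
  using winding_number_reversepath[OF p(3) n(3)] by simp
 moreover have "winding_number (T \<circ> triangle_loop z r) u =
  winding_number (seg T a b) u + (winding_number (seg T b c) u + winding_number (seg T c a) u)"
  unfolding loop path_compose_join using p n
  by (simp add: winding_number_join not_in_path_image_join pathfinish_compose pathstart_compose)
 moreover have "winding_number (edge_path (singular_face 2 0 f)) u = winding_number (seg T b c) u"
  "winding_number (edge_path (singular_face 2 1 f)) u = winding_number (seg T a c) u"
  "winding_number (edge_path (singular_face 2 2 f)) u = winding_number (seg T a b) u"
  by (rule winding_number_cong, simp add: faces del: One_nat_def)+
 ultimately show ?thesis by (simp add: boundary_of_triangle chain_winding_linear flip: f_def)
qed

lemma triangle_simplex_center: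
 assumes "r > 0" "x \<in> standard_simplex 2" "triangle_simplex z r x = z"
 shows "x 0 = 1/3" "x 1 = 1/3" "x 2 = 1/3"
proof -
 have "Complex (3 * x 1 - 1) (3 * x 2 - 1) = 0" using assms by (simp add: triangle_simplex_def)
 thus "x 0 = 1/3" "x 1 = 1/3" "x 2 = 1/3" using simplex2_coords(4)[OF assms(2)] by (auto simp: complex_eq_iff)
qed

text \<open>The centre \<open>z\<close> has all barycentric coordinates equal to \<open>1/3\<close>,
  while on the face number \<open>k\<close> the coordinate \<open>k\<close> is \<open>0\<close>; so
  the boundary avoids \<open>z\<close>.\<close>

lemma triangle_relcycle:
 assumes "r > 0" "cball z (4 * r) \<subseteq> W"
 shows "singular_relcycle 2 (top_of_set W) (W - {z}) (frag_of (triangle_simplex z r))"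
proof -
 have s: "singular_simplex 2 (top_of_set W) (triangle_simplex z r)"
  by (rule singular_triangle_simplex[OF assms])
 have "singular_simplex 1 (subtopology (top_of_set W) (W - {z})) (singular_face 2 k (triangle_simplex z r))" if "k \<le> 2" for k
  unfolding singular_simplex_subtopology[of _ "top_of_set W"]
 proof
  show "singular_simplex 1 (top_of_set W) (singular_face 2 k (triangle_simplex z r))"
   using singular_simplex_singular_face[OF s _ that] by simp
  have "singular_face 2 k (triangle_simplex z r) x \<in> W - {z}" if x: "x \<in> standard_simplex 1" for x
  proof -
   have y: "simplical_face k x \<in> standard_simplex 2"
    using simplical_face_in_standard_simplex[of 2 k x] x \<open>k \<le> 2\<close> by simp
   have "simplical_face k x k = 0" by (simp add: simplical_face_def)
   have "triangle_simplex z r (simplical_face k x) \<noteq> z"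
   proof
    assume "triangle_simplex z r (simplical_face k x) = z"
    note c = triangle_simplex_center[OF assms(1) y this]
    have "k = 0 \<or> k = 1 \<or> k = 2" using \<open>k \<le> 2\<close> by linarith
    hence "simplical_face k x k = 1/3" using c by (elim disjE) (simp_all only:)
    thus False using \<open>simplical_face k x k = 0\<close> by simp
   qed
   moreover have "triangle_simplex z r (simplical_face k x) \<in> W"
    using triangle_simplex_in[OF assms(1) y] assms(2) by blast
   ultimately show ?thesis using x by (simp add: singular_face_def)
  qed
  thus "singular_face 2 k (triangle_simplex z r) ` standard_simplex 1 \<subseteq> W - {z}" by (rule image_subsetI)
 qed
 hence "singular_chain 1 (subtopology (top_of_set W) (W - {z})) (chain_boundary 2 (frag_of (triangle_simplex z r)))"
  unfolding boundary_of_triangle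
  by (intro singular_chain_add singular_chain_diff) (simp_all add: singular_chain_of)
 thus ?thesis using s by (simp add: singular_relcycle singular_chain_of)
qed

text \<open>The difference is a boundary up to a chain avoiding \<open>z\<close>. The boundary of a
  boundary is \<open>0\<close>, and \<open>chain_winding_boundary\<close> disposes of the other
  part.\<close>

lemma chain_winding_homologous:
 assumes "homologous_rel 2 (top_of_set W) (W - {z}) k l"
 shows "chain_winding z (chain_boundary 2 k) = chain_winding z (chain_boundary 2 l)"
proof -
 obtain d where d: "singular_chain 3 (top_of_set W) d"
  "singular_chain 2 (subtopology (top_of_set W) (W - {z})) (chain_boundary 3 d - (k - l))"
  using assms unfolding homologous_rel_def singular_relboundary_def mod_subset_def by (auto simp: numeral_3_eq_3 numeral_2_eq_2)
 have "chain_boundary 2 (chain_boundary 3 d) = 0"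
  using chain_boundary_boundary_alt[of 2 "top_of_set W" d] d(1) by (simp add: numeral_3_eq_3 numeral_2_eq_2)
 moreover have "singular_chain 2 (top_of_set (- {z})) (chain_boundary 3 d - (k - l))"
 proof -
  have "subtopology (top_of_set W) (W - {z}) = subtopology euclidean (W - {z})"
   by (simp add: subtopology_subtopology Int_absorb1)
  thus ?thesis using d(2) singular_chain_mono[of 2 euclidean "W - {z}" _ "- {z}"] by auto
 qed
 from chain_winding_boundary[OF this]
 have "chain_winding z (chain_boundary 2 (chain_boundary 3 d)) - (chain_winding z (chain_boundary 2 k) - chain_winding z (chain_boundary 2 l)) = 0"
  by (simp add: chain_boundary_diff chain_winding_linear)
 ultimately show ?thesis by simp
qed

lemma relcycle_winding_Ints:
 assumes "singular_relcycle 2 (top_of_set W) (W - {z}) k"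
 shows "chain_winding z (chain_boundary 2 k) \<in> \<int>"
proof (rule chain_winding_cycle_Ints)
 have "subtopology (top_of_set W) (W - {z}) = subtopology euclidean (W - {z})"
  by (simp add: subtopology_subtopology Int_absorb1)
 thus "singular_chain 1 (top_of_set (- {z})) (chain_boundary 2 k)"
  using assms singular_chain_mono[of 1 euclidean "W - {z}" _ "- {z}"] by (auto simp: singular_relcycle)
 show "chain_boundary 1 (chain_boundary 2 k) = 0"
  using chain_boundary_boundary[of 2 "top_of_set W" k] assms by (simp add: singular_relcycle)
qed

subsection \<open>Homology classes as chains\<close>

lemma mult_homologous_rel_set:
 assumes "singular_relcycle p X S a" "singular_relcycle p X S b"
 shows "homologous_rel_set p X S a \<otimes>\<^bsub>relative_homology_group (int p) X S\<^esub> homologous_rel_set p X S b = homologous_rel_set p X S (a + b)"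
proof -
 interpret normal "singular_relboundary_set p X S" "relcycle_group p X S"
  by (rule normal_subgroup_singular_relboundary_relcycle)
 have "homologous_rel_set p X S c = singular_relboundary_set p X S #>\<^bsub>relcycle_group p X S\<^esub> c" for c
  using fun_cong[OF right_coset_singular_relboundary[of p X S], of c] by simp
 thus ?thesis using rcos_sum[of a b] assms by (simp add: relative_homology_group_def FactGroup_def)
qed

lemma pow_homologous_rel_set:
 assumes "singular_relcycle p X S a"
 shows "homologous_rel_set p X S a [^]\<^bsub>relative_homology_group (int p) X S\<^esub> (k::int) = homologous_rel_set p X S (frag_cmul k a)"
proof -
 let ?G = "relative_homology_group (int p) X S"
 interpret G: group ?G by simp
 have c: "homologous_rel_set p X S (frag_cmul k a) \<in> carrier ?G" for k
  unfolding carrier_relative_homology_group using singular_relcycle_cmul[OF assms] by (intro imageI) simp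
 have "(\<lambda>k. homologous_rel_set p X S (frag_cmul k a)) \<in> hom integer_group ?G"
  using c mult_homologous_rel_set[OF singular_relcycle_cmul[OF assms] singular_relcycle_cmul[OF assms]]
  by (auto simp: hom_def frag_cmul_distrib)
 then interpret h: group_hom integer_group ?G "\<lambda>k. homologous_rel_set p X S (frag_cmul k a)"
  by (intro group_hom.intro group_hom_axioms.intro group_integer_group G.is_group)
 have "(\<lambda>k. homologous_rel_set p X S (frag_cmul k a)) (1 [^]\<^bsub>integer_group\<^esub> k) = homologous_rel_set p X S (frag_cmul 1 a) [^]\<^bsub>?G\<^esub> k"
  by (rule h.hom_int_pow) simp
 thus ?thesis by simp
qed

subsection \<open>The degree of a chart\<close>

definition open_embedding :: "complex set \<Rightarrow> (complex \<Rightarrow> 'a::topological_space) \<Rightarrow> 'a set \<Rightarrow> bool" where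
 "open_embedding W e N \<longleftrightarrow> open W \<and> continuous_on W e \<and> inj_on e W \<and> e ` W \<subseteq> N \<and>
  (\<forall>V. open V \<longrightarrow> V \<subseteq> W \<longrightarrow> openin (top_of_set N) (e ` V))"

lemma open_embedding_subset:
 "open_embedding W e N \<Longrightarrow> open V \<Longrightarrow> V \<subseteq> W \<Longrightarrow> open_embedding V e N"
 unfolding open_embedding_def by (meson continuous_on_subset inj_on_subset image_mono order_trans)

text \<open>A homeomorphism onto the image followed by excision of the rest of \<open>N\<close>.
  Excision applies because \<open>e\<close> maps \<open>W\<close> to an open set and the compact
  \<open>K\<close> to a closed one.\<close>

lemma open_embedding_homology_iso:
 assumes e: "open_embedding W e N" and N: "Hausdorff_space (top_of_set N)" and K: "compact K" "K \<subseteq> W"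
 shows "hom_induced p (top_of_set W) (W - K) (top_of_set N) (N - e ` K) e
  \<in> Group.iso (relative_homology_group p (top_of_set W) (W - K)) (relative_homology_group p (top_of_set N) (N - e ` K))"
proof -
 have W: "open W" "continuous_on W e" "inj_on e W" "e ` W \<subseteq> N" and op: "\<And>V. open V \<Longrightarrow> V \<subseteq> W \<Longrightarrow> openin (top_of_set N) (e ` V)"
  using e by (auto simp: open_embedding_def)
 let ?X = "top_of_set N" and ?T = "N - e ` K" and ?U = "N - e ` W"
 have eK: "closedin ?X (e ` K)"
 proof (rule compactin_imp_closedin[OF N])
  have "compact (e ` K)" using K W(2) by (meson compact_continuous_image continuous_on_subset)
  thus "compactin ?X (e ` K)" using K W(4) by (auto simp: compactin_subtopology)
 qed
 have homeo: "homeomorphic_map (top_of_set W) (top_of_set (e ` W)) e"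
 proof (rule bijective_open_imp_homeomorphic_map)
  show "continuous_map (top_of_set W) (top_of_set (e ` W)) e"
   using W(2) by (auto simp: continuous_map_in_subtopology)
  show "open_map (top_of_set W) (top_of_set (e ` W)) e" unfolding open_map_def
  proof (intro allI impI)
   fix U assume "openin (top_of_set W) U"
   hence "open U" "U \<subseteq> W" using W(1) by (auto simp: openin_open_eq)
   hence "openin ?X (e ` U)" "e ` U \<subseteq> e ` W" using op by auto
   thus "openin (top_of_set (e ` W)) (e ` U)" using W(4) by (meson openin_subset_trans)
  qed
 qed (use W in auto)
 have i1: "hom_induced p (top_of_set W) (W - K) (top_of_set (e ` W)) (e ` W - e ` K) e
  \<in> Group.iso (relative_homology_group p (top_of_set W) (W - K)) (relative_homology_group p (top_of_set (e ` W)) (e ` W - e ` K))"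
  using K(2) W(3) by (intro homeomorphic_map_relative_homology_iso[OF homeo]) (auto simp: inj_on_image_set_diff)
 have "?X closure_of ?U = ?U"
  by (rule closure_of_closedin) (use op[OF W(1)] in \<open>auto simp: closedin_def double_diff[OF W(4)]\<close>)
 moreover have "?X interior_of ?T = ?T"
  by (rule interior_of_openin) (use eK in \<open>auto simp: closedin_def\<close>)
 moreover have "?U \<subseteq> ?T" using K(2) by auto
 ultimately have "?X closure_of ?U \<subseteq> ?X interior_of ?T" by simp
 from homology_excision_axiom[OF this, of N p]
 have i2: "hom_induced p (subtopology ?X (N - ?U)) (?T - ?U) (subtopology ?X N) ?T id
  \<in> Group.iso (relative_homology_group p (subtopology ?X (N - ?U)) (?T - ?U)) (relative_homology_group p (subtopology ?X N) ?T)" by auto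
 have eqs: "N - ?U = e ` W" "?T - ?U = e ` W - e ` K" using W(4) by auto
 have eqs2: "subtopology ?X (e ` W) = top_of_set (e ` W)" "subtopology ?X N = ?X"
  using W(4) by (simp_all add: subtopology_subtopology Int_absorb1)
 have i2: "hom_induced p (top_of_set (e ` W)) (e ` W - e ` K) ?X ?T id
  \<in> Group.iso (relative_homology_group p (top_of_set (e ` W)) (e ` W - e ` K)) (relative_homology_group p ?X ?T)"
  using i2 unfolding eqs eqs2 .
 have "hom_induced p (top_of_set W) (W - K) ?X ?T (id \<circ> e) =
  hom_induced p (top_of_set (e ` W)) (e ` W - e ` K) ?X ?T id \<circ> hom_induced p (top_of_set W) (W - K) (top_of_set (e ` W)) (e ` W - e ` K) e"
 proof (rule hom_induced_compose)
  show "continuous_map (top_of_set W) (top_of_set (e ` W)) e" using W(2) by (auto simp: continuous_map_in_subtopology)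
  show "e \<in> (W - K) \<rightarrow> e ` W - e ` K" using W(3) K(2) by (auto simp: inj_on_def subset_iff)
  show "continuous_map (top_of_set (e ` W)) ?X id" using W(4) by (auto simp: continuous_map_in_subtopology)
 qed (use W(4) in auto)
 thus ?thesis using iso_set_trans[OF i1 i2] by simp
qed

lemma homology_class_in_chart:
 assumes e: "open_embedding W e N" and N: "Hausdorff_space (top_of_set N)" and K: "compact K" "K \<subseteq> W"
  and \<kappa>: "\<kappa> \<in> carrier (relative_homology_group (int p) (top_of_set N) (N - e ` K))"
 obtains k where "singular_relcycle p (top_of_set W) (W - K) k"
  "homologous_rel_set p (top_of_set N) (N - e ` K) (chain_map p e k) = \<kappa>"
proof -
 have cm: "continuous_map (top_of_set W) (top_of_set N) e" "e \<in> (W - K) \<rightarrow> N - e ` K"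
  using e K by (auto simp: open_embedding_def continuous_map_in_subtopology inj_on_def subset_iff)
 let ?h = "hom_induced (int p) (top_of_set W) (W - K) (top_of_set N) (N - e ` K) e"
 let ?A = "relative_homology_group (int p) (top_of_set W) (W - K)"
 have "\<kappa> \<in> ?h ` carrier ?A"
  using open_embedding_homology_iso[OF e N K, of "int p"] \<kappa> by (simp add: iso_def bij_betw_def)
 then obtain k where k: "singular_relcycle p (top_of_set W) (W - K) k"
  "\<kappa> = ?h (homologous_rel_set p (top_of_set W) (W - K) k)"
  unfolding carrier_relative_homology_group by blast
 show thesis by (rule that[OF k(1)]) (simp add: k(2) hom_induced_chain_map[OF cm k(1)])
qed

lemma homologous_in_chart:
 assumes e: "open_embedding W e N" and N: "Hausdorff_space (top_of_set N)" and K: "compact K" "K \<subseteq> W"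
  and kl: "singular_relcycle p (top_of_set W) (W - K) k" "singular_relcycle p (top_of_set W) (W - K) l"
  and eq: "homologous_rel_set p (top_of_set N) (N - e ` K) (chain_map p e k) = homologous_rel_set p (top_of_set N) (N - e ` K) (chain_map p e l)"
 shows "homologous_rel p (top_of_set W) (W - K) k l"
proof -
 have cm: "continuous_map (top_of_set W) (top_of_set N) e" "e \<in> (W - K) \<rightarrow> N - e ` K"
  using e K by (auto simp: open_embedding_def continuous_map_in_subtopology inj_on_def subset_iff)
 have "inj_on (hom_induced (int p) (top_of_set W) (W - K) (top_of_set N) (N - e ` K) e) (carrier (relative_homology_group (int p) (top_of_set W) (W - K)))"
  using open_embedding_homology_iso[OF e N K, of "int p"] by (simp add: iso_def bij_betw_def)
 hence "homologous_rel_set p (top_of_set W) (W - K) k = homologous_rel_set p (top_of_set W) (W - K) l"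
  by (rule inj_onD) (use kl eq hom_induced_chain_map[OF cm] in \<open>auto simp: carrier_relative_homology_group\<close>)
 thus ?thesis by (simp add: homologous_rel_set_eq)
qed

text \<open>The local generator is pulled back to a relative cycle in the chart domain and measured
  by the winding of its boundary around \<open>w\<close>; \<open>s\<close> is the sign with which
  the chart respects \<open>\<mu>\<close>. It is a relation because existence and uniqueness of the
  value rest on the excision isomorphism.\<close>

definition chart_degree :: "'a::topological_space set \<Rightarrow> ('a \<Rightarrow> 'a chain set) \<Rightarrow> complex set \<Rightarrow> (complex \<Rightarrow> 'a) \<Rightarrow> complex \<Rightarrow> complex \<Rightarrow> bool" where
 "chart_degree N \<mu> W e w s \<longleftrightarrow> (\<exists>k. singular_relcycle 2 (top_of_set W) (W - {w}) k \<and>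
  homologous_rel_set 2 (top_of_set N) (N - {e w}) (chain_map 2 e k) = \<mu> (e w) \<and>
  chain_winding w (chain_boundary 2 k) = s)"

lemma singular_relcycle_top_mono:
 assumes "singular_relcycle p (top_of_set V) (V - K) k" "V \<subseteq> W" "L \<subseteq> K"
 shows "singular_relcycle p (top_of_set W) (W - L) k"
proof -
 have "subtopology (top_of_set V) (V - K) = subtopology euclidean (V - K)"
  "subtopology (top_of_set W) (W - L) = subtopology euclidean (W - L)"
  by (simp_all add: subtopology_subtopology Int_absorb1)
 thus ?thesis
  using assms singular_chain_mono[of p euclidean V k W] singular_chain_mono[of "p - 1" euclidean "V - K" "chain_boundary p k" "W - L"]
  unfolding singular_relcycle by (metis Diff_mono)
qed

lemma open_embedding_inverse_continuous:
 assumes "open_embedding W e M'"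
 shows "continuous_on (e ` W) (inv_into W e)"
proof (rule continuous_on_inverse_open_map[of W e])
 show "continuous_on W e" "e ` W = e ` W" using assms by (auto simp: open_embedding_def)
 show "inv_into W e (e x) = x" if "x \<in> W" for x using assms that by (simp add: open_embedding_def)
 fix U assume "openin (top_of_set W) U"
 hence "open U" "U \<subseteq> W" using assms by (auto simp: openin_open_eq open_embedding_def)
 hence "openin (top_of_set M') (e ` U)" "e ` U \<subseteq> e ` W" "e ` W \<subseteq> M'" using assms by (auto simp: open_embedding_def)
 thus "openin (top_of_set (e ` W)) (e ` U)" by (meson openin_subset_trans)
qed

context
 fixes N :: "'a::topological_space set" and \<mu> :: "'a \<Rightarrow> 'a chain set"
 assumes N: "Hausdorff_space (top_of_set N)" and \<mu>: "local_orientation N \<mu>"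
begin

lemma chart_degree_unique:
 assumes e: "open_embedding W e N" "w \<in> W" and st: "chart_degree N \<mu> W e w s" "chart_degree N \<mu> W e w t"
 shows "s = t"
proof -
 obtain k where k: "singular_relcycle 2 (top_of_set W) (W - {w}) k"
  "homologous_rel_set 2 (top_of_set N) (N - {e w}) (chain_map 2 e k) = \<mu> (e w)" "chain_winding w (chain_boundary 2 k) = s"
  using st(1) unfolding chart_degree_def by blast
 obtain l where l: "singular_relcycle 2 (top_of_set W) (W - {w}) l"
  "homologous_rel_set 2 (top_of_set N) (N - {e w}) (chain_map 2 e l) = \<mu> (e w)" "chain_winding w (chain_boundary 2 l) = t"
  using st(2) unfolding chart_degree_def by blast
 have "homologous_rel 2 (top_of_set W) (W - {w}) k l"
  by (rule homologous_in_chart[OF e(1) N, of "{w}"]) (use k l e(2) in auto)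
 from chain_winding_homologous[OF this] show ?thesis using k(3) l(3) by simp
qed

lemma orientation_carrier:
 assumes "y \<in> N"
 shows "\<mu> y \<in> carrier (relative_homology_group (int 2) (top_of_set N) (N - {y}))"
  "generate (relative_homology_group (int 2) (top_of_set N) (N - {y})) {\<mu> y}
   = carrier (relative_homology_group (int 2) (top_of_set N) (N - {y}))"
 using \<mu> assms unfolding local_orientation_def by auto

text \<open>As \<open>\<mu> (e w)\<close> generates, the class of a small triangle is a multiple
  \<open>n\<close> of it. The triangle has boundary winding \<open>1\<close>, so the boundary
  winding of a cycle \<open>k\<close> representing \<open>\<mu> (e w)\<close> is invertible.\<close>

lemma triangle_class:
 assumes e: "open_embedding W e N" "w \<in> W" and r: "r > 0" "cball w (4 * r) \<subseteq> W"
  and k: "singular_relcycle 2 (top_of_set W) (W - {w}) k"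
   "homologous_rel_set 2 (top_of_set N) (N - {e w}) (chain_map 2 e k) = \<mu> (e w)"
 obtains n where "homologous_rel_set 2 (top_of_set N) (N - {e w}) (chain_map 2 e (frag_of (triangle_simplex w r)))
   = homologous_rel_set 2 (top_of_set N) (N - {e w}) (chain_map 2 e (frag_cmul n k))"
  "of_int n * chain_winding w (chain_boundary 2 k) = 1"
proof -
 let ?G = "relative_homology_group (int 2) (top_of_set N) (N - {e w})"
 let ?c = "homologous_rel_set 2 (top_of_set N) (N - {e w})"
 let ?t = "frag_of (triangle_simplex w r)"
 interpret G: group ?G by simp
 have yN: "e w \<in> N" using e by (auto simp: open_embedding_def)
 have cm: "continuous_map (top_of_set W) (top_of_set N) e" "e \<in> (W - {w}) \<rightarrow> N - {e w}"
  using e by (auto simp: open_embedding_def continuous_map_in_subtopology inj_on_def)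
 have t: "singular_relcycle 2 (top_of_set W) (W - {w}) ?t" by (rule triangle_relcycle[OF r])
 have et: "singular_relcycle 2 (top_of_set N) (N - {e w}) (chain_map 2 e ?t)"
  and ek: "singular_relcycle 2 (top_of_set N) (N - {e w}) (chain_map 2 e k)"
  using singular_relcycle_chain_map cm t k(1) by blast+
 have "?c (chain_map 2 e ?t) \<in> carrier ?G" unfolding carrier_relative_homology_group using et by blast
 hence "?c (chain_map 2 e ?t) \<in> generate ?G {\<mu> (e w)}" by (simp only: orientation_carrier(2)[OF yN])
 then obtain n :: int where "?c (chain_map 2 e ?t) = \<mu> (e w) [^]\<^bsub>?G\<^esub> n"
  unfolding G.generate_pow[OF orientation_carrier(1)[OF yN]] by blast
 also have "\<dots> = ?c (chain_map 2 e (frag_cmul n k))"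
  using pow_homologous_rel_set[OF ek, of n] k(2) by simp
 finally have eq: "?c (chain_map 2 e ?t) = ?c (chain_map 2 e (frag_cmul n k))" .
 have "homologous_rel 2 (top_of_set W) (W - {w}) ?t (frag_cmul n k)"
  by (rule homologous_in_chart[OF e(1) N, of "{w}"]) (use e(2) t singular_relcycle_cmul[OF k(1)] eq in auto)
 from chain_winding_homologous[OF this]
 have "chain_winding w (chain_boundary 2 ?t) = of_int n * chain_winding w (chain_boundary 2 k)"
  by (simp add: chain_boundary_cmul chain_winding_linear)
 moreover have "chain_winding w (chain_boundary 2 ?t) = 1"
 proof -
  have w: "w \<in> ball w (r/2)" using r by simp
  have "chain_map 2 id ?t = ?t"
   by (rule chain_map_ident[of 2 "top_of_set W"]) (use t in \<open>simp add: singular_relcycle\<close>)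
  moreover have "chain_winding w (chain_boundary 2 (chain_map 2 id ?t)) = winding_number (id \<circ> triangle_loop w r) w"
   by (rule triangle_boundary_winding[OF r(1)]) (use triangle_loop_winding(2)[OF r(1) w] in auto)
  ultimately show ?thesis using triangle_loop_winding(1)[OF r(1) w] by (simp del: chain_map_of)
 qed
 ultimately show thesis using that eq by simp
qed

text \<open>The value is an integer, and by \<open>triangle_class\<close> a divisor of
  \<open>1\<close>.\<close>

lemma chart_degree_exists:
 assumes e: "open_embedding W e N" "w \<in> W"
 shows "\<exists>s\<in>{1, -1}. chart_degree N \<mu> W e w s"
proof -
 have yN: "e w \<in> N" using e by (auto simp: open_embedding_def)
 obtain k where k: "singular_relcycle 2 (top_of_set W) (W - {w}) k"
  "homologous_rel_set 2 (top_of_set N) (N - {e w}) (chain_map 2 e k) = \<mu> (e w)"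
 proof -
  have K: "compact {w}" "{w} \<subseteq> W" "e ` {w} = {e w}" using e(2) by auto
  show ?thesis
   by (rule homology_class_in_chart[OF e(1) N K(1,2), unfolded K(3), OF orientation_carrier(1)[OF yN]]) (rule that)
 qed
 have "open W" using e by (simp add: open_embedding_def)
 then obtain r0 where "r0 > 0" "cball w r0 \<subseteq> W" using e(2) open_contains_cball by blast
 hence r: "r0/4 > 0" "cball w (4 * (r0/4)) \<subseteq> W" by auto
 obtain n where n: "of_int n * chain_winding w (chain_boundary 2 k) = 1"
  using triangle_class[OF e r k] by blast
 obtain m where m: "chain_winding w (chain_boundary 2 k) = of_int m"
  using relcycle_winding_Ints[OF k(1)] Ints_cases by blast
 hence "(of_int (n * m) :: complex) = of_int 1" using n by simp
 hence "n * m = 1" by (simp only: of_int_eq_iff)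
 hence "m = 1 \<or> m = -1" by (auto simp: zmult_eq_1_iff)
 thus ?thesis using k m unfolding chart_degree_def by fastforce
qed

lemma chart_degree_subset:
 assumes e: "open_embedding W e N" and V: "open V" "V \<subseteq> W" "w \<in> V"
 shows "chart_degree N \<mu> V e w s \<longleftrightarrow> chart_degree N \<mu> W e w s"
proof -
 have up: "chart_degree N \<mu> V e w t \<Longrightarrow> chart_degree N \<mu> W e w t" for t
  unfolding chart_degree_def using singular_relcycle_top_mono[OF _ V(2) order_refl] by blast
 obtain t where "chart_degree N \<mu> V e w t"
  using chart_degree_exists[OF open_embedding_subset[OF e V(1,2)] V(3)] by blast
 thus ?thesis using up chart_degree_unique[OF e, of w] V(2,3) by (metis subsetD)
qed

text \<open>A single class induces all nearby generators, so one cycle relative to a closed disc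
  \<open>D\<close> computes the degree at every point of \<open>D\<close>. Its boundary winding is
  continuous in that point and takes only the values \<open>1\<close> and \<open>-1\<close>.\<close>

lemma chart_degree_locally_constant:
 assumes e: "open_embedding W e N" "w0 \<in> W"
 obtains \<delta> s where "\<delta> > 0" "cball w0 \<delta> \<subseteq> W" "\<And>w. w \<in> cball w0 \<delta> \<Longrightarrow> chart_degree N \<mu> W e w s"
proof -
 have W: "open W" "continuous_on W e" "inj_on e W" "e ` W \<subseteq> N" using e(1) by (auto simp: open_embedding_def)
 have cmW: "continuous_map (top_of_set W) (top_of_set N) e" using W by (auto simp: continuous_map_in_subtopology)
 have "e w0 \<in> N" using W e by auto
 then obtain B c where B: "openin (top_of_set N) B" "e w0 \<in> B"
  "c \<in> carrier (relative_homology_group 2 (top_of_set N) (N - B))"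
  "\<forall>y\<in>B. hom_induced 2 (top_of_set N) (N - B) (top_of_set N) (N - {y}) id c = \<mu> y"
  using \<mu> unfolding local_orientation_def by meson
 have "openin (top_of_set W) {w \<in> W. e w \<in> B}"
  using openin_continuous_map_preimage[OF cmW B(1)] by simp
 hence "open {w \<in> W. e w \<in> B}" using W(1) by (simp add: openin_open_eq)
 then obtain \<delta> where \<delta>: "\<delta> > 0" "cball w0 \<delta> \<subseteq> {w \<in> W. e w \<in> B}"
  using open_contains_cball B(2) e(2) by (metis (mono_tags, lifting) mem_Collect_eq)
 define D where "D = cball w0 \<delta>"
 have D: "compact D" "D \<subseteq> W" "e ` D \<subseteq> B" using \<delta>(2) by (auto simp: D_def)
 \<comment> \<open>Passing from \<open>B\<close> to the compact image of \<open>D\<close> allows the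
   class to be represented by a cycle in the chart domain.\<close>
 define c' where "c' = hom_induced (int 2) (top_of_set N) (N - B) (top_of_set N) (N - e ` D) id c"
 have "hom_induced (int 2) (top_of_set N) (N - B) (top_of_set N) (N - e ` D) id
  \<in> hom (relative_homology_group (int 2) (top_of_set N) (N - B)) (relative_homology_group (int 2) (top_of_set N) (N - e ` D))"
  by (rule hom_induced_hom)
 hence c': "c' \<in> carrier (relative_homology_group (int 2) (top_of_set N) (N - e ` D))"
  unfolding c'_def using B(3) by (auto simp: hom_def)
 obtain k where k: "singular_relcycle 2 (top_of_set W) (W - D) k"
  "homologous_rel_set 2 (top_of_set N) (N - e ` D) (chain_map 2 e k) = c'"
  using homology_class_in_chart[OF e(1) N D(1,2) c'] .
 define s where "s w = chain_winding w (chain_boundary 2 k)" for w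
 have deg: "chart_degree N \<mu> W e w (s w)" if w: "w \<in> D" for w unfolding chart_degree_def
 proof (intro exI[of _ k] conjI)
  show "singular_relcycle 2 (top_of_set W) (W - {w}) k"
   by (rule singular_relcycle_top_mono[OF k(1)]) (use w in auto)
  have "e \<in> (W - D) \<rightarrow> N - e ` D" using W(3,4) D(2) by (auto simp: inj_on_def subset_iff)
  hence ek: "singular_relcycle 2 (top_of_set N) (N - e ` D) (chain_map 2 e k)"
   by (rule singular_relcycle_chain_map[OF k(1) cmW])
  have "\<mu> (e w) = hom_induced (int 2) (top_of_set N) (N - B) (top_of_set N) (N - {e w}) (id \<circ> id) c"
   using B(4) w D(3) by auto
  also have "\<dots> = hom_induced (int 2) (top_of_set N) (N - e ` D) (top_of_set N) (N - {e w}) id c'"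
   unfolding c'_def by (rule hom_induced_compose'[symmetric]) (use w D in auto)
  also have "\<dots> = homologous_rel_set 2 (top_of_set N) (N - {e w}) (chain_map 2 id (chain_map 2 e k))"
   unfolding k(2)[symmetric] by (rule hom_induced_chain_map[OF _ _ ek]) (use w in auto)
  also have "chain_map 2 id (chain_map 2 e k) = chain_map 2 e k"
   by (rule chain_map_ident[of 2 "top_of_set N"]) (use ek in \<open>simp add: singular_relcycle\<close>)
  finally show "homologous_rel_set 2 (top_of_set N) (N - {e w}) (chain_map 2 e k) = \<mu> (e w)" by simp
 qed (simp add: s_def)
 have s1: "s w \<in> {1, -1}" if w: "w \<in> D" for w
  using chart_degree_exists[OF e(1)] chart_degree_unique[OF e(1) _ deg[OF w]] w D(2) by (metis subsetD)
 have "subtopology (top_of_set W) (W - D) = subtopology euclidean (W - D)"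
  by (simp add: subtopology_subtopology Int_absorb1)
 hence "singular_chain 1 (top_of_set (- D)) (chain_boundary 2 k)"
  using k(1) singular_chain_mono[of 1 euclidean "W - D" _ "- D"] by (auto simp: singular_relcycle)
 hence "continuous_on D s" unfolding s_def by (rule chain_winding_continuous)
 moreover have "connected D" by (simp add: D_def convex_connected)
 moreover have "finite (s ` D)" by (rule finite_subset[of _ "{1, -1}"]) (use s1 in auto)
 ultimately have "s constant_on D" using continuous_finite_range_constant by blast
 then obtain s0 where "\<And>w. w \<in> D \<Longrightarrow> s w = s0" unfolding constant_on_def by blast
 thus thesis using that[of \<delta> s0] \<delta>(1) deg D(2) by (auto simp: D_def)
qed

lemma chart_degree_constant:
 assumes e: "open_embedding W e N" and "connected W" "w \<in> W" "v \<in> W" "chart_degree N \<mu> W e w s"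
 shows "chart_degree N \<mu> W e v s"
proof (rule ccontr)
 assume nv: "\<not> chart_degree N \<mu> W e v s"
 have op: "open {x \<in> W. chart_degree N \<mu> W e x s = b}" for b unfolding open_contains_cball
 proof
  fix x assume x: "x \<in> {x \<in> W. chart_degree N \<mu> W e x s = b}"
  hence xW: "x \<in> W" by simp
  obtain \<delta> t where d: "\<delta> > 0" "cball x \<delta> \<subseteq> W" "\<And>v. v \<in> cball x \<delta> \<Longrightarrow> chart_degree N \<mu> W e v t"
   using chart_degree_locally_constant[OF e xW] by blast
  have eq: "chart_degree N \<mu> W e v s = (s = t)" if "v \<in> cball x \<delta>" for v
   using chart_degree_unique[OF e _ d(3)[OF that]] that d(2,3) by blast
  have "cball x \<delta> \<subseteq> {x \<in> W. chart_degree N \<mu> W e x s = b}"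
  proof
   fix v assume v: "v \<in> cball x \<delta>"
   have "x \<in> cball x \<delta>" using d(1) by simp
   thus "v \<in> {x \<in> W. chart_degree N \<mu> W e x s = b}" using eq[OF v] eq[of x] x v d(2) by blast
  qed
  thus "\<exists>\<delta>>0. cball x \<delta> \<subseteq> {x \<in> W. chart_degree N \<mu> W e x s = b}" using d(1) by blast
 qed
 show False using connectedD[OF assms(2) op[of True] op[of False]] assms(3-5) nv by blast
qed

text \<open>Degree \<open>1\<close> of \<open>e\<close> makes a small triangle represent the local
  generator; its image under the transition map represents it in \<open>e'\<close>, where degree
  \<open>1\<close> gives boundary winding \<open>1\<close>. By \<open>index_at_loop\<close> a circle
  can take the place of the triangle.\<close>

lemma chart_degree_compatible:
 assumes e: "open_embedding W e N" "z \<in> W" "chart_degree N \<mu> W e z 1"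
  and e': "open_embedding W' e' N" "z' \<in> W'" "chart_degree N \<mu> W' e' z' 1"
  and eq: "e z = e' z'"
 shows "\<exists>r>0. cball z r \<subseteq> W \<and> e ` cball z r \<subseteq> e' ` W' \<and>
  winding_number (inv_into W' e' \<circ> e \<circ> circlepath z r) z' = 1"
proof -
 have W: "open W" "continuous_on W e" "inj_on e W" "e ` W \<subseteq> N" using e(1) by (auto simp: open_embedding_def)
 have W': "open W'" "inj_on e' W'" "openin (top_of_set N) (e' ` W')" "e' ` W' \<subseteq> N" using e'(1) by (auto simp: open_embedding_def)
 have cmW: "continuous_map (top_of_set W) (top_of_set N) e" using W by (auto simp: continuous_map_in_subtopology)
 have "openin (top_of_set W) {w \<in> W. e w \<in> e' ` W'}"
  using openin_continuous_map_preimage[OF cmW W'(3)] by simp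
 hence "open {w \<in> W. e w \<in> e' ` W'}" using W(1) by (simp add: openin_open_eq)
 moreover have "z \<in> {w \<in> W. e w \<in> e' ` W'}" using e eq e'(2) by auto
 ultimately obtain R where R: "R > 0" "ball z R \<subseteq> {w \<in> W. e w \<in> e' ` W'}" using open_contains_ball by blast
 define V where "V = ball z R"
 have V: "open V" "V \<subseteq> W" "z \<in> V" "e ` V \<subseteq> e' ` W'" using R by (auto simp: V_def)
 define r where "r = R/8"
 have r: "r > 0" "cball z (4 * r) \<subseteq> V" using R(1) by (auto simp: r_def V_def)
 define T where "T = inv_into W' e' \<circ> e"
 have eT: "e' (T v) = e v" "T v \<in> W'" if "v \<in> V" for v
  using that V(4) by (auto simp: T_def f_inv_into_f inv_into_into image_subset_iff)
 have Tc: "continuous_on V T" unfolding T_def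
  by (rule continuous_on_compose[OF continuous_on_subset[OF W(2) V(2)] continuous_on_subset[OF open_embedding_inverse_continuous[OF e'(1)] V(4)]])
 have Tz: "T z = z'" using eq W'(2) e'(2) by (simp add: T_def)
 have Tne: "T v \<noteq> z'" if "v \<in> V" "v \<noteq> z" for v
 proof
  assume "T v = z'"
  hence "e v = e z" using eT(1)[OF that(1)] eq by simp
  thus False using inj_onD[OF W(3)] that V(2,3) by blast
 qed
 note eV = open_embedding_subset[OF e(1) V(1,2)]
 have "chart_degree N \<mu> V e z 1" using chart_degree_subset[OF e(1) V(1-3)] e(3) by simp
 then obtain k where k: "singular_relcycle 2 (top_of_set V) (V - {z}) k"
  "homologous_rel_set 2 (top_of_set N) (N - {e z}) (chain_map 2 e k) = \<mu> (e z)"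
  "chain_winding z (chain_boundary 2 k) = 1" unfolding chart_degree_def by blast
 let ?t = "frag_of (triangle_simplex z r)"
 obtain n where "homologous_rel_set 2 (top_of_set N) (N - {e z}) (chain_map 2 e ?t)
   = homologous_rel_set 2 (top_of_set N) (N - {e z}) (chain_map 2 e (frag_cmul n k))"
  "of_int n * chain_winding z (chain_boundary 2 k) = 1" using triangle_class[OF eV V(3) r k(1,2)] by blast
 hence n: "homologous_rel_set 2 (top_of_set N) (N - {e z}) (chain_map 2 e ?t) = \<mu> (e z)"
  using k(2,3) by simp
 have t: "singular_relcycle 2 (top_of_set V) (V - {z}) ?t" by (rule triangle_relcycle[OF r])
 have cT: "continuous_map (top_of_set V) (top_of_set W') T" "T \<in> (V - {z}) \<rightarrow> W' - {z'}"
  using Tc eT(2) Tne by (auto simp: continuous_map_in_subtopology)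
 have "chain_map 2 e' (chain_map 2 T ?t) = chain_map 2 (e' \<circ> T) ?t"
  by (simp add: chain_map_compose del: chain_map_of)
 also have "\<dots> = chain_map 2 e ?t"
  by (rule chain_map_eq[of 2 "top_of_set V"]) (use t eT in \<open>auto simp: singular_relcycle simp del: chain_map_of\<close>)
 finally have "chart_degree N \<mu> W' e' z' (chain_winding z' (chain_boundary 2 (chain_map 2 T ?t)))"
  unfolding chart_degree_def
  by (intro exI[of _ "chain_map 2 T ?t"] conjI singular_relcycle_chain_map[OF t cT])
   (use n eq in \<open>auto simp del: chain_map_of\<close>)
 hence w1: "chain_winding z' (chain_boundary 2 (chain_map 2 T ?t)) = 1"
  using chart_degree_unique[OF e'(1,2) _ e'(3)] by blast
 have zr: "z \<in> ball z (r/2)" using r by simp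
 note tl = triangle_loop_winding[OF r(1) zr]
 have ti: "path_image (triangle_loop z r) \<subseteq> cball z (4 * r) - {z}"
  using triangle_loop_image[OF r(1), of z] tl(2) by blast
 have "z' \<notin> T ` path_image (triangle_loop z r)" using ti r(2) Tne by blast
 hence "winding_number (T \<circ> triangle_loop z r) z' = 1"
  using triangle_boundary_winding[OF r(1) continuous_on_subset[OF Tc r(2)]] w1 by simp
 hence wt: "wind ((\<lambda>v. T v - z') \<circ> triangle_loop z r) = 1"
  using winding_number_offset[of "T \<circ> triangle_loop z r" z'] by (simp add: o_def)
 have r4: "4 * r > 0" using r by simp
 have fc: "continuous_on (cball z (4 * r) - {z}) (\<lambda>v. T v - z')"
  using r(2) by (intro continuous_intros continuous_on_subset[OF Tc]) auto
 have f0: "\<forall>v\<in>cball z (4 * r) - {z}. T v - z' \<noteq> 0" using Tne r(2) by auto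
 have "wind ((\<lambda>v. T v - z') \<circ> circlepath z (4 * r)) = 1"
  using index_at_loop[OF r4 fc f0 tl(3,4) ti tl(1)] index_at_circle[OF r4 fc f0] wt by simp
 hence "winding_number (T \<circ> circlepath z (4 * r)) z' = 1"
  using winding_number_offset[of "T \<circ> circlepath z (4 * r)" z'] by (simp add: o_def)
 moreover have "e ` cball z (4 * r) \<subseteq> e' ` W'" "cball z (4 * r) \<subseteq> W" using r(2) V by blast+
 ultimately show ?thesis using r4 unfolding T_def by blast
qed

lemma chain_winding_cnj:
 assumes "singular_chain 1 (top_of_set (- {z})) c"
 shows "chain_winding (cnj z) (chain_map 1 cnj c) = - cnj (chain_winding z c)"
 using assms unfolding singular_chain_def
proof (induction c rule: frag_induction)
 case (one f)
 hence f: "singular_simplex 1 (top_of_set (- {z})) f" by simp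
 have "winding_number (edge_path (simplex_map 1 cnj f)) (cnj z) = winding_number (cnj \<circ> edge_path f) (cnj z)"
 proof (rule winding_number_cong)
  fix t :: real assume "0 \<le> t" "t \<le> 1"
  hence "bary1 t \<in> standard_simplex 1" by (intro bary1_simplex) auto
  thus "edge_path (simplex_map 1 cnj f) t = (cnj \<circ> edge_path f) t"
   by (simp add: edge_path_def simplex_map_def)
 qed
 also have "\<dots> = - cnj (winding_number (edge_path f) z)"
  using edge_path[OF f] by (intro winding_number_cnj) auto
 finally show ?case by simp
qed (simp_all add: chain_map_diff chain_winding_linear)

text \<open>Conjugation reverses the sense of winding, so precomposing with it turns degree
  \<open>-1\<close> into degree \<open>1\<close>.\<close>

lemma chart_degree_cnj:
 assumes e: "open_embedding W e N" "w \<in> W" "chart_degree N \<mu> W e w s"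
 shows "chart_degree N \<mu> (cnj ` W) (e \<circ> cnj) (cnj w) (- cnj s)"
proof -
 obtain k where k: "singular_relcycle 2 (top_of_set W) (W - {w}) k"
  "homologous_rel_set 2 (top_of_set N) (N - {e w}) (chain_map 2 e k) = \<mu> (e w)"
  "chain_winding w (chain_boundary 2 k) = s" using e(3) unfolding chart_degree_def by blast
 have sc: "singular_chain 2 (top_of_set W) k" using k(1) by (simp add: singular_relcycle)
 have "chain_map 2 (e \<circ> cnj) (chain_map 2 cnj k) = chain_map 2 ((e \<circ> cnj) \<circ> cnj) k"
  by (simp only: chain_map_compose o_apply)
 also have "\<dots> = chain_map 2 e k" by (rule chain_map_eq[OF sc]) simp
 finally have m: "chain_map 2 (e \<circ> cnj) (chain_map 2 cnj k) = chain_map 2 e k" .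
 have "subtopology (top_of_set W) (W - {w}) = subtopology euclidean (W - {w})"
  by (simp add: subtopology_subtopology Int_absorb1)
 hence "singular_chain 1 (top_of_set (- {w})) (chain_boundary 2 k)"
  using k(1) singular_chain_mono[of 1 euclidean "W - {w}" _ "- {w}"] by (auto simp: singular_relcycle)
 hence "chain_winding (cnj w) (chain_boundary 2 (chain_map 2 cnj k)) = - cnj s"
  using chain_winding_cnj k(3) by (simp add: chain_boundary_chain_map[OF sc])
 moreover have "singular_relcycle 2 (top_of_set (cnj ` W)) (cnj ` W - {cnj w}) (chain_map 2 cnj k)"
  by (rule singular_relcycle_chain_map[OF k(1)])
   (auto simp: continuous_map_in_subtopology intro!: continuous_intros)
 ultimately show ?thesis
  unfolding chart_degree_def using k(2) m by (intro exI[of _ "chain_map 2 cnj k"]) simp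
qed

end

section \<open>Attaching a collar to a surface with boundary\<close>

lemma local_degree_circle:
 assumes "continuous_on U T" "inj_on T U" "r > 0" "cball z r \<subseteq> U"
 shows "index_at (\<lambda>u. T u - T z) z = winding_number (T \<circ> circlepath z r) (T z)"
proof -
 have "index_at (\<lambda>u. T u - T z) z = wind ((\<lambda>u. T u - T z) \<circ> circlepath z r)"
 proof (rule index_at_circle[OF assms(3)])
  show "continuous_on (cball z r - {z}) (\<lambda>u. T u - T z)"
   by (intro continuous_on_diff continuous_on_const continuous_on_subset[OF assms(1)]) (use assms(4) in blast)
  show "\<forall>u\<in>cball z r - {z}. T u - T z \<noteq> 0"
  proof
   fix u assume u: "u \<in> cball z r - {z}"
   have "z \<in> cball z r" using assms(3) by simp
   hence "u \<in> U" "z \<in> U" using u assms(4) by blast+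
   thus "T u - T z \<noteq> 0" using inj_onD[OF assms(2), of u z] u by auto
  qed
 qed
 thus ?thesis using winding_number_offset[of "T \<circ> circlepath z r" "T z"] by (simp add: o_def)
qed

text \<open>All points \<open>z\<close> of the ball are compared with one circle: it winds once
  around each \<open>z\<close>, and \<open>T z\<close> moves in a connected set disjoint from the
  image of the circle. The factor \<open>3\<close> makes \<open>cball z (2 * R)\<close>, which
  contains that circle, lie in \<open>U\<close>.\<close>

lemma local_degree_ball:
 assumes "continuous_on U T" "inj_on T U" "R > 0" "cball z0 (3 * R) \<subseteq> U" "z \<in> ball z0 R"
 shows "index_at (\<lambda>w. T w - T z) z = winding_number (T \<circ> circlepath z0 R) (T z0)"
proof -
 let ?f = "\<lambda>w. T w - T z"
 let ?c = "circlepath z0 R"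
 have sub: "cball z (2 * R) \<subseteq> U"
 proof
  fix w assume "w \<in> cball z (2 * R)"
  hence "w \<in> cball z0 (3 * R)" using assms(5) dist_triangle[of z0 w z] by simp
  thus "w \<in> U" using assms(4) by blast
 qed
 have zU: "z \<in> U" "z0 \<in> U" using sub assms(3,4) by auto
 have ci: "path_image ?c = sphere z0 R" using assms(3) by simp
 have sph: "sphere z0 R \<subseteq> cball z (2 * R) - {z}"
 proof
  fix w assume "w \<in> sphere z0 R"
  thus "w \<in> cball z (2 * R) - {z}" using assms(5) dist_triangle[of z w z0] by (auto simp: dist_commute)
 qed
 have wc: "winding_number ?c z = 1"
  using assms(5) by (intro winding_number_circlepath) (simp add: dist_norm norm_minus_commute)
 have fc: "continuous_on (cball z (2 * R) - {z}) ?f"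
  by (intro continuous_intros continuous_on_subset[OF assms(1)]) (use sub in blast)
 have f0: "\<forall>w\<in>cball z (2 * R) - {z}. ?f w \<noteq> 0"
 proof
  fix w assume "w \<in> cball z (2 * R) - {z}"
  thus "?f w \<noteq> 0" using inj_onD[OF assms(2), of w z] sub zU by auto
 qed
 have "index_at ?f z = wind (?f \<circ> ?c)"
  by (rule index_at_loop[symmetric, OF _ fc f0]) (use assms(3) sph ci wc in auto)
 also have "\<dots> = winding_number (T \<circ> ?c) (T z)"
  using winding_number_offset[of "T \<circ> ?c" "T z"] by (simp add: o_def)
 also have "\<dots> = winding_number (T \<circ> ?c) (T z0)"
 proof (rule winding_number_eq[where S = "T ` ball z0 R"])
  have b: "ball z0 R \<subseteq> U"
  proof
   fix w assume "w \<in> ball z0 R"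
   hence "w \<in> cball z0 (3 * R)" using assms(3) by simp
   thus "w \<in> U" using assms(4) by blast
  qed
  show "connected (T ` ball z0 R)"
   by (rule connected_continuous_image[OF continuous_on_subset[OF assms(1) b]]) (simp add: convex_connected)
  have "sphere z0 R \<subseteq> U" using sph sub by blast
  thus "T ` ball z0 R \<inter> path_image (T \<circ> ?c) = {}"
   using inj_onD[OF assms(2)] b unfolding path_image_compose ci by fastforce
  show "path (T \<circ> ?c)"
   by (rule path_continuous_image[OF _ continuous_on_subset[OF assms(1)]]) (use ci sph sub in auto)
 qed (use assms(3,5) in \<open>auto simp: pathfinish_compose pathstart_compose\<close>)
 finally show ?thesis .
qed

lemma local_degree_connected:
 assumes "open U" "continuous_on U T" "inj_on T U" "connected \<sigma>" "\<sigma> \<subseteq> U" "z \<in> \<sigma>" "w \<in> \<sigma>"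
  and "index_at (\<lambda>u. T u - T z) z = d"
 shows "index_at (\<lambda>u. T u - T w) w = d"
proof (rule ccontr)
 assume nw: "index_at (\<lambda>u. T u - T w) w \<noteq> d"
 have op: "open {x \<in> U. (index_at (\<lambda>u. T u - T x) x = d) = b}" for b
  unfolding open_contains_ball
 proof
  fix x assume x: "x \<in> {x \<in> U. (index_at (\<lambda>u. T u - T x) x = d) = b}"
  then obtain \<delta> where \<delta>: "\<delta> > 0" "cball x \<delta> \<subseteq> U" using assms(1) open_contains_cball by blast
  have r: "\<delta>/3 > 0" "cball x (3 * (\<delta>/3)) \<subseteq> U" using \<delta> by auto
  note eq = local_degree_ball[OF assms(2,3) r]
  have "ball x (\<delta>/3) \<subseteq> {x \<in> U. (index_at (\<lambda>u. T u - T x) x = d) = b}"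
  proof
   fix v assume v: "v \<in> ball x (\<delta>/3)"
   hence "v \<in> U" using r \<delta> by auto
   moreover have "x \<in> ball x (\<delta>/3)" using r by simp
   ultimately show "v \<in> {x \<in> U. (index_at (\<lambda>u. T u - T x) x = d) = b}"
    using x eq[OF v] eq[of x] by simp
  qed
  thus "\<exists>\<phi>>0. ball x \<phi> \<subseteq> {x \<in> U. (index_at (\<lambda>u. T u - T x) x = d) = b}" using r(1) by blast
 qed
 show False using connectedD[OF assms(4) op[of True] op[of False]] assms(5-8) nw by blast
qed

lemma open_embedding_homeomorphism:
 assumes "homeomorphism W (e ` W) e k" "open W" "openin (top_of_set X) (e ` W)"
 shows "open_embedding W e X" unfolding open_embedding_def
proof (intro conjI allI impI)
 show "open W" "continuous_on W e" using assms by (auto simp: homeomorphism_def)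
 show "inj_on e W" using assms(1) by (metis homeomorphism_apply1 inj_onI)
 show "e ` W \<subseteq> X" using assms(3) by (rule openin_imp_subset)
 fix V assume "open V" "V \<subseteq> W"
 hence "openin (top_of_set W) V" using assms(2) by (simp add: openin_open_eq)
 hence "openin (top_of_set (e ` W)) (e ` V)" by (rule homeomorphism_imp_open_map[OF assms(1)])
 thus "openin (top_of_set X) (e ` V)" using assms(3) openin_trans by blast
qed

lemma open_embedding_interior:
 assumes "open_embedding W e M"
 shows "e ` W \<subseteq> surface_interior M"
proof
 fix x assume x: "x \<in> e ` W"
 have "homeomorphism W (e ` W) e (inv_into W e)" using assms open_embedding_inverse_continuous[OF assms]
  by (auto simp: homeomorphism_def open_embedding_def f_inv_into_f inv_into_into)
 hence "e ` W homeomorphic W" using homeomorphic_def homeomorphic_sym by blast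
 moreover have "openin (top_of_set M) (e ` W)" "open W" "e ` W \<subseteq> M" using assms by (auto simp: open_embedding_def)
 ultimately show "x \<in> surface_interior M" unfolding surface_interior_def using x by blast
qed

lemma interior_chart:
 assumes "x \<in> surface_interior M"
 obtains e where "open_embedding UNIV e M" "x \<in> range e"
proof -
 obtain U and V :: "complex set" where U: "openin (top_of_set M) U" "x \<in> U" "open V" "U homeomorphic V"
  using assms unfolding surface_interior_def by blast
 obtain f k where fk: "homeomorphism U V f k" using U(4) homeomorphic_def by blast
 have "f x \<in> V" using fk U(2) by (auto simp: homeomorphism_def)
 then obtain r where r: "r > 0" "ball (f x) r \<subseteq> V" using U(3) open_contains_ball by blast
 obtain \<psi> \<phi> where \<phi>: "homeomorphism (ball (f x) r) (UNIV :: complex set) \<psi> \<phi>"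
  using homeomorphic_ball_UNIV[OF r(1)] homeomorphic_def by blast
 let ?B = "ball (f x) r"
 have "homeomorphism V U k f" using fk by (rule homeomorphism_symD)
 hence kB: "homeomorphism ?B (k ` ?B) k f"
  by (rule homeomorphism_of_subsets[OF _ r(2)]) (use fk r(2) in \<open>auto simp: homeomorphism_def\<close>)
 have op: "openin (top_of_set M) (k ` ?B)"
 proof -
  have "openin (top_of_set V) ?B" using r(2) U(3) by (simp add: openin_open_eq)
  hence "openin (top_of_set U) (k ` ?B)" by (rule homeomorphism_imp_open_map[OF homeomorphism_symD[OF fk]])
  thus ?thesis using U(1) openin_trans by blast
 qed
 have h: "homeomorphism UNIV (k ` ?B) (k \<circ> \<phi>) (\<psi> \<circ> f)"
  by (rule homeomorphism_compose[OF homeomorphism_symD[OF \<phi>] kB])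
 hence im: "(k \<circ> \<phi>) ` UNIV = k ` ?B" by (simp add: homeomorphism_def)
 have "open_embedding UNIV (k \<circ> \<phi>) M"
  by (rule open_embedding_homeomorphism[of _ _ "\<psi> \<circ> f"]) (use h op im in auto)
 moreover have "x \<in> range (k \<circ> \<phi>)"
 proof -
  have "k (f x) \<in> k ` ?B" using r(1) by auto
  moreover have "k (f x) = x" using fk U(2) by (simp add: homeomorphism_def)
  ultimately show ?thesis using im by simp
 qed
 ultimately show thesis by (rule that)
qed

section \<open>Half-plane charts and the collar\<close>

abbreviation half_plane :: "complex set" where
 "half_plane \<equiv> {z. Im z \<ge> 0}"

text \<open>Radial shrinking that takes modulus \<open>t\<close> to \<open>r t / (1 + t)\<close>;
  with \<open>b\<close> on the real axis, the positive scaling and the translation preserve the half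
  plane.\<close>

lemma half_disc_homeomorphism:
 assumes "Im b = 0" "r > 0"
 shows "homeomorphism half_plane (half_plane \<inter> ball b r)
  (\<lambda>z. b + of_real (r / (1 + cmod z)) * z) (\<lambda>w. of_real (1 / (r - cmod (w - b))) * (w - b))"
proof (rule homeomorphismI)
 have p: "1 + cmod z \<noteq> 0" "1 + cmod z > 0" for z by (smt (verit) norm_ge_zero)+
 have cm: "cmod (of_real (r / (1 + cmod z)) * z) = r * cmod z / (1 + cmod z)" for z
  using assms(2) p[of z] by (simp add: norm_mult del: of_real_divide of_real_add)
 show "continuous_on half_plane (\<lambda>z. b + of_real (r / (1 + cmod z)) * z)"
  by (intro continuous_intros) (use p in auto)
 show "continuous_on (half_plane \<inter> ball b r) (\<lambda>w. of_real (1 / (r - cmod (w - b))) * (w - b))"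
  by (intro continuous_intros) (auto simp: dist_norm norm_minus_commute)
 show "(\<lambda>z. b + of_real (r / (1 + cmod z)) * z) ` half_plane \<subseteq> half_plane \<inter> ball b r"
 proof (intro image_subsetI IntI)
  fix z assume z: "z \<in> half_plane"
  show "b + of_real (r / (1 + cmod z)) * z \<in> half_plane"
   using z assms p[of z] by (simp add: Im_divide_of_real)
  have "r * cmod z / (1 + cmod z) < r" using assms(2) p[of z] by (simp add: field_simps)
  thus "b + of_real (r / (1 + cmod z)) * z \<in> ball b r"
   using cm[of z] by (simp add: dist_norm del: of_real_divide of_real_add)
 qed
 show "(\<lambda>w. of_real (1 / (r - cmod (w - b))) * (w - b)) ` (half_plane \<inter> ball b r) \<subseteq> half_plane"
  using assms by (auto simp: dist_norm norm_minus_commute Im_divide_of_real)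
 show "of_real (1 / (r - cmod (b + of_real (r / (1 + cmod z)) * z - b))) * (b + of_real (r / (1 + cmod z)) * z - b) = z"
  if "z \<in> half_plane" for z
 proof -
  have "r - cmod (b + of_real (r / (1 + cmod z)) * z - b) = r / (1 + cmod z)"
   using p[of z] by (simp only: cm add_diff_cancel_left') (simp add: field_simps)
  hence "of_real (1 / (r - cmod (b + of_real (r / (1 + cmod z)) * z - b))) * (b + of_real (r / (1 + cmod z)) * z - b)
    = of_real (1 / (r / (1 + cmod z)) * (r / (1 + cmod z))) * z"
   by (simp only: add_diff_cancel_left' of_real_mult mult.assoc)
  also have "1 / (r / (1 + cmod z)) * (r / (1 + cmod z)) = 1" using assms(2) p[of z] by simp
  finally show ?thesis by simp
 qed
 show "b + of_real (r / (1 + cmod (of_real (1 / (r - cmod (w - b))) * (w - b)))) * (of_real (1 / (r - cmod (w - b))) * (w - b)) = w"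
  if "w \<in> half_plane \<inter> ball b r" for w
 proof -
  have q: "r - cmod (w - b) > 0" using that by (simp add: dist_norm norm_minus_commute)
  have "1 + cmod (of_real (1 / (r - cmod (w - b))) * (w - b)) = r / (r - cmod (w - b))"
  proof -
   have "cmod (of_real (1 / (r - cmod (w - b))) * (w - b)) = cmod (w - b) / (r - cmod (w - b))"
    using q by (simp add: norm_mult del: of_real_divide of_real_diff)
   thus ?thesis using q by (simp only:) (simp add: field_simps)
  qed
  hence "of_real (r / (1 + cmod (of_real (1 / (r - cmod (w - b))) * (w - b)))) * (of_real (1 / (r - cmod (w - b))) * (w - b))
   = of_real (r / (r / (r - cmod (w - b))) * (1 / (r - cmod (w - b)))) * (w - b)"
   by (simp only: of_real_mult mult.assoc)
  also have "r / (r / (r - cmod (w - b))) * (1 / (r - cmod (w - b))) = 1" using q assms(2) by simp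
  finally show ?thesis by simp
 qed
qed

text \<open>If the chart took \<open>x\<close> to a point with positive imaginary part, a smaller
  chart would have an open image in the plane and \<open>x\<close> would be interior. So
  \<open>x\<close> goes to a real point, and a half disc around it is homeomorphic to the half
  plane.\<close>

lemma boundary_half_chart:
 assumes "surface_with_boundary M" "x \<in> surface_boundary M"
 obtains g k where "homeomorphism half_plane (g ` half_plane) g k" "openin (top_of_set M) (g ` half_plane)" "x = g 0"
proof -
 have xM: "x \<in> M" "x \<notin> surface_interior M" using assms(2) by (auto simp: surface_boundary_def)
 obtain U V where UV: "openin (top_of_set M) U" "x \<in> U" "openin (top_of_set half_plane) V" "U homeomorphic V"
  using assms(1) xM(1) unfolding surface_with_boundary_def by meson
 obtain f k where fk: "homeomorphism U V f k" using UV(4) homeomorphic_def by blast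
 have V: "V \<subseteq> half_plane" using UV(3) by (rule openin_imp_subset)
 obtain O' where O': "open O'" "V = half_plane \<inter> O'" using UV(3) by (auto simp: openin_open)
 define b where "b = f x"
 have bV: "b \<in> V" and kb: "k b = x" using fk UV(2) by (auto simp: homeomorphism_def b_def)
 have Ub: "openin (top_of_set M) (k ` P)" and kP: "homeomorphism P (k ` P) k f"
  if P: "openin (top_of_set half_plane) P" "P \<subseteq> V" for P
 proof -
  have "openin (top_of_set V) P" using P V by (meson openin_subset_trans)
  hence "openin (top_of_set U) (k ` P)" by (rule homeomorphism_imp_open_map[OF homeomorphism_symD[OF fk]])
  thus "openin (top_of_set M) (k ` P)" using UV(1) openin_trans by blast
  show "homeomorphism P (k ` P) k f"
   by (rule homeomorphism_of_subsets[OF homeomorphism_symD[OF fk] P(2)]) (use fk P(2) in \<open>auto simp: homeomorphism_def\<close>)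
 qed
 have Im_b: "Im b = 0"
 proof (rule ccontr)
  assume "Im b \<noteq> 0"
  hence pos: "Im b > 0" using bV V by force
  define P where "P = {z. Im z > 0} \<inter> O'"
  have "open P" unfolding P_def using O'(1) by (intro open_Int open_halfspace_Im_gt) 
  moreover have PV: "P \<subseteq> V" using O'(2) by (auto simp: P_def)
  moreover have "half_plane \<inter> P = P" using PV V by blast
  ultimately have "openin (top_of_set half_plane) P" by (metis openin_open_Int)
  note * = Ub[OF this PV] kP[OF this PV]
  have "open_embedding P k M" by (rule open_embedding_homeomorphism[OF *(2) \<open>open P\<close> *(1)])
  moreover have "b \<in> P" using pos bV O'(2) by (auto simp: P_def)
  ultimately show False using open_embedding_interior kb xM(2) by blast
 qed
 obtain r where r: "r > 0" "ball b r \<subseteq> O'" using O' bV open_contains_ball by blast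
 let ?P = "half_plane \<inter> ball b r"
 have oP: "openin (top_of_set half_plane) ?P" by (rule openin_open_Int) simp
 have PV: "?P \<subseteq> V" using r(2) O'(2) by blast
 note * = Ub[OF oP PV] kP[OF oP PV]
 have h: "homeomorphism half_plane (k ` ?P) (k \<circ> (\<lambda>z. b + of_real (r / (1 + cmod z)) * z)) ((\<lambda>w. of_real (1 / (r - cmod (w - b))) * (w - b)) \<circ> f)"
  by (rule homeomorphism_compose[OF half_disc_homeomorphism[OF Im_b r(1)] *(2)])
 hence im: "(k \<circ> (\<lambda>z. b + of_real (r / (1 + cmod z)) * z)) ` half_plane = k ` ?P" by (simp add: homeomorphism_def)
 show thesis
 proof (rule that)
  show "homeomorphism half_plane ((k \<circ> (\<lambda>z. b + of_real (r / (1 + cmod z)) * z)) ` half_plane)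
   (k \<circ> (\<lambda>z. b + of_real (r / (1 + cmod z)) * z)) ((\<lambda>w. of_real (1 / (r - cmod (w - b))) * (w - b)) \<circ> f)"
   unfolding im by (rule h)
  show "openin (top_of_set M) ((k \<circ> (\<lambda>z. b + of_real (r / (1 + cmod z)) * z)) ` half_plane)"
   unfolding im by (rule *(1))
  show "x = (k \<circ> (\<lambda>z. b + of_real (r / (1 + cmod z)) * z)) 0" using kb by simp
 qed
qed

text \<open>Invariance of domain: given a plane chart at \<open>g a\<close>, the map
  \<open>k\<close> would take a neighbourhood of \<open>g a\<close> onto an open set of the plane
  containing the real point \<open>a\<close>, although that set lies in the half plane.\<close>

lemma half_chart_real_boundary:
 assumes g: "homeomorphism half_plane (g ` half_plane) g k" "openin (top_of_set M) (g ` half_plane)" and "Im a = 0"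
 shows "g a \<in> surface_boundary M"
proof (rule ccontr)
 assume n: "g a \<notin> surface_boundary M"
 have "g a \<in> M" using openin_imp_subset[OF g(2)] assms(3) by auto
 then obtain U and V :: "complex set" where U: "openin (top_of_set M) U" "g a \<in> U" "open V" "U homeomorphic V"
  using n unfolding surface_boundary_def surface_interior_def by blast
 obtain f h where fh: "homeomorphism U V f h" using U(4) homeomorphic_def by blast
 define Q where "Q = U \<inter> g ` half_plane"
 have "openin (top_of_set M) Q" unfolding Q_def using U(1) g(2) by (rule openin_Int)
 hence "openin (top_of_set U) Q" 
  by (rule openin_subset_trans) (use openin_imp_subset[OF U(1)] in \<open>auto simp: Q_def\<close>)
 hence "openin (top_of_set V) (f ` Q)" by (rule homeomorphism_imp_open_map[OF fh])
 hence oQ: "open (f ` Q)" using U(3) by (simp add: openin_open_eq)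
 have fQV: "f ` Q \<subseteq> V" using fh by (auto simp: homeomorphism_def Q_def)
 have hf: "h (f x) = x" if "x \<in> Q" for x using fh that by (auto simp: homeomorphism_def Q_def)
 have hQ: "h ` f ` Q = Q" using hf by (auto simp: image_image)
 have "open ((k \<circ> h) ` f ` Q)"
 proof (rule invariance_of_domain_gen[OF oQ])
  show "continuous_on (f ` Q) (k \<circ> h)"
  proof (rule continuous_on_compose)
   show "continuous_on (f ` Q) h" using fh fQV by (meson homeomorphism_def continuous_on_subset)
   have "Q \<subseteq> g ` half_plane" by (simp add: Q_def)
   thus "continuous_on (h ` f ` Q) k" unfolding hQ using g(1) by (meson homeomorphism_def continuous_on_subset)
  qed
  show "inj_on (k \<circ> h) (f ` Q)"
  proof (rule inj_onI, clarify)
   fix x y assume xy: "x \<in> Q" "y \<in> Q" "(k \<circ> h) (f x) = (k \<circ> h) (f y)"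
   hence kk: "k x = k y" using hf by simp
   have "g (k x) = x" "g (k y) = y" using xy(1,2) g(1) by (auto simp: homeomorphism_def Q_def)
   thus "f x = f y" using kk by metis
  qed
 qed simp
 moreover have "(k \<circ> h) ` f ` Q = k ` Q" unfolding image_comp[symmetric] hQ ..
 ultimately have oK: "open (k ` Q)" by simp
 have aH: "a \<in> half_plane" using assms(3) by simp
 have "k (g a) = a" using g(1) aH by (simp add: homeomorphism_def)
 moreover have "g a \<in> Q" using U(2) aH by (auto simp: Q_def)
 ultimately have "a \<in> k ` Q" by (metis imageI)
 then obtain \<phi> where \<phi>: "\<phi> > 0" "ball a \<phi> \<subseteq> k ` Q" using oK open_contains_ball by blast
 have "a - of_real (\<phi>/2) * \<i> \<in> ball a \<phi>" using \<phi>(1) by (simp add: dist_norm norm_mult)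
 hence "a - of_real (\<phi>/2) * \<i> \<in> k ` Q" using \<phi>(2) by blast
 moreover have "k ` Q \<subseteq> half_plane" using g(1) unfolding homeomorphism_def Q_def by blast
 ultimately have "Im (a - of_real (\<phi>/2) * \<i>) \<ge> 0" by blast
 thus False using assms(3) \<phi>(1) by simp
qed

text \<open>\<open>M\<close> with an open collar, its boundary times
  \<open>[0, \<infinity>)\<close>, attached at height \<open>0\<close>. As a subset of a product it
  inherits topology and retraction, and points of the boundary of \<open>M\<close> acquire
  neighbourhoods that are planes.\<close>

definition collared :: "'a::topological_space set \<Rightarrow> ('a \<times> real) set" where
 "collared M = {(x, t). x \<in> M \<and> 0 \<le> t \<and> (t = 0 \<or> x \<in> surface_boundary M)}"

text \<open>The ranges of charts are closed under moving down the collar, so that orientations can be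
 compared along collar segments.\<close>

definition collar_chart :: "'a::topological_space set \<Rightarrow> (complex \<Rightarrow> 'a \<times> real) \<Rightarrow> bool" where
 "collar_chart M e \<longleftrightarrow> open_embedding UNIV e (collared M) \<and>
  (\<forall>x t s. (x, t) \<in> range e \<longrightarrow> 0 \<le> s \<longrightarrow> s \<le> t \<longrightarrow> (x, s) \<in> range e)"

definition interior_part :: "'a::topological_space set \<Rightarrow> (complex \<Rightarrow> 'a \<times> real) \<Rightarrow> complex set" where
 "interior_part M e = {w. fst (e w) \<in> surface_interior M \<and> snd (e w) = 0}"

text \<open>Degree \<open>1\<close> is asked over interior points of \<open>M\<close>, where
  \<open>\<mu>\<close> lives; at the other points the orientation is determined by
  continuity.\<close>

definition collar_atlas :: "'a::topological_space set \<Rightarrow> ('a \<Rightarrow> 'a chain set) \<Rightarrow> (complex \<Rightarrow> 'a \<times> real) set" where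
 "collar_atlas M \<mu> = {e. collar_chart M e \<and>
  (\<forall>w\<in>interior_part M e. chart_degree (surface_interior M) \<mu> (interior_part M e) (fst \<circ> e) w 1)}"

lemma openin_surface_interior: "openin (top_of_set M) (surface_interior M)"
proof (subst openin_subopen, intro ballI)
 fix x assume "x \<in> surface_interior M"
 then obtain e where e: "open_embedding UNIV e M" "x \<in> range e" by (rule interior_chart)
 hence "openin (top_of_set M) (range e)" by (auto simp: open_embedding_def)
 thus "\<exists>T. openin (top_of_set M) T \<and> x \<in> T \<and> T \<subseteq> surface_interior M"
  using e(2) open_embedding_interior[OF e(1)] by blast
qed

lemma surface_interior_subset: "surface_interior M \<subseteq> M" by (auto simp: surface_interior_def)

lemma openin_collared:
 assumes "openin (top_of_set M) U"
 shows "openin (top_of_set (collared M)) (collared M \<inter> U \<times> UNIV)"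
proof -
 obtain O' where O': "open O'" "U = M \<inter> O'" using assms by (auto simp: openin_open)
 have "collared M \<inter> U \<times> UNIV = collared M \<inter> (O' \<times> UNIV)" using O'(2) by (auto simp: collared_def)
 moreover have "open (O' \<times> (UNIV :: real set))" using O'(1) by (intro open_Times) auto
 ultimately show ?thesis by (metis openin_open_Int)
qed

lemma collared_interior: "x \<in> surface_interior M \<Longrightarrow> (x, t) \<in> collared M \<longleftrightarrow> t = 0"
 using surface_interior_subset[of M] by (auto simp: collared_def surface_boundary_def)

lemma continuous_on_pair_zero: "continuous_on A (\<lambda>x. (x, 0::real))" by (intro continuous_intros)

lemma interior_collar_chart:
 assumes "open_embedding UNIV e M"
 shows "collar_chart M (\<lambda>z. (e z, 0))" "interior_part M (\<lambda>z. (e z, 0)) = UNIV"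
proof -
 have ri: "range e \<subseteq> surface_interior M" by (rule open_embedding_interior[OF assms])
 have e: "continuous_on UNIV e" "inj e" "openin (top_of_set M) (range e)" using assms by (auto simp: open_embedding_def)
 have im: "range (\<lambda>z. (e z, 0)) = collared M \<inter> range e \<times> UNIV"
 proof (rule subset_antisym; rule subsetI)
  fix p :: "'a \<times> real" assume "p \<in> range (\<lambda>z. (e z, 0))"
  then obtain z where "p = (e z, 0)" by auto
  moreover have "e z \<in> surface_interior M" using ri by blast
  ultimately show "p \<in> collared M \<inter> range e \<times> UNIV" using collared_interior by auto
 next
  fix p :: "'a \<times> real" assume p: "p \<in> collared M \<inter> range e \<times> UNIV"
  obtain x t where xt: "p = (x, t)" by force
  hence "x \<in> surface_interior M" "x \<in> range e" using p ri by auto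
  thus "p \<in> range (\<lambda>z. (e z, 0))" using collared_interior p xt by auto
 qed
 have "homeomorphism UNIV (range (\<lambda>z. (e z, 0::real))) (\<lambda>z. (e z, 0)) (inv_into UNIV e \<circ> fst)"
 proof (rule homeomorphismI)
  show "continuous_on (range (\<lambda>z. (e z, 0::real))) (inv_into UNIV e \<circ> fst)"
   by (intro continuous_on_compose continuous_intros continuous_on_subset[OF open_embedding_inverse_continuous[OF assms]]) auto
 qed (use e in \<open>auto intro!: continuous_intros\<close>)
 hence "open_embedding UNIV (\<lambda>z. (e z, 0)) (collared M)"
  by (rule open_embedding_homeomorphism) (auto simp: im intro: openin_collared e)
 thus "collar_chart M (\<lambda>z. (e z, 0))" unfolding collar_chart_def by auto
 show "interior_part M (\<lambda>z. (e z, 0)) = UNIV" unfolding interior_part_def using ri by auto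
qed

text \<open>On the upper half plane this is \<open>g\<close> at height \<open>0\<close>; below the
  real axis the real part gives the boundary point and the negated imaginary part the height in the
  collar.\<close>

definition half_chart_extension :: "(complex \<Rightarrow> 'a) \<Rightarrow> complex \<Rightarrow> 'a \<times> real" where
 "half_chart_extension g z = (g (Complex (Re z) (max (Im z) 0)), max (- Im z) 0)"

lemma half_chart_interior:
 assumes g: "homeomorphism half_plane (g ` half_plane) g k" "openin (top_of_set M) (g ` half_plane)" and "Im a > 0"
 shows "g a \<in> surface_interior M"
proof -
 let ?P = "{z. Im z > 0}"
 have oP: "open ?P" by (rule open_halfspace_Im_gt)
 have "half_plane \<inter> ?P = ?P" by auto
 hence "openin (top_of_set half_plane) ?P" by (metis oP openin_open_Int)
 hence "openin (top_of_set (g ` half_plane)) (g ` ?P)" by (rule homeomorphism_imp_open_map[OF g(1)])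
 hence op: "openin (top_of_set M) (g ` ?P)" using g(2) openin_trans by blast
 have "homeomorphism ?P (g ` ?P) g k" by (rule homeomorphism_of_subsets[OF g(1)]) auto
 hence "open_embedding ?P g M" by (rule open_embedding_homeomorphism[OF _ oP op])
 thus ?thesis using open_embedding_interior assms(3) by blast
qed

lemma half_chart_collar_chart:
 assumes g: "homeomorphism half_plane (g ` half_plane) g k" "openin (top_of_set M) (g ` half_plane)"
 shows "collar_chart M (half_chart_extension g)"
  and "range (half_chart_extension g) = collared M \<inter> g ` half_plane \<times> UNIV"
  and "interior_part M (half_chart_extension g) = {z. Im z > 0}"
proof -
 let ?\<Psi> = "half_chart_extension g"
 \<comment> \<open>Inverse of the extended chart: the height is subtracted from the imaginary part.
   Positive height occurs only over points with real coordinate.\<close>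
 let ?k = "\<lambda>p. k (fst p) - \<i> * of_real (snd p)"
 have gM: "g z \<in> M" if "Im z \<ge> 0" for z using openin_imp_subset[OF g(2)] that by auto
 have gb: "g z \<in> surface_boundary M" if "Im z = 0" for z by (rule half_chart_real_boundary[OF g that])
 have gi: "g z \<in> surface_interior M" if "Im z > 0" for z by (rule half_chart_interior[OF g that])
 have kg: "k (g z) = z" if "Im z \<ge> 0" for z using g(1) that by (simp add: homeomorphism_def)
 have gk: "g (k x) = x" "Im (k x) \<ge> 0" if "x \<in> g ` half_plane" for x using g(1) that by (auto simp: homeomorphism_def)
 have kk: "?k (?\<Psi> z) = z" for z
  using kg[of "Complex (Re z) (max (Im z) 0)"] by (simp add: half_chart_extension_def complex_eq_iff max_def)
 have in1: "?\<Psi> z \<in> collared M \<inter> g ` half_plane \<times> UNIV" for z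
 proof -
  have "g (Complex (Re z) (max (Im z) 0)) \<in> M" by (rule gM) simp
  moreover have "max (- Im z) 0 = 0 \<or> g (Complex (Re z) (max (Im z) 0)) \<in> surface_boundary M"
  proof (cases "Im z \<ge> 0")
   case False
   thus ?thesis by (intro disjI2 gb) simp
  qed simp
  moreover have "g (Complex (Re z) (max (Im z) 0)) \<in> g ` half_plane" by (rule imageI) simp
  ultimately show ?thesis unfolding half_chart_extension_def collared_def by simp
 qed
 have in2: "?\<Psi> (?k p) = p" if p: "p \<in> collared M \<inter> g ` half_plane \<times> UNIV" for p
 proof -
  obtain x t where xt: "p = (x, t)" by force
  have x: "x \<in> g ` half_plane" "t \<ge> 0" "t = 0 \<or> x \<in> surface_boundary M" using p xt by (auto simp: collared_def)
  note gx = gk[OF x(1)]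
  have "t = 0 \<or> Im (k x) = 0"
  proof (rule ccontr)
   assume "\<not> ?thesis"
   hence "Im (k x) > 0" "x \<in> surface_boundary M" using gx(2) x(3) by auto
   thus False using gi gx(1) by (metis DiffD2 surface_boundary_def)
  qed
  hence "Complex (Re (?k p)) (max (Im (?k p)) 0) = k x" "max (- Im (?k p)) 0 = t"
   using gx(2) x(2) by (auto simp: xt complex_eq_iff)
  thus ?thesis unfolding half_chart_extension_def using gx(1) xt by simp
 qed
 show im: "range ?\<Psi> = collared M \<inter> g ` half_plane \<times> UNIV"
  using in1 in2 by (metis (no_types, lifting) image_subsetI rangeI subsetI subset_antisym)
 have "homeomorphism UNIV (range ?\<Psi>) ?\<Psi> ?k"
 proof (rule homeomorphismI)
  have "continuous_on half_plane g" using g(1) by (simp add: homeomorphism_def)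
  moreover have "continuous_on UNIV (\<lambda>z. Complex (Re z) (max (Im z) 0))"
   unfolding Complex_eq by (intro continuous_intros)
  ultimately have "continuous_on UNIV (\<lambda>z. g (Complex (Re z) (max (Im z) 0)))"
   by (rule continuous_on_compose2) auto
  thus "continuous_on UNIV ?\<Psi>" unfolding half_chart_extension_def[abs_def] by (intro continuous_intros)
  have "continuous_on (range ?\<Psi>) (\<lambda>p. k (fst p))"
   by (rule continuous_on_compose2[of "g ` half_plane" k])
    (use g(1) im in \<open>auto simp: homeomorphism_def intro!: continuous_intros\<close>)
  thus "continuous_on (range ?\<Psi>) ?k" by (intro continuous_intros)
 qed (use kk in2 im in auto)
 hence "open_embedding UNIV ?\<Psi> (collared M)"
  by (rule open_embedding_homeomorphism) (auto simp: im intro: openin_collared g)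
 moreover have "(x, s) \<in> range ?\<Psi>" if "(x, t) \<in> range ?\<Psi>" "0 \<le> s" "s \<le> t" for x t s
  using that unfolding im by (auto simp: collared_def)
 ultimately show "collar_chart M ?\<Psi>" unfolding collar_chart_def by blast
 show "interior_part M ?\<Psi> = {z. Im z > 0}"
 proof (rule subset_antisym; rule subsetI)
  fix z assume "z \<in> interior_part M ?\<Psi>"
  hence z: "Im z \<ge> 0" "g (Complex (Re z) (max (Im z) 0)) \<in> surface_interior M"
   by (auto simp: interior_part_def half_chart_extension_def max_def split: if_splits)
  thus "z \<in> {z. Im z > 0}" using gb[of z] by (force simp: surface_boundary_def max_def)
 next
  fix z :: complex assume "z \<in> {z. Im z > 0}"
  thus "z \<in> interior_part M ?\<Psi>" using gi[of z] by (auto simp: interior_part_def half_chart_extension_def)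
 qed
qed

text \<open>Over the interior part a collar chart stays at height \<open>0\<close>; forgetting the
  height turns it into a chart of the interior, to which \<open>chart_degree\<close>
  applies.\<close>

lemma interior_part_embedding:
 assumes "collar_chart M e"
 shows "open_embedding (interior_part M e) (fst \<circ> e) (surface_interior M)"
proof -
 let ?N = "surface_interior M"
 have e: "continuous_on UNIV e" "inj e" "range e \<subseteq> collared M" "\<And>V. open V \<Longrightarrow> openin (top_of_set (collared M)) (e ` V)"
  using assms by (auto simp: collar_chart_def open_embedding_def)
 have cm: "continuous_map euclidean (top_of_set (collared M)) e"
  using e by (auto simp: continuous_map_in_subtopology)
 have W: "interior_part M e = e -` (collared M \<inter> ?N \<times> UNIV)"
  using e(3) collared_interior[of _ M] by (auto simp: interior_part_def mem_Times_iff prod_eq_iff)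
 have "openin (top_of_set (collared M)) (collared M \<inter> ?N \<times> UNIV)"
  by (rule openin_collared[OF openin_surface_interior])
 from openin_continuous_map_preimage[OF cm this]
 have oW: "open (interior_part M e)" unfolding W vimage_def by simp
 have op: "openin (top_of_set ?N) ((fst \<circ> e) ` V)" if V: "open V" "V \<subseteq> interior_part M e" for V
 proof -
  obtain O' where O': "open O'" "e ` V = collared M \<inter> O'" using e(4)[OF V(1)] by (auto simp: openin_open)
  have "(fst \<circ> e) ` V = {x \<in> ?N. (x, 0) \<in> O'}"
  proof (rule subset_antisym; rule subsetI)
   fix x assume "x \<in> (fst \<circ> e) ` V"
   then obtain v where v: "v \<in> V" "x = fst (e v)" by auto
   hence "x \<in> ?N" "e v = (x, 0)" using V(2) by (auto simp: interior_part_def prod_eq_iff)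
   moreover have "e v \<in> O'" using v(1) O'(2) by blast
   ultimately show "x \<in> {x \<in> ?N. (x, 0) \<in> O'}" by simp
  next
   fix x assume "x \<in> {x \<in> ?N. (x, 0) \<in> O'}"
   hence "(x, 0) \<in> e ` V" using O'(2) collared_interior[of x M 0] by blast
   then obtain v where "v \<in> V" "e v = (x, 0)" by (metis imageE)
   thus "x \<in> (fst \<circ> e) ` V" by (intro image_eqI[of _ _ v]) simp_all
  qed
  also have "\<dots> = ?N \<inter> (\<lambda>x. (x, 0)) -` O'" by auto
  also have "openin (top_of_set ?N) \<dots>"
   by (rule continuous_openin_preimage_gen[OF continuous_on_pair_zero O'(1)])
  finally show ?thesis .
 qed
 have "inj_on (fst \<circ> e) (interior_part M e)"
 proof (rule inj_onI)
  fix x y assume "x \<in> interior_part M e" "y \<in> interior_part M e" "(fst \<circ> e) x = (fst \<circ> e) y"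
  hence "e x = e y" by (auto simp: interior_part_def prod_eq_iff)
  thus "x = y" using e(2) by (simp add: inj_eq)
 qed
 moreover have "continuous_on (interior_part M e) (fst \<circ> e)"
  by (intro continuous_on_compose continuous_intros continuous_on_subset[OF e(1)]) auto
 ultimately show ?thesis unfolding open_embedding_def using oW op by (auto simp: interior_part_def)
qed

lemma collar_chart_cnj:
 assumes "collar_chart M e"
 shows "collar_chart M (e \<circ> cnj)" "range (e \<circ> cnj) = range e"
  "interior_part M (e \<circ> cnj) = cnj ` interior_part M e"
proof -
 have c: "cnj ` V = cnj -` V" for V
 proof (rule subset_antisym; rule subsetI)
  fix z assume "z \<in> cnj -` V"
  thus "z \<in> cnj ` V" by (intro image_eqI[of _ _ "cnj z"]) simp_all
 qed auto
 have r: "range cnj = UNIV" unfolding c by simp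
 show ran: "range (e \<circ> cnj) = range e" unfolding image_comp[symmetric] r ..
 have oc: "open (cnj ` V)" if "open V" for V
  unfolding c by (rule open_vimage[OF that]) (intro continuous_intros)
 have "openin (top_of_set (collared M)) (e ` V)" if "open V" for V
  using assms that by (simp add: collar_chart_def open_embedding_def)
 hence op: "openin (top_of_set (collared M)) ((e \<circ> cnj) ` V)" if "open V" for V
  using oc[OF that] by (simp only: image_comp[symmetric])
 have "open_embedding UNIV (e \<circ> cnj) (collared M)" unfolding open_embedding_def
 proof (intro conjI allI impI)
  have "continuous_on UNIV e" "inj e" using assms by (auto simp: collar_chart_def open_embedding_def)
  note e = this
  show "continuous_on UNIV (e \<circ> cnj)"
   by (rule continuous_on_compose[OF _ continuous_on_subset[OF e(1)]]) (auto intro!: continuous_intros)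
  show "inj (e \<circ> cnj)" by (rule inj_compose[OF e(2)]) (metis complex_cnj_cnj injI)
  show "range (e \<circ> cnj) \<subseteq> collared M" unfolding ran using assms by (auto simp: collar_chart_def open_embedding_def)
 qed (use op in auto)
 moreover have "\<forall>x t s. (x, t) \<in> range (e \<circ> cnj) \<longrightarrow> 0 \<le> s \<longrightarrow> s \<le> t \<longrightarrow> (x, s) \<in> range (e \<circ> cnj)"
  unfolding ran using assms unfolding collar_chart_def by (rule conjunct2)
 ultimately show "collar_chart M (e \<circ> cnj)" by (simp only: collar_chart_def simp_thms)
 show "interior_part M (e \<circ> cnj) = cnj ` interior_part M e"
  unfolding c by (simp add: interior_part_def vimage_def)
qed

section \<open>Orienting the collar atlas\<close>

context
 fixes M :: "'a::topological_space set" and \<mu>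
 assumes M: "surface_with_boundary M" and \<mu>: "local_orientation (surface_interior M) \<mu>"
begin

lemma Hausdorff_interior: "Hausdorff_space (top_of_set (surface_interior M))"
proof -
 have "top_of_set (surface_interior M) = subtopology (top_of_set M) (surface_interior M)"
  using surface_interior_subset[of M] by (simp add: subtopology_subtopology Int_absorb1)
 thus ?thesis using M Hausdorff_space_subtopology unfolding surface_with_boundary_def by metis
qed

text \<open>The degree is constant on a connected interior part, so at most one conjugation, which
  does not change the range, orients the whole chart.\<close>

lemma collar_chart_in_atlas:
 assumes e: "collar_chart M e" and con: "connected (interior_part M e)"
 obtains e' where "e' \<in> collar_atlas M \<mu>" "range e' = range e"
proof (cases "interior_part M e = {}")
 case True
 hence "e \<in> collar_atlas M \<mu>" using e by (simp add: collar_atlas_def)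
 thus thesis using that by blast
next
 case False
 then obtain w where w: "w \<in> interior_part M e" by blast
 note emb = interior_part_embedding[OF e]
 obtain s where s: "s \<in> {1, -1}" "chart_degree (surface_interior M) \<mu> (interior_part M e) (fst \<circ> e) w s"
  using chart_degree_exists[OF Hausdorff_interior \<mu> emb w] by blast
 have all: "chart_degree (surface_interior M) \<mu> (interior_part M e) (fst \<circ> e) v s" if "v \<in> interior_part M e" for v
  by (rule chart_degree_constant[OF Hausdorff_interior \<mu> emb con w that s(2)])
 show thesis
 proof (cases "s = 1")
  case True
  hence "e \<in> collar_atlas M \<mu>" using e all by (simp add: collar_atlas_def)
  thus thesis using that by blast
 next
  case False
  hence s1: "s = -1" using s(1) by simp
  note c = collar_chart_cnj[OF e]
  have "chart_degree (surface_interior M) \<mu> (interior_part M (e \<circ> cnj)) (fst \<circ> (e \<circ> cnj)) v 1"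
   if v: "v \<in> interior_part M (e \<circ> cnj)" for v
  proof -
   obtain u where u: "u \<in> interior_part M e" "v = cnj u" using v unfolding c(3) by blast
   show ?thesis
    using chart_degree_cnj[OF Hausdorff_interior \<mu> emb u(1) all[OF u(1)]] unfolding c(3) u(2) s1 by (simp add: o_assoc)
  qed
  hence "e \<circ> cnj \<in> collar_atlas M \<mu>" using c(1) by (simp add: collar_atlas_def)
  thus thesis using that c(2) by blast
 qed
qed

lemma collar_atlas_covers: "collared M \<subseteq> (\<Union>e\<in>collar_atlas M \<mu>. range e)"
proof
 fix p assume p: "p \<in> collared M"
 obtain x t where xt: "p = (x, t)" by force
 have x: "x \<in> M" "t \<ge> 0" "t = 0 \<or> x \<in> surface_boundary M" using p by (auto simp: xt collared_def)
 have "\<exists>e. collar_chart M e \<and> connected (interior_part M e) \<and> p \<in> range e"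
 proof (cases "x \<in> surface_interior M")
  case True
  obtain e where e: "open_embedding UNIV e M" "x \<in> range e" by (rule interior_chart[OF True])
  have "t = 0" using x(3) True by (auto simp: surface_boundary_def)
  hence "p \<in> range (\<lambda>z. (e z, 0))" using e(2) xt by auto
  thus ?thesis using interior_collar_chart[OF e(1)] by (metis connected_UNIV)
 next
  case False
  hence "x \<in> surface_boundary M" using x(1) by (simp add: surface_boundary_def)
  then obtain g k where g: "homeomorphism half_plane (g ` half_plane) g k" "openin (top_of_set M) (g ` half_plane)" "x = g 0"
   by (rule boundary_half_chart[OF M])
  note h = half_chart_collar_chart[OF g(1,2)]
  have "p \<in> range (half_chart_extension g)" unfolding h(2) using p g(3) xt by auto
  moreover have "connected (interior_part M (half_chart_extension g))"
   unfolding h(3) by (intro convex_connected convex_halfspace_Im_gt)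
  ultimately show ?thesis using h(1) by blast
 qed
 then obtain e where e: "collar_chart M e" "connected (interior_part M e)" "p \<in> range e" by blast
 obtain e' where "e' \<in> collar_atlas M \<mu>" "range e' = range e" by (rule collar_chart_in_atlas[OF e(1,2)])
 thus "p \<in> (\<Union>e\<in>collar_atlas M \<mu>. range e)" using e(3) by blast
qed

text \<open>A boundary point is the limit of points on the positive imaginary axis of a half-plane
  chart. This leads from the foot of a collar segment to points where \<open>\<mu>\<close> is
  available.\<close>

lemma interior_dense:
 assumes e: "collar_chart M e" "e a = (x, 0)" and B: "open B" "a \<in> B"
 obtains w where "w \<in> B" "w \<in> interior_part M e"
proof (cases "x \<in> surface_interior M")
 case True
 thus thesis using that[of a] B e(2) by (simp add: interior_part_def)
next
 case False
 have emb: "open_embedding UNIV e (collared M)" using e(1) by (simp add: collar_chart_def)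
 have "(x, 0) \<in> collared M" using emb e(2) unfolding open_embedding_def by (metis rangeI subsetD)
 hence "x \<in> surface_boundary M" using False by (auto simp: collared_def surface_boundary_def)
 then obtain g k where g: "homeomorphism half_plane (g ` half_plane) g k" "openin (top_of_set M) (g ` half_plane)" "x = g 0"
  by (rule boundary_half_chart[OF M])
 let ?\<Psi> = "half_chart_extension g"
 note h = half_chart_collar_chart[OF g(1,2)]
 have \<Psi>: "continuous_map euclidean (top_of_set (collared M)) ?\<Psi>"
  using h(1) by (auto simp: collar_chart_def open_embedding_def continuous_map_in_subtopology)
 have "openin (top_of_set (collared M)) (e ` B)" using emb B(1) by (auto simp: open_embedding_def)
 from openin_continuous_map_preimage[OF \<Psi> this] have "open {z. ?\<Psi> z \<in> e ` B}" by simp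
 moreover have "?\<Psi> 0 = e a" using g(3) e(2) by (simp add: half_chart_extension_def zero_complex.code)
 hence "0 \<in> {z. ?\<Psi> z \<in> e ` B}" using B(2) by simp
 ultimately obtain \<phi> where \<phi>: "\<phi> > 0" "ball 0 \<phi> \<subseteq> {z. ?\<Psi> z \<in> e ` B}" using open_contains_ball by blast
 define z where "z = \<i> * of_real (\<phi>/2)"
 have "z \<in> ball 0 \<phi>" using \<phi>(1) by (simp add: z_def norm_mult)
 hence "?\<Psi> z \<in> e ` B" using \<phi>(2) by blast
 then obtain w where w: "w \<in> B" "?\<Psi> z = e w" by blast
 have "z \<in> interior_part M ?\<Psi>" unfolding h(3) using \<phi>(1) by (simp add: z_def)
 hence "w \<in> interior_part M e" using w(2) by (simp add: interior_part_def)
 thus thesis using that w(1) by blast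
qed

end

context
 fixes M :: "'a::topological_space set" and \<mu>
 assumes M: "surface_with_boundary M" and \<mu>: "local_orientation (surface_interior M) \<mu>"
begin

lemma collar_atlas_embedding:
 assumes "e \<in> collar_atlas M \<mu>"
 shows "continuous_map euclidean (top_of_set (collared M)) e" "inj e"
  "\<And>V. open V \<Longrightarrow> openin (top_of_set (collared M)) (e ` V)" "range e \<subseteq> collared M"
 using assms by (auto simp: collar_atlas_def collar_chart_def open_embedding_def continuous_map_in_subtopology)

lemma collar_transition_continuous:
 assumes e: "e \<in> collar_atlas M \<mu>" and e': "e' \<in> collar_atlas M \<mu>"
 shows "open (e -` range e')" "continuous_on (e -` range e') (inv_into UNIV e' \<circ> e)"
  "inj_on (inv_into UNIV e' \<circ> e) (e -` range e')"
proof -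
 have "openin (top_of_set (collared M)) (range e')" using collar_atlas_embedding(3)[OF e'] by blast
 from openin_continuous_map_preimage[OF collar_atlas_embedding(1)[OF e] this]
 show "open (e -` range e')" by (simp add: vimage_def)
 have emb: "open_embedding UNIV e' (collared M)" using e' by (simp add: collar_atlas_def collar_chart_def)
 have "continuous_on UNIV e" using collar_atlas_embedding(1)[OF e] by (simp add: continuous_map_in_subtopology)
 hence ec: "continuous_on (e -` range e') e" by (rule continuous_on_subset) simp
 have im: "e ` (e -` range e') \<subseteq> range e'" by auto
 show "continuous_on (e -` range e') (inv_into UNIV e' \<circ> e)"
  by (rule continuous_on_compose[OF ec continuous_on_subset[OF open_embedding_inverse_continuous[OF emb] im]])
 show "inj_on (inv_into UNIV e' \<circ> e) (e -` range e')"
 proof (rule inj_onI)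
  fix x y assume xy: "x \<in> e -` range e'" "y \<in> e -` range e'" "(inv_into UNIV e' \<circ> e) x = (inv_into UNIV e' \<circ> e) y"
  hence "e x = e y" by (auto intro: inv_into_injective)
  thus "x = y" using collar_atlas_embedding(2)[OF e] by (simp add: inj_eq)
 qed
qed

text \<open>Near an interior point the inverse of \<open>fst \<circ> e'\<close> gives the same
  coordinates as the inverse of \<open>e'\<close>, so \<open>chart_degree_compatible\<close> speaks
  about the transition map itself.\<close>

lemma collar_transition_interior_degree:
 assumes e: "e \<in> collar_atlas M \<mu>" and e': "e' \<in> collar_atlas M \<mu>"
  and w: "w \<in> interior_part M e" "w \<in> e -` range e'"
 shows "index_at (\<lambda>u. (inv_into UNIV e' \<circ> e) u - (inv_into UNIV e' \<circ> e) w) w = 1"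
proof -
 let ?N = "surface_interior M" and ?T = "inv_into UNIV e' \<circ> e"
 let ?W = "interior_part M e" and ?W' = "interior_part M e'"
 have c: "collar_chart M e" "collar_chart M e'" using e e' by (auto simp: collar_atlas_def)
 have H: "Hausdorff_space (top_of_set ?N)" by (rule Hausdorff_interior[OF M \<mu>])
 have eT: "e' (?T v) = e v" if "v \<in> e -` range e'" for v using that by (simp add: f_inv_into_f)
 have w': "?T w \<in> ?W'" using w(1) eT[OF w(2)] by (simp add: interior_part_def)
 have d: "chart_degree ?N \<mu> ?W (fst \<circ> e) w 1" "chart_degree ?N \<mu> ?W' (fst \<circ> e') (?T w) 1"
  using e e' w(1) w' by (auto simp: collar_atlas_def)
 have eq: "(fst \<circ> e) w = (fst \<circ> e') (?T w)" using eT[OF w(2)] by simp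
 obtain r where r: "r > 0" "cball w r \<subseteq> ?W" "(fst \<circ> e) ` cball w r \<subseteq> (fst \<circ> e') ` ?W'"
  "winding_number (inv_into ?W' (fst \<circ> e') \<circ> (fst \<circ> e) \<circ> circlepath w r) (?T w) = 1"
  using chart_degree_compatible[OF H \<mu> interior_part_embedding[OF c(1)] w(1) d(1)
   interior_part_embedding[OF c(2)] w' d(2) eq] by blast
 have inj': "inj_on (fst \<circ> e') ?W'" using interior_part_embedding[OF c(2)] by (simp add: open_embedding_def)
 have key: "v \<in> e -` range e' \<and> inv_into ?W' (fst \<circ> e') ((fst \<circ> e) v) = ?T v" if v: "v \<in> cball w r" for v
 proof -
  obtain v' where v': "v' \<in> ?W'" "(fst \<circ> e) v = (fst \<circ> e') v'" using r(3) v by blast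
  moreover have "v \<in> ?W" using v r(2) by blast
  ultimately have ee: "e v = e' v'" by (auto simp: interior_part_def prod_eq_iff)
  hence "v \<in> e -` range e'" by auto
  moreover have "?T v = v'" using collar_atlas_embedding(2)[OF e'] ee by simp
  moreover have "inv_into ?W' (fst \<circ> e') ((fst \<circ> e) v) = v'" unfolding v'(2) by (rule inv_into_f_f[OF inj' v'(1)])
  ultimately show ?thesis by simp
 qed
 note T = collar_transition_continuous[OF e e']
 have sub: "cball w r \<subseteq> e -` range e'" using key by blast
 have "winding_number (?T \<circ> circlepath w r) (?T w) = winding_number (inv_into ?W' (fst \<circ> e') \<circ> (fst \<circ> e) \<circ> circlepath w r) (?T w)"
 proof (rule winding_number_cong)
  fix t :: real assume "0 \<le> t" "t \<le> 1"
  have "circlepath w r t \<in> cball w r" using r(1) by (simp add: circlepath norm_mult dist_norm)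
  from conjunct2[OF key[OF this]]
  show "(?T \<circ> circlepath w r) t = (inv_into ?W' (fst \<circ> e') \<circ> (fst \<circ> e) \<circ> circlepath w r) t"
   by (simp only: o_apply)
 qed
 thus ?thesis using r(4) local_degree_circle[OF T(2,3) r(1) sub] by simp
qed

text \<open>The transition degree at a point of the collar is transported down the segment to the boundary
 and from there to a nearby interior point.\<close>

lemma collar_transition_degree:
 assumes e: "e \<in> collar_atlas M \<mu>" and e': "e' \<in> collar_atlas M \<mu>" and eq: "e z = e' z'"
 shows "\<exists>r>0. e ` cball z r \<subseteq> range e' \<and> winding_number (inv_into UNIV e' \<circ> e \<circ> circlepath z r) z' = 1"
proof -
 let ?U = "e -` range e'" and ?T = "inv_into UNIV e' \<circ> e" and ?X = "collared M"
 note T = collar_transition_continuous[OF e e']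
 have c: "collar_chart M e" "collar_chart M e'" using e e' by (auto simp: collar_atlas_def)
 have emb: "open_embedding UNIV e ?X" using c(1) by (simp add: collar_chart_def)
 have inj: "inj e" using collar_atlas_embedding(2)[OF e] .
 obtain x t where xt: "e z = (x, t)" by force
 have "(x, t) \<in> ?X" using collar_atlas_embedding(4)[OF e] xt by (metis rangeI subsetD)
 hence t0: "t \<ge> 0" by (auto simp: collared_def)
 have seg: "{x} \<times> {0..t} \<subseteq> range e \<inter> range e'"
 proof clarify
  fix s assume s: "s \<in> {0..t}"
  have "(x, t) \<in> range e" "(x, t) \<in> range e'" using xt eq by (metis rangeI)+
  thus "(x, s) \<in> range e \<inter> range e'"
   using c s unfolding collar_chart_def by (metis Int_iff atLeastAtMost_iff)
 qed
 define \<sigma> where "\<sigma> = inv_into UNIV e ` ({x} \<times> {0..t})"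
 have con\<sigma>: "connected \<sigma>" unfolding \<sigma>_def
 proof (rule connected_continuous_image)
  show "continuous_on ({x} \<times> {0..t}) (inv_into UNIV e)"
   by (rule continuous_on_subset[OF open_embedding_inverse_continuous[OF emb]]) (use seg in blast)
  show "connected ({x} \<times> {0..t})" by (intro connected_Times) auto
 qed
 have \<sigma>U: "\<sigma> \<subseteq> ?U" unfolding \<sigma>_def
 proof (rule image_subsetI)
  fix p assume "p \<in> {x} \<times> {0..t}"
  hence p: "p \<in> range e" "p \<in> range e'" using seg by blast+
  have "e (inv_into UNIV e p) = p" by (rule f_inv_into_f[OF p(1)])
  thus "inv_into UNIV e p \<in> ?U" using p(2) by simp
 qed
 have z\<sigma>: "z \<in> \<sigma>" unfolding \<sigma>_def
 proof (rule image_eqI)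
  show "z = inv_into UNIV e (x, t)" using inj xt by (metis inv_into_f_f UNIV_I)
 qed (use t0 in simp)
 define a where "a = inv_into UNIV e (x, 0)"
 have x0: "(x, 0) \<in> {x} \<times> {0..t}" using t0 by simp
 hence a\<sigma>: "a \<in> \<sigma>" unfolding a_def \<sigma>_def by (rule imageI)
 have ea: "e a = (x, 0)" unfolding a_def by (rule f_inv_into_f) (use x0 seg in blast)
 obtain \<delta> where \<delta>: "\<delta> > 0" "ball a \<delta> \<subseteq> ?U" using T(1) a\<sigma> \<sigma>U open_contains_ball by blast
 have aB: "a \<in> ball a \<delta>" using \<delta>(1) by simp
 obtain w where w: "w \<in> ball a \<delta>" "w \<in> interior_part M e"
  by (rule interior_dense[OF M \<mu> c(1) ea open_ball aB])
 have wU: "w \<in> ?U" using w(1) \<delta>(2) by blast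
 have "index_at (\<lambda>u. ?T u - ?T w) w = 1" by (rule collar_transition_interior_degree[OF e e' w(2) wU])
 \<comment> \<open>A connected set inside the overlap joins \<open>z\<close> to \<open>w\<close>, so
   the degree known at \<open>w\<close> is also the one at \<open>z\<close>.\<close>
 moreover have "connected (\<sigma> \<union> ball a \<delta>)"
  by (rule connected_Un[OF con\<sigma>]) (use a\<sigma> aB in \<open>auto simp: convex_connected\<close>)
 ultimately have pz: "index_at (\<lambda>u. ?T u - ?T z) z = 1"
  by (intro local_degree_connected[OF T, of "\<sigma> \<union> ball a \<delta>" w z 1]) (use \<sigma>U \<delta>(2) w(1) z\<sigma> in auto)
 obtain r where r: "r > 0" "cball z r \<subseteq> ?U" using T(1) z\<sigma> \<sigma>U open_contains_cball by blast
 have "winding_number (?T \<circ> circlepath z r) (?T z) = 1"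
  using pz local_degree_circle[OF T(2,3) r] by simp
 moreover have "?T z = z'" using eq collar_atlas_embedding(2)[OF e'] by simp
 moreover have "e ` cball z r \<subseteq> range e'" using r(2) by blast
 ultimately show ?thesis using r(1) by auto
qed

lemma oriented_surface_collared: "oriented_surface (top_of_set (collared M)) (collar_atlas M \<mu>)"
proof
 let ?X = "collared M" and ?E = "collar_atlas M \<mu>"
 have "Hausdorff_space (prod_topology (top_of_set M) (euclidean :: real topology))"
  using M by (auto simp: Hausdorff_space_prod_topology surface_with_boundary_def)
 moreover have "prod_topology (top_of_set M) (euclidean :: real topology) = top_of_set (M \<times> UNIV)"
  using prod_topology_subtopology_eu[of M "UNIV :: real set"] by simp
 moreover have "top_of_set ?X = subtopology (top_of_set (M \<times> UNIV)) ?X"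
 proof -
  have "?X \<subseteq> M \<times> UNIV" by (auto simp: collared_def)
  thus ?thesis by (simp add: subtopology_subtopology Int_absorb1)
 qed
 ultimately show "Hausdorff_space (top_of_set ?X)" by (simp add: Hausdorff_space_subtopology)
 show "inj e" if "e \<in> ?E" for e using collar_atlas_embedding(2)[OF that] .
 show "openin (top_of_set ?X) U \<longleftrightarrow> U \<subseteq> (\<Union>e\<in>?E. range e) \<and> (\<forall>e\<in>?E. open (e -` U))" for U
 proof
  assume U: "openin (top_of_set ?X) U"
  have "open (e -` U)" if "e \<in> ?E" for e
   using openin_continuous_map_preimage[OF collar_atlas_embedding(1)[OF that] U] by (simp add: vimage_def)
  moreover have "U \<subseteq> (\<Union>e\<in>?E. range e)" using openin_imp_subset[OF U] collar_atlas_covers[OF M \<mu>] by (rule subset_trans)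
  ultimately show "U \<subseteq> (\<Union>e\<in>?E. range e) \<and> (\<forall>e\<in>?E. open (e -` U))" by simp
 next
  assume U: "U \<subseteq> (\<Union>e\<in>?E. range e) \<and> (\<forall>e\<in>?E. open (e -` U))"
  have "openin (top_of_set ?X) (\<Union>e\<in>?E. e ` (e -` U))"
  proof (rule openin_Union)
   fix S assume "S \<in> (\<lambda>e. e ` (e -` U)) ` ?E"
   then obtain e where e: "e \<in> ?E" "S = e ` (e -` U)" by blast
   show "openin (top_of_set ?X) S" unfolding e(2) by (rule collar_atlas_embedding(3)[OF e(1)]) (use U e(1) in blast)
  qed
  moreover have "(\<Union>e\<in>?E. e ` (e -` U)) = U"
  proof (rule subset_antisym; rule subsetI)
   fix u assume u: "u \<in> U"
   then obtain e z where "e \<in> ?E" "u = e z" using U by blast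
   thus "u \<in> (\<Union>e\<in>?E. e ` (e -` U))" using u by auto
  qed auto
  ultimately show "openin (top_of_set ?X) U" by simp
 qed
 show "open (e' -` (e ` W))" if "e \<in> ?E" "e' \<in> ?E" "open W" for e e' W
  using openin_continuous_map_preimage[OF collar_atlas_embedding(1)[OF that(2)] collar_atlas_embedding(3)[OF that(1,3)]]
  by (simp add: vimage_def)
 show "\<exists>r>0. e ` cball z r \<subseteq> range e' \<and> winding_number (inv_into UNIV e' \<circ> e \<circ> circlepath z r) z' = 1"
  if "e \<in> ?E" "e' \<in> ?E" "e z = e' z'" for e e' z z' by (rule collar_transition_degree[OF that])
qed

end

section \<open>Coverings\<close>

text \<open>A functor from the fundamental groupoid of \<open>Y\<close> to \<open>G\<close>. Having
  values on all paths, not just on loops, lets cosets be transported along every segment.\<close>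

locale path_functor = group G for G :: "('g, 'm) monoid_scheme" (structure) +
 fixes Y :: "'b::topological_space set" and h :: "(real \<Rightarrow> 'b) \<Rightarrow> 'g"
 assumes h_closed: "path c \<Longrightarrow> path_image c \<subseteq> Y \<Longrightarrow> h c \<in> carrier G"
  and h_join: "path c \<Longrightarrow> path d \<Longrightarrow> path_image c \<subseteq> Y \<Longrightarrow> path_image d \<subseteq> Y \<Longrightarrow>
   pathfinish c = pathstart d \<Longrightarrow> h (c +++ d) = h c \<otimes> h d"
  and h_homotopic: "homotopic_paths Y c d \<Longrightarrow> h c = h d"
begin

lemma segment_path:
 fixes k :: "'c::real_normed_vector \<Rightarrow> 'b"
 assumes "convex D" "continuous_on D k" "k ` D \<subseteq> Y" "u \<in> D" "v \<in> D"
 shows "path (seg k u v)" "path_image (seg k u v) \<subseteq> Y" "h (seg k u v) \<in> carrier G"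
proof -
 have "path_image (linepath u v) \<subseteq> D" using assms by (simp add: closed_segment_subset)
 thus *: "path (seg k u v)" "path_image (seg k u v) \<subseteq> Y"
  using assms(2,3) by (auto simp: path_image_compose intro!: path_continuous_image intro: continuous_on_subset)
 thus "h (seg k u v) \<in> carrier G" by (rule h_closed)
qed

lemma h_segment_join:
 fixes k :: "'c::real_normed_vector \<Rightarrow> 'b"
 assumes D: "convex D" "continuous_on D k" "k ` D \<subseteq> Y" and uvw: "u \<in> D" "v \<in> D" "w \<in> D"
 shows "h (seg k u w) = h (seg k u v) \<otimes> h (seg k v w)"
proof -
 have s: "path_image (linepath u v) \<subseteq> D" "path_image (linepath v w) \<subseteq> D" "path_image (linepath u w) \<subseteq> D"
  using D(1) uvw by (simp_all add: closed_segment_subset)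
 have "homotopic_paths Y (k \<circ> (linepath u v +++ linepath v w)) (seg k u w)"
  by (rule homotopic_paths_linear_image[OF D(2,3,1)]) (use s in \<open>auto simp: path_image_join\<close>)
 hence "h (seg k u w) = h ((seg k u v) +++ (seg k v w))" using h_homotopic by (simp add: path_compose_join)
 also have "\<dots> = h (seg k u v) \<otimes> h (seg k v w)"
  by (rule h_join) (use segment_path[OF D] uvw in \<open>auto simp: pathfinish_compose pathstart_compose\<close>)
 finally show ?thesis .
qed

lemma h_segment_refl:
 fixes k :: "'c::real_normed_vector \<Rightarrow> 'b"
 assumes D: "convex D" "continuous_on D k" "k ` D \<subseteq> Y" and "u \<in> D"
 shows "h (seg k u u) = \<one>"
proof -
 have "h (seg k u u) = h (seg k u u) \<otimes> h (seg k u u)" using h_segment_join[OF D assms(4,4,4)] .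
 thus ?thesis using segment_path(3)[OF D assms(4,4)] by (metis l_cancel_one)
qed

text \<open>The plane is simply connected: inside a chart only the end points of a path
  matter.\<close>

lemma h_plane:
 assumes "continuous_on UNIV e" "range e \<subseteq> Y" "path (p :: real \<Rightarrow> complex)"
 shows "h (e \<circ> p) = h (seg e (pathstart p) (pathfinish p))"
 by (intro h_homotopic homotopic_paths_linear_image[of UNIV]) (use assms in auto)

end

locale covering = path_functor G Y h + oriented_surface "top_of_set Y" E + subgroup H G
 for G :: "('g, 'm) monoid_scheme" (structure) and Y :: "'b::topological_space set" and h and E and H
begin

text \<open>The covering belonging to \<open>H\<close> consists of pairs of a point and a right coset of \<open>H\<close>; over a
 chart, cosets are transported along the images of straight segments.\<close>

definition lift_chart :: "(complex \<Rightarrow> 'b) \<Rightarrow> 'g \<Rightarrow> complex \<Rightarrow> 'b \<times> 'g set" where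
 "lift_chart e g z = (e z, H #> (g \<otimes> h (seg e 0 z)))"

definition lift_charts :: "(complex \<Rightarrow> 'b \<times> 'g set) set" where
 "lift_charts = {lift_chart e g | e g. e \<in> E \<and> g \<in> carrier G}"

text \<open>The final topology for the lifted charts, in the form that \<open>openin_iff\<close>
  asks for.\<close>

definition cover :: "('b \<times> 'g set) topology" where
 "cover = topology (\<lambda>U. U \<subseteq> (\<Union>e\<in>lift_charts. range e) \<and> (\<forall>e\<in>lift_charts. open (e -` U)))"

lemma openin_cover: "openin cover U \<longleftrightarrow> U \<subseteq> (\<Union>e\<in>lift_charts. range e) \<and> (\<forall>e\<in>lift_charts. open (e -` U))"
proof -
 have "istopology (\<lambda>U. U \<subseteq> (\<Union>e\<in>lift_charts. range e) \<and> (\<forall>e\<in>lift_charts. open (e -` U)))"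
  unfolding istopology_def
 proof (intro conjI allI impI)
  fix S T
  assume S: "S \<subseteq> (\<Union>e\<in>lift_charts. range e) \<and> (\<forall>e\<in>lift_charts. open (e -` S))"
   and T: "T \<subseteq> (\<Union>e\<in>lift_charts. range e) \<and> (\<forall>e\<in>lift_charts. open (e -` T))"
  show "S \<inter> T \<subseteq> (\<Union>e\<in>lift_charts. range e)" using S by blast
  show "\<forall>e\<in>lift_charts. open (e -` (S \<inter> T))" using S T by (simp add: open_Int)
 next
  fix K assume K: "\<forall>S\<in>K. S \<subseteq> (\<Union>e\<in>lift_charts. range e) \<and> (\<forall>e\<in>lift_charts. open (e -` S))"
  show "\<Union>K \<subseteq> (\<Union>e\<in>lift_charts. range e)" using K by blast
  show "\<forall>e\<in>lift_charts. open (e -` \<Union>K)" using K by (simp add: vimage_Union open_UN)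
 qed
 thus ?thesis unfolding cover_def by (simp add: topology_inverse')
qed

lemma rcos_mult_right:
 assumes "H #> a = H #> b" "a \<in> carrier G" "b \<in> carrier G" "c \<in> carrier G"
 shows "H #> (a \<otimes> c) = H #> (b \<otimes> c)" using assms coset_mult_assoc[OF subset] by metis

lemma rcos_cancel_right:
 assumes "H #> (a \<otimes> c) = H #> (b \<otimes> c)" "a \<in> carrier G" "b \<in> carrier G" "c \<in> carrier G"
 shows "H #> a = H #> b" using rcos_mult_right[OF assms(1), of "inv c"] assms(2-4) by (simp add: m_assoc)

lemma chart_embedding: "e \<in> E \<Longrightarrow> open_embedding UNIV e Y"
 using continuous_map_chart[of e] openin_chart_image[of e] chart_inj[of e]
 by (auto simp: open_embedding_def continuous_map_in_subtopology)

lemma chart_continuous_on: "e \<in> E \<Longrightarrow> continuous_on UNIV e" and chart_range: "e \<in> E \<Longrightarrow> range e \<subseteq> Y"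
 using chart_embedding[of e] by (auto simp: open_embedding_def)

lemma coord_continuous:
 assumes "e \<in> E" "continuous_on D k" "k ` D \<subseteq> range e"
 shows "continuous_on D (\<lambda>v. coord e (k v))"
 by (rule continuous_on_compose2[OF open_embedding_inverse_continuous[OF chart_embedding[OF assms(1)]] assms(2,3)])

lemma chart_segment:
 assumes "e \<in> E"
 shows "h (seg e z w) \<in> carrier G"
  "h (seg e z w) = h (seg e z u) \<otimes> h (seg e u w)"
 using segment_path(3)[of UNIV e z w] h_segment_join[of UNIV e z u w] chart_continuous_on[OF assms] chart_range[OF assms]
 by auto

lemma h_segment_chart:
 fixes k :: "'c::real_normed_vector \<Rightarrow> 'b"
 assumes "e \<in> E" "convex D" "continuous_on D k" "k ` D \<subseteq> range e" "u \<in> D" "v \<in> D"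
 shows "h (seg k u v) = h (seg e (coord e (k u)) (coord e (k v)))"
proof -
 have sD: "path_image (linepath u v) \<subseteq> D" using assms by (simp add: closed_segment_subset)
 have "path (seg (\<lambda>v. coord e (k v)) u v)"
  by (rule path_continuous_image[OF path_linepath continuous_on_subset[OF coord_continuous[OF assms(1,3,4)] sD]])
 from h_plane[OF chart_continuous_on[OF assms(1)] chart_range[OF assms(1)] this]
 have "h (e \<circ> (seg (\<lambda>v. coord e (k v)) u v)) = h (seg e (coord e (k u)) (coord e (k v)))"
  by (simp add: pathstart_compose pathfinish_compose)
 moreover have "homotopic_paths Y (seg k u v) (e \<circ> (seg (\<lambda>v. coord e (k v)) u v))"
 proof (rule homotopic_paths_eq)
  have kY: "k ` D \<subseteq> Y" using assms(4) chart_range[OF assms(1)] by blast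
  show "path (seg k u v)" "path_image (seg k u v) \<subseteq> Y"
   by (rule segment_path(1,2)[OF assms(2,3) kY assms(5,6)])+
  fix t :: real assume "t \<in> {0..1}"
  hence "linepath u v t \<in> D" using sD by (auto simp: path_image_def)
  hence "k (linepath u v t) \<in> range e" using assms(4) by blast
  thus "(seg k u v) t = (e \<circ> (seg (\<lambda>v. coord e (k v)) u v)) t" by (simp add: f_inv_into_f)
 qed
 ultimately show ?thesis using h_homotopic by simp
qed

lemma lift_chart_move:
 fixes k :: "'c::real_normed_vector \<Rightarrow> 'b"
 assumes "e \<in> E" "convex D" "continuous_on D k" "k ` D \<subseteq> range e" "u \<in> D" "v \<in> D" "g \<in> carrier G"
 shows "lift_chart e g (coord e (k v)) = (k v, H #> (g \<otimes> h (seg e 0 (coord e (k u))) \<otimes> h (seg k u v)))"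
proof -
 have "h (seg e 0 (coord e (k v))) = h (seg e 0 (coord e (k u))) \<otimes> h (seg k u v)"
  unfolding h_segment_chart[OF assms(1-6)] by (rule chart_segment(2)[OF assms(1)])
 moreover have "k v \<in> range e" using assms(4,6) by blast
 hence "e (coord e (k v)) = k v" by (rule f_inv_into_f)
 moreover have "h (seg k u v) \<in> carrier G"
  unfolding h_segment_chart[OF assms(1-6)] by (rule chart_segment(1)[OF assms(1)])
 ultimately show ?thesis using chart_segment(1)[OF assms(1)] assms(7) by (simp add: lift_chart_def m_assoc)
qed

text \<open>The image of the segment from \<open>z'\<close> to \<open>v\<close> is read in both
  charts, and both transport the coset by its value under \<open>h\<close>. So lifted charts
  agreeing at one point agree over the whole convex piece.\<close>

lemma lift_chart_agree:
 assumes e: "e \<in> E" "g \<in> carrier G" and e': "e' \<in> E" "g' \<in> carrier G"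
  and eq: "lift_chart e g z = lift_chart e' g' z'" and D: "convex D" "z' \<in> D" "e' ` D \<subseteq> range e" "v \<in> D"
 shows "lift_chart e' g' v = lift_chart e g (coord e (e' v))"
proof -
 have c: "continuous_on D e'" using chart_continuous_on[OF e'(1)] by (rule continuous_on_subset) simp
 have ez: "e z = e' z'" and K: "H #> (g \<otimes> h (seg e 0 z)) = H #> (g' \<otimes> h (seg e' 0 z'))"
  using eq by (auto simp: lift_chart_def)
 have z: "coord e (e' z') = z" using coord_chart[OF e(1), of z] ez by simp
 have "lift_chart e g (coord e (e' v)) = (e' v, H #> (g \<otimes> h (seg e 0 z) \<otimes> h (seg e' z' v)))"
  using lift_chart_move[OF e(1) D(1) c D(3,2,4) e(2)] z by simp
 also have "\<dots> = (e' v, H #> (g' \<otimes> h (seg e' 0 z') \<otimes> h (seg e' z' v)))"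
  using rcos_mult_right[OF K] e(2) e'(2) chart_segment(1) e(1) e'(1) by simp
 also have "g' \<otimes> h (seg e' 0 z') \<otimes> h (seg e' z' v) = g' \<otimes> h (seg e' 0 v)"
  using chart_segment[OF e'(1)] e'(2) by (simp add: m_assoc)
 finally show ?thesis by (simp add: lift_chart_def)
qed

lemma lift_chart_inj: "e \<in> E \<Longrightarrow> inj (lift_chart e g)"
 using chart_inj[of e] by (auto simp: inj_def lift_chart_def)

lemma lift_chart_open:
 assumes "\<phi> \<in> lift_charts" "\<phi>' \<in> lift_charts" "open W"
 shows "open (\<phi>' -` (\<phi> ` W))" unfolding open_contains_ball
proof
 obtain e g where e: "e \<in> E" "g \<in> carrier G" "\<phi> = lift_chart e g" using assms(1) by (auto simp: lift_charts_def)
 obtain e' g' where e': "e' \<in> E" "g' \<in> carrier G" "\<phi>' = lift_chart e' g'" using assms(2) by (auto simp: lift_charts_def)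
 fix z' assume "z' \<in> \<phi>' -` (\<phi> ` W)"
 then obtain z where z: "z \<in> W" "\<phi> z = \<phi>' z'" by fastforce
 hence "e' z' = e z" by (simp add: e(3) e'(3) lift_chart_def)
 hence "z' \<in> e' -` (e ` W)" using z(1) by auto
 then obtain r where r: "r > 0" "ball z' r \<subseteq> e' -` (e ` W)"
  using chart_open[OF e(1) e'(1) assms(3)] open_contains_ball by blast
 have sub: "e' ` ball z' r \<subseteq> range e" using r(2) by blast
 have "ball z' r \<subseteq> \<phi>' -` (\<phi> ` W)"
 proof
  fix v assume v: "v \<in> ball z' r"
  then obtain w where w: "w \<in> W" "e' v = e w" using r(2) by blast
  have "\<phi>' v = \<phi> (coord e (e' v))" unfolding e(3) e'(3)
   by (rule lift_chart_agree[OF e(1,2) e'(1,2) z(2)[unfolded e(3) e'(3)] convex_ball _ sub v]) (use r(1) in simp)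
  thus "v \<in> \<phi>' -` (\<phi> ` W)" using w coord_chart[OF e(1)] by auto
 qed
 thus "\<exists>r>0. ball z' r \<subseteq> \<phi>' -` (\<phi> ` W)" using r(1) by blast
qed

text \<open>Lifted charts have the transition maps of the charts below, so the orientation is
  inherited. For the Hausdorff property, points over different base points are separated in
  \<open>Y\<close>, and points over the same base point by two sheets over one chart.\<close>

lemma oriented_surface_cover: "oriented_surface cover lift_charts"
proof
 show "openin cover U \<longleftrightarrow> U \<subseteq> (\<Union>e\<in>lift_charts. range e) \<and> (\<forall>e\<in>lift_charts. open (e -` U))" for U
  by (rule openin_cover)
 show "inj e" if "e \<in> lift_charts" for e using that lift_chart_inj by (auto simp: lift_charts_def)
 show "open (e' -` (e ` W))" if "e \<in> lift_charts" "e' \<in> lift_charts" "open W" for e e' W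
  by (rule lift_chart_open[OF that])
 show "\<exists>r>0. \<phi> ` cball z r \<subseteq> range \<phi>' \<and> winding_number (coord \<phi>' \<circ> \<phi> \<circ> circlepath z r) z' = 1"
  if mem: "\<phi> \<in> lift_charts" "\<phi>' \<in> lift_charts" and eq: "\<phi> z = \<phi>' z'" for \<phi> \<phi>' z z'
 proof -
  obtain e g where e: "e \<in> E" "g \<in> carrier G" "\<phi> = lift_chart e g" using mem(1) by (auto simp: lift_charts_def)
  obtain e' g' where e': "e' \<in> E" "g' \<in> carrier G" "\<phi>' = lift_chart e' g'" using mem(2) by (auto simp: lift_charts_def)
  have ee: "e z = e' z'" using eq by (simp add: e(3) e'(3) lift_chart_def)
  obtain r where r: "r > 0" "e ` cball z r \<subseteq> range e'" "winding_number (coord e' \<circ> e \<circ> circlepath z r) z' = 1"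
   using oriented[OF e(1) e'(1) ee] by blast
  have ag: "\<phi> v = \<phi>' (coord e' (e v))" if "v \<in> cball z r" for v unfolding e(3) e'(3)
   by (rule lift_chart_agree[OF e'(1,2) e(1,2) eq[symmetric, unfolded e(3) e'(3)] convex_cball _ r(2) that]) (use r(1) in simp)
  have inj': "inj \<phi>'" unfolding e'(3) by (rule lift_chart_inj[OF e'(1)])
  have "winding_number (coord \<phi>' \<circ> \<phi> \<circ> circlepath z r) z' = winding_number (coord e' \<circ> e \<circ> circlepath z r) z'"
  proof (rule winding_number_cong)
   fix t :: real assume "0 \<le> t" "t \<le> 1"
   have "circlepath z r t \<in> cball z r" using r(1) by (simp add: circlepath norm_mult dist_norm)
   from ag[OF this] show "(coord \<phi>' \<circ> \<phi> \<circ> circlepath z r) t = (coord e' \<circ> e \<circ> circlepath z r) t"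
    using inj' by simp
  qed
  moreover have "\<phi> ` cball z r \<subseteq> range \<phi>'" using ag by blast
  ultimately show ?thesis using r(1,3) by auto
 qed
 have lc: "lift_chart e g \<in> lift_charts" if "e \<in> E" "g \<in> carrier G" for e g using that by (auto simp: lift_charts_def)
 have op: "openin cover (\<phi> ` W)" if "\<phi> \<in> lift_charts" "open W" for \<phi> W
  unfolding openin_cover using lift_chart_open[OF that(1) _ that(2)] that(1) by blast
 have top: "topspace cover = (\<Union>e\<in>lift_charts. range e)"
 proof (rule subset_antisym)
  show "topspace cover \<subseteq> (\<Union>e\<in>lift_charts. range e)" using openin_cover openin_topspace by blast
  show "(\<Union>e\<in>lift_charts. range e) \<subseteq> topspace cover" using op[OF _ open_UNIV] openin_subset by blast
 qed
 show "Hausdorff_space cover" unfolding Hausdorff_space_def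
 proof (intro allI impI)
  fix a b assume ab: "a \<in> topspace cover \<and> b \<in> topspace cover \<and> a \<noteq> b"
  obtain e g z where a: "e \<in> E" "g \<in> carrier G" "a = lift_chart e g z" using ab by (auto simp: top lift_charts_def)
  obtain e' g' z' where b: "e' \<in> E" "g' \<in> carrier G" "b = lift_chart e' g' z'" using ab by (auto simp: top lift_charts_def)
  show "\<exists>U V. openin cover U \<and> openin cover V \<and> a \<in> U \<and> b \<in> V \<and> disjnt U V"
  proof (cases "e z = e' z'")
   case False
   then obtain U V where UV: "openin (top_of_set Y) U" "openin (top_of_set Y) V" "e z \<in> U" "e' z' \<in> V" "disjnt U V"
    using hausdorff chart_in_topspace a(1) b(1) unfolding Hausdorff_space_def by meson
   have fo: "openin cover {p \<in> topspace cover. fst p \<in> U}" if U: "openin (top_of_set Y) U" for U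
    unfolding openin_cover
   proof (intro conjI ballI)
    show "{p \<in> topspace cover. fst p \<in> U} \<subseteq> (\<Union>e\<in>lift_charts. range e)" using top by blast
    fix \<phi> assume \<phi>: "\<phi> \<in> lift_charts"
    then obtain e g where e: "e \<in> E" "\<phi> = lift_chart e g" by (auto simp: lift_charts_def)
    have "\<phi> v \<in> topspace cover" "fst (\<phi> v) = e v" for v
     using \<phi> unfolding top by (blast, simp add: e(2) lift_chart_def)
    hence "\<phi> -` {p \<in> topspace cover. fst p \<in> U} = e -` U" by auto
    thus "open (\<phi> -` {p \<in> topspace cover. fst p \<in> U})" using open_chart_vimage[OF e(1) U] by simp
   qed
   show ?thesis
   proof (intro exI conjI)
    show "a \<in> {p \<in> topspace cover. fst p \<in> U}" "b \<in> {p \<in> topspace cover. fst p \<in> V}"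
     using ab UV(3,4) a(3) b(3) by (auto simp: lift_chart_def)
    show "disjnt {p \<in> topspace cover. fst p \<in> U} {p \<in> topspace cover. fst p \<in> V}"
     using UV(5) by (auto simp: disjnt_iff)
   qed (use fo UV(1,2) in auto)
  next
   case True
   \<comment> \<open>\<open>?x\<close> relabels the sheet through \<open>b\<close> so that it lies
     over the chart \<open>e\<close> used for \<open>a\<close>; sheets over one chart coincide or
     are disjoint.\<close>
   let ?x = "g' \<otimes> h (seg e' 0 z') \<otimes> inv (h (seg e 0 z))"
   have cl: "h (seg e 0 w) \<in> carrier G" "h (seg e' 0 w) \<in> carrier G" for w
    using chart_segment(1) a(1) b(1) by blast+
   have x: "?x \<in> carrier G" using cl b(2) by simp
   have "?x \<otimes> h (seg e 0 z) = g' \<otimes> h (seg e' 0 z')" using cl b(2) by (simp add: m_assoc)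
   hence b': "b = lift_chart e ?x z" unfolding b(3) lift_chart_def using True by simp
   have ne: "H #> g \<noteq> H #> ?x"
   proof
    assume "H #> g = H #> ?x"
    from rcos_mult_right[OF this a(2) x cl(1)[of z]] have "a = b" unfolding a(3) b' lift_chart_def by simp
    thus False using ab by simp
   qed
   show ?thesis
   proof (intro exI conjI)
    show "openin cover (range (lift_chart e g))" "openin cover (range (lift_chart e ?x))"
     using op lc a(1,2) x by blast+
    show "disjnt (range (lift_chart e g)) (range (lift_chart e ?x))"
    proof (rule ccontr)
     assume "\<not> ?thesis"
     then obtain v w where vw: "lift_chart e g v = lift_chart e ?x w" unfolding disjnt_def by blast
     hence "e v = e w" by (simp add: lift_chart_def)
     hence "v = w" using chart_inj[OF a(1)] by (simp add: inj_eq)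
     hence "H #> (g \<otimes> h (seg e 0 w)) = H #> (?x \<otimes> h (seg e 0 w))" using vw by (simp add: lift_chart_def)
     hence "H #> g = H #> ?x" by (rule rcos_cancel_right[OF _ a(2) x cl(1)])
     thus False using ne by simp
    qed
    show "a \<in> range (lift_chart e g)" "b \<in> range (lift_chart e ?x)" using a(3) b' by auto
   qed
  qed
 qed
qed

end

sublocale covering \<subseteq> cov: oriented_surface cover lift_charts by (rule oriented_surface_cover)

section \<open>Lifts of maps from convex sets\<close>

context covering
begin

lemma lift_chartsI: "e \<in> E \<Longrightarrow> g \<in> carrier G \<Longrightarrow> lift_chart e g \<in> lift_charts"
 unfolding lift_charts_def by blast

text \<open>The straight segment from \<open>b\<close> is a canonical path in a convex domain, so
  lifting is a formula and needs no subdivision. Paths are lifted from \<open>{0..1}\<close> with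
  \<open>b = 0\<close>, homotopies from the unit square.\<close>

definition lift :: "('c::real_normed_vector \<Rightarrow> 'b) \<Rightarrow> 'c \<Rightarrow> 'c \<Rightarrow> 'b \<times> 'g set" where
 "lift k b v = (k v, H #> h (seg k b v))"

text \<open>Near \<open>u\<close> the lift is the coordinate map followed by a single lifted chart;
  continuity of the lift comes from this.\<close>

lemma lift_local:
 assumes D: "convex D" "continuous_on D k" "k ` D \<subseteq> Y" "b \<in> D" "u \<in> D"
  and D': "convex D'" "D' \<subseteq> D" "u \<in> D'" "k ` D' \<subseteq> range e" "v \<in> D'" and e: "e \<in> E"
 shows "lift k b v = lift_chart e (h (seg k b u) \<otimes> inv (h (seg e 0 (coord e (k u))))) (coord e (k v))"
proof -
 let ?a = "h (seg e 0 (coord e (k u)))"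
 have c: "?a \<in> carrier G" "h (seg k b u) \<in> carrier G"
  using chart_segment(1)[OF e] segment_path(3)[OF D(1-5)] by auto
 have "lift_chart e (h (seg k b u) \<otimes> inv ?a) (coord e (k v)) =
  (k v, H #> (h (seg k b u) \<otimes> inv ?a \<otimes> ?a \<otimes> h (seg k u v)))"
  by (rule lift_chart_move[OF e D'(1) continuous_on_subset[OF D(2) D'(2)] D'(4) D'(3,5)]) (use c in simp)
 also have "h (seg k b u) \<otimes> inv ?a \<otimes> ?a \<otimes> h (seg k u v) = h (seg k b u) \<otimes> h (seg k u v)"
  using c by (simp add: m_assoc)
 also have "\<dots> = h (seg k b v)"
  by (rule h_segment_join[OF D(1-4) _ , symmetric]) (use D(5) D'(2,5) in auto)
 finally show ?thesis unfolding lift_def by (rule sym)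
qed

lemma lift_in_cover:
 assumes D: "convex D" "continuous_on D k" "k ` D \<subseteq> Y" "b \<in> D" "u \<in> D"
 shows "lift k b u \<in> topspace cover"
proof -
 have "k u \<in> topspace (top_of_set Y)" using D by auto
 then obtain e z where e: "e \<in> E" "k u = e z" using in_range_chart by blast
 have "lift k b u = lift_chart e (h (seg k b u) \<otimes> inv (h (seg e 0 (coord e (k u))))) (coord e (k u))"
  by (rule lift_local[OF D convex_singleton]) (use e D in auto)
 moreover have "lift_chart e (h (seg k b u) \<otimes> inv (h (seg e 0 (coord e (k u))))) \<in> lift_charts"
  using segment_path(3)[OF D] chart_segment(1)[OF e(1)] by (intro lift_chartsI e(1)) simp
 ultimately show ?thesis unfolding cov.topspace_eq by (metis UN_I rangeI)
qed

lemma lift_continuous: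
 assumes D: "convex D" "continuous_on D k" "k ` D \<subseteq> Y" "b \<in> D"
 shows "continuous_map (top_of_set D) cover (lift k b)" unfolding continuous_map_def
proof (intro conjI allI impI)
 show "lift k b \<in> topspace (top_of_set D) \<rightarrow> topspace cover" using lift_in_cover[OF D] by auto
 fix U assume U: "openin cover U"
 have cm: "continuous_map (top_of_set D) (top_of_set Y) k" using D by (auto simp: continuous_map_in_subtopology)
 show "openin (top_of_set D) {x \<in> topspace (top_of_set D). lift k b x \<in> U}"
 proof (subst openin_subopen, intro ballI)
  fix u assume "u \<in> {x \<in> topspace (top_of_set D). lift k b x \<in> U}"
  hence u: "u \<in> D" "lift k b u \<in> U" by auto
  have "k u \<in> topspace (top_of_set Y)" using D u(1) by auto
  then obtain e z where e: "e \<in> E" "k u = e z" using in_range_chart by blast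
  have "openin (top_of_set D) {x \<in> D. k x \<in> range e}"
   using openin_continuous_map_preimage[OF cm openin_chart_image[OF e(1) open_UNIV]] by simp
  moreover have "u \<in> {x \<in> D. k x \<in> range e}" using u e(2) by auto
  ultimately obtain \<delta> where \<delta>: "\<delta> > 0" "ball u \<delta> \<inter> D \<subseteq> {x \<in> D. k x \<in> range e}"
   unfolding openin_contains_ball by blast
  define D' where "D' = ball u \<delta> \<inter> D"
  have D': "convex D'" "D' \<subseteq> D" "u \<in> D'" "k ` D' \<subseteq> range e"
   using \<delta> u(1) D(1) by (auto simp: D'_def convex_Int)
  define \<phi> where "\<phi> = lift_chart e (h (seg k b u) \<otimes> inv (h (seg e 0 (coord e (k u)))))"
  have ll: "lift k b v = \<phi> (coord e (k v))" if "v \<in> D'" for v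
   unfolding \<phi>_def by (rule lift_local[OF D u(1) D' that e(1)])
  have "\<phi> \<in> lift_charts"
   unfolding \<phi>_def using segment_path(3)[OF D u(1)] chart_segment(1)[OF e(1)] by (intro lift_chartsI e(1)) simp
  hence "open (\<phi> -` U)" by (rule cov.open_chart_vimage[OF _ U])
  hence "openin (top_of_set D') (D' \<inter> (\<lambda>v. coord e (k v)) -` (\<phi> -` U))"
   by (rule continuous_openin_preimage_gen[OF coord_continuous[OF e(1) continuous_on_subset[OF D(2) D'(2)] D'(4)]])
  moreover have "openin (top_of_set D) D'" unfolding D'_def by (simp add: openin_open_Int Int_commute)
  ultimately have "openin (top_of_set D) (D' \<inter> (\<lambda>v. coord e (k v)) -` (\<phi> -` U))" by (rule openin_trans)
  moreover have "u \<in> D' \<inter> (\<lambda>v. coord e (k v)) -` (\<phi> -` U)" using ll[OF D'(3)] D'(3) u(2) by simp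
  moreover have "D' \<inter> (\<lambda>v. coord e (k v)) -` (\<phi> -` U) \<subseteq> {x \<in> topspace (top_of_set D). lift k b x \<in> U}"
   using ll D'(2) by auto
  ultimately show "\<exists>T. openin (top_of_set D) T \<and> u \<in> T \<and> T \<subseteq> {x \<in> topspace (top_of_set D). lift k b x \<in> U}" by blast
 qed
qed

lemma lift_path_continuous:
 "path c \<Longrightarrow> path_image c \<subseteq> Y \<Longrightarrow> continuous_map (top_of_set {0..1}) cover (lift c 0)"
 by (rule lift_continuous) (auto simp: path_def path_image_def)

lemma h_cong:
 assumes "path c" "path_image c \<subseteq> Y" "\<And>t. t \<in> {0..1} \<Longrightarrow> c t = d t"
 shows "h c = h d" by (rule h_homotopic[OF homotopic_paths_eq[OF assms]])

lemma initial_segment: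
 assumes "path c" "path_image c \<subseteq> Y" "t \<in> {0..1}"
 shows "path (seg c 0 t)" "path_image (seg c 0 t) \<subseteq> Y" "h (seg c 0 t) \<in> carrier G"
 using segment_path[of "{0..1}" c 0 t] assms by (auto simp: path_def path_image_def)

lemma h_linepath01: "h (seg c 0 1) = h c"
proof -
 have "seg c 0 1 = c" by (auto simp: linepath_def fun_eq_iff)
 thus ?thesis by simp
qed

lemma h_linepath00:
 assumes "path c" "path_image c \<subseteq> Y"
 shows "h (seg c 0 0) = \<one>"
 using h_segment_refl[of "{0..1}" c 0] assms by (auto simp: path_def path_image_def)

lemma lift_start: "path c \<Longrightarrow> path_image c \<subseteq> Y \<Longrightarrow> lift c 0 0 = (pathstart c, H)"
 by (simp add: lift_def h_linepath00 pathstart_def coset_mult_one[OF subset])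

lemma lift_end: "lift c 0 1 = (pathfinish c, H #> h c)" by (simp add: lift_def h_linepath01 pathfinish_def)

lemma h_join_initial:
 assumes c: "path c" "path_image c \<subseteq> Y" and d: "path d" "path_image d \<subseteq> Y" and cd: "pathfinish c = pathstart d"
  and t: "t \<in> {0..1}"
 shows "h (seg (c +++ d) 0 t) = (if t \<le> 1/2 then h (seg c 0 (2 * t)) else h c \<otimes> h (seg d 0 (2 * t - 1)))"
proof -
 have j: "path (c +++ d)" "path_image (c +++ d) \<subseteq> Y" using c d cd by (simp_all add: subset_path_image_join)
 have low: "h (seg (c +++ d) 0 s) = h (seg c 0 (2 * s))" if s: "s \<in> {0..1}" "s \<le> 1/2" for s
 proof (rule h_cong)
  show "path (seg (c +++ d) 0 s)" "path_image (seg (c +++ d) 0 s) \<subseteq> Y"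
   using initial_segment[OF j s(1)] by auto
  fix x :: real assume x: "x \<in> {0..1}"
  have "x * s \<le> 1 * (1/2)" by (rule mult_mono) (use x s in auto)
  thus "(seg (c +++ d) 0 s) x = (seg c 0 (2 * s)) x" by (simp add: joinpaths_def linepath_def mult_ac)
 qed
 show ?thesis
 proof (cases "t \<le> 1/2")
  case True
  thus ?thesis using low[OF t] by simp
 next
  case False
  have D: "convex {0..1::real}" "continuous_on {0..1} (c +++ d)" "(c +++ d) ` {0..1} \<subseteq> Y"
   using j by (auto simp: path_def path_image_def)
  have "h (seg (c +++ d) 0 t) = h (seg (c +++ d) 0 (1/2)) \<otimes> h (seg (c +++ d) (1/2) t)"
   by (rule h_segment_join[OF D]) (use t in auto)
  moreover have "h (seg (c +++ d) 0 (1/2)) = h c" using low[of "1/2"] h_linepath01[of c] by simp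
  moreover have "h (seg (c +++ d) (1/2) t) = h (seg d 0 (2 * t - 1))"
  proof (rule h_cong)
   show "path (seg (c +++ d) (1/2) t)" "path_image (seg (c +++ d) (1/2) t) \<subseteq> Y"
    using segment_path(1,2)[OF D, of "1/2" t] t by auto
   fix x :: real assume x: "x \<in> {0..1}"
   have l: "linepath (1/2) t x = 1/2 + x * (t - 1/2)" by (simp add: linepath_def field_simps)
   have m: "2 * (1/2 + x * (t - 1/2)) - 1 = linepath 0 (2 * t - 1) x" by (simp add: linepath_def field_simps)
   have ge: "x * (t - 1/2) \<ge> 0" using x False by simp
   show "(seg (c +++ d) (1/2) t) x = (seg d 0 (2 * t - 1)) x"
   proof (cases "x * (t - 1/2) = 0")
    case True
    hence z: "linepath 0 (2 * t - 1) x = 0" using m by (simp add: mult.commute)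
    show ?thesis using cd unfolding o_apply l True z by (simp add: joinpaths_def pathfinish_def pathstart_def)
   next
    case False
    thus ?thesis using ge unfolding o_apply l m[symmetric] by (simp add: joinpaths_def)
   qed
  qed
  ultimately show ?thesis using False by simp
 qed
qed

lemma rcos_absorb: "a \<in> H \<Longrightarrow> b \<in> carrier G \<Longrightarrow> H #> (a \<otimes> b) = H #> b"
 using coset_mult_assoc[OF subset, of a b] coset_join2[OF _ is_subgroup] mem_carrier by metis

text \<open>After \<open>c\<close> the lift is back at the base coset because \<open>h c\<close>
  lies in \<open>H\<close>, so the lift of \<open>d\<close> can simply be appended.\<close>

lemma lift_join:
 assumes c: "path c" "path_image c \<subseteq> Y" and d: "path d" "path_image d \<subseteq> Y" and cd: "pathfinish c = pathstart d"
  and hc: "h c \<in> H" and t: "t \<in> {0..1}"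
 shows "lift (c +++ d) 0 t = (if t \<le> 1/2 then lift c 0 (2 * t) else lift d 0 (2 * t - 1))"
proof (cases "t \<le> 1/2")
 case True
 thus ?thesis using h_join_initial[OF c d cd t] by (simp add: lift_def joinpaths_def)
next
 case False
 hence "h (seg d 0 (2 * t - 1)) \<in> carrier G" by (intro initial_segment[OF d]) (use t in auto)
 thus ?thesis using h_join_initial[OF c d cd t] False by (simp add: lift_def joinpaths_def rcos_absorb[OF hc])
qed

text \<open>The unit square is convex, so the homotopy is lifted by the same formula, and
  \<open>K\<close> is its compact image. If the punctures of \<open>\<Theta>\<close> are off
  \<open>K\<close>, composing with \<open>\<Theta>\<close> gives a homotopy in the punctured
  plane.\<close>

lemma lift_homotopy:
 assumes hom: "homotopic_paths Y c d"
 obtains K where "compactin cover K" "lift c 0 ` {0..1} \<subseteq> K" "lift d 0 ` {0..1} \<subseteq> K"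
  "\<And>Q \<Theta>. cov.punctured Q \<Theta> \<Longrightarrow> Q \<inter> K = {} \<Longrightarrow> wind (\<Theta> \<circ> lift c 0) = wind (\<Theta> \<circ> lift d 0)"
proof -
 obtain F where F: "continuous_on ({0..1} \<times> {0..1}) F" "F \<in> ({0..1} \<times> {0..1}) \<rightarrow> Y"
  "\<forall>x\<in>{0..1}. F (0, x) = c x" "\<forall>x\<in>{0..1}. F (1, x) = d x"
  "\<forall>t\<in>{0..1::real}. pathstart (F \<circ> Pair t) = pathstart c \<and> pathfinish (F \<circ> Pair t) = pathfinish c"
  using hom unfolding homotopic_paths by blast
 let ?D = "{0..1::real} \<times> {0..1::real}"
 let ?F = "lift F (0, 0)"
 have D: "convex ?D" "continuous_on ?D F" "F ` ?D \<subseteq> Y" using F by (auto intro: convex_Times)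
 have D0: "(0, 0) \<in> ?D" by simp
 have pc: "path c" "path_image c \<subseteq> Y" "path d" "path_image d \<subseteq> Y"
  using hom homotopic_paths_imp_path homotopic_paths_imp_subset by blast+
 have F0: "F (s, 0) = c 0" "F (s, 1) = c 1" if "s \<in> {0..1}" for s
  using F(5) that by (auto simp: pathstart_def pathfinish_def)
 \<comment> \<open>End points are fixed during the homotopy, so it is constant on the sides
   \<open>b = 0\<close> and \<open>b = 1\<close> of the square, and the transport along them is
   trivial.\<close>
 have const: "h (seg F (0, b) (s, b)) = \<one>" if b: "b = 0 \<or> b = 1" and s: "s \<in> {0..1}" for b s
 proof -
  have eq: "(seg F (0, b) (s, b)) x = (seg F (0, b) (0, b)) x" if x: "x \<in> {0..1}" for x
  proof -
   have "linepath (0, b) (s, b) x = (x * s, b)" "linepath (0, b) (0, b) x = (0, b)"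
    by (auto simp: linepath_def algebra_simps)
   moreover have "x * s \<in> {0..1}" using x s by (auto intro: mult_le_one)
   ultimately show ?thesis using F0[of "x * s"] F0[of 0] b by auto
  qed
  have "h (seg F (0, b) (s, b)) = h (seg F (0, b) (0, b))"
   by (rule h_cong) (use segment_path(1,2)[OF D, of "(0, b)" "(s, b)"] b s eq in auto)
  also have "\<dots> = \<one>" by (rule h_segment_refl[OF D]) (use b in auto)
  finally show ?thesis .
 qed
 have side: "h (seg F (s, 0) (s, t)) = h (seg p 0 t)"
  if s: "s \<in> {0..1}" and t: "t \<in> {0..1}" and p: "\<And>x. x \<in> {0..1} \<Longrightarrow> F (s, x) = p x" for s t p
 proof (rule h_cong)
  show "path (seg F (s, 0) (s, t))" "path_image (seg F (s, 0) (s, t)) \<subseteq> Y"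
   using segment_path(1,2)[OF D, of "(s, 0)" "(s, t)"] s t by auto
  fix x :: real assume x: "x \<in> {0..1}"
  have "linepath (s, 0) (s, t) x = (s, x * t)" "linepath 0 t x = x * t" by (auto simp: linepath_def algebra_simps)
  moreover have "x * t \<in> {0..1}" using x t by (auto intro: mult_le_one)
  ultimately show "(seg F (s, 0) (s, t)) x = (seg p 0 t) x" using p by simp
 qed
 have bottom: "?F (0, t) = lift c 0 t" if "t \<in> {0..1}" for t
  using side[of 0 t c] that F(3) by (simp add: lift_def)
 have top: "?F (1, t) = lift d 0 t" if t: "t \<in> {0..1}" for t
 proof -
  have "h (seg F (0, 0) (1, t)) = h (seg F (0, 0) (1, 0)) \<otimes> h (seg F (1, 0) (1, t))"
   by (rule h_segment_join[OF D]) (use t in auto)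
  also have "\<dots> = h (seg d 0 t)" using const[of 0 1] side[of 1 t d] t F(4) initial_segment(3)[OF pc(3,4) t] by simp
  finally show ?thesis using t F(4) by (simp add: lift_def)
 qed
 have left: "?F (s, 0) = (c 0, H)" if s: "s \<in> {0..1}" for s
  using const[of 0 s] s F0 coset_mult_one[OF subset] by (simp add: lift_def)
 have right: "?F (s, 1) = (c 1, H #> h c)" if s: "s \<in> {0..1}" for s
 proof -
  have "h (seg F (0, 0) (s, 1)) = h (seg F (0, 0) (0, 1)) \<otimes> h (seg F (0, 1) (s, 1))"
   by (rule h_segment_join[OF D]) (use s in auto)
  also have "\<dots> = h c" using const[of 1 s] side[of 0 1 c] s F(3) h_linepath01[of c] h_closed[OF pc(1,2)] by simp
  finally show ?thesis using s F0 by (simp add: lift_def)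
 qed
 have cm: "continuous_map (top_of_set ?D) cover ?F" by (rule lift_continuous[OF D D0])
 let ?K = "?F ` ?D"
 have KX: "?K \<subseteq> topspace cover" using lift_in_cover[OF D D0] by blast
 have "compactin cover ?K"
  by (rule image_compactin[OF _ cm]) (simp add: compactin_subtopology compact_Times)
 moreover have "lift c 0 ` {0..1} \<subseteq> ?K"
 proof (rule image_subsetI)
  fix t :: real assume "t \<in> {0..1}"
  hence "lift c 0 t = ?F (0, t)" "(0, t) \<in> ?D" using bottom by auto
  thus "lift c 0 t \<in> ?K" by (rule image_eqI)
 qed
 moreover have "lift d 0 ` {0..1} \<subseteq> ?K"
 proof (rule image_subsetI)
  fix t :: real assume "t \<in> {0..1}"
  hence "lift d 0 t = ?F (1, t)" "(1, t) \<in> ?D" using top by auto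
  thus "lift d 0 t \<in> ?K" by (rule image_eqI)
 qed
 moreover have "wind (\<Theta> \<circ> lift c 0) = wind (\<Theta> \<circ> lift d 0)"
  if \<Theta>: "cov.punctured Q \<Theta>" "Q \<inter> ?K = {}" for Q \<Theta>
 proof (rule winding_number_homotopic_paths)
  let ?X = "topspace cover - Q"
  have KQ: "?K \<subseteq> ?X" using KX \<Theta>(2) by blast
  have c\<Theta>: "continuous_map (subtopology cover ?X) euclidean \<Theta>"
   by (rule cov.chart_continuous_imp_continuous_map) (use \<Theta>(1) in \<open>auto simp: cov.punctured_def\<close>)
  have "continuous_map (top_of_set ?D) (subtopology cover ?X) ?F"
   unfolding continuous_map_in_subtopology using cm KQ by (simp only: topspace_euclidean_subtopology image_subset_iff_funcset)
  from continuous_map_compose[OF this c\<Theta>] have cF: "continuous_on ?D (\<Theta> \<circ> ?F)" by (simp only: continuous_map_iff_continuous)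
  have nz: "\<Theta> (?F p) \<noteq> 0" if "p \<in> ?D" for p
  proof -
   have "?F p \<in> ?X" using KQ that by blast
   hence "cmod (\<Theta> (?F p)) = 1" using \<Theta>(1) by (simp add: cov.punctured_def)
   thus ?thesis by auto
  qed
  show "homotopic_paths (- {0}) (\<Theta> \<circ> lift c 0) (\<Theta> \<circ> lift d 0)"
   unfolding homotopic_paths
  proof (intro exI[of _ "\<Theta> \<circ> ?F"] conjI ballI)
   show "continuous_on ?D (\<Theta> \<circ> ?F)" by (rule cF)
   show "(\<Theta> \<circ> ?F) \<in> ?D \<rightarrow> - {0}" using nz by auto
   show "(\<Theta> \<circ> ?F) (0, x) = (\<Theta> \<circ> lift c 0) x" if "x \<in> {0..1}" for x using bottom[OF that] by simp
   show "(\<Theta> \<circ> ?F) (1, x) = (\<Theta> \<circ> lift d 0) x" if "x \<in> {0..1}" for x using top[OF that] by simp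
   fix s :: real assume s: "s \<in> {0..1}"
   show "pathstart ((\<Theta> \<circ> ?F) \<circ> Pair s) = pathstart (\<Theta> \<circ> lift c 0)"
    using left[OF s] lift_start[OF pc(1,2)] by (simp add: pathstart_def)
   show "pathfinish ((\<Theta> \<circ> ?F) \<circ> Pair s) = pathfinish (\<Theta> \<circ> lift c 0)"
    using right[OF s] lift_end[of c] by (simp add: pathfinish_def)
  qed
 qed
 ultimately show thesis by (rule that)
qed

end

section \<open>Powers of loops and winding numbers of their lifts\<close>

primrec loop_power :: "(real \<Rightarrow> 'a::topological_space) \<Rightarrow> nat \<Rightarrow> real \<Rightarrow> 'a" where
 "loop_power c 0 = (\<lambda>t. c 0)"
| "loop_power c (Suc n) = c +++ loop_power c n"

lemma loop_at_power: "loop_at Y p c \<Longrightarrow> loop_at Y p (loop_power c n)"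
proof (induction n)
 case 0
 hence "p \<in> Y" "c 0 = p" by (auto simp: loop_at_def pathstart_def path_image_def)
 thus ?case using loop_at_const by simp
qed (simp add: loop_at_join)

context path_functor
begin

lemma loop_closed: "loop_at Y p c \<Longrightarrow> h c \<in> carrier G"
 by (auto simp: loop_at_def intro: h_closed)

lemma h_loop_join: "loop_at Y p c \<Longrightarrow> loop_at Y p d \<Longrightarrow> h (c +++ d) = h c \<otimes> h d"
 by (auto simp: loop_at_def intro: h_join)

lemma h_const: "p \<in> Y \<Longrightarrow> h (\<lambda>t. p) = \<one>"
 using h_segment_refl[of UNIV "\<lambda>_::real. p" 0] by (simp add: o_def)

lemma h_loop_power: "loop_at Y p c \<Longrightarrow> h (loop_power c n) = h c [^] n"
proof (induction n)
 case 0
 hence "p \<in> Y" "c 0 = p" by (auto simp: loop_at_def pathstart_def path_image_def)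
 thus ?case using h_const by simp
next
 case (Suc n)
 thus ?case using h_loop_join[OF Suc.prems loop_at_power[OF Suc.prems]] nat_pow_Suc2[OF loop_closed[OF Suc.prems]] by simp
qed

end

context covering
begin

lemma punctured_lift_path:
 assumes "cov.punctured Q \<Theta>" "path c" "path_image c \<subseteq> Y" "lift c 0 ` {0..1} \<inter> Q = {}"
 shows "path (\<Theta> \<circ> lift c 0)" "0 \<notin> path_image (\<Theta> \<circ> lift c 0)"
proof -
 note cl = lift_path_continuous[OF assms(2,3)]
 have im: "lift c 0 ` {0..1} \<subseteq> topspace cover - Q"
  using continuous_map_image_subset_topspace[OF cl] assms(4) by auto
 show "path (\<Theta> \<circ> lift c 0)"
  by (rule cov.chart_continuous_path[OF _ cl im]) (use assms(1) in \<open>auto simp: cov.punctured_def\<close>)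
 have "\<Theta> (lift c 0 t) \<noteq> 0" if "t \<in> {0..1}" for t
 proof -
  have "lift c 0 t \<in> topspace cover - Q" using im that by blast
  hence "cmod (\<Theta> (lift c 0 t)) = 1" using assms(1) by (simp add: cov.punctured_def)
  thus ?thesis by auto
 qed
 thus "0 \<notin> path_image (\<Theta> \<circ> lift c 0)" by (auto simp: path_image_def)
qed

lemma lift_loop_start: "loop_at Y p c \<Longrightarrow> lift c 0 0 = (p, H)"
 by (simp add: loop_at_def lift_start)

lemma lift_loop_end: "loop_at Y p c \<Longrightarrow> h c \<in> H \<Longrightarrow> lift c 0 1 = (p, H)"
 using coset_join2[OF _ is_subgroup] mem_carrier by (simp add: loop_at_def lift_end)

lemma lift_loop_power_image:
 assumes c: "loop_at Y p c" "h c \<in> H"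
 shows "lift (loop_power c n) 0 ` {0..1} \<subseteq> lift c 0 ` {0..1}"
proof (induction n)
 case 0
 have p: "p \<in> Y" "c 0 = p" using c by (auto simp: loop_at_def pathstart_def path_image_def)
 have "lift (\<lambda>t. p) 0 t = lift c 0 0" for t :: real
  using h_const[OF p(1)] lift_loop_start[OF c(1)] coset_mult_one[OF subset] by (simp add: lift_def o_def)
 hence "lift (loop_power c 0) 0 ` {0..1} \<subseteq> {lift c 0 0}" using p(2) by auto
 thus ?case by auto
next
 case (Suc n)
 have p: "path c" "path_image c \<subseteq> Y" "path (loop_power c n)" "path_image (loop_power c n) \<subseteq> Y" "pathfinish c = pathstart (loop_power c n)"
  using c loop_at_power[OF c(1), of n] by (auto simp: loop_at_def)
 show ?case
 proof (rule image_subsetI)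
  fix t :: real assume t: "t \<in> {0..1}"
  show "lift (loop_power c (Suc n)) 0 t \<in> lift c 0 ` {0..1}"
  proof (cases "t \<le> 1/2")
   case True
   thus ?thesis using lift_join[OF p c(2) t] t by auto
  next
   case False
   hence "lift (loop_power c (Suc n)) 0 t = lift (loop_power c n) 0 (2 * t - 1)" using lift_join[OF p c(2) t] by simp
   moreover have "2 * t - 1 \<in> {0..1}" using False t by auto
   ultimately show ?thesis using Suc by blast
  qed
 qed
qed

lemma lift_image_loop_power:
 assumes c: "loop_at Y p c" "h c \<in> H" and "n > 0"
 shows "lift c 0 ` {0..1} \<subseteq> lift (loop_power c n) 0 ` {0..1}"
proof (rule image_subsetI)
 obtain m where m: "n = Suc m" using assms(3) gr0_implies_Suc by blast
 have p: "path c" "path_image c \<subseteq> Y" "path (loop_power c m)" "path_image (loop_power c m) \<subseteq> Y" "pathfinish c = pathstart (loop_power c m)"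
  using c loop_at_power[OF c(1), of m] by (auto simp: loop_at_def)
 fix t :: real assume t: "t \<in> {0..1}"
 hence t2: "t / 2 \<in> {0..1}" "t / 2 \<le> 1 / 2" by auto
 have "lift (loop_power c n) 0 (t / 2) = lift c 0 t" using lift_join[OF p c(2) t2(1)] t2(2) by (simp add: m)
 thus "lift c 0 t \<in> lift (loop_power c n) 0 ` {0..1}" using t2(1) by (metis imageI)
qed

lemma winding_loop_power:
 assumes \<Theta>: "cov.punctured Q \<Theta>" and c: "loop_at Y p c" "h c \<in> H" "lift c 0 ` {0..1} \<inter> Q = {}"
 shows "wind (\<Theta> \<circ> lift (loop_power c n) 0) = of_nat n * wind (\<Theta> \<circ> lift c 0)"
proof (induction n)
 case 0
 have p: "p \<in> Y" "c 0 = p" using c by (auto simp: loop_at_def pathstart_def path_image_def)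
 have "lift (\<lambda>t. p) 0 t = lift c 0 0" for t :: real
  using h_const[OF p(1)] lift_loop_start[OF c(1)] coset_mult_one[OF subset] by (simp add: lift_def o_def)
 hence "\<Theta> \<circ> lift (loop_power c 0) 0 = (\<lambda>t. \<Theta> (lift c 0 0))" using p by (simp add: o_def)
 moreover have "\<Theta> (lift c 0 0) \<noteq> 0"
  using punctured_lift_path(2)[OF \<Theta> _ _ c(3)] c(1) by (force simp: loop_at_def path_image_def)
 ultimately show ?case using winding_number_zero_const by simp
next
 case (Suc n)
 let ?d = "loop_power c n"
 have d: "loop_at Y p ?d" by (rule loop_at_power[OF c(1)])
 have p: "path c" "path_image c \<subseteq> Y" "path ?d" "path_image ?d \<subseteq> Y" "pathfinish c = pathstart ?d"
  using c d by (auto simp: loop_at_def)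
 have dQ: "lift ?d 0 ` {0..1} \<inter> Q = {}" using lift_loop_power_image[OF c(1,2)] c(3) by blast
 have "wind (\<Theta> \<circ> lift (loop_power c (Suc n)) 0) = wind ((\<Theta> \<circ> lift c 0) +++ (\<Theta> \<circ> lift ?d 0))"
 proof (rule winding_number_cong)
  fix t :: real assume "0 \<le> t" "t \<le> 1"
  thus "(\<Theta> \<circ> lift (loop_power c (Suc n)) 0) t = ((\<Theta> \<circ> lift c 0) +++ (\<Theta> \<circ> lift ?d 0)) t"
   using lift_join[OF p c(2), of t] by (simp add: joinpaths_def)
 qed
 also have "\<dots> = wind (\<Theta> \<circ> lift c 0) + wind (\<Theta> \<circ> lift ?d 0)"
  by (rule winding_number_join)
   (use punctured_lift_path[OF \<Theta> p(1,2) c(3)] punctured_lift_path[OF \<Theta> p(3,4) dQ] lift_loop_end[OF c(1,2)] lift_loop_start[OF d]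
    in \<open>auto simp: pathfinish_def pathstart_def\<close>)
 finally show ?case using Suc by (simp add: algebra_simps o_def)
qed

text \<open>Comparing winding numbers gives \<open>d = l * i\<close> with an integer
  \<open>i\<close>. The case \<open>l = 0\<close>, a null-homotopic power of \<open>c\<close>, is
  the one for finite order of \<open>x\<close>; there the winding number \<open>0\<close>
  contradicts \<open>d > 0\<close>.\<close>

lemma loop_power_winding_obstruction:
 assumes c: "loop_at Y p c" "h c \<in> H" and a: "loop_at Y p a" "h a \<in> H" and d: "d > 0"
  and hom: "homotopic_paths Y (loop_power c d) (loop_power a l)"
 obtains K where "compactin cover K" "lift c 0 ` {0..1} \<subseteq> K"
  "\<And>Q \<Theta>. cov.punctured Q \<Theta> \<Longrightarrow> Q \<inter> K = {} \<Longrightarrow> wind (\<Theta> \<circ> lift c 0) = 1 \<Longrightarrow> l dvd d"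
proof -
 obtain K where K: "compactin cover K" "lift (loop_power c d) 0 ` {0..1} \<subseteq> K" "lift (loop_power a l) 0 ` {0..1} \<subseteq> K"
  "\<And>Q \<Theta>. cov.punctured Q \<Theta> \<Longrightarrow> Q \<inter> K = {} \<Longrightarrow>
   wind (\<Theta> \<circ> lift (loop_power c d) 0) = wind (\<Theta> \<circ> lift (loop_power a l) 0)"
  by (rule lift_homotopy[OF hom]) blast
 have cK: "lift c 0 ` {0..1} \<subseteq> K" using lift_image_loop_power[OF c d] K(2) by blast
 have "l dvd d" if \<Theta>: "cov.punctured Q \<Theta>" "Q \<inter> K = {}" "wind (\<Theta> \<circ> lift c 0) = 1" for Q \<Theta>
 proof -
  have cQ: "lift c 0 ` {0..1} \<inter> Q = {}" using cK \<Theta>(2) by blast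
  have d1: "wind (\<Theta> \<circ> lift (loop_power a l) 0) = of_nat d"
   using K(4)[OF \<Theta>(1,2)] winding_loop_power[OF \<Theta>(1) c cQ] \<Theta>(3) by simp
  show ?thesis
  proof (cases "l = 0")
   case True
   have p: "p \<in> Y" "a 0 = p" using a by (auto simp: loop_at_def pathstart_def path_image_def)
   have "lift (\<lambda>t. p) 0 t = (p, H)" for t :: real
    using h_const[OF p(1)] coset_mult_one[OF subset] by (simp add: lift_def o_def)
   moreover have "loop_at Y p (loop_power a l)" by (rule loop_at_power[OF a(1)])
   hence "\<Theta> (lift (loop_power a l) 0 0) \<noteq> 0"
    using punctured_lift_path(2)[OF \<Theta>(1), of "loop_power a l"] K(3) \<Theta>(2) by (force simp: loop_at_def path_image_def)
   ultimately have "wind (\<Theta> \<circ> lift (loop_power a l) 0) = 0"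
    using winding_number_zero_const True p(2) by (simp add: o_def)
   thus ?thesis using d1 d by simp
  next
   case False
   hence aQ: "lift a 0 ` {0..1} \<inter> Q = {}" using lift_image_loop_power[OF a, of l] K(3) \<Theta>(2) by blast
   have pa: "path a" "path_image a \<subseteq> Y" using a(1) by (auto simp: loop_at_def)
   have "wind (\<Theta> \<circ> lift a 0) \<in> \<int>" by (rule integer_winding_number)
     (use punctured_lift_path[OF \<Theta>(1) pa aQ] lift_loop_end[OF a] lift_loop_start[OF a(1)] in \<open>auto simp: pathfinish_def pathstart_def\<close>)
   then obtain i where "wind (\<Theta> \<circ> lift a 0) = of_int i" by (auto elim: Ints_cases)
   hence "(of_int (int l * i) :: complex) = of_int (int d)"
    using winding_loop_power[OF \<Theta>(1) a aQ, of l] d1 by simp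
   hence "int l * i = int d" by (simp only: of_int_eq_iff)
   hence "int l dvd int d" by (metis dvd_triv_left)
   thus ?thesis by simp
  qed
 qed
 thus thesis using that K(1) cK by blast
qed

end

context covering
begin

subsection \<open>Flat line bundles on a covering\<close>

definition coset_rep :: "'g set \<Rightarrow> 'g" where
 "coset_rep K = (SOME k. k \<in> K)"

text \<open>A lifted chart determines the chart below, but the group element only up to left
  multiplication by \<open>H\<close>; one pair is fixed once and for all.\<close>

definition chart_base :: "(complex \<Rightarrow> 'b \<times> 'g set) \<Rightarrow> (complex \<Rightarrow> 'b) \<times> 'g" where
 "chart_base \<phi> = (SOME eg. \<phi> = lift_chart (fst eg) (snd eg) \<and> fst eg \<in> E \<and> snd eg \<in> carrier G)"

definition chart_elt :: "(complex \<Rightarrow> 'b \<times> 'g set) \<Rightarrow> complex \<Rightarrow> 'g" where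
 "chart_elt \<phi> z = snd (chart_base \<phi>) \<otimes> h (fst (chart_base \<phi>) \<circ> linepath 0 z)"

text \<open>The line bundle of a character \<open>\<xi>\<close> of \<open>H\<close>, trivialized at each point of the covering by an
 arbitrary representative of its coset.\<close>

definition twist :: "('g \<Rightarrow> complex) \<Rightarrow> (complex \<Rightarrow> 'b \<times> 'g set) \<Rightarrow> 'b \<times> 'g set \<Rightarrow> complex" where
 "twist \<xi> \<phi> x = \<xi> (coset_rep (snd x) \<otimes> inv (chart_elt \<phi> (coord \<phi> x)))"

lemma chart_base:
 assumes "\<phi> \<in> lift_charts"
 shows "\<phi> = lift_chart (fst (chart_base \<phi>)) (snd (chart_base \<phi>))" "fst (chart_base \<phi>) \<in> E" "snd (chart_base \<phi>) \<in> carrier G"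
proof -
 have "\<exists>eg. \<phi> = lift_chart (fst eg) (snd eg) \<and> fst eg \<in> E \<and> snd eg \<in> carrier G"
  using assms unfolding lift_charts_def by force
 from someI_ex[OF this] show "\<phi> = lift_chart (fst (chart_base \<phi>)) (snd (chart_base \<phi>))"
  "fst (chart_base \<phi>) \<in> E" "snd (chart_base \<phi>) \<in> carrier G"
  unfolding chart_base_def[symmetric] by blast+
qed

lemma chart_eval:
 assumes "\<phi> \<in> lift_charts"
 shows "\<phi> z = (fst (chart_base \<phi>) z, H #> chart_elt \<phi> z)" "chart_elt \<phi> z \<in> carrier G"
 using chart_base[OF assms] chart_segment(1)[OF chart_base(2)[OF assms]]
 by (metis lift_chart_def chart_elt_def, simp add: chart_elt_def)

lemma coord_eval:
 assumes "\<phi> \<in> lift_charts" "x \<in> range \<phi>"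
 shows "coord \<phi> x = coord (fst (chart_base \<phi>)) (fst x)"
 using assms chart_eval(1)[OF assms(1)] cov.coord_chart[OF assms(1)] coord_chart[OF chart_base(2)[OF assms(1)]]
 by (metis fst_conv imageE)

lemma chart_elt_move:
 fixes k :: "'c::real_normed_vector \<Rightarrow> 'b"
 assumes \<phi>: "\<phi> \<in> lift_charts" and e: "e = fst (chart_base \<phi>)"
  and D: "convex D" "continuous_on D k" "k ` D \<subseteq> range e" "u \<in> D" "v \<in> D"
 shows "chart_elt \<phi> (coord e (k v)) = chart_elt \<phi> (coord e (k u)) \<otimes> h (seg k u v)"
proof -
 have eE: "e \<in> E" using chart_base(2)[OF \<phi>] e by simp
 have "h (seg e 0 (coord e (k v))) = h (seg e 0 (coord e (k u))) \<otimes> h (seg k u v)"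
  unfolding h_segment_chart[OF eE D] by (rule chart_segment(2)[OF eE])
 moreover have "h (seg k u v) \<in> carrier G"
  unfolding h_segment_chart[OF eE D] by (rule chart_segment(1)[OF eE])
 ultimately show ?thesis
  unfolding chart_elt_def e[symmetric] using chart_base(3)[OF \<phi>] chart_segment(1)[OF eE] by (simp add: m_assoc)
qed

lemma coset_rep:
 assumes "a \<in> carrier G"
 shows "coset_rep (H #> a) \<in> carrier G" "coset_rep (H #> a) \<otimes> inv a \<in> H"
proof -
 have "a \<in> H #> a" by (rule rcos_self[OF assms is_subgroup])
 hence m: "coset_rep (H #> a) \<in> H #> a" unfolding coset_rep_def by (rule someI)
 thus "coset_rep (H #> a) \<in> carrier G" using elemrcos_carrier[OF is_group assms] by blast
 thus "coset_rep (H #> a) \<otimes> inv a \<in> H" using m rcos_module[OF is_group assms] by blast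
qed

lemma quot_cancel:
 assumes "a \<in> carrier G" "b \<in> carrier G" "q \<in> carrier G"
 shows "(b \<otimes> q) \<otimes> inv (a \<otimes> q) = b \<otimes> inv a"
 using assms by (simp add: inv_mult_group m_assoc) (simp add: m_assoc[symmetric])

context
 fixes \<xi> :: "'g \<Rightarrow> complex" and n :: nat
 assumes n: "n > 0" and \<xi>_mult: "\<And>a b. a \<in> H \<Longrightarrow> b \<in> H \<Longrightarrow> \<xi> (a \<otimes> b) = \<xi> a * \<xi> b"
  and \<xi>_root: "\<And>a. a \<in> H \<Longrightarrow> \<xi> a ^ n = 1"
begin

lemma character_nonzero: "a \<in> H \<Longrightarrow> \<xi> a \<noteq> 0"
 using \<xi>_root[of a] n by (auto simp: power_0_left)

text \<open>Changing the reference element from \<open>b\<close> to \<open>a\<close> multiplies the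
  character value by a factor that does not involve \<open>k\<close>; such factors are the
  transition functions of the bundle.\<close>

lemma character_quot:
 assumes "k \<in> carrier G" "a \<in> carrier G" "b \<in> carrier G" "k \<otimes> inv a \<in> H" "k \<otimes> inv b \<in> H"
 shows "\<xi> (k \<otimes> inv a) = \<xi> (k \<otimes> inv b) * \<xi> (b \<otimes> inv a)"
proof -
 have eq: "(k \<otimes> inv b) \<otimes> (b \<otimes> inv a) = k \<otimes> inv a"
  using assms by (simp add: m_assoc) (simp add: m_assoc[symmetric])
 have "b \<otimes> inv a = inv (k \<otimes> inv b) \<otimes> (k \<otimes> inv a)"
  using assms by (simp add: inv_mult_group m_assoc) (simp add: m_assoc[symmetric])
 hence "b \<otimes> inv a \<in> H" using assms(4,5) by simp
 thus ?thesis using \<xi>_mult[OF assms(5)] eq by metis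
qed

lemma twist_eval:
 assumes "\<phi> \<in> lift_charts" "x = \<phi> z"
 shows "coset_rep (snd x) \<in> carrier G" "coset_rep (snd x) \<otimes> inv (chart_elt \<phi> z) \<in> H"
  "twist \<xi> \<phi> x = \<xi> (coset_rep (snd x) \<otimes> inv (chart_elt \<phi> z))"
proof -
 have "snd x = H #> chart_elt \<phi> z" using chart_eval(1)[OF assms(1), of z] assms(2) by simp
 thus "coset_rep (snd x) \<in> carrier G" "coset_rep (snd x) \<otimes> inv (chart_elt \<phi> z) \<in> H"
  using coset_rep[OF chart_eval(2)[OF assms(1), of z]] by simp_all
 have "coord \<phi> x = z" using cov.coord_chart[OF assms(1), of z] assms(2) by simp
 thus "twist \<xi> \<phi> x = \<xi> (coset_rep (snd x) \<otimes> inv (chart_elt \<phi> z))" by (simp add: twist_def)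
qed

text \<open>Moving along a common segment multiplies both chart elements on the right by the same
  group element, which cancels in the quotient. So the transition functions are constant near each
  point.\<close>

lemma local_system_twist: "cov.local_system n (twist \<xi>)" unfolding cov.local_system_def
proof (intro conjI ballI)
 show "n > 0" by (rule n)
 fix \<phi> x assume "\<phi> \<in> lift_charts" "x \<in> range \<phi>"
 thus "twist \<xi> \<phi> x ^ n = 1" using twist_eval(2,3) \<xi>_root by (metis imageE)
next
 fix \<phi> \<phi>' x assume \<phi>: "\<phi> \<in> lift_charts" and \<phi>': "\<phi>' \<in> lift_charts" and x: "x \<in> range \<phi> \<inter> range \<phi>'"
 obtain z where z: "x = \<phi> z" using x by blast
 obtain z' where z': "x = \<phi>' z'" using x by blast
 define e where "e = fst (chart_base \<phi>)"
 define e' where "e' = fst (chart_base \<phi>')"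
 have E: "e \<in> E" "e' \<in> E" using chart_base(2) \<phi> \<phi>' by (auto simp: e_def e'_def)
 have zz: "e z = e' z'" using chart_eval(1)[OF \<phi>, of z] chart_eval(1)[OF \<phi>', of z'] z z' by (simp add: e_def e'_def)
 have "open (e -` range e')" by (rule open_chart_vimage[OF E(1) openin_chart_image[OF E(2) open_UNIV]])
 moreover have "z \<in> e -` range e'" using zz by auto
 ultimately obtain r where r: "r > 0" "ball z r \<subseteq> e -` range e'" using open_contains_ball by blast
 have c: "continuous_on (ball z r) e" using chart_continuous_on[OF E(1)] by (rule continuous_on_subset) simp
 have im: "e ` ball z r \<subseteq> range e" "e ` ball z r \<subseteq> range e'" using r(2) by auto
 have zb: "z \<in> ball z r" using r(1) by simp
 have quot: "twist \<xi> \<phi> y / twist \<xi> \<phi>' y = \<xi> (chart_elt \<phi>' z' \<otimes> inv (chart_elt \<phi> z))"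
  if y: "y \<in> \<phi> ` ball z r" "y \<in> range \<phi>'" for y
 proof -
  obtain v where v: "v \<in> ball z r" "y = \<phi> v" using y(1) by blast
  obtain v' where v': "y = \<phi>' v'" using y(2) by blast
  have vv: "e v = e' v'" using chart_eval(1)[OF \<phi>, of v] chart_eval(1)[OF \<phi>', of v'] v v' by (simp add: e_def e'_def)
  let ?q = "h (seg e z v)"
  have a: "chart_elt \<phi> v = chart_elt \<phi> z \<otimes> ?q"
   using chart_elt_move[OF \<phi> e_def convex_ball c im(1) zb v(1)] coord_chart[OF E(1)] by simp
  have b: "chart_elt \<phi>' v' = chart_elt \<phi>' z' \<otimes> ?q"
   using chart_elt_move[OF \<phi>' e'_def convex_ball c im(2) zb v(1)] coord_chart[OF E(2)] vv zz by simp
  note ty = twist_eval[OF \<phi> v(2)] and ty' = twist_eval[OF \<phi>' v']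
  have "twist \<xi> \<phi> y = twist \<xi> \<phi>' y * \<xi> (chart_elt \<phi>' v' \<otimes> inv (chart_elt \<phi> v))"
   unfolding ty(3) ty'(3)
   by (rule character_quot[OF ty(1) chart_eval(2)[OF \<phi>] chart_eval(2)[OF \<phi>'] ty(2) ty'(2)])
  moreover have "chart_elt \<phi>' v' \<otimes> inv (chart_elt \<phi> v) = chart_elt \<phi>' z' \<otimes> inv (chart_elt \<phi> z)"
   unfolding a b using quot_cancel chart_eval(2)[OF \<phi>] chart_eval(2)[OF \<phi>'] chart_segment(1)[OF E(1)] by simp
  moreover have "twist \<xi> \<phi>' y \<noteq> 0" unfolding ty'(3) by (rule character_nonzero[OF ty'(2)])
  ultimately show ?thesis by simp
 qed
 have "openin cover (\<phi> ` ball z r)" by (rule cov.openin_chart_image[OF \<phi> open_ball])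
 moreover have "x \<in> \<phi> ` ball z r" using z zb by blast
 moreover have "twist \<xi> \<phi> y / twist \<xi> \<phi>' y = twist \<xi> \<phi> x / twist \<xi> \<phi>' x"
  if "y \<in> \<phi> ` ball z r \<inter> range \<phi> \<inter> range \<phi>'" for y
  using quot[of y] quot[of x] that x calculation(2) by auto
 ultimately show "\<exists>W. openin cover W \<and> x \<in> W \<and>
   (\<forall>y\<in>W \<inter> range \<phi> \<inter> range \<phi>'. twist \<xi> \<phi> y / twist \<xi> \<phi>' y = twist \<xi> \<phi> x / twist \<xi> \<phi>' x)" by blast
qed

text \<open>Dragged along the curve from its start, the section is
  \<open>exp (m \<theta> / n)\<close>, an \<open>n\<close>-th root of the \<open>m\<close>-th power
  of the given function. After one turn it has gained \<open>exp (2 \<pi> \<i> m / n)\<close>, and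
  the assumption on \<open>m\<close> says that the holonomy \<open>\<xi> (h c)\<close> compensates
  this.\<close>

lemma twist_section:
 assumes c: "loop_at Y p c" "h c \<in> H" "cov.simple_loop (lift c 0)"
  and \<theta>: "path \<theta>" "\<theta> 1 - \<theta> 0 = 2 * of_real pi * \<i>" "\<And>t. t \<in> {0..1} \<Longrightarrow> cmod (exp (\<theta> t)) = 1"
  and m: "\<xi> (h c) * exp (of_nat m * (2 * of_real pi * \<i>) / of_nat n) = 1"
 obtains s where "cov.flat_section (twist \<xi>) (lift c 0 ` {0..1}) s"
  "\<And>t. t \<in> {0..1} \<Longrightarrow> cmod (s (lift c 0 t)) = 1"
  "\<And>t. t \<in> {0..1} \<Longrightarrow> s (lift c 0 t) ^ n = exp (\<theta> t) ^ m"
proof -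
 let ?C = "lift c 0"
 have pc: "path c" "path_image c \<subseteq> Y" using c(1) by (auto simp: loop_at_def)
 have cc: "continuous_on {0..1} c" "c ` {0..1} \<subseteq> Y" using pc by (auto simp: path_def path_image_def)
 have Cc: "continuous_map (top_of_set {0..1}) cover ?C" and C01: "?C 0 = ?C 1" and Ci: "inj_on ?C {0<..1}"
  using c(3) by (auto simp: cov.simple_loop_def)
 define b where "b t = h (seg c 0 t)" for t
 have bG: "b t \<in> carrier G" if "t \<in> {0..1}" for t unfolding b_def by (rule initial_segment(3)[OF pc that])
 have Ct: "snd (?C t) = H #> b t" for t by (simp add: lift_def b_def)
 define \<kappa> where "\<kappa> t = coset_rep (snd (?C t))" for t
 have \<kappa>: "\<kappa> t \<in> carrier G" "\<kappa> t \<otimes> inv (b t) \<in> H" if "t \<in> {0..1}" for t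
  using coset_rep[OF bG[OF that]] by (simp_all add: \<kappa>_def Ct)
 \<comment> \<open>The factor in front passes from the trivialization dragged along the curve to the
   one by coset representatives.\<close>
 define \<sigma> where "\<sigma> t = inverse (\<xi> (\<kappa> t \<otimes> inv (b t))) * exp (of_nat m * \<theta> t / of_nat n)" for t
 have "\<sigma> 0 = \<sigma> 1"
 proof -
  have k: "\<kappa> 0 = \<kappa> 1" by (simp add: \<kappa>_def C01)
  have b0: "b 0 = \<one>" "b 1 = h c" unfolding b_def by (rule h_linepath00[OF pc], rule h_linepath01)
  have hc: "h c \<in> carrier G" using bG[of 1] b0 by simp
  have "\<xi> (\<kappa> 1 \<otimes> inv (b 0)) = \<xi> (\<kappa> 1 \<otimes> inv (b 1)) * \<xi> (b 1 \<otimes> inv (b 0))"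
   by (rule character_quot) (use \<kappa>[of 0] \<kappa>[of 1] bG[of 0] bG[of 1] k in auto)
  hence 1: "\<xi> (\<kappa> 0 \<otimes> inv (b 0)) = \<xi> (\<kappa> 1 \<otimes> inv (b 1)) * \<xi> (h c)" using hc by (simp add: k b0)
  have "\<theta> 1 = \<theta> 0 + 2 * of_real pi * \<i>" using \<theta>(2) by (simp add: algebra_simps)
  hence "of_nat m * \<theta> 1 / of_nat n = of_nat m * \<theta> 0 / of_nat n + of_nat m * (2 * of_real pi * \<i>) / of_nat n"
   by (simp only: distrib_left add_divide_distrib)
  hence 2: "exp (of_nat m * \<theta> 1 / of_nat n) = exp (of_nat m * \<theta> 0 / of_nat n) * exp (of_nat m * (2 * of_real pi * \<i>) / of_nat n)"
   by (simp only: exp_add)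
  have "inverse (\<xi> (h c)) = exp (of_nat m * (2 * of_real pi * \<i>) / of_nat n)"
   by (rule inverse_unique[OF m])
  thus ?thesis unfolding \<sigma>_def 1 2 by simp
 qed
 have \<sigma>_wd: "\<sigma> t = \<sigma> t'" if t: "t \<in> {0..1}" "t' \<in> {0..1}" "?C t = ?C t'" for t t'
 proof -
  define u where "u = (if t = 0 then 1 else t)"
  define u' where "u' = (if t' = 0 then 1 else t')"
  have "?C u = ?C t" "?C u' = ?C t'" "\<sigma> u = \<sigma> t" "\<sigma> u' = \<sigma> t'" using C01 \<open>\<sigma> 0 = \<sigma> 1\<close> by (auto simp: u_def u'_def)
  moreover have "u \<in> {0<..1}" "u' \<in> {0<..1}" using t by (auto simp: u_def u'_def)
  ultimately show ?thesis using inj_onD[OF Ci, of u u'] t(3) by simp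
 qed
 define s where "s x = \<sigma> (SOME t. t \<in> {0..1} \<and> ?C t = x)" for x
 have s: "s (?C t) = \<sigma> t" if "t \<in> {0..1}" for t
 proof -
  have "\<exists>u. u \<in> {0..1} \<and> ?C u = ?C t" using that by blast
  from someI_ex[OF this] show ?thesis unfolding s_def using \<sigma>_wd that by blast
 qed
 have sn: "s (?C t) ^ n = exp (\<theta> t) ^ m" if t: "t \<in> {0..1}" for t
 proof -
  have "exp (of_nat m * \<theta> t / of_nat n) ^ n = exp (\<theta> t) ^ m"
   using n by (simp add: exp_of_nat_mult[symmetric])
  thus ?thesis unfolding s[OF t] \<sigma>_def using \<xi>_root[OF \<kappa>(2)[OF t]] by (simp add: power_mult_distrib power_inverse)
 qed
 have "cmod (s (?C t)) = 1" if t: "t \<in> {0..1}" for t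
 proof -
  have "cmod (s (?C t)) ^ n = cmod (exp (\<theta> t)) ^ m" unfolding norm_power[symmetric] sn[OF t] ..
  hence "cmod (s (?C t)) ^ n = 1 ^ n" by (simp only: \<theta>(3)[OF t] power_one)
  thus ?thesis by (rule power_eq_imp_eq_base) (use n in auto)
 qed
 moreover have "cov.flat_section (twist \<xi>) (?C ` {0..1}) s" unfolding cov.flat_section_def
 proof
  fix \<phi> assume \<phi>: "\<phi> \<in> lift_charts"
  define e where "e = fst (chart_base \<phi>)"
  have eE: "e \<in> E" using chart_base(2)[OF \<phi>] by (simp add: e_def)
  define T where "T = {t \<in> {0..1}. ?C t \<in> range \<phi>}"
  define F where "F t = \<sigma> t * twist \<xi> \<phi> (?C t)" for t
  have "continuous_on T F" unfolding continuous_on_eq_continuous_within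
  proof
   fix u assume u: "u \<in> T"
   have u01: "u \<in> {0..1}" using u by (simp add: T_def)
   have "c u \<in> range e" using u chart_eval(1)[OF \<phi>] by (auto simp: T_def e_def lift_def)
   moreover have "openin (top_of_set {0..1}) {x \<in> {0..1}. c x \<in> range e}"
    using openin_continuous_map_preimage[of "top_of_set {0..1}" "top_of_set Y" c, OF _ openin_chart_image[OF eE open_UNIV]] cc
    by (simp add: continuous_map_in_subtopology image_subset_iff_funcset)
   ultimately obtain \<delta> where \<delta>: "\<delta> > 0" "ball u \<delta> \<inter> {0..1} \<subseteq> {x \<in> {0..1}. c x \<in> range e}"
    unfolding openin_contains_ball using u01 by blast
   define D where "D = ball u \<delta> \<inter> {0..1}"
   have D: "convex D" "continuous_on D c" "c ` D \<subseteq> range e" "u \<in> D" "D \<subseteq> {0..1}"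
    using \<delta> u01 continuous_on_subset[OF cc(1)] by (auto simp: D_def convex_Int)
   \<comment> \<open>Near \<open>u\<close> the coset representative drops out of the product,
     leaving a constant times an exponential, although \<open>\<sigma>\<close> and
     \<open>twist\<close> may jump separately.\<close>
   have FD: "F t = \<xi> (b u \<otimes> inv (chart_elt \<phi> (coord e (c u)))) * exp (of_nat m * \<theta> t / of_nat n)" if t: "t \<in> T" "t \<in> D" for t
   proof -
    have t01: "t \<in> {0..1}" using t by (simp add: T_def)
    obtain w where w: "?C t = \<phi> w" using t(1) by (auto simp: T_def)
    have w': "w = coord e (c t)"
     using coord_eval[OF \<phi>, of "?C t"] cov.coord_chart[OF \<phi>, of w] w by (simp add: e_def lift_def)
    note tw = twist_eval[OF \<phi> w]
    let ?q = "h (seg c u t)"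
    have qG: "?q \<in> carrier G" using segment_path(3)[of "{0..1}" c u t] cc u01 t01 by simp
    have bt: "b t = b u \<otimes> ?q" unfolding b_def by (rule h_segment_join[OF _ cc]) (use u01 t01 in auto)
    have at: "chart_elt \<phi> w = chart_elt \<phi> (coord e (c u)) \<otimes> ?q"
     unfolding w' by (rule chart_elt_move[OF \<phi> e_def D(1-4) t(2)])
    have "twist \<xi> \<phi> (?C t) = \<xi> (\<kappa> t \<otimes> inv (b t)) * \<xi> (b t \<otimes> inv (chart_elt \<phi> w))"
     unfolding tw(3) \<kappa>_def
     by (rule character_quot) (use tw chart_eval(2)[OF \<phi>] bG[OF t01] \<kappa>[OF t01] in \<open>auto simp: \<kappa>_def\<close>)
    moreover have "b t \<otimes> inv (chart_elt \<phi> w) = b u \<otimes> inv (chart_elt \<phi> (coord e (c u)))"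
     unfolding bt at by (rule quot_cancel[OF chart_eval(2)[OF \<phi>] bG[OF u01] qG])
    ultimately show ?thesis
     unfolding F_def \<sigma>_def using character_nonzero[OF \<kappa>(2)[OF t01]] by simp
   qed
   have "continuous_on (T \<inter> ball u \<delta>) (\<lambda>t. \<xi> (b u \<otimes> inv (chart_elt \<phi> (coord e (c u)))) * exp (of_nat m * \<theta> t / of_nat n))"
    by (intro continuous_intros continuous_on_subset[OF \<theta>(1)[unfolded path_def]]) (use n in \<open>auto simp: T_def\<close>)
   hence "continuous_on (T \<inter> ball u \<delta>) F"
    by (rule continuous_on_eq) (use FD in \<open>auto simp: D_def T_def\<close>)
   hence "continuous (at u within T \<inter> ball u \<delta>) F"
    using u \<delta>(1) by (simp add: continuous_on_eq_continuous_within)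
   moreover have "at u within T \<inter> ball u \<delta> = at u within T"
    by (rule at_within_nhd[of u "ball u \<delta>"]) (use \<delta>(1) in auto)
   ultimately show "continuous (at u within T) F" by simp
  qed
  \<comment> \<open>Continuity passes from the parameter to the curve by way of closed sets, because
    images of closed subsets of \<open>{0..1}\<close> are closed in the covering.\<close>
  hence inv: "\<forall>B. closed B \<longrightarrow> (\<exists>A. closed A \<and> A \<inter> T = F -` B \<inter> T)"
   by (simp only: continuous_on_closed_invariant)
  show "continuous_on (\<phi> -` ?C ` {0..1}) (\<lambda>w. s (\<phi> w) * twist \<xi> \<phi> (\<phi> w))"
   unfolding continuous_on_closed_invariant
  proof (intro allI impI)
   fix B :: "complex set" assume "closed B"
   then obtain A where A: "closed A" "A \<inter> T = F -` B \<inter> T" using inv by blast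
   have val: "t \<in> T" "s (\<phi> w) * twist \<xi> \<phi> (\<phi> w) = F t" if "t \<in> {0..1}" "\<phi> w = ?C t" for t w
   proof -
    have "?C t \<in> range \<phi>" using that(2) by (metis rangeI)
    thus "t \<in> T" using that(1) by (simp add: T_def)
    show "s (\<phi> w) * twist \<xi> \<phi> (\<phi> w) = F t" unfolding that(2) s[OF that(1)] F_def ..
   qed
   have "compact (A \<inter> {0..1})" using A(1) by (intro closed_Int_compact) auto
   hence "closedin cover (?C ` (A \<inter> {0..1}))" by (rule cov.closedin_path_piece(1)[OF Cc]) simp
   hence "closed (\<phi> -` ?C ` (A \<inter> {0..1}))" by (rule cov.closed_chart_vimage[OF \<phi>])
   moreover have "\<phi> -` ?C ` (A \<inter> {0..1}) \<inter> \<phi> -` ?C ` {0..1}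
     = (\<lambda>w. s (\<phi> w) * twist \<xi> \<phi> (\<phi> w)) -` B \<inter> \<phi> -` ?C ` {0..1}"
   proof (rule subset_antisym; rule subsetI)
    fix w assume "w \<in> \<phi> -` ?C ` (A \<inter> {0..1}) \<inter> \<phi> -` ?C ` {0..1}"
    then obtain t where t: "t \<in> A" "t \<in> {0..1}" "\<phi> w = ?C t" by auto
    have "F t \<in> B" using A(2) t(1) val(1)[OF t(2,3)] by blast
    thus "w \<in> (\<lambda>w. s (\<phi> w) * twist \<xi> \<phi> (\<phi> w)) -` B \<inter> \<phi> -` ?C ` {0..1}"
     using val(2)[OF t(2,3)] t(2,3) by auto
   next
    fix w assume w: "w \<in> (\<lambda>w. s (\<phi> w) * twist \<xi> \<phi> (\<phi> w)) -` B \<inter> \<phi> -` ?C ` {0..1}"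
    then obtain t where t: "t \<in> {0..1}" "\<phi> w = ?C t" by auto
    have "F t \<in> B" using w val(2)[OF t] by simp
    hence "t \<in> A" using A(2) val(1)[OF t] by blast
    thus "w \<in> \<phi> -` ?C ` (A \<inter> {0..1}) \<inter> \<phi> -` ?C ` {0..1}" using t by auto
   qed
   ultimately show "\<exists>A. closed A \<and> A \<inter> \<phi> -` ?C ` {0..1}
     = (\<lambda>w. s (\<phi> w) * twist \<xi> \<phi> (\<phi> w)) -` B \<inter> \<phi> -` ?C ` {0..1}" by blast
  qed
 qed
 ultimately show thesis using that sn by blast
qed

lemma character_obstruction:
 assumes c: "loop_at Y p c" "h c \<in> H" "cov.simple_loop (lift c 0)"
  and K: "compactin cover K" "lift c 0 ` {0..1} \<subseteq> K"
  and hom: "\<And>Q \<Theta>. cov.punctured Q \<Theta> \<Longrightarrow> Q \<inter> K = {} \<Longrightarrow> wind (\<Theta> \<circ> lift c 0) \<noteq> 1"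
  and m: "\<xi> (h c) * exp (of_nat m * (2 * of_real pi * \<i>) / of_nat n) = 1"
 shows "n dvd m"
proof (rule ccontr)
 assume nm: "\<not> n dvd m"
 show False
 proof (rule cov.simple_loop_obstruction[OF c(3) K hom])
  fix \<Theta> assume \<Theta>: "path (\<Theta> \<circ> lift c 0)" "\<forall>t\<in>{0..1}. cmod (\<Theta> (lift c 0 t)) = 1" "wind (\<Theta> \<circ> lift c 0) = 1"
  have "0 \<notin> path_image (\<Theta> \<circ> lift c 0)" using \<Theta>(2) by (force simp: path_image_def)
  then obtain \<theta> where \<theta>: "path \<theta>" "pathfinish \<theta> - pathstart \<theta> = 2 * of_real pi * \<i> * wind (\<Theta> \<circ> lift c 0)"
   "\<And>t. t \<in> {0..1} \<Longrightarrow> (\<Theta> \<circ> lift c 0) t = exp (\<theta> t)"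
   using path_log[OF \<Theta>(1)] by blast
  have \<theta>2: "\<theta> 1 - \<theta> 0 = 2 * of_real pi * \<i>" using \<theta>(2) \<Theta>(3) by (simp add: pathfinish_def pathstart_def)
  have \<theta>3: "cmod (exp (\<theta> t)) = 1" if "t \<in> {0..1}" for t using \<theta>(3)[OF that] \<Theta>(2) that by (metis o_apply)
  obtain s where s: "cov.flat_section (twist \<xi>) (lift c 0 ` {0..1}) s"
   "\<And>t. t \<in> {0..1} \<Longrightarrow> cmod (s (lift c 0 t)) = 1"
   "\<And>t. t \<in> {0..1} \<Longrightarrow> s (lift c 0 t) ^ n = exp (\<theta> t) ^ m"
   by (rule twist_section[OF c \<theta>(1) \<theta>2 \<theta>3 m]) auto
  have "s (lift c 0 t) ^ n = \<Theta> (lift c 0 t) ^ m" if "t \<in> {0..1}" for t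
   using s(3)[OF that] \<theta>(3)[OF that] by simp
  thus "\<exists>n m \<rho> s. cov.local_system n \<rho> \<and> cov.flat_section \<rho> (lift c 0 ` {0..1}) s \<and>
    (\<forall>x\<in>lift c 0 ` {0..1}. cmod (s x) = 1) \<and> (\<forall>x\<in>lift c 0 ` {0..1}. s x ^ n = \<Theta> x ^ m) \<and> \<not> n dvd m"
   using local_system_twist s(1,2) nm by (intro exI[of _ n] exI[of _ m] exI[of _ "twist \<xi>"] exI[of _ s]) auto
 qed
qed

end

end

section \<open>Words in simple loops\<close>

fun join_list :: "(real \<Rightarrow> 'a::topological_space) list \<Rightarrow> real \<Rightarrow> 'a" where
 "join_list [] = (\<lambda>t. undefined)"
| "join_list [u] = u"
| "join_list (u # v # vs) = u +++ join_list (v # vs)"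

text \<open>The index of the letter traversed at time \<open>t\<close> and the time inside that
  letter. A junction counts as time \<open>1\<close> of the earlier letter, in accordance with the
  half-open interval \<open>{0<..1}\<close>.\<close>

fun letter_position :: "'a list \<Rightarrow> real \<Rightarrow> nat \<times> real" where
 "letter_position [] t = (0, t)"
| "letter_position [u] t = (0, t)"
| "letter_position (u # v # vs) t = (if t \<le> 1/2 then (0, 2 * t)
  else apfst Suc (letter_position (v # vs) (2 * t - 1)))"

lemma letter_position_inj: "inj_on (letter_position us) {0<..1}"
proof (induction us rule: induct_list012)
 case (3 u v vs)
 show ?case
 proof (rule inj_onI)
  fix s t :: real assume st: "s \<in> {0<..1}" "t \<in> {0<..1}" "letter_position (u # v # vs) s = letter_position (u # v # vs) t"
  consider "s \<le> 1/2" "t \<le> 1/2" | "\<not> s \<le> 1/2" "\<not> t \<le> 1/2"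
   using st(3) by (cases "s \<le> 1/2"; cases "t \<le> 1/2") (auto simp: prod_eq_iff)
  thus "s = t"
  proof cases
   case 1
   thus ?thesis using st(3) by simp
  next
   case 2
   hence "letter_position (v # vs) (2 * s - 1) = letter_position (v # vs) (2 * t - 1)"
    using st(3) by (auto simp: prod_eq_iff)
   hence "2 * s - 1 = 2 * t - 1" by (rule inj_onD[OF "3.IH"(2)]) (use 2 st in auto)
   thus ?thesis by simp
  qed
 qed
qed (auto simp: inj_on_def)

lemma loop_at_join_list: "us \<noteq> [] \<Longrightarrow> \<forall>u\<in>set us. loop_at Y p u \<Longrightarrow> loop_at Y p (join_list us)"
 by (induction us rule: induct_list012) (auto intro: loop_at_join)

lemma simple_loop_basepoint:
 assumes "loop_at Y p u" "simple_path u" "t \<in> {0<..1}" "u t = p"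
 shows "t = 1"
proof -
 have "u 0 = u t" using assms by (auto simp: loop_at_def pathstart_def)
 hence "0 = t \<or> 0 = (0::real) \<and> t = 1 \<or> 0 = (1::real) \<and> t = 0"
  using assms(2)[unfolded simple_path_def loop_free_def, THEN conjunct2, THEN bspec[of _ _ 0], THEN bspec[of _ _ t]] assms(3) by auto
 thus ?thesis using assms(3) by auto
qed

context path_functor
begin

definition loop_word :: "(real \<Rightarrow> 'b) list \<Rightarrow> 'g" where
 "loop_word us = foldr (\<lambda>u y. h u \<otimes> y) us \<one>"

lemma loop_word_simps [simp]: "loop_word [] = \<one>" "loop_word (u # us) = h u \<otimes> loop_word us"
 by (simp_all add: loop_word_def)

lemma loop_word_closed: "\<forall>u\<in>set us. loop_at Y p u \<Longrightarrow> loop_word us \<in> carrier G"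
 by (induction us) (auto simp: loop_closed)

lemma loop_word_append:
 "\<forall>u\<in>set (us @ vs). loop_at Y p u \<Longrightarrow> loop_word (us @ vs) = loop_word us \<otimes> loop_word vs"
proof (induction us)
 case (Cons u us)
 hence "loop_word us \<in> carrier G" "loop_word vs \<in> carrier G" "h u \<in> carrier G"
  using loop_word_closed[of us p] loop_word_closed[of vs p] loop_closed[of p u] by auto
 thus ?case using Cons by (simp add: m_assoc)
qed (simp add: loop_word_closed)

lemma loop_word_take_Suc:
 assumes "\<forall>u\<in>set us. loop_at Y p u" "i < length us"
 shows "loop_word (take (Suc i) us) = loop_word (take i us) \<otimes> h (us ! i)"
proof -
 have "\<forall>u\<in>set (take i us @ [us ! i]). loop_at Y p u" using assms set_take_subset[of i us] by auto
 from loop_word_append[OF this] show ?thesis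
  using assms loop_closed nth_mem by (fastforce simp: take_Suc_conv_app_nth)
qed

lemma h_join_list: "us \<noteq> [] \<Longrightarrow> \<forall>u\<in>set us. loop_at Y p u \<Longrightarrow> h (join_list us) = loop_word us"
 by (induction us rule: induct_list012) (auto simp: loop_closed h_loop_join[OF _ loop_at_join_list])

lemma h_reversepath:
 assumes "loop_at Y p u"
 shows "h (reversepath u) = inv (h u)"
proof -
 have u: "continuous_on {0..1} u" "u ` {0..1} \<subseteq> Y" using assms by (auto simp: loop_at_def path_def path_image_def)
 have eq: "seg u 1 0 = reversepath u" "seg u 0 1 = u"
  by (auto simp: fun_eq_iff linepath_def reversepath_def)
 have "h (seg u 1 0) \<otimes> h (seg u 0 1) = h (seg u 1 1)"
  by (rule h_segment_join[OF _ u, symmetric]) auto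
 also have "\<dots> = \<one>" by (rule h_segment_refl[OF _ u]) auto
 finally have "h (reversepath u) \<otimes> h u = \<one>" unfolding eq .
 thus ?thesis
  using loop_closed[OF assms] loop_closed[OF loop_at_reversepath[OF assms]] by (metis inv_equality)
qed

end

context covering
begin

text \<open>Up to time \<open>t\<close> the transport is the product of the completed letters and a
  part of the current one; so the vertices of the edge path are the cosets of the prefixes.\<close>

lemma letter_position:
 assumes "us \<noteq> []" "\<forall>u\<in>set us. loop_at Y p u" "t \<in> {0<..1}" "letter_position us t = (i, \<tau>)"
 shows "i < length us \<and> \<tau> \<in> {0<..1} \<and> join_list us t = (us ! i) \<tau> \<and>
  h (join_list us \<circ> linepath 0 t) = loop_word (take i us) \<otimes> h (seg (us ! i) 0 \<tau>)"
 using assms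
proof (induction us arbitrary: t i rule: induct_list012)
 case (2 u)
 hence u: "path u" "path_image u \<subseteq> Y" by (auto simp: loop_at_def)
 have "continuous_on {0..1} u" "u ` {0..1} \<subseteq> Y" using u by (auto simp: path_def path_image_def)
 hence "h (seg u 0 t) \<in> carrier G" using segment_path(3)[of "{0..1}" u 0 t] 2 by auto
 hence one: "\<one> \<otimes> h (seg u 0 t) = h (seg u 0 t)" by (rule l_one)
 have it: "i = 0" "\<tau> = t" using 2 by auto
 have "h (join_list [u] \<circ> linepath 0 t) = loop_word (take i [u]) \<otimes> h (seg ([u] ! i) 0 \<tau>)"
  by (simp only: it join_list.simps take_0 loop_word_simps nth_Cons_0 one)
 moreover have "i < length [u]" "\<tau> \<in> {0<..1}" "join_list [u] t = ([u] ! i) \<tau>" using 2 it by auto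
 ultimately show ?case by blast
next
 case (3 u v vs)
 let ?d = "join_list (v # vs)"
 have lp: "loop_at Y p u" "loop_at Y p ?d" using loop_at_join_list[of "v # vs"] "3.prems"(2) by auto
 hence c: "path u" "path_image u \<subseteq> Y" "path ?d" "path_image ?d \<subseteq> Y" "pathfinish u = pathstart ?d"
  by (auto simp: loop_at_def)
 have t01: "t \<in> {0..1}" using "3.prems" by auto
 note hj = h_join_initial[OF c t01]
 show ?case
 proof (cases "t \<le> 1/2")
  case True
  have "continuous_on {0..1} u" "u ` {0..1} \<subseteq> Y" using c by (auto simp: path_def path_image_def)
  hence "h (seg u 0 (2 * t)) \<in> carrier G" using segment_path(3)[of "{0..1}" u 0 "2 * t"] "3.prems" True by auto
  hence one: "\<one> \<otimes> h (seg u 0 (2 * t)) = h (seg u 0 (2 * t))" by (rule l_one)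
  have it: "i = 0" "\<tau> = 2 * t" using "3.prems"(4) True by auto
  have "h (join_list (u # v # vs) \<circ> linepath 0 t) = loop_word (take i (u # v # vs)) \<otimes> h (seg ((u # v # vs) ! i) 0 \<tau>)"
   by (simp only: it join_list.simps take_0 loop_word_simps nth_Cons_0 one hj True if_True)
  moreover have "join_list (u # v # vs) t = ((u # v # vs) ! i) \<tau>" using True by (simp add: it joinpaths_def)
  moreover have "i < length (u # v # vs)" "\<tau> \<in> {0<..1}" using "3.prems"(3) True it by auto
  ultimately show ?thesis by blast
 next
  case False
  obtain j where j: "letter_position (v # vs) (2 * t - 1) = (j, \<tau>)" "i = Suc j"
   using "3.prems"(4) False by (cases "letter_position (v # vs) (2 * t - 1)") auto
  have vv: "\<forall>w\<in>set (v # vs). loop_at Y p w" using "3.prems"(2) by simp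
  have p1: "2 * t - 1 \<in> {0<..1}" using "3.prems"(3) False by simp
  have IH: "j < length (v # vs)" "\<tau> \<in> {0<..1}" "?d (2 * t - 1) = ((v # vs) ! j) \<tau>"
   "h (seg ?d 0 (2 * t - 1)) = loop_word (take j (v # vs)) \<otimes> h (seg ((v # vs) ! j) 0 \<tau>)"
   using "3.IH"(2)[OF list.distinct(2) vv p1 j(1)] by blast+
  have w: "loop_at Y p ((v # vs) ! j)" using vv IH(1) nth_mem by blast
  hence "path ((v # vs) ! j)" "path_image ((v # vs) ! j) \<subseteq> Y" by (auto simp: loop_at_def)
  hence wG: "h (seg ((v # vs) ! j) 0 \<tau>) \<in> carrier G"
   by (rule initial_segment(3)) (use IH(2) in simp)
  have "\<forall>w\<in>set (take j (v # vs)). loop_at Y p w"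
   using vv set_take_subset[of j "v # vs"] by (simp only: subset_iff ball_simps) blast
  hence tG: "loop_word (take j (v # vs)) \<in> carrier G" by (rule loop_word_closed)
  have "h (join_list (u # v # vs) \<circ> linepath 0 t) = h u \<otimes> h (seg ?d 0 (2 * t - 1))" using hj False by simp
  also have "\<dots> = (h u \<otimes> loop_word (take j (v # vs))) \<otimes> h (seg ((v # vs) ! j) 0 \<tau>)"
   unfolding IH(4) using loop_closed[OF lp(1)] tG wG by (simp add: m_assoc)
  finally have "h (join_list (u # v # vs) \<circ> linepath 0 t)
    = loop_word (take i (u # v # vs)) \<otimes> h (seg ((u # v # vs) ! i) 0 \<tau>)" by (simp add: j(2))
  moreover have "join_list (u # v # vs) t = ((u # v # vs) ! i) \<tau>" using IH(3) False by (simp add: j(2) joinpaths_def)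
  moreover have "i < length (u # v # vs)" using IH(1) j(2) by simp
  ultimately show ?thesis using IH(2) by blast
 qed
qed simp

text \<open>Two lifted edges can only coincide if they are traversed in opposite directions; then the edge path
 consists of just these two, and its class is trivial.\<close>

theorem word_lift_simple:
 assumes ne: "us \<noteq> []" and loops: "\<forall>u\<in>set us. loop_at Y p u \<and> simple_path u"
  and disj: "\<forall>u\<in>set us. \<forall>v\<in>set us. u = v \<or> u = reversepath v \<or> path_image u \<inter> path_image v = {p}"
  and dist: "\<And>i k. i < k \<Longrightarrow> k < length us \<Longrightarrow> H #> loop_word (take i us) \<noteq> H #> loop_word (take k us)"
  and closed: "loop_word us \<in> H" and nontriv: "loop_word us \<noteq> \<one>"
 shows "cov.simple_loop (lift (join_list us) 0)"
proof -
 let ?J = "join_list us" and ?n = "length us"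
 define A where "A i = loop_word (take i us)" for i
 have lp: "\<forall>u\<in>set us. loop_at Y p u" using loops by blast
 have J: "loop_at Y p ?J" by (rule loop_at_join_list[OF ne lp])
 have hJ: "h ?J = loop_word us" by (rule h_join_list[OF ne lp])
 have AG: "A i \<in> carrier G" for i
  unfolding A_def by (rule loop_word_closed[of _ p]) (use lp in \<open>auto dest: in_set_takeD\<close>)
 have ASuc: "A (Suc i) = A i \<otimes> h (us ! i)" if "i < ?n" for i
  unfolding A_def by (rule loop_word_take_Suc[OF lp that])
 have uG: "h (us ! i) \<in> carrier G" if "i < ?n" for i 
  by (rule loop_closed[of p]) (use lp nth_mem[OF that] in blast)
 have An: "H #> A ?n = H #> A 0"
  using coset_join2[OF _ is_subgroup closed] mem_carrier[OF closed] coset_mult_one[OF subset] by (simp add: A_def)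
 have Aeq: "i = k" if "i < ?n" "k < ?n" "H #> A i = H #> A k" for i k
  using dist[of i k] dist[of k i] that unfolding A_def by (metis linorder_neqE_nat)
 \<comment> \<open>Vertices are numbered cyclically: the end of the last letter lies at the base
   coset again, that is, at vertex \<open>0\<close>.\<close>
 define nx where "nx i = (if Suc i = ?n then 0 else Suc i)" for i
 have nx: "H #> A (Suc i) = H #> A (nx i)" "nx i < ?n" if "i < ?n" for i
  using An that by (auto simp: nx_def)
 have main: "t = t'" if t: "t \<in> {0<..1}" "t' \<in> {0<..1}" and eq: "lift ?J 0 t = lift ?J 0 t'" for t t'
 proof -
  obtain i \<tau> where i: "letter_position us t = (i, \<tau>)" by force
  obtain k \<sigma> where k: "letter_position us t' = (k, \<sigma>)" by force
  have ii: "i < ?n" "\<tau> \<in> {0<..1}" "?J t = (us ! i) \<tau>"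
   "h (seg ?J 0 t) = A i \<otimes> h (seg (us ! i) 0 \<tau>)"
   using letter_position[OF ne lp t(1) i] unfolding A_def by blast+
  have kk: "k < ?n" "\<sigma> \<in> {0<..1}" "?J t' = (us ! k) \<sigma>"
   "h (seg ?J 0 t') = A k \<otimes> h (seg (us ! k) 0 \<sigma>)"
   using letter_position[OF ne lp t(2) k] unfolding A_def by blast+
  define u where "u = us ! i"
  define v where "v = us ! k"
  have u: "u \<in> set us" "loop_at Y p u" "simple_path u" using ii(1) loops by (auto simp: u_def)
  have v: "v \<in> set us" "loop_at Y p v" "simple_path v" using kk(1) loops by (auto simp: v_def)
  have x: "u \<tau> = v \<sigma>" using eq ii(3) kk(3) by (simp add: lift_def u_def v_def)
  have co: "H #> (A i \<otimes> h (seg u 0 \<tau>)) = H #> (A k \<otimes> h (seg v 0 \<sigma>))"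
   using eq ii(4) kk(4) by (simp add: lift_def u_def v_def)
  have seg: "continuous_on {0..1} w" "w ` {0..1} \<subseteq> Y" if "loop_at Y p w" for w
   using that by (auto simp: loop_at_def path_def path_image_def)
  have qu: "h (seg u 0 \<tau>) \<in> carrier G" 
   by (rule initial_segment(3)) (use u(2) ii(2) in \<open>auto simp: loop_at_def\<close>)
  have qv: "h (seg v 0 \<sigma>) \<in> carrier G" 
   by (rule initial_segment(3)) (use v(2) kk(2) in \<open>auto simp: loop_at_def\<close>)
  have "i = k \<and> \<tau> = \<sigma>"
  proof (cases "u \<tau> = p")
   \<comment> \<open>A point over \<open>p\<close> is a vertex, reached at time \<open>1\<close> of
     both letters. As vertices are not repeated, the two letters have the same index.\<close>
   case True
   have "\<tau> = 1" by (rule simple_loop_basepoint[OF u(2,3) ii(2) True])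
   moreover have "\<sigma> = 1" by (rule simple_loop_basepoint[OF v(2,3) kk(2)]) (use x True in simp)
   moreover have "seg w 0 1 = w" for w :: "real \<Rightarrow> 'b" by (auto simp: fun_eq_iff linepath_def)
   ultimately have "H #> A (Suc i) = H #> A (Suc k)" using co ASuc ii(1) kk(1) by (simp add: u_def v_def)
   hence "nx i = nx k" using nx ii(1) kk(1) Aeq by metis
   hence "i = k" using ii(1) kk(1) by (auto simp: nx_def split: if_splits)
   thus ?thesis using \<open>\<tau> = 1\<close> \<open>\<sigma> = 1\<close> by simp
  next
   case False
   have end_p: "w 0 = p" "w 1 = p" if "loop_at Y p w" for w
    using that by (auto simp: loop_at_def pathstart_def pathfinish_def)
   have \<tau>1: "\<tau> \<in> {0<..<1}" using ii(2) False end_p[OF u(2)] by (cases "\<tau> = 1") auto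
   have \<sigma>1: "\<sigma> \<in> {0<..<1}" using kk(2) False x end_p[OF v(2)] by (cases "\<sigma> = 1") auto
   have sinj: "a = b" if "a \<in> {0<..<1}" "b \<in> {0<..<1}" "v a = v b" for a b
    using v(3)[unfolded simple_path_def loop_free_def, THEN conjunct2, THEN bspec[of _ _ a], THEN bspec[of _ _ b]] that by auto
   have "u \<tau> \<in> path_image u" unfolding path_image_def by (rule imageI) (use ii(2) in simp)
   moreover have "u \<tau> \<in> path_image v" unfolding path_image_def x by (rule imageI) (use kk(2) in simp)
   ultimately have "path_image u \<inter> path_image v \<noteq> {p}" using False by blast
   then consider "u = v" | "u \<noteq> v" "u = reversepath v" using disj u(1) v(1) by blast
   thus ?thesis
   proof cases
    case 1
    have "\<tau> = \<sigma>" using sinj[OF \<tau>1 \<sigma>1] x 1 by simp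
    hence "H #> A i = H #> A k" using co 1 AG qv by (intro rcos_cancel_right[of "A i" "h (seg v 0 \<sigma>)"]) auto
    thus ?thesis using Aeq ii(1) kk(1) \<open>\<tau> = \<sigma>\<close> by blast
   next
    case 2
    hence ik: "i \<noteq> k" by (auto simp: u_def v_def)
    have "v (1 - \<tau>) = v \<sigma>" using x 2(2) by (simp add: reversepath_def)
    hence \<sigma>: "\<sigma> = 1 - \<tau>" using sinj[of "1 - \<tau>" \<sigma>] \<tau>1 \<sigma>1 by auto
    have key: "h (seg w 0 (1 - a)) = h w \<otimes> h (reversepath w \<circ> linepath 0 a)"
     if w: "loop_at Y p w" "a \<in> {0..1}" for w a
    proof -
     have f: "reversepath w \<circ> linepath 0 a = seg w 1 (1 - a)" "seg w 0 1 = w"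
      by (auto simp: fun_eq_iff linepath_def reversepath_def algebra_simps)
     have "h (seg w 0 (1 - a)) = h (seg w 0 1) \<otimes> h (seg w 1 (1 - a))"
      by (rule h_segment_join[OF _ seg[OF w(1)]]) (use w(2) in auto)
     thus ?thesis by (simp only: f)
    qed
    have "h (seg v 0 \<sigma>) = h v \<otimes> h (seg u 0 \<tau>)"
     using key[OF v(2), of \<tau>] \<tau>1 by (simp add: \<sigma> 2(2))
    hence "H #> (A i \<otimes> h (seg u 0 \<tau>)) = H #> (A (Suc k) \<otimes> h (seg u 0 \<tau>))"
     using co ASuc[OF kk(1)] AG uG[OF kk(1)] qu by (simp add: v_def m_assoc)
    hence "H #> A i = H #> A (Suc k)" by (rule rcos_cancel_right) (use AG qu in auto)
    \<comment> \<open>The end of letter \<open>k\<close> is the start of letter \<open>i\<close>.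
      The converse holds by symmetry, and two positions that follow each other cyclically force
      length \<open>2\<close>.\<close>
    hence i_nx: "i = nx k" using nx[OF kk(1)] Aeq ii(1) by metis
    have vu: "v = reversepath u" using 2(2) by simp
    have "h (seg u 0 \<tau>) = h u \<otimes> h (seg v 0 \<sigma>)"
     using key[OF u(2), of \<sigma>] \<sigma>1 by (simp add: \<sigma> vu)
    hence "H #> (A k \<otimes> h (seg v 0 \<sigma>)) = H #> (A (Suc i) \<otimes> h (seg v 0 \<sigma>))"
     using co ASuc[OF ii(1)] AG uG[OF ii(1)] qv by (simp add: u_def m_assoc)
    hence "H #> A k = H #> A (Suc i)" by (rule rcos_cancel_right) (use AG qv in auto)
    hence k_nx: "k = nx i" using nx[OF ii(1)] Aeq kk(1) by metis
    have n2: "?n = 2" and ik01: "{i, k} = {0, 1}"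
     using i_nx k_nx ik ii(1) kk(1) by (auto simp: nx_def split: if_splits)
    obtain a b where us: "us = [a, b]" using n2 by (auto simp: length_Suc_conv numeral_2_eq_2)
    have la: "loop_at Y p a" "loop_at Y p b" using lp us by auto
    have "a = reversepath b" using ik01 2(2) vu us unfolding u_def v_def by (auto simp: doubleton_eq_iff)
    hence "h a = inv (h b)" using h_reversepath[OF la(2)] by simp
    hence "loop_word us = \<one>" using loop_closed[OF la(2)] by (simp add: us)
    thus ?thesis using nontriv by simp
   qed
  qed
  hence "letter_position us t = letter_position us t'" using i k by simp
  thus ?thesis by (rule inj_onD[OF letter_position_inj _ t])
 qed
 show ?thesis unfolding cov.simple_loop_def
 proof (intro conjI)
  show "continuous_map (top_of_set {0..1}) cover (lift ?J 0)"
   by (rule lift_path_continuous) (use J in \<open>auto simp: loop_at_def\<close>)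
  show "lift ?J 0 0 = lift ?J 0 1" using lift_loop_start[OF J] lift_loop_end[OF J] hJ closed by simp
  show "inj_on (lift ?J 0) {0<..1}" using main by (auto intro: inj_onI)
 qed
qed

end

section \<open>Simple closed curves over a cyclic subgroup\<close>

context group
begin

text \<open>Well defined because \<open>x [^] i = x [^] k\<close> forces \<open>n\<close> to divide
  \<open>k - i\<close>. For infinite order every positive \<open>n\<close> is admissible, for finite
  order every divisor of it.\<close>

lemma cyclic_character:
 assumes x: "x \<in> carrier G" and n: "n > 0" "\<And>i::int. x [^] i = \<one> \<Longrightarrow> int n dvd i"
 obtains \<xi> :: "'a \<Rightarrow> complex" where "\<And>i::int. \<xi> (x [^] i) = exp (2 * of_real pi * \<i> * of_int i / of_nat n)"
proof -
 define \<xi> :: "'a \<Rightarrow> complex" where "\<xi> y = exp (2 * of_real pi * \<i> * of_int (SOME i::int. y = x [^] i) / of_nat n)" for y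
 have "\<xi> (x [^] i) = exp (2 * of_real pi * \<i> * of_int i / of_nat n)" for i :: int
 proof -
  define k :: int where "k = (SOME k::int. x [^] i = x [^] k)"
  have "\<exists>k::int. x [^] i = x [^] k" by blast
  from someI_ex[OF this] have "x [^] i = x [^] k" unfolding k_def .
  hence "x [^] (k - i) = \<one>" using x by (simp add: int_pow_diff)
  hence "int n dvd k - i" by (rule n(2))
  then obtain q where q: "k = i + int n * q" by (metis add.commute diff_add_cancel dvdE)
  have "2 * of_real pi * \<i> * of_int k / of_nat n = 2 * of_real pi * \<i> * of_int i / of_nat n + 2 * of_int q * of_real pi * \<i>"
   using n(1) by (simp add: q field_simps)
  hence "exp (2 * of_real pi * \<i> * of_int k / of_nat n) = exp (2 * of_real pi * \<i> * of_int i / of_nat n) * exp (2 * of_int q * of_real pi * \<i>)"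
   by (simp only: exp_add)
  moreover have "exp (2 * of_int q * of_real pi * \<i>) = 1"
   using exp_integer_2pi[of "of_int q"] by (simp add: mult_ac)
  ultimately show ?thesis unfolding \<xi>_def k_def[symmetric] by simp
 qed
 thus thesis by (rule that)
qed

end

context covering
begin

text \<open>A power outside the claim would violate both alternatives of
  \<open>simple_loop_obstruction\<close>: a homotopy between powers of loops forbids charges outside
  a compact set, and a character forbids a compact side.\<close>

lemma cyclic_simple_loop:
 assumes H: "H = generate G {x}" and a: "loop_at Y p a" "h a = x"
  and c: "loop_at Y p c" "h c = x [^] (j::int)" "cov.simple_loop (lift c 0)"
  and faithful: "\<And>c d. loop_at Y p c \<Longrightarrow> loop_at Y p d \<Longrightarrow> h c = h d \<Longrightarrow> homotopic_paths Y c d"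
 shows "x [^] j = \<one> \<or> ord x = 0 \<and> \<bar>j\<bar> = 1"
proof (rule ccontr)
 assume neg: "\<not> ?thesis"
 have xG: "x \<in> carrier G" using a loop_closed by blast
 have Hx: "H = {x [^] (i::int) | i. i \<in> UNIV}" unfolding H generate_pow[OF xG] by auto
 have xH: "x [^] (i::int) \<in> H" for i unfolding Hx by blast
 have aH: "h a \<in> H" using xH[of 1] a(2) xG by simp
 have cH: "h c \<in> H" using xH c(2) by simp
 \<comment> \<open>The subgroup has a character of order \<open>n\<close>, and \<open>n\<close> does
   not divide \<open>j\<close>: for infinite order \<open>0 < \<bar>j\<bar> < n\<close>, for finite
   order \<open>x [^] j\<close> is not \<open>\<one>\<close>.\<close>
 define n where "n = (if ord x = 0 then nat \<bar>j\<bar> + 1 else ord x)"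
 have n: "n > 0" by (simp add: n_def)
 have ndvd: "int n dvd i" if "x [^] i = \<one>" for i :: int
  using that int_pow_eq_id[OF xG, of i] by (auto simp: n_def)
 have j0: "j \<noteq> 0" using neg by auto
 have nj: "\<not> int n dvd j"
 proof (cases "ord x = 0")
  case True
  hence "int n = \<bar>j\<bar> + 1" by (simp add: n_def)
  thus ?thesis using j0 zdvd_not_zless[of "\<bar>j\<bar>" "int n"] by (auto simp: abs_if split: if_splits)
 next
  case False
  thus ?thesis using neg int_pow_eq_id[OF xG, of j] by (simp add: n_def)
 qed
 \<comment> \<open>\<open>m\<close> is a natural representative of \<open>- j\<close> modulo
   \<open>n\<close>, so that \<open>exp (2 \<pi> \<i> m / n)\<close> is inverse to
   \<open>\<xi> (h c)\<close>.\<close>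
 define m where "m = nat ((- j) mod int n)"
 have m: "int m = (- j) mod int n" using n by (simp add: m_def)
 have nm: "\<not> n dvd m"
 proof
  assume "n dvd m"
  hence "int n dvd (- j) mod int n" using m by (metis int_dvd_int_iff)
  hence "int n dvd - j" by (simp add: dvd_mod_iff)
  thus False using nj by simp
 qed
 have "int n dvd j + int m" unfolding m by (simp add: dvd_eq_mod_eq_0 mod_add_right_eq)
 then obtain q where q: "j + int m = int n * q" by (elim dvdE)
 obtain \<xi> where \<xi>: "\<And>i::int. \<xi> (x [^] i) = exp (2 * of_real pi * \<i> * of_int i / of_nat n)"
  using cyclic_character[OF xG n ndvd] by blast
 have \<xi>_mult: "\<xi> (u \<otimes> v) = \<xi> u * \<xi> v" if uv: "u \<in> H" "v \<in> H" for u v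
 proof -
  obtain i k :: int where ik: "u = x [^] i" "v = x [^] k" using uv unfolding Hx by blast
  have "u \<otimes> v = x [^] (i + k)" using ik int_pow_mult[OF xG] by simp
  thus ?thesis using ik by (simp add: \<xi> algebra_simps add_divide_distrib flip: exp_add)
 qed
 have \<xi>_root: "\<xi> u ^ n = 1" if u: "u \<in> H" for u
 proof -
  obtain i :: int where i: "u = x [^] i" using u unfolding Hx by blast
  have "\<xi> u ^ n = exp (of_nat n * (2 * of_real pi * \<i> * of_int i / of_nat n))" unfolding i \<xi> exp_of_nat_mult ..
  also have "of_nat n * (2 * of_real pi * \<i> * of_int i / of_nat n) = 2 * of_int i * of_real pi * \<i>" using n by (simp add: field_simps)
  also have "exp \<dots> = 1" using exp_integer_2pi[of "of_int i"] by (simp add: mult_ac)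
  finally show ?thesis .
 qed
 have \<xi>c: "\<xi> (h c) * exp (of_nat m * (2 * of_real pi * \<i>) / of_nat n) = 1"
 proof -
  have "\<xi> (h c) * exp (of_nat m * (2 * of_real pi * \<i>) / of_nat n)
    = exp (2 * of_real pi * \<i> * of_int j / of_nat n + of_nat m * (2 * of_real pi * \<i>) / of_nat n)"
   unfolding c(2) \<xi> exp_add ..
  also have "2 * of_real pi * \<i> * of_int j / of_nat n + of_nat m * (2 * of_real pi * \<i>) / of_nat n
    = 2 * of_real pi * \<i> * of_int (j + int m) / of_nat n" by (simp add: algebra_simps add_divide_distrib)
  also have "\<dots> = 2 * of_int q * of_real pi * \<i>" unfolding q using n by (simp add: field_simps)
  also have "exp \<dots> = 1" using exp_integer_2pi[of "of_int q"] by (simp add: mult_ac)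
  finally show ?thesis .
 qed
 \<comment> \<open>The relation that rules out charges off \<open>K\<close>. For infinite order
   \<open>c\<close> is homotopic to the \<open>\<bar>j\<bar>\<close>-th power of \<open>a\<close> or
   of its reverse, and \<open>\<bar>j\<bar>\<close> does not divide \<open>1\<close>. For finite
   order a positive power of \<open>c\<close> is null-homotopic, and \<open>0\<close> divides no
   positive number.\<close>
 obtain d l b where b: "loop_at Y p b" "h b \<in> H" and dl: "d > 0" "\<not> l dvd d"
  "homotopic_paths Y (loop_power c d) (loop_power b l)"
 proof (cases "ord x = 0")
  case True
  define b where "b = (if j > 0 then a else reversepath a)"
  have b: "loop_at Y p b" using a(1) loop_at_reversepath[OF a(1)] by (simp add: b_def)
  have hb: "h b = x [^] (sgn j)" using a j0 xG h_reversepath[OF a(1)] by (auto simp: b_def sgn_if int_pow_neg)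
  have "h (loop_power c 1) = h (loop_power b (nat \<bar>j\<bar>))"
  proof -
   have "h (loop_power b (nat \<bar>j\<bar>)) = (x [^] sgn j) [^] int (nat \<bar>j\<bar>)"
    unfolding h_loop_power[OF b] hb int_pow_int ..
   also have "\<dots> = x [^] (sgn j * \<bar>j\<bar>)" using int_pow_pow[OF xG] by simp
   also have "sgn j * \<bar>j\<bar> = j" by (simp add: sgn_mult_abs)
   finally show ?thesis using h_loop_power[OF c(1), of 1] c(2) xG by simp
  qed
  hence "homotopic_paths Y (loop_power c 1) (loop_power b (nat \<bar>j\<bar>))"
   by (rule faithful[OF loop_at_power[OF c(1)] loop_at_power[OF b]])
  moreover have "\<not> nat \<bar>j\<bar> dvd 1" using neg True j0 by auto
  ultimately show thesis using that[of b 1 "nat \<bar>j\<bar>"] b hb xH by simp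
 next
  case False
  have "h (loop_power c (ord x)) = (x [^] j) [^] int (ord x)" unfolding h_loop_power[OF c(1)] c(2) int_pow_int ..
  also have "\<dots> = \<one>" using int_pow_eq_id[OF xG] int_pow_pow[OF xG] by simp
  finally have "h (loop_power c (ord x)) = h (loop_power a 0)" using h_loop_power[OF a(1), of 0] by simp
  hence "homotopic_paths Y (loop_power c (ord x)) (loop_power a 0)"
   by (rule faithful[OF loop_at_power[OF c(1)] loop_at_power[OF a(1)]])
  thus thesis using that[of a "ord x" 0] a(1) aH False by simp
 qed
 obtain K where K: "compactin cover K" "lift c 0 ` {0..1} \<subseteq> K"
  "\<And>Q \<Theta>. cov.punctured Q \<Theta> \<Longrightarrow> Q \<inter> K = {} \<Longrightarrow> wind (\<Theta> \<circ> lift c 0) = 1 \<Longrightarrow> l dvd d"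
  by (rule loop_power_winding_obstruction[OF c(1) cH b dl(1,3)]) blast
 have "n dvd m"
  by (rule character_obstruction[OF n \<xi>_mult \<xi>_root c(1) cH c(3) K(1,2) _ \<xi>c]) (use K(3) dl(2) in blast)+
 thus False using nm by simp
qed

theorem cyclic_word_obstruction:
 assumes H: "H = generate G {x}" and a: "loop_at Y p a" "h a = x"
  and faithful: "\<And>c d. loop_at Y p c \<Longrightarrow> loop_at Y p d \<Longrightarrow> h c = h d \<Longrightarrow> homotopic_paths Y c d"
  and ne: "us \<noteq> []" and loops: "\<forall>u\<in>set us. loop_at Y p u \<and> simple_path u"
  and disj: "\<forall>u\<in>set us. \<forall>v\<in>set us. u = v \<or> u = reversepath v \<or> path_image u \<inter> path_image v = {p}"
  and dist: "\<And>i k. i < k \<Longrightarrow> k < length us \<Longrightarrow> H #> loop_word (take i us) \<noteq> H #> loop_word (take k us)"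
  and closed: "loop_word us \<in> H"
 shows "loop_word us = \<one> \<or> ord x = 0 \<and> (loop_word us = x \<or> loop_word us = inv x)"
proof (cases "loop_word us = \<one>")
 case False
 have lp: "\<forall>u\<in>set us. loop_at Y p u" using loops by blast
 have xG: "x \<in> carrier G" using a loop_closed by blast
 obtain j :: int where j: "loop_word us = x [^] j" using closed unfolding H generate_pow[OF xG] by blast
 have "x [^] j = \<one> \<or> ord x = 0 \<and> \<bar>j\<bar> = 1"
  by (rule cyclic_simple_loop[OF H a loop_at_join_list[OF ne lp] _ word_lift_simple[OF ne loops disj dist closed False] faithful])
   (simp_all add: h_join_list[OF ne lp] j)
 hence "ord x = 0" "j = 1 \<or> j = -1" using False j by auto
 thus ?thesis using j xG by (auto simp: int_pow_neg)
qed simp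

end

section \<open>Homotopy classes in the collared surface\<close>

lemma homotopic_paths_const_left:
 assumes "path a" "path_image a \<subseteq> M"
 shows "homotopic_paths M ((\<lambda>t. pathstart a) +++ a) a"
proof -
 have ca: "continuous_on {0..1} a" "a ` {0..1} \<subseteq> M" using assms by (auto simp: path_def path_image_def)
 have "homotopic_paths M (a \<circ> (linepath 0 0 +++ linepath 0 1)) (seg a 0 1)"
  by (rule homotopic_paths_linear_image[OF ca])
   (auto simp: path_image_join closed_segment_eq_real_ivl intro!: path_join_imp)
 moreover have "a \<circ> (linepath 0 0 +++ linepath 0 1) = (\<lambda>t. pathstart a) +++ a" "seg a 0 1 = a"
  by (auto simp: fun_eq_iff joinpaths_def linepath_def pathstart_def)
 ultimately show ?thesis by simp
qed

lemma homotopic_paths_const_right: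
 assumes "path a" "path_image a \<subseteq> M"
 shows "homotopic_paths M (a +++ (\<lambda>t. pathfinish a)) a"
proof -
 have ca: "continuous_on {0..1} a" "a ` {0..1} \<subseteq> M" using assms by (auto simp: path_def path_image_def)
 have "homotopic_paths M (a \<circ> (linepath 0 1 +++ linepath 1 1)) (seg a 0 1)"
  by (rule homotopic_paths_linear_image[OF ca])
   (auto simp: path_image_join closed_segment_eq_real_ivl intro!: path_join_imp)
 moreover have "a \<circ> (linepath 0 1 +++ linepath 1 1) = a +++ (\<lambda>t. pathfinish a)" "seg a 0 1 = a"
  by (auto simp: fun_eq_iff joinpaths_def linepath_def pathfinish_def)
 ultimately show ?thesis by simp
qed

lemma homotopic_paths_left_inverse:
 assumes "path a" "path_image a \<subseteq> M"
 shows "homotopic_paths M (reversepath a +++ a) (\<lambda>t. pathfinish a)"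
proof -
 have ca: "continuous_on {0..1} a" "a ` {0..1} \<subseteq> M" using assms by (auto simp: path_def path_image_def)
 have "homotopic_paths M (a \<circ> (linepath 1 0 +++ linepath 0 1)) (seg a 1 1)"
  by (rule homotopic_paths_linear_image[OF ca])
   (auto simp: path_image_join closed_segment_eq_real_ivl intro!: path_join_imp)
 moreover have "a \<circ> (linepath 1 0 +++ linepath 0 1) = reversepath a +++ a" "seg a 1 1 = (\<lambda>t. pathfinish a)"
  by (auto simp: fun_eq_iff joinpaths_def linepath_def reversepath_def pathfinish_def)
 ultimately show ?thesis by simp
qed

lemma homotopic_paths_cancel:
 assumes a: "path a" "path_image a \<subseteq> M" and b: "path b" "path_image b \<subseteq> M" and ab: "pathfinish a = pathstart b"
 shows "homotopic_paths M (reversepath a +++ (a +++ b)) b"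
proof -
 have "homotopic_paths M (reversepath a +++ (a +++ b)) ((reversepath a +++ a) +++ b)"
  using a b ab by (intro homotopic_paths_assoc) auto
 also have "homotopic_paths M \<dots> ((\<lambda>t. pathfinish a) +++ b)"
  by (rule homotopic_paths_join[OF homotopic_paths_left_inverse[OF a]]) (use a b ab in auto)
 also have "homotopic_paths M \<dots> b" unfolding ab by (rule homotopic_paths_const_left[OF b])
 finally show ?thesis .
qed

text \<open>Closing up paths by fixed paths \<open>r x\<close> from the base point to \<open>x\<close> sends the fundamental
 groupoid to the fundamental group.\<close>

definition path_class :: "'a::topological_space set \<Rightarrow> ('a \<Rightarrow> real \<Rightarrow> 'a) \<Rightarrow> (real \<Rightarrow> 'a) \<Rightarrow> (real \<Rightarrow> 'a) set" where
 "path_class M r c = loop_class M (r (pathstart c) +++ (c +++ reversepath (r (pathfinish c))))"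

context
 fixes M :: "'a::topological_space set" and p :: 'a and r :: "'a \<Rightarrow> real \<Rightarrow> 'a"
 assumes p: "p \<in> M" and r: "\<And>x. x \<in> M \<Longrightarrow> path (r x) \<and> path_image (r x) \<subseteq> M \<and> pathstart (r x) = p \<and> pathfinish (r x) = x"
  and rp: "r p = (\<lambda>t. p)"
begin

lemma closed_up_loop:
 assumes "path c" "path_image c \<subseteq> M"
 shows "loop_at M p (r (pathstart c) +++ (c +++ reversepath (r (pathfinish c))))"
proof -
 have "pathstart c \<in> M" "pathfinish c \<in> M" using assms pathstart_in_path_image pathfinish_in_path_image by blast+
 thus ?thesis using r[of "pathstart c"] r[of "pathfinish c"] assms
  by (simp add: loop_at_def subset_path_image_join)
qed

lemma path_class_loop:
 assumes c: "loop_at M p c"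
 shows "path_class M r c = loop_class M c"
proof -
 have c': "path c" "path_image c \<subseteq> M" "pathstart c = p" "pathfinish c = p" using c by (auto simp: loop_at_def)
 have k: "reversepath (\<lambda>t. p) = (\<lambda>t. p)" by (simp add: reversepath_def)
 have kp: "path (\<lambda>t. p)" "path_image (\<lambda>t. p) \<subseteq> M" using p by (auto simp: path_def path_image_def)
 have 1: "homotopic_paths M (c +++ (\<lambda>t. p)) c" using homotopic_paths_const_right[OF c'(1,2)] c'(4) by simp
 have "homotopic_paths M ((\<lambda>t. p) +++ (c +++ (\<lambda>t. p))) ((\<lambda>t. p) +++ c)"
  by (rule homotopic_paths_join[OF _ 1]) (use kp c' in \<open>auto simp: pathfinish_def pathstart_def joinpaths_def\<close>)
 also have "homotopic_paths M \<dots> c" using homotopic_paths_const_left[OF c'(1,2)] c'(3) by simp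
 finally have h: "homotopic_paths M ((\<lambda>t. p) +++ (c +++ (\<lambda>t. p))) c" .
 have eq: "path_class M r c = loop_class M ((\<lambda>t. p) +++ (c +++ (\<lambda>t. p)))" by (simp add: path_class_def c' rp k)
 have "loop_at M p ((\<lambda>t. p) +++ (c +++ (\<lambda>t. p)))" using loop_at_const[OF p] c by (intro loop_at_join)
 from loop_class_eq_iff[OF this] h show ?thesis unfolding eq by blast
qed

text \<open>The detour to the base point and back, inserted at the junction, cancels up to
  homotopy.\<close>

lemma path_class_join:
 assumes c: "path c" "path_image c \<subseteq> M" and d: "path d" "path_image d \<subseteq> M" and cd: "pathfinish c = pathstart d"
 shows "path_class M r (c +++ d) = path_class M r c \<otimes>\<^bsub>fundamental_group M p\<^esub> path_class M r d"
proof -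
 let ?y = "pathstart d"
 have ends: "pathstart c \<in> M" "?y \<in> M" "pathfinish d \<in> M"
  using c d pathstart_in_path_image pathfinish_in_path_image by blast+
 define A where "A = r (pathstart c)"
 define B where "B = r ?y"
 define C where "C = reversepath (r (pathfinish d))"
 have A: "path A" "path_image A \<subseteq> M" "pathfinish A = pathstart c" "pathstart A = p" using r[OF ends(1)] by (auto simp: A_def)
 have B: "path B" "path_image B \<subseteq> M" "pathfinish B = ?y" "pathstart B = p" using r[OF ends(2)] by (auto simp: B_def)
 have C: "path C" "path_image C \<subseteq> M" "pathstart C = pathfinish d" "pathfinish C = p" using r[OF ends(3)] by (auto simp: C_def)
 note ABC = A B C c d cd
 have "homotopic_paths M ((A +++ (c +++ reversepath B)) +++ (B +++ (d +++ C))) (A +++ ((c +++ reversepath B) +++ (B +++ (d +++ C))))"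
  by (rule homotopic_paths_sym[OF homotopic_paths_assoc]) (use ABC in \<open>simp_all add: subset_path_image_join\<close>)
 also have "homotopic_paths M \<dots> (A +++ (c +++ (reversepath B +++ (B +++ (d +++ C)))))"
  by (rule homotopic_paths_join[OF _ homotopic_paths_sym[OF homotopic_paths_assoc]]) (use ABC in \<open>simp_all add: subset_path_image_join\<close>)
 also have "homotopic_paths M \<dots> (A +++ (c +++ (d +++ C)))"
  by (intro homotopic_paths_join homotopic_paths_cancel) (use ABC in \<open>simp_all add: subset_path_image_join\<close>)
 also have "homotopic_paths M \<dots> (A +++ ((c +++ d) +++ C))"
  by (rule homotopic_paths_join[OF _ homotopic_paths_assoc]) (use ABC in \<open>simp_all add: subset_path_image_join\<close>)
 finally have h: "homotopic_paths M ((A +++ (c +++ reversepath B)) +++ (B +++ (d +++ C))) (A +++ ((c +++ d) +++ C))" .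
 have lc: "loop_at M p (A +++ (c +++ reversepath B))" using closed_up_loop[OF c] by (simp add: A_def B_def cd)
 have ld: "loop_at M p (B +++ (d +++ C))" using closed_up_loop[OF d] by (simp add: B_def C_def)
 have eqs: "path_class M r c = loop_class M (A +++ (c +++ reversepath B))" "path_class M r d = loop_class M (B +++ (d +++ C))"
  "path_class M r (c +++ d) = loop_class M (A +++ ((c +++ d) +++ C))"
  by (simp_all add: path_class_def A_def B_def C_def cd)
 show ?thesis unfolding eqs mult_fundamental_group[OF lc ld]
  by (rule sym, rule loop_class_eq_iff[OF loop_at_join[OF lc ld], THEN iffD2, OF h])
qed

lemma path_class_homotopic:
 assumes "homotopic_paths M c d"
 shows "path_class M r c = path_class M r d"
proof -
 have cd: "path c" "path_image c \<subseteq> M" "path d" "path_image d \<subseteq> M" "pathstart d = pathstart c" "pathfinish d = pathfinish c"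
  using assms homotopic_paths_imp_path homotopic_paths_imp_subset homotopic_paths_imp_pathstart homotopic_paths_imp_pathfinish by metis+
 have ends: "pathstart c \<in> M" "pathfinish c \<in> M" using cd pathstart_in_path_image pathfinish_in_path_image by blast+
 have "homotopic_paths M (r (pathstart c) +++ (c +++ reversepath (r (pathfinish c)))) (r (pathstart c) +++ (d +++ reversepath (r (pathfinish c))))"
  by (intro homotopic_paths_join assms) (use r[OF ends(1)] r[OF ends(2)] cd in auto)
 thus ?thesis
  unfolding path_class_def cd(5,6) using loop_class_eq_iff[OF closed_up_loop[OF cd(1,2)]] by simp
qed

lemma fst_collared: "path c \<Longrightarrow> path_image c \<subseteq> collared M \<Longrightarrow> path (fst \<circ> c) \<and> path_image (fst \<circ> c) \<subseteq> M"
 by (auto simp: path_image_compose collared_def intro!: path_continuous_image continuous_intros)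

lemma path_functor_collared: "path_functor (fundamental_group M p) (collared M) (\<lambda>c. path_class M r (fst \<circ> c))"
proof -
 interpret group "fundamental_group M p" by (rule group_fundamental_group[OF p])
 show ?thesis
 proof
  show "path_class M r (fst \<circ> c) \<in> carrier (fundamental_group M p)" if "path c" "path_image c \<subseteq> collared M" for c
   unfolding path_class_def using closed_up_loop fst_collared[OF that] carrier_fundamental_group by blast
  show "path_class M r (fst \<circ> (c +++ d)) = path_class M r (fst \<circ> c) \<otimes>\<^bsub>fundamental_group M p\<^esub> path_class M r (fst \<circ> d)"
   if "path c" "path d" "path_image c \<subseteq> collared M" "path_image d \<subseteq> collared M" "pathfinish c = pathstart d" for c d
   unfolding path_compose_join
   by (rule path_class_join) (use fst_collared that in \<open>auto simp: pathfinish_compose pathstart_compose\<close>)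
  show "path_class M r (fst \<circ> c) = path_class M r (fst \<circ> d)" if "homotopic_paths (collared M) c d" for c d
   by (rule path_class_homotopic[OF homotopic_paths_continuous_image[OF that]])
    (auto simp: collared_def intro!: continuous_intros)
 qed
qed

text \<open>Lowering the height linearly to \<open>0\<close> stays in the collared surface, and the
  base point already has height \<open>0\<close>.\<close>

lemma collared_retract_homotopic:
 assumes "loop_at (collared M) (q, 0) c"
 shows "homotopic_paths (collared M) c ((\<lambda>x. (x, 0)) \<circ> (fst \<circ> c))"
 unfolding homotopic_paths
proof (intro exI[of _ "\<lambda>z. (fst (c (snd z)), (1 - fst z) * snd (c (snd z)))"] conjI ballI)
 have c: "continuous_on {0..1} c" "c ` {0..1} \<subseteq> collared M" "c 0 = (q, 0)" "c 1 = (q, 0)"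
  using assms by (auto simp: loop_at_def path_def path_image_def pathstart_def pathfinish_def)
 have cc: "continuous_on ({0..1} \<times> {0..1}) (\<lambda>z::real \<times> real. c (snd z))"
  by (rule continuous_on_compose2[OF c(1)]) (auto intro!: continuous_intros)
 show "continuous_on ({0..1} \<times> {0..1}) (\<lambda>z::real \<times> real. (fst (c (snd z)), (1 - fst z) * snd (c (snd z))))"
  by (intro continuous_intros cc)
 show "(\<lambda>z::real \<times> real. (fst (c (snd z)), (1 - fst z) * snd (c (snd z)))) \<in> {0..1} \<times> {0..1} \<rightarrow> collared M"
 proof
  fix z :: "real \<times> real" assume z: "z \<in> {0..1} \<times> {0..1}"
  hence "c (snd z) \<in> collared M" using c(2) by auto
  thus "(fst (c (snd z)), (1 - fst z) * snd (c (snd z))) \<in> collared M"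
   using z by (auto simp: collared_def split: prod.splits)
 qed
 fix s :: real
 show "pathstart ((\<lambda>z. (fst (c (snd z)), (1 - fst z) * snd (c (snd z)))) \<circ> Pair s) = pathstart c"
  "pathfinish ((\<lambda>z. (fst (c (snd z)), (1 - fst z) * snd (c (snd z)))) \<circ> Pair s) = pathfinish c"
  using c(3,4) by (simp_all add: pathstart_def pathfinish_def)
qed auto

text \<open>Equal classes give a homotopy in \<open>M\<close> between the projections, and both
  loops are homotopic to the copies of their projections at height \<open>0\<close>. So classes in
  \<open>M\<close> decide homotopy in the collared surface.\<close>

lemma path_class_faithful:
 assumes c: "loop_at (collared M) (p, 0) c" and d: "loop_at (collared M) (p, 0) d"
  and eq: "path_class M r (fst \<circ> c) = path_class M r (fst \<circ> d)"
 shows "homotopic_paths (collared M) c d"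
proof -
 have l: "loop_at M p (fst \<circ> c)" "loop_at M p (fst \<circ> d)"
  using c d fst_collared by (auto simp: loop_at_def pathstart_compose pathfinish_compose)
 have "homotopic_paths M (fst \<circ> c) (fst \<circ> d)"
  using eq unfolding path_class_loop[OF l(1)] path_class_loop[OF l(2)] loop_class_eq_iff[OF l(1)] .
 hence "homotopic_paths (collared M) ((\<lambda>x. (x, 0)) \<circ> (fst \<circ> c)) ((\<lambda>x. (x, 0)) \<circ> (fst \<circ> d))"
  by (rule homotopic_paths_continuous_image[OF _ continuous_on_pair_zero]) (auto simp: collared_def)
 thus ?thesis using collared_retract_homotopic[OF c] collared_retract_homotopic[OF d]
  by (meson homotopic_paths_sym homotopic_paths_trans)
qed

end

text \<open>Charts provide path-connected neighbourhoods, also at the boundary. Paths from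
  \<open>p\<close> to all points are needed to close up paths in \<open>path_class\<close>.\<close>

lemma path_connected_surface:
 assumes M: "surface_with_boundary M" and "connected M"
 shows "path_connected M"
proof -
 have nbhd: "\<exists>U. openin (top_of_set M) U \<and> x \<in> U \<and> path_connected U" if x: "x \<in> M" for x
 proof (cases "x \<in> surface_interior M")
  case True
  obtain e where e: "open_embedding UNIV e M" "x \<in> range e" by (rule interior_chart[OF True])
  have "path_connected (range e)"
   by (rule path_connected_continuous_image) (use e in \<open>auto simp: open_embedding_def convex_imp_path_connected\<close>)
  thus ?thesis using e by (auto simp: open_embedding_def)
 next
  case False
  hence "x \<in> surface_boundary M" using x by (simp add: surface_boundary_def)
  then obtain g k where g: "homeomorphism half_plane (g ` half_plane) g k" "openin (top_of_set M) (g ` half_plane)" "x = g 0"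
   by (rule boundary_half_chart[OF M])
  have "path_connected (g ` half_plane)"
   by (rule path_connected_continuous_image) (use g in \<open>auto simp: homeomorphism_def convex_imp_path_connected convex_halfspace_Im_ge\<close>)
  moreover have "x \<in> g ` half_plane" using g(3) by auto
  ultimately show ?thesis using g(2) by blast
 qed
 show ?thesis unfolding path_connected_component
 proof (intro ballI)
  fix x y assume "x \<in> M" "y \<in> M"
  thus "path_component M x y"
  proof (rule connected_equivalence_relation[OF assms(2)])
   show "\<exists>U. openin (top_of_set M) U \<and> a \<in> U \<and> (\<forall>x\<in>U. path_component M a x)" if a: "a \<in> M" for a
   proof -
    obtain U where U: "openin (top_of_set M) U" "a \<in> U" "path_connected U" using nbhd[OF a] by blast
    have "path_component M a x" if "x \<in> U" for x
     using U(2,3) that path_component_of_subset[OF openin_imp_subset[OF U(1)]] by (simp add: path_connected_component)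
    thus ?thesis using U(1,2) by blast
   qed
  qed (blast intro: path_component_sym path_component_trans)+
 qed
qed

text \<open>The generators are placed at height \<open>0\<close> of the collared surface, and their
  inverses become reversed loops. With classes in the fundamental group of \<open>M\<close> as the
  functor, the cosets here are the points over the base point.\<close>

theorem surface_word_obstruction:
 fixes M :: "'a::topological_space set" and p :: 'a and S ws
 defines "G \<equiv> fundamental_group M p"
 assumes M: "surface_with_boundary M" "connected M" "orientable_surface M" and p: "p \<in> M"
  and S: "simple_generating_set M p S" and x: "x \<in> carrier G"
  and ws: "ws \<noteq> []" "set ws \<subseteq> S \<union> m_inv G ` S"
  and dist: "\<And>i k. i < k \<Longrightarrow> k < length ws \<Longrightarrow>
   generate G {x} #>\<^bsub>G\<^esub> foldr (\<otimes>\<^bsub>G\<^esub>) (take i ws) \<one>\<^bsub>G\<^esub> \<noteq> generate G {x} #>\<^bsub>G\<^esub> foldr (\<otimes>\<^bsub>G\<^esub>) (take k ws) \<one>\<^bsub>G\<^esub>"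
  and closed: "foldr (\<otimes>\<^bsub>G\<^esub>) ws \<one>\<^bsub>G\<^esub> \<in> generate G {x}"
 shows "foldr (\<otimes>\<^bsub>G\<^esub>) ws \<one>\<^bsub>G\<^esub> = \<one>\<^bsub>G\<^esub> \<or>
  group.ord G x = 0 \<and> (foldr (\<otimes>\<^bsub>G\<^esub>) ws \<one>\<^bsub>G\<^esub> = x \<or> foldr (\<otimes>\<^bsub>G\<^esub>) ws \<one>\<^bsub>G\<^esub> = inv\<^bsub>G\<^esub> x)"
proof -
 interpret G: group G unfolding G_def by (rule group_fundamental_group[OF p])
 obtain \<mu> where \<mu>: "local_orientation (surface_interior M) \<mu>" using M(3) by (auto simp: orientable_surface_def)
 obtain L where L: "S = loop_class M ` L" "\<forall>a\<in>L. loop_at M p a \<and> simple_path a"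
  "pairwise (\<lambda>a b. \<not> homotopic_paths M a b \<and> path_image a \<inter> path_image b = {p}) L"
  using S unfolding simple_generating_set_def by blast
 have pc: "path_connected M" by (rule path_connected_surface[OF M(1,2)])
 \<comment> \<open>With the constant path at \<open>p\<close>, the functor gives a based loop its
   own class in the fundamental group.\<close>
 define r where "r x = (if x = p then (\<lambda>t. p) else (SOME c. path c \<and> path_image c \<subseteq> M \<and> pathstart c = p \<and> pathfinish c = x))" for x
 have r: "path (r x) \<and> path_image (r x) \<subseteq> M \<and> pathstart (r x) = p \<and> pathfinish (r x) = x" if x: "x \<in> M" for x
 proof (cases "x = p")
  case True
  thus ?thesis using loop_at_const[OF p] by (simp add: r_def loop_at_def)
 next
  case False
  have "\<exists>c. path c \<and> path_image c \<subseteq> M \<and> pathstart c = p \<and> pathfinish c = x"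
   using pc p x unfolding path_connected_def by blast
  from someI_ex[OF this] show ?thesis using False by (simp add: r_def)
 qed
 have rp: "r p = (\<lambda>t. p)" by (simp add: r_def)
 let ?Y = "collared M"
 define h where "h c = path_class M r (fst \<circ> c)" for c :: "real \<Rightarrow> 'a \<times> real"
 define up where "up a = (\<lambda>x. (x, 0::real)) \<circ> a" for a :: "real \<Rightarrow> 'a"
 have fst_up: "fst \<circ> up a = a" for a by (simp add: up_def fun_eq_iff)
 have up_loop: "loop_at ?Y (p, 0) (up a)" if a: "loop_at M p a" for a
 proof -
  have "path (up a)" unfolding up_def
   by (rule path_continuous_image[OF _ continuous_on_pair_zero]) (use a in \<open>simp add: loop_at_def\<close>)
  moreover have "path_image (up a) \<subseteq> ?Y" using a by (auto simp: up_def path_image_compose loop_at_def collared_def)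
  ultimately show ?thesis using a by (auto simp: loop_at_def up_def pathstart_compose pathfinish_compose)
 qed
 have h_up: "h (up a) = loop_class M a" if "loop_at M p a" for a
  unfolding h_def fst_up by (rule path_class_loop[OF p r rp that])
 interpret C: covering G ?Y h "collar_atlas M \<mu>" "generate G {x}"
 proof (intro covering.intro)
  show "path_functor G ?Y h" unfolding G_def h_def by (rule path_functor_collared[OF p r rp])
  show "oriented_surface (top_of_set ?Y) (collar_atlas M \<mu>)" by (rule oriented_surface_collared[OF M(1) \<mu>])
  show "subgroup (generate G {x}) G" by (rule G.generate_is_subgroup) (use x in simp)
 qed
 define Ls where "Ls = up ` L \<union> reversepath ` up ` L"
 have upL: "loop_at ?Y (p, 0) (up a) \<and> simple_path (up a)" if "a \<in> L" for a
 proof -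
  have a: "loop_at M p a" "simple_path a" using L(2) that by auto
  have "simple_path (up a)"
   using a(2) up_loop[OF a(1)] by (auto simp: simple_path_def loop_free_def up_def loop_at_def)
  thus ?thesis using up_loop[OF a(1)] by simp
 qed
 have Ls: "loop_at ?Y (p, 0) u \<and> simple_path u" if "u \<in> Ls" for u
  using that upL loop_at_reversepath simple_path_reversepath unfolding Ls_def by blast
 \<comment> \<open>Two letters from the same generator are equal or mutually reversed; letters from
   different generators meet only at the base point.\<close>
 have disj: "u = v \<or> u = reversepath v \<or> path_image u \<inter> path_image v = {(p, 0)}" if uv: "u \<in> Ls" "v \<in> Ls" for u v
 proof -
  obtain a where a: "a \<in> L" "u = up a \<or> u = reversepath (up a)" using uv(1) unfolding Ls_def by blast
  obtain b where b: "b \<in> L" "v = up b \<or> v = reversepath (up b)" using uv(2) unfolding Ls_def by blast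
  show ?thesis
  proof (cases "a = b")
   case True
   thus ?thesis using a(2) b(2) by auto
  next
   case False
   hence "path_image a \<inter> path_image b = {p}" using L(3) a(1) b(1) unfolding pairwise_def by blast
   moreover have "path_image u = (\<lambda>x. (x, 0)) ` path_image a" "path_image v = (\<lambda>x. (x, 0)) ` path_image b"
    using a(2) b(2) by (auto simp: up_def path_image_compose)
   ultimately show ?thesis by (metis (no_types, lifting) image_Int image_empty image_insert inj_on_def Pair_inject)
  qed
 qed
 have "\<exists>u\<in>Ls. h u = w" if w: "w \<in> S \<union> m_inv G ` S" for w
 proof -
  obtain a where a: "a \<in> L" "w = loop_class M a \<or> w = inv\<^bsub>G\<^esub> (loop_class M a)" using w L(1) by auto
  have la: "loop_at M p a" using L(2) a(1) by blast
  have "h (reversepath (up a)) = inv\<^bsub>G\<^esub> (loop_class M a)" using C.h_reversepath[OF up_loop[OF la]] h_up[OF la] by simp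
  moreover have "up a \<in> Ls" "reversepath (up a) \<in> Ls" using a(1) by (auto simp: Ls_def)
  ultimately show ?thesis using a(2) h_up[OF la] by blast
 qed
 then obtain f where f: "\<And>w. w \<in> S \<union> m_inv G ` S \<Longrightarrow> f w \<in> Ls \<and> h (f w) = w" by metis
 define us where "us = map f ws"
 have word: "C.loop_word (map f vs) = foldr (\<otimes>\<^bsub>G\<^esub>) vs \<one>\<^bsub>G\<^esub>" if "set vs \<subseteq> S \<union> m_inv G ` S" for vs
  using that by (induction vs) (auto simp: f)
 have wt: "C.loop_word (take i us) = foldr (\<otimes>\<^bsub>G\<^esub>) (take i ws) \<one>\<^bsub>G\<^esub>" for i
  unfolding us_def take_map by (rule word) (use ws(2) in \<open>auto dest: in_set_takeD\<close>)
 have wu: "C.loop_word us = foldr (\<otimes>\<^bsub>G\<^esub>) ws \<one>\<^bsub>G\<^esub>" unfolding us_def by (rule word[OF ws(2)])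
 have usL: "set us \<subseteq> Ls" using f ws(2) by (auto simp: us_def)
 obtain a where a: "loop_at M p a" "x = loop_class M a" using x unfolding G_def carrier_fundamental_group by blast
 have "C.loop_word us = \<one>\<^bsub>G\<^esub> \<or> G.ord x = 0 \<and> (C.loop_word us = x \<or> C.loop_word us = inv\<^bsub>G\<^esub> x)"
 proof (rule C.cyclic_word_obstruction[OF refl up_loop[OF a(1)]])
  show "h (up a) = x" using h_up[OF a(1)] a(2) by simp
  show "homotopic_paths ?Y c d" if "loop_at ?Y (p, 0) c" "loop_at ?Y (p, 0) d" "h c = h d" for c d
   by (rule path_class_faithful[OF p r rp that(1,2) that(3)[unfolded h_def]])
  show "us \<noteq> []" using ws(1) by (simp add: us_def)
  show "\<forall>u\<in>set us. loop_at ?Y (p, 0) u \<and> simple_path u" using usL Ls by blast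
  show "\<forall>u\<in>set us. \<forall>v\<in>set us. u = v \<or> u = reversepath v \<or> path_image u \<inter> path_image v = {(p, 0)}"
  proof (intro ballI)
   fix u v assume "u \<in> set us" "v \<in> set us"
   hence "u \<in> Ls" "v \<in> Ls" using usL by blast+
   thus "u = v \<or> u = reversepath v \<or> path_image u \<inter> path_image v = {(p, 0)}" by (rule disj)
  qed
  show "generate G {x} #>\<^bsub>G\<^esub> C.loop_word (take i us) \<noteq> generate G {x} #>\<^bsub>G\<^esub> C.loop_word (take k us)"
   if "i < k" "k < length us" for i k
   unfolding wt by (rule dist[OF that(1)]) (use that(2) in \<open>simp add: us_def\<close>)
  show "C.loop_word us \<in> generate G {x}" unfolding wu by (rule closed)
 qed
 thus ?thesis unfolding wu .
qed

section \<open>Lengths of conjugacy classes\<close>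

declare foldr_append [simp del]

context group
begin

abbreviation word_prod :: "'a list \<Rightarrow> 'a" where
 "word_prod ws \<equiv> foldr (\<otimes>) ws \<one>"

lemma word_prod_closed: "set ws \<subseteq> carrier G \<Longrightarrow> word_prod ws \<in> carrier G"
 by (induction ws) auto

lemma word_prod_append:
 "set us \<subseteq> carrier G \<Longrightarrow> set vs \<subseteq> carrier G \<Longrightarrow> word_prod (us @ vs) = word_prod us \<otimes> word_prod vs"
proof (induction us)
 case (Cons u us)
 hence "word_prod us \<in> carrier G" "word_prod vs \<in> carrier G" "u \<in> carrier G" using word_prod_closed by auto
 thus ?case using Cons by (simp add: m_assoc)
qed (simp add: word_prod_closed)

lemma word_prod_inverse:
 "set ws \<subseteq> carrier G \<Longrightarrow> word_prod (rev (map (m_inv G) ws)) = inv (word_prod ws)"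
proof (induction ws)
 case (Cons w ws)
 hence c: "w \<in> carrier G" "word_prod ws \<in> carrier G" "set (rev (map (m_inv G) ws)) \<subseteq> carrier G"
  using word_prod_closed by auto
 thus ?case using Cons word_prod_append[of "rev (map (m_inv G) ws)" "[inv w]"] by (simp add: inv_mult_group)
qed simp

lemma word_prod_replicate: "x \<in> carrier G \<Longrightarrow> word_prod (replicate n x) = x [^] n"
 by (induction n) (simp_all add: nat_pow_Suc2[symmetric] del: nat_pow_Suc)

lemma word_prod_concat_replicate:
 "set ws \<subseteq> carrier G \<Longrightarrow> word_prod (concat (replicate n ws)) = word_prod ws [^] n"
proof (induction n)
 case (Suc n)
 have "set (concat (replicate n ws)) \<subseteq> carrier G" using Suc.prems by (auto simp: set_replicate_conv_if split: if_splits)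
 thus ?case using Suc word_prod_append[OF Suc.prems] nat_pow_Suc2[OF word_prod_closed[OF Suc.prems]] by simp
qed simp

lemma conj_int_pow:
 assumes "a \<in> carrier G" "x \<in> carrier G"
 shows "(a \<otimes> x \<otimes> inv a) [^] (j::int) = a \<otimes> x [^] j \<otimes> inv a"
proof -
 have n: "(a \<otimes> x \<otimes> inv a) [^] (n::nat) = a \<otimes> x [^] n \<otimes> inv a" for n
 proof (induction n)
  case (Suc n)
  have "(a \<otimes> x \<otimes> inv a) [^] Suc n = (a \<otimes> x [^] n \<otimes> inv a) \<otimes> (a \<otimes> x \<otimes> inv a)" using Suc by simp
  also have "\<dots> = a \<otimes> x [^] n \<otimes> ((inv a \<otimes> a) \<otimes> (x \<otimes> inv a))"
   using assms by (simp only: m_assoc m_closed inv_closed nat_pow_closed)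
  also have "\<dots> = a \<otimes> x [^] Suc n \<otimes> inv a" using assms by (simp add: m_assoc)
  finally show ?case .
 qed (use assms in simp)
 show ?thesis
 proof (cases j rule: int_cases2)
  case (nonneg m)
  thus ?thesis using n by (simp add: int_pow_int)
 next
  case (nonpos m)
  thus ?thesis using n[of m] assms by (simp add: int_pow_neg_int inv_mult_group m_assoc)
 qed
qed

section \<open>Word length and its minimum over a conjugacy class\<close>

context
 fixes S
 assumes S: "S \<subseteq> carrier G"
begin

lemma letters_closed: "set ws \<subseteq> S \<union> m_inv G ` S \<Longrightarrow> set ws \<subseteq> carrier G"
 using S by auto

text \<open>Together with its converse \<open>word_value_letters\<close> this spells powers
  \<open>x [^] \<alpha>\<close> as \<open>\<bar>\<alpha>\<bar>\<close> single letters, so the word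
  length counts the edges of a path.\<close>

lemma letters_word_value:
 assumes "set ws \<subseteq> S \<union> m_inv G ` S"
 shows "\<exists>u. fst ` set u \<subseteq> S \<and> word_value G u = word_prod ws \<and> length ws = (\<Sum>(x, \<alpha>)\<leftarrow>u. nat \<bar>\<alpha>\<bar>)"
 using assms
proof (induction ws)
 case Nil
 show ?case by (intro exI[of _ "[]"]) (simp add: word_value_def)
next
 case (Cons w ws)
 then obtain u where u: "fst ` set u \<subseteq> S" "word_value G u = word_prod ws" "length ws = (\<Sum>(x, \<alpha>)\<leftarrow>u. nat \<bar>\<alpha>\<bar>)" by auto
 obtain x and \<alpha> :: int where x: "x \<in> S" "w = x [^] \<alpha>" "\<bar>\<alpha>\<bar> = 1"
 proof (cases "w \<in> S")
  case True
  thus thesis using that[of w 1] S by (auto simp: int_pow_1)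
 next
  case False
  then obtain x where "x \<in> S" "w = inv x" using Cons.prems by auto
  thus thesis using that[of x "-1"] S by (auto simp: int_pow_neg)
 qed
 thus ?case using u by (intro exI[of _ "(x, \<alpha>) # u"]) (auto simp: word_value_def)
qed

lemma word_length_le:
 assumes ws: "set ws \<subseteq> S \<union> m_inv G ` S"
 shows "word_length G S (word_prod ws) \<le> length ws"
 unfolding word_length_def by (rule Least_le) (rule letters_word_value[OF ws])

lemma word_value_letters:
 assumes "fst ` set u \<subseteq> S"
 shows "\<exists>ws. set ws \<subseteq> S \<union> m_inv G ` S \<and> word_prod ws = word_value G u \<and> length ws = (\<Sum>(x, \<alpha>)\<leftarrow>u. nat \<bar>\<alpha>\<bar>)"
 using assms
proof (induction u)
 case Nil
 show ?case by (intro exI[of _ "[]"]) (simp add: word_value_def)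
next
 case (Cons xa u)
 obtain x \<alpha> where xa: "xa = (x, \<alpha>)" by force
 have xS: "x \<in> S" and xG: "x \<in> carrier G" using Cons.prems xa S by auto
 obtain ws where ws: "set ws \<subseteq> S \<union> m_inv G ` S" "word_prod ws = word_value G u" "length ws = (\<Sum>(x, \<alpha>)\<leftarrow>u. nat \<bar>\<alpha>\<bar>)"
  using Cons by auto
 define v where "v = replicate (nat \<bar>\<alpha>\<bar>) (if \<alpha> \<ge> 0 then x else inv x)"
 have vS: "set v \<subseteq> S \<union> m_inv G ` S" using xS by (auto simp: v_def)
 have "word_prod v = x [^] \<alpha>"
 proof (cases "\<alpha> \<ge> 0")
  case True
  thus ?thesis using word_prod_replicate[OF xG, of "nat \<alpha>"] int_pow_int[of G x "nat \<alpha>"] by (simp add: v_def)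
 next
  case False
  then obtain m where m: "\<alpha> = - int m" "m > 0" by (metis neg_int_cases not_le)
  have "word_prod v = inv x [^] m" using word_prod_replicate[of "inv x" m] xG m by (simp add: v_def)
  also have "\<dots> = x [^] \<alpha>" unfolding m(1) using xG by (simp add: int_pow_neg_int nat_pow_inv)
  finally show ?thesis .
 qed
 hence "word_prod (v @ ws) = word_value G (xa # u)"
  using word_prod_append[OF letters_closed[OF vS] letters_closed[OF ws(1)]] ws(2) by (simp add: word_value_def xa)
 moreover have "length (v @ ws) = (\<Sum>(x, \<alpha>)\<leftarrow>xa # u. nat \<bar>\<alpha>\<bar>)" using ws(3) by (simp add: v_def xa)
 ultimately show ?case using vS ws(1) by (intro exI[of _ "v @ ws"]) auto
qed

lemma generate_letters:
 assumes "y \<in> generate G S"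
 shows "\<exists>ws. set ws \<subseteq> S \<union> m_inv G ` S \<and> word_prod ws = y" using assms
proof (induction rule: generate.induct)
 case one
 show ?case by (intro exI[of _ "[]"]) simp
next
 case (incl x)
 thus ?case using S by (intro exI[of _ "[x]"]) auto
next
 case (inv x)
 thus ?case using S by (intro exI[of _ "[inv x]"]) auto
next
 case (eng x y)
 then obtain us vs where "set us \<subseteq> S \<union> m_inv G ` S" "word_prod us = x" "set vs \<subseteq> S \<union> m_inv G ` S" "word_prod vs = y" by blast
 thus ?case using word_prod_append[of us vs] letters_closed by (intro exI[of _ "us @ vs"]) auto
qed

lemma word_length_attained:
 assumes "y \<in> generate G S"
 obtains ws where "set ws \<subseteq> S \<union> m_inv G ` S" "word_prod ws = y" "length ws = word_length G S y"
proof -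
 let ?P = "\<lambda>n. \<exists>u. fst ` set u \<subseteq> S \<and> word_value G u = y \<and> n = (\<Sum>(x, \<alpha>)\<leftarrow>u. nat \<bar>\<alpha>\<bar>)"
 obtain vs where vs: "set vs \<subseteq> S \<union> m_inv G ` S" "word_prod vs = y" using generate_letters[OF assms] by blast
 have "?P (length vs)" using letters_word_value[OF vs(1)] vs(2) by simp
 hence "?P (word_length G S y)" unfolding word_length_def by (rule LeastI)
 then obtain u where u: "fst ` set u \<subseteq> S" "word_value G u = y" "word_length G S y = (\<Sum>(x, \<alpha>)\<leftarrow>u. nat \<bar>\<alpha>\<bar>)" by blast
 from word_value_letters[OF u(1)] show thesis using that u(2,3) by auto
qed

definition conj_length :: "'a \<Rightarrow> nat" where
 "conj_length x = (LEAST n. \<exists>a\<in>carrier G. n = word_length G S (a \<otimes> x \<otimes> inv a))"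

lemma conj_length_le: "a \<in> carrier G \<Longrightarrow> conj_length x \<le> word_length G S (a \<otimes> x \<otimes> inv a)"
 unfolding conj_length_def by (rule Least_le) blast

lemma conj_length_attained:
 obtains a where "a \<in> carrier G" "conj_length x = word_length G S (a \<otimes> x \<otimes> inv a)"
proof -
 have "\<exists>a\<in>carrier G. word_length G S (\<one> \<otimes> x \<otimes> inv \<one>) = word_length G S (a \<otimes> x \<otimes> inv a)" by (rule bexI[of _ \<one>]) simp_all
 hence "\<exists>a\<in>carrier G. conj_length x = word_length G S (a \<otimes> x \<otimes> inv a)"
  unfolding conj_length_def by (rule LeastI)
 thus thesis using that by blast
qed

lemma conj_conj:
 assumes "a \<in> carrier G" "b \<in> carrier G" "x \<in> carrier G"
 shows "a \<otimes> (b \<otimes> x \<otimes> inv b) \<otimes> inv a = (a \<otimes> b) \<otimes> x \<otimes> inv (a \<otimes> b)"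
 using assms by (simp add: inv_mult_group m_assoc)

lemma conj_length_conj:
 assumes "b \<in> carrier G" "x \<in> carrier G"
 shows "conj_length (b \<otimes> x \<otimes> inv b) = conj_length x"
proof (rule antisym)
 obtain a where a: "a \<in> carrier G" "conj_length x = word_length G S (a \<otimes> x \<otimes> inv a)"
  by (rule conj_length_attained)
 have "(a \<otimes> inv b) \<otimes> (b \<otimes> x \<otimes> inv b) \<otimes> inv (a \<otimes> inv b) = a \<otimes> x \<otimes> inv a"
  unfolding conj_conj[OF m_closed[OF a(1) inv_closed[OF assms(1)]] assms(1,2)] using a(1) assms by (simp add: m_assoc)
 thus "conj_length (b \<otimes> x \<otimes> inv b) \<le> conj_length x"
  using conj_length_le[of "a \<otimes> inv b" "b \<otimes> x \<otimes> inv b"] a assms by simp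
next
 obtain a where a: "a \<in> carrier G" "conj_length (b \<otimes> x \<otimes> inv b) = word_length G S (a \<otimes> (b \<otimes> x \<otimes> inv b) \<otimes> inv a)"
  by (rule conj_length_attained)
 thus "conj_length x \<le> conj_length (b \<otimes> x \<otimes> inv b)"
  using conj_length_le[of "a \<otimes> b" x] conj_conj[OF a(1) assms] assms by simp
qed

text \<open>Inverting and reversing a word keeps its length, so a word for the inverse of
  \<open>x\<close> bounds the length as well.\<close>

lemma conj_length_le_length:
 assumes "set ws \<subseteq> S \<union> m_inv G ` S" "x \<in> carrier G" "word_prod ws = x \<or> word_prod ws = inv x"
 shows "conj_length x \<le> length ws"
proof -
 have *: "conj_length x \<le> length vs" if "set vs \<subseteq> S \<union> m_inv G ` S" "word_prod vs = x" for vs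
  using conj_length_le[OF one_closed, of x] word_length_le[OF that(1)] that(2) assms(2) by simp
 show ?thesis
 proof (cases "word_prod ws = x")
  case False
  hence "word_prod (rev (map (m_inv G) ws)) = x"
   using word_prod_inverse[OF letters_closed[OF assms(1)]] assms by simp
  moreover have "set (rev (map (m_inv G) ws)) \<subseteq> S \<union> m_inv G ` S" using assms(1) S by (force simp: subset_iff)
  ultimately show ?thesis using *[of "rev (map (m_inv G) ws)"] by simp
 qed (use * assms in blast)
qed

text \<open>Closed edge paths in the coset graph of a cyclic subgroup are cut at repeated vertices into
 simple ones, to which the hypothesis \<open>simple\<close> applies.\<close>

context
 assumes simple: "\<And>x ws. x \<in> carrier G \<Longrightarrow> ws \<noteq> [] \<Longrightarrow> set ws \<subseteq> S \<union> m_inv G ` S \<Longrightarrow>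
   (\<And>i k. i < k \<Longrightarrow> k < length ws \<Longrightarrow>
    generate G {x} #> word_prod (take i ws) \<noteq> generate G {x} #> word_prod (take k ws)) \<Longrightarrow>
   word_prod ws \<in> generate G {x} \<Longrightarrow>
   word_prod ws = \<one> \<or> ord x = 0 \<and> (word_prod ws = x \<or> word_prod ws = inv x)"
begin

text \<open>A repeated vertex cuts out a closed piece, which represents a power of a conjugate of
  \<open>x\<close>; exponents and lengths add, and conjugates have equal \<open>conj_length\<close>.
  Without repetition the exponent is \<open>0\<close>, \<open>1\<close> or \<open>-1\<close>. For
  finite order every simple piece is trivial, and so is the product.\<close>

lemma cyclic_word_bound:
 assumes "x \<in> carrier G" "set ws \<subseteq> S \<union> m_inv G ` S" "word_prod ws \<in> generate G {x}"
 shows "\<exists>j::int. word_prod ws = x [^] j \<and> nat \<bar>j\<bar> * conj_length x \<le> length ws \<and> (ord x \<noteq> 0 \<longrightarrow> word_prod ws = \<one>)"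
 using assms
proof (induction "length ws" arbitrary: x ws rule: less_induct)
 case less
 note x = less.prems(1) and ws = less.prems(2) and wx = less.prems(3)
 let ?H = "generate G {x}"
 show ?case
 proof (cases "\<exists>i k. i < k \<and> k < length ws \<and> ?H #> word_prod (take i ws) = ?H #> word_prod (take k ws)")
  case False
  show ?thesis
  proof (cases "word_prod ws = \<one>")
   case True
   thus ?thesis by (intro exI[of _ 0]) simp
  next
   case nontriv: False
   hence "ws \<noteq> []" by auto
   hence c: "ord x = 0" "word_prod ws = x \<or> word_prod ws = inv x"
    using simple[OF x _ ws _ wx] False nontriv by blast+
   note le = conj_length_le_length[OF ws x c(2)]
   show ?thesis
   proof (cases "word_prod ws = x")
    case True
    thus ?thesis using c(1) le x by (intro exI[of _ 1]) (simp add: int_pow_1)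
   next
    case False
    thus ?thesis using c le x by (intro exI[of _ "-1"]) (simp add: int_pow_neg)
   qed
  qed
 next
  case True
  then obtain i k where ik: "i < k" "k < length ws" "?H #> word_prod (take i ws) = ?H #> word_prod (take k ws)" by blast
  define us where "us = take i ws"
  define vs where "vs = drop i (take k ws)"
  define zs where "zs = drop k ws"
  have tk: "take k ws = us @ vs" using append_take_drop_id[of i "take k ws"] ik(1) by (simp add: us_def vs_def min_def)
  have wse: "ws = us @ vs @ zs" using append_take_drop_id[of k ws] tk by (simp add: zs_def)
  have len: "length vs < length ws" "length (us @ zs) < length ws" "length vs + length (us @ zs) = length ws"
   using ik by (auto simp: us_def vs_def zs_def)
  have letters: "set us \<subseteq> S \<union> m_inv G ` S" "set vs \<subseteq> S \<union> m_inv G ` S" "set zs \<subseteq> S \<union> m_inv G ` S"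
   using ws unfolding wse by auto
  define a where "a = word_prod us"
  define b where "b = word_prod vs"
  define c where "c = word_prod zs"
  have abc: "a \<in> carrier G" "b \<in> carrier G" "c \<in> carrier G"
   unfolding a_def b_def c_def using word_prod_closed letters_closed letters by auto
  have uvz: "set us \<subseteq> carrier G" "set vs \<subseteq> carrier G" "set zs \<subseteq> carrier G" using letters_closed letters by auto
  have w: "word_prod ws = a \<otimes> (b \<otimes> c)" "word_prod (us @ zs) = a \<otimes> c"
   using uvz unfolding wse by (simp_all add: word_prod_append a_def b_def c_def)
  have wt: "word_prod (take k ws) = a \<otimes> b" using uvz unfolding tk by (simp add: word_prod_append a_def b_def)
  interpret H: subgroup ?H G by (rule generate_is_subgroup) (use x in simp)
  let ?b = "a \<otimes> b \<otimes> inv a"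
  have bH: "?b \<in> ?H"
  proof -
   have "?H #> (a \<otimes> b) = ?H #> a" using ik(3) wt by (simp add: us_def a_def)
   hence "?H #> ((a \<otimes> b) \<otimes> inv a) = ?H" by (rule coset_mult_inv2) (use abc H.subset in auto)
   thus ?thesis by (rule coset_join1) (use abc H.subgroup_axioms in auto)
  qed
  \<comment> \<open>The piece \<open>vs\<close> starts at the vertex \<open>?H #> a\<close>; seen
    from there it is closed for the conjugate subgroup generated by \<open>y\<close>.\<close>
  define y where "y = inv a \<otimes> x \<otimes> inv (inv a)"
  have y: "y \<in> carrier G" using abc x by (simp add: y_def)
  have axy: "a \<otimes> y [^] (m::int) \<otimes> inv a = x [^] m" for m
   unfolding y_def conj_int_pow[OF inv_closed[OF abc(1)] x] using conj_conj[OF abc(1) inv_closed[OF abc(1)], of "x [^] m"] x abc by simp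
  obtain m :: int where m: "?b = x [^] m" using bH unfolding generate_pow[OF x] by blast
  have "b = inv a \<otimes> ?b \<otimes> inv (inv a)" using conj_conj[OF inv_closed[OF abc(1)] abc(1,2)] abc by simp
  also have "\<dots> = y [^] m" unfolding m y_def conj_int_pow[OF inv_closed[OF abc(1)] x] ..
  finally have "word_prod vs \<in> generate G {y}" unfolding generate_pow[OF y] b_def by blast
  then obtain j1 :: int where j1: "b = y [^] j1" "nat \<bar>j1\<bar> * conj_length y \<le> length vs" "ord y \<noteq> 0 \<longrightarrow> b = \<one>"
   using less.hyps[OF len(1) y letters(2)] unfolding b_def by blast
  have bx: "?b = x [^] j1" unfolding j1(1) by (rule axy)
  have cy: "conj_length y = conj_length x" unfolding y_def by (rule conj_length_conj) (use abc x in auto)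
  have oy: "ord y \<noteq> 0" if "ord x \<noteq> 0"
  proof -
   have "x [^] int (ord x) = \<one>" using int_pow_eq_id[OF x] by simp
   hence "y [^] int (ord x) = \<one>" unfolding y_def conj_int_pow[OF inv_closed[OF abc(1)] x] using abc by simp
   hence "int (ord y) dvd int (ord x)" using int_pow_eq_id[OF y] by simp
   thus ?thesis using that by auto
  qed
  \<comment> \<open>The word is the conjugated piece times the word with the piece removed, and both
    factors lie in \<open>?H\<close>.\<close>
  have split: "word_prod ws = ?b \<otimes> (a \<otimes> c)"
  proof -
   have "?b \<otimes> (a \<otimes> c) = a \<otimes> b \<otimes> ((inv a \<otimes> a) \<otimes> c)" using abc by (simp only: m_assoc m_closed inv_closed)
   thus ?thesis unfolding w using abc by (simp add: m_assoc)
  qed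
  have "a \<otimes> c = inv ?b \<otimes> word_prod ws" unfolding split using abc inv_solve_left by simp
  hence "word_prod (us @ zs) \<in> ?H" unfolding w(2) using bH wx by simp
  moreover have "set (us @ zs) \<subseteq> S \<union> m_inv G ` S" using letters by simp
  ultimately obtain j2 :: int where j2: "a \<otimes> c = x [^] j2" "nat \<bar>j2\<bar> * conj_length x \<le> length (us @ zs)"
   "ord x \<noteq> 0 \<longrightarrow> a \<otimes> c = \<one>"
   using less.hyps[OF len(2) x] unfolding w(2) by blast
  show ?thesis
  proof (intro exI[of _ "j1 + j2"] conjI impI)
   show "word_prod ws = x [^] (j1 + j2)" unfolding split bx j2(1) using int_pow_mult[OF x] by simp
   have "nat \<bar>j1 + j2\<bar> \<le> nat \<bar>j1\<bar> + nat \<bar>j2\<bar>" by linarith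
   hence "nat \<bar>j1 + j2\<bar> * conj_length x \<le> (nat \<bar>j1\<bar> + nat \<bar>j2\<bar>) * conj_length x" by (rule mult_right_mono) simp
   also have "\<dots> \<le> length vs + length (us @ zs)" using j1(2) j2(2) unfolding cy by (simp add: distrib_right)
   finally show "nat \<bar>j1 + j2\<bar> * conj_length x \<le> length ws" using len(3) by simp
   assume "ord x \<noteq> 0"
   thus "word_prod ws = \<one>" using split j1(3) j2(3) oy abc by simp
  qed
 qed
qed

text \<open>A shortest word for a conjugate, repeated \<open>k\<close> times, gives one inequality.
  For the other, a shortest word for a conjugate \<open>y [^] k\<close> is a closed edge path for
  the subgroup generated by \<open>y\<close>, and at infinite order its exponent must be
  \<open>k\<close>. An element of finite order is trivial, since a word for \<open>y\<close> itself
  is already closed.\<close>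

theorem conj_length_pow:
 assumes gen: "generate G S = carrier G" and x: "x \<in> carrier G" and k: "k \<ge> 1"
 shows "conj_length (x [^] (k::nat)) = k * conj_length x"
proof (rule antisym)
 obtain a where a: "a \<in> carrier G" "conj_length x = word_length G S (a \<otimes> x \<otimes> inv a)"
  by (rule conj_length_attained)
 have axG: "a \<otimes> x \<otimes> inv a \<in> generate G S" using a(1) x gen by simp
 obtain ws where ws: "set ws \<subseteq> S \<union> m_inv G ` S" "word_prod ws = a \<otimes> x \<otimes> inv a" "length ws = conj_length x"
  using word_length_attained[OF axG] a(2) by metis
 have "word_prod (concat (replicate k ws)) = (a \<otimes> x \<otimes> inv a) [^] k"
  using word_prod_concat_replicate[OF letters_closed[OF ws(1)]] ws(2) by simp
 also have "\<dots> = a \<otimes> x [^] k \<otimes> inv a" using conj_int_pow[OF a(1) x, of "int k"] by (simp add: int_pow_int)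
 finally have v: "word_prod (concat (replicate k ws)) = a \<otimes> x [^] k \<otimes> inv a" .
 have "set (concat (replicate k ws)) \<subseteq> S \<union> m_inv G ` S" using ws(1) by (auto simp: set_replicate_conv_if split: if_splits)
 from word_length_le[OF this] have "word_length G S (a \<otimes> x [^] k \<otimes> inv a) \<le> k * length ws"
  unfolding v by (simp add: length_concat sum_list_replicate)
 thus "conj_length (x [^] k) \<le> k * conj_length x"
  using conj_length_le[OF a(1), of "x [^] k"] ws(3) by simp
next
 obtain a where a: "a \<in> carrier G" "conj_length (x [^] k) = word_length G S (a \<otimes> x [^] k \<otimes> inv a)"
  by (rule conj_length_attained)
 define y where "y = a \<otimes> x \<otimes> inv a"
 have y: "y \<in> carrier G" using a(1) x by (simp add: y_def)
 have yk: "a \<otimes> x [^] k \<otimes> inv a = y [^] k" unfolding y_def using conj_int_pow[OF a(1) x, of "int k"] by (simp add: int_pow_int)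
 have cy: "conj_length y = conj_length x" unfolding y_def by (rule conj_length_conj[OF a(1) x])
 show "k * conj_length x \<le> conj_length (x [^] k)"
 proof (cases "ord y = 0")
  case True
  have "y [^] k \<in> generate G S" using y gen by simp
  then obtain ws where ws: "set ws \<subseteq> S \<union> m_inv G ` S" "word_prod ws = y [^] k" "length ws = word_length G S (y [^] k)"
   by (rule word_length_attained)
  have "word_prod ws \<in> generate G {y}" unfolding ws(2) generate_pow[OF y] using int_pow_int[of G y k, symmetric] by blast
  then obtain j :: int where j: "word_prod ws = y [^] j" "nat \<bar>j\<bar> * conj_length y \<le> length ws"
   using cyclic_word_bound[OF y ws(1)] by blast
  have "y [^] j = y [^] int k" using j(1) ws(2) by (simp add: int_pow_int)
  hence "j = int k" using int_pow_eq[OF y, of j "int k"] True by simp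
  thus ?thesis using j(2) ws(3) a(2) yk cy by simp
 next
  case False
  have "y \<in> generate G S" using y gen by simp
  then obtain ws where ws: "set ws \<subseteq> S \<union> m_inv G ` S" "word_prod ws = y" using generate_letters by blast
  have "word_prod ws \<in> generate G {y}" unfolding ws(2) by (rule generate.incl) simp
  hence "y = \<one>" using cyclic_word_bound[OF y ws(1)] False ws(2) by auto
  hence "conj_length y = 0" using conj_length_le_length[of "[]" y] by simp
  thus ?thesis using cy by simp
 qed
qed

end

end

end

section \<open>Curves, based loops and conjugacy classes\<close>

lemma homotopic_to_based_loop:
 assumes M: "path_connected M" "p \<in> M" and \<gamma>: "path \<gamma>" "path_image \<gamma> \<subseteq> M" "pathfinish \<gamma> = pathstart \<gamma>"
 obtains \<delta> where "loop_at M p \<delta>" "homotopic_loops M \<gamma> \<delta>"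
proof -
 have "pathstart \<gamma> \<in> M" using \<gamma> pathstart_in_path_image by blast
 then obtain c where c: "path c" "path_image c \<subseteq> M" "pathstart c = p" "pathfinish c = pathstart \<gamma>"
  using M unfolding path_connected_def by blast
 define J where "J = c +++ (\<gamma> +++ reversepath c)"
 have J: "loop_at M p J" using c \<gamma> by (simp add: J_def loop_at_def subset_path_image_join)
 have cJ: "continuous_on {0..1} J" "J ` {0..1} \<subseteq> M" using J by (auto simp: loop_at_def path_def path_image_def)
 \<comment> \<open>\<open>J\<close> runs through \<open>\<gamma>\<close> on
   \<open>[1/2, 3/4]\<close>. Stage \<open>s\<close> runs through \<open>J\<close> on
   \<open>[s/2, 1 - s/4]\<close>, an interval of length \<open>1 - 3 s/4\<close> at whose ends
   \<open>J\<close> takes the same value \<open>c s\<close>; stage \<open>1\<close> is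
   \<open>\<gamma>\<close>.\<close>
 define F where "F = (\<lambda>z::real \<times> real. J (fst z / 2 + snd z * (1 - 3 * fst z / 4)))"
 have rng: "s / 2 + t * (1 - 3 * s / 4) \<in> {0..1}" if "s \<in> {0..1}" "t \<in> {0..1}" for s t :: real
 proof -
  define w where "w = 1 - 3 * s / 4"
  have "0 \<le> w" using that by (simp add: w_def)
  hence "0 \<le> t * w" "t * w \<le> w" using that by (auto intro: mult_left_le_one_le)
  moreover have "s / 2 + w \<le> 1" "0 \<le> s / 2" using that by (auto simp: w_def)
  ultimately show ?thesis unfolding w_def[symmetric] atLeastAtMost_iff by linarith
 qed
 have "homotopic_loops M J \<gamma>" unfolding homotopic_loops
 proof (intro exI[of _ F] conjI ballI)
  show "continuous_on ({0..1} \<times> {0..1}) F"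
   unfolding F_def by (rule continuous_on_compose2[OF cJ(1)]) (use rng in \<open>auto intro!: continuous_intros\<close>)
  show "F \<in> {0..1} \<times> {0..1} \<rightarrow> M"
  proof
   fix z :: "real \<times> real" assume "z \<in> {0..1} \<times> {0..1}"
   hence "fst z / 2 + snd z * (1 - 3 * fst z / 4) \<in> {0..1}" by (intro rng) auto
   thus "F z \<in> M" using cJ(2) unfolding F_def by blast
  qed
  show "F (0, t) = J t" for t by (simp add: F_def)
  show "F (1, t) = \<gamma> t" if t: "t \<in> {0..1}" for t
  proof (cases "t = 0")
   case True
   thus ?thesis using c(4) by (simp add: F_def J_def joinpaths_def pathfinish_def pathstart_def)
  next
   case False
   have "1 / 2 + t * (1 - 3 * 1 / 4) = 1 / 2 + t / 4" by simp
   moreover have "J (1 / 2 + t / 4) = \<gamma> t" using False t by (simp add: J_def joinpaths_def)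
   ultimately show ?thesis by (simp add: F_def)
  qed
  fix s :: real assume s: "s \<in> {0..1}"
  have "J (s / 2) = c s" using s by (simp add: J_def joinpaths_def)
  moreover have "J (1 - s / 4) = c s"
  proof (cases "s = 1")
   case True
   thus ?thesis using \<gamma>(3) c(4) by (simp add: J_def joinpaths_def pathfinish_def pathstart_def)
  next
   case False
   hence "\<not> 1 - s / 4 \<le> 1 / 2" "\<not> 2 * (1 - s / 4) - 1 \<le> 1 / 2" "2 * (2 * (1 - s / 4) - 1) - 1 = 1 - s"
    using s by auto
   thus ?thesis by (simp add: J_def joinpaths_def reversepath_def)
  qed
  moreover have "s / 2 + 1 * (1 - 3 * s / 4) = 1 - s / 4" by simp
  ultimately show "pathfinish (F \<circ> Pair s) = pathstart (F \<circ> Pair s)"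
   by (simp add: F_def pathfinish_def pathstart_def)
 qed
 thus thesis using that[OF J] homotopic_loops_sym by blast
qed

text \<open>Replacing a conjugating element by its inverse matches the two ways of writing
  conjugates; the minima are then taken over the same set.\<close>

lemma curve_length_conj_length:
 assumes S: "S \<subseteq> carrier (fundamental_group M p)" and \<delta>: "loop_at M p \<delta>" "homotopic_loops M \<gamma> \<delta>"
 shows "curve_length M p S \<gamma> = group.conj_length (fundamental_group M p) S (loop_class M \<delta>)"
proof -
 let ?G = "fundamental_group M p" and ?d = "loop_class M \<delta>"
 have p: "p \<in> M" using \<delta>(1) by (auto simp: loop_at_def path_image_def pathstart_def)
 interpret group ?G by (rule group_fundamental_group[OF p])
 have d: "?d \<in> carrier ?G" using \<delta>(1) carrier_fundamental_group by blast
 have "free_class M p \<gamma> = {inv\<^bsub>?G\<^esub> x \<otimes>\<^bsub>?G\<^esub> (?d \<otimes>\<^bsub>?G\<^esub> x) | x. x \<in> carrier ?G}"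
  using free_class_homotopic_loops[OF \<delta>(2)] free_class_loop_at[OF \<delta>(1)] by metis
 also have "\<dots> = (\<lambda>a. a \<otimes>\<^bsub>?G\<^esub> ?d \<otimes>\<^bsub>?G\<^esub> inv\<^bsub>?G\<^esub> a) ` carrier ?G"
 proof (rule subset_antisym; rule subsetI)
  fix y assume "y \<in> {inv\<^bsub>?G\<^esub> x \<otimes>\<^bsub>?G\<^esub> (?d \<otimes>\<^bsub>?G\<^esub> x) | x. x \<in> carrier ?G}"
  then obtain x where x: "x \<in> carrier ?G" "y = inv\<^bsub>?G\<^esub> x \<otimes>\<^bsub>?G\<^esub> (?d \<otimes>\<^bsub>?G\<^esub> x)" by blast
  thus "y \<in> (\<lambda>a. a \<otimes>\<^bsub>?G\<^esub> ?d \<otimes>\<^bsub>?G\<^esub> inv\<^bsub>?G\<^esub> a) ` carrier ?G"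
   using d by (intro image_eqI[of _ _ "inv\<^bsub>?G\<^esub> x"]) (simp_all add: m_assoc)
 next
  fix y assume "y \<in> (\<lambda>a. a \<otimes>\<^bsub>?G\<^esub> ?d \<otimes>\<^bsub>?G\<^esub> inv\<^bsub>?G\<^esub> a) ` carrier ?G"
  then obtain a where a: "a \<in> carrier ?G" "y = a \<otimes>\<^bsub>?G\<^esub> ?d \<otimes>\<^bsub>?G\<^esub> inv\<^bsub>?G\<^esub> a" by blast
  hence "y = inv\<^bsub>?G\<^esub> (inv\<^bsub>?G\<^esub> a) \<otimes>\<^bsub>?G\<^esub> (?d \<otimes>\<^bsub>?G\<^esub> inv\<^bsub>?G\<^esub> a)" using d by (simp add: m_assoc)
  thus "y \<in> {inv\<^bsub>?G\<^esub> x \<otimes>\<^bsub>?G\<^esub> (?d \<otimes>\<^bsub>?G\<^esub> x) | x. x \<in> carrier ?G}" using inv_closed[OF a(1)] by blast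
 qed
 finally have fc: "free_class M p \<gamma> = (\<lambda>a. a \<otimes>\<^bsub>?G\<^esub> ?d \<otimes>\<^bsub>?G\<^esub> inv\<^bsub>?G\<^esub> a) ` carrier ?G" .
 show ?thesis unfolding curve_length_def conj_length_def[OF S] fc bex_simps(7) ..
qed

theorem mainTheorem3:
 fixes M :: "'a::topological_space set" and p :: 'a
  and S :: "(real \<Rightarrow> 'a) set set" and \<gamma> :: "real \<Rightarrow> 'a" and g r k :: nat
 assumes "surface_with_boundary M" and "compact M" and "connected M" and "orientable_surface M"
  and "has_genus M g" and "has_boundary_components M r" and "3 * g + r > 3"
  and "p \<in> M" and "simple_generating_set M p S"
  and "curve_on M \<gamma>" and "k \<ge> 1"
 shows "curve_length M p S (curve_power \<gamma> k) = k * curve_length M p S \<gamma>"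
proof -
 let ?G = "fundamental_group M p"
 interpret group ?G by (rule group_fundamental_group[OF assms(8)])
 have \<gamma>: "path \<gamma>" "pathfinish \<gamma> = pathstart \<gamma>" "path_image \<gamma> \<subseteq> M"
  using assms(10) surface_interior_subset[of M] by (auto simp: curve_on_def immersed_closed_curve_def)
 obtain \<delta> where \<delta>: "loop_at M p \<delta>" "homotopic_loops M \<gamma> \<delta>"
  by (rule homotopic_to_based_loop[OF path_connected_surface[OF assms(1,3)] assms(8) \<gamma>(1,3,2)])
 have d: "loop_class M \<delta> \<in> carrier ?G" using \<delta>(1) carrier_fundamental_group by blast
 have gen: "generate ?G S = carrier ?G" using assms(9) by (simp add: simple_generating_set_def)
 have S: "S \<subseteq> carrier ?G" using generate.incl[of _ S ?G] gen by blast
 have "curve_length M p S (curve_power \<gamma> k) = conj_length S (loop_class M \<delta> [^]\<^bsub>?G\<^esub> k)"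
  using curve_length_conj_length[OF S loop_class_curve_power(1)[OF \<delta>(1)] homotopic_loops_curve_power[OF \<delta>(2)]]
   loop_class_curve_power(2)[OF \<delta>(1)] by metis
 \<comment> \<open>\<open>surface_word_obstruction\<close> supplies the hypothesis on closed edge
   paths without repeated vertices.\<close>
 also have "\<dots> = k * conj_length S (loop_class M \<delta>)"
  by (rule conj_length_pow[OF S surface_word_obstruction[OF assms(1,3,4,8,9)] gen d assms(11)])
 also have "conj_length S (loop_class M \<delta>) = curve_length M p S \<gamma>"
  by (rule curve_length_conj_length[OF S \<delta>, symmetric])
 finally show ?thesis .
qed

end
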